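(* Let $k$ be a field. If $A$ and $B$ are integrally closed domains that are $k$-algebras, then $A\otimes_k B$ satisfies MPC.
   Context: All rings and algebras are commutative with identity. A ring satisfies MPC if its minimal prime ideals are pairwise comaximal (i.e., each maximal ideal contains only one minimal prime ideal). A domain is integrally closed if it is integrally closed in its quotient field. *)

theory Defs
  imports "HOL-Algebra.Algebra"
begin

definition minimal_prime :: "('a, 'm) ring_scheme \<Rightarrow> 'a set \<Rightarrow> bool" where
  "minimal_prime R P \<longleftrightarrow> primeideal P R \<and> (\<forall>Q. primeideal Q R \<and> Q \<subseteq> P \<longrightarrow> Q = P)"

definition comaximal :: "('a, 'm) ring_scheme \<Rightarrow> 'a set \<Rightarrow> 'a set \<Rightarrow> bool" where
  "comaximal R I J \<longleftrightarrow> I <+>\<^bsub>R\<^esub> J = carrier R"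

definition MPC :: "('a, 'm) ring_scheme \<Rightarrow> bool" where
  "MPC R \<longleftrightarrow> (\<forall>P Q. minimal_prime R P \<and> minimal_prime R Q \<and> P \<noteq> Q \<longrightarrow> comaximal R P Q)"

text \<open>The fraction \<open>a / b\<close> is the class of all pairs \<open>(c, d)\<close>, \<open>d\<close> nonzero, with \<open>a d = c b\<close>.\<close>

definition fraction :: "('a, 'm) ring_scheme \<Rightarrow> 'a \<Rightarrow> 'a \<Rightarrow> ('a \<times> 'a) set" where
  "fraction R a b =
     {(c, d). c \<in> carrier R \<and> d \<in> carrier R - {\<zero>\<^bsub>R\<^esub>} \<and> a \<otimes>\<^bsub>R\<^esub> d = c \<otimes>\<^bsub>R\<^esub> b}"

text \<open>The unions below run over all representatives; each member of such a union is the
  same class (see \<open>fraction_mult\<close> and \<open>fraction_add\<close>).\<close>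

definition quotient_field :: "('a, 'm) ring_scheme \<Rightarrow> ('a \<times> 'a) set ring" where
  "quotient_field R =
     \<lparr> carrier = {fraction R a b | a b. a \<in> carrier R \<and> b \<in> carrier R - {\<zero>\<^bsub>R\<^esub>}},
       monoid.mult = (\<lambda>u v. \<Union>(a, b)\<in>u. \<Union>(c, d)\<in>v. fraction R (a \<otimes>\<^bsub>R\<^esub> c) (b \<otimes>\<^bsub>R\<^esub> d)),
       one = fraction R \<one>\<^bsub>R\<^esub> \<one>\<^bsub>R\<^esub>,
       ring.zero = fraction R \<zero>\<^bsub>R\<^esub> \<one>\<^bsub>R\<^esub>,
       add = (\<lambda>u v. \<Union>(a, b)\<in>u. \<Union>(c, d)\<in>v.
                fraction R (a \<otimes>\<^bsub>R\<^esub> d \<oplus>\<^bsub>R\<^esub> c \<otimes>\<^bsub>R\<^esub> b) (b \<otimes>\<^bsub>R\<^esub> d)) \<rparr>"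

definition quotient_embed :: "('a, 'm) ring_scheme \<Rightarrow> 'a \<Rightarrow> ('a \<times> 'a) set" where
  "quotient_embed R a = fraction R a \<one>\<^bsub>R\<^esub>"

text \<open>Polynomials are coefficient lists, leading coefficient first, as in
  \<^theory>\<open>HOL-Algebra.Polynomials\<close>.\<close>

definition integral_over :: "('a, 'm) ring_scheme \<Rightarrow> 'a set \<Rightarrow> 'a \<Rightarrow> bool" where
  "integral_over R S x \<longleftrightarrow>
     (\<exists>p. polynomial\<^bsub>R\<^esub> S p \<and> p \<noteq> [] \<and> hd p = \<one>\<^bsub>R\<^esub> \<and> ring.eval R p x = \<zero>\<^bsub>R\<^esub>)"

definition integrally_closed_domain :: "('a, 'm) ring_scheme \<Rightarrow> bool" where
  "integrally_closed_domain R \<longleftrightarrow> domain R \<and>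
     (\<forall>x \<in> carrier (quotient_field R).
        integral_over (quotient_field R) (quotient_embed R ` carrier R) x
          \<longrightarrow> x \<in> quotient_embed R ` carrier R)"

context domain
begin

lemma fraction_eq_iff:
  assumes "a \<in> carrier R" "b \<in> carrier R - {\<zero>}" "c \<in> carrier R" "d \<in> carrier R - {\<zero>}"
  shows "fraction R a b = fraction R c d \<longleftrightarrow> a \<otimes> d = c \<otimes> b"
proof
  assume "fraction R a b = fraction R c d"
  moreover have "(c, d) \<in> fraction R c d" using assms by (simp add: fraction_def)
  ultimately show "a \<otimes> d = c \<otimes> b" by (auto simp: fraction_def)
next
  assume eq: "a \<otimes> d = c \<otimes> b"
  have "a \<otimes> y = x \<otimes> b \<longleftrightarrow> c \<otimes> y = x \<otimes> d" if x: "x \<in> carrier R" and y: "y \<in> carrier R" for x y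
  proof -
    have "a \<otimes> y = x \<otimes> b \<longleftrightarrow> d \<otimes> (a \<otimes> y) = d \<otimes> (x \<otimes> b)"
      using assms x y by (simp add: m_lcancel)
    also have "d \<otimes> (a \<otimes> y) = (a \<otimes> d) \<otimes> y" using assms x y by (simp add: m_ac)
    also have "\<dots> = b \<otimes> (c \<otimes> y)" unfolding eq using assms x y by (simp add: m_ac)
    also have "d \<otimes> (x \<otimes> b) = b \<otimes> (x \<otimes> d)" using assms x y by (simp add: m_ac)
    also have "b \<otimes> (c \<otimes> y) = b \<otimes> (x \<otimes> d) \<longleftrightarrow> c \<otimes> y = x \<otimes> d"
      using assms x y by (simp add: m_lcancel)
    finally show ?thesis .
  qed
  then show "fraction R a b = fraction R c d" by (auto simp: fraction_def)
qed

lemma fraction_class: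
  assumes "a \<in> carrier R" "b \<in> carrier R - {\<zero>}" "(x, y) \<in> fraction R a b"
  shows "x \<in> carrier R" "y \<in> carrier R - {\<zero>}" "fraction R x y = fraction R a b"
  using assms fraction_eq_iff[of x y a b] by (auto simp: fraction_def)

lemma fraction_self: "a \<in> carrier R \<Longrightarrow> b \<in> carrier R - {\<zero>} \<Longrightarrow> (a, b) \<in> fraction R a b"
  by (simp add: fraction_def)

lemma nonzero_mult: "b \<in> carrier R - {\<zero>} \<Longrightarrow> d \<in> carrier R - {\<zero>} \<Longrightarrow> b \<otimes> d \<in> carrier R - {\<zero>}"
  using integral by auto

lemma fraction_mult:
  assumes A: "a \<in> carrier R" "b \<in> carrier R - {\<zero>}" "c \<in> carrier R" "d \<in> carrier R - {\<zero>}"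
  shows "fraction R a b \<otimes>\<^bsub>quotient_field R\<^esub> fraction R c d = fraction R (a \<otimes> c) (b \<otimes> d)"
proof -
  have *: "fraction R (x \<otimes> u) (y \<otimes> v) = fraction R (a \<otimes> c) (b \<otimes> d)"
    if xy: "(x, y) \<in> fraction R a b" and uv: "(u, v) \<in> fraction R c d" for x y u v
  proof -
    note FX = fraction_class[OF A(1,2) xy] and FU = fraction_class[OF A(3,4) uv]
    have e: "a \<otimes> y = x \<otimes> b" "c \<otimes> v = u \<otimes> d" using xy uv by (auto simp: fraction_def)
    have "(a \<otimes> c) \<otimes> (y \<otimes> v) = (a \<otimes> y) \<otimes> (c \<otimes> v)" using A FX FU by (simp add: m_ac)
    also have "\<dots> = (x \<otimes> u) \<otimes> (b \<otimes> d)" unfolding e using A FX FU by (simp add: m_ac)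
    finally show ?thesis
      using A FX(1,2) FU(1,2) nonzero_mult fraction_eq_iff[of "x \<otimes> u" "y \<otimes> v" "a \<otimes> c" "b \<otimes> d"] by auto
  qed
  show ?thesis unfolding quotient_field_def monoid.simps
    using * fraction_self[OF A(1,2)] fraction_self[OF A(3,4)] by blast
qed

lemma fraction_add:
  assumes A: "a \<in> carrier R" "b \<in> carrier R - {\<zero>}" "c \<in> carrier R" "d \<in> carrier R - {\<zero>}"
  shows "fraction R a b \<oplus>\<^bsub>quotient_field R\<^esub> fraction R c d
    = fraction R (a \<otimes> d \<oplus> c \<otimes> b) (b \<otimes> d)"
proof -
  have *: "fraction R (x \<otimes> v \<oplus> u \<otimes> y) (y \<otimes> v) = fraction R (a \<otimes> d \<oplus> c \<otimes> b) (b \<otimes> d)"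
    if xy: "(x, y) \<in> fraction R a b" and uv: "(u, v) \<in> fraction R c d" for x y u v
  proof -
    note FX = fraction_class[OF A(1,2) xy] and FU = fraction_class[OF A(3,4) uv]
    have e: "a \<otimes> y = x \<otimes> b" "c \<otimes> v = u \<otimes> d" using xy uv by (auto simp: fraction_def)
    have "(a \<otimes> d \<oplus> c \<otimes> b) \<otimes> (y \<otimes> v) = (a \<otimes> y) \<otimes> (d \<otimes> v) \<oplus> (c \<otimes> v) \<otimes> (b \<otimes> y)"
      using A FX FU by (simp add: l_distr r_distr m_ac)
    also have "\<dots> = (x \<otimes> v \<oplus> u \<otimes> y) \<otimes> (b \<otimes> d)"
      unfolding e using A FX FU by (simp add: l_distr r_distr m_ac)
    finally show ?thesis
      using A FX(1,2) FU(1,2) nonzero_mult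
        fraction_eq_iff[of "x \<otimes> v \<oplus> u \<otimes> y" "y \<otimes> v" "a \<otimes> d \<oplus> c \<otimes> b" "b \<otimes> d"] by auto
  qed
  show ?thesis unfolding quotient_field_def ring.simps
    using * fraction_self[OF A(1,2)] fraction_self[OF A(3,4)] by blast
qed

lemma quotient_field_elem:
  assumes "x \<in> carrier (quotient_field R)"
  obtains a b where "a \<in> carrier R" "b \<in> carrier R - {\<zero>}" "x = fraction R a b"
  using assms by (auto simp: quotient_field_def)

lemma fraction_in: "a \<in> carrier R \<Longrightarrow> b \<in> carrier R - {\<zero>} \<Longrightarrow> fraction R a b \<in> carrier (quotient_field R)"
  by (auto simp: quotient_field_def)

lemma quotient_field_zero: "\<zero>\<^bsub>quotient_field R\<^esub> = fraction R \<zero> \<one>"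
  and quotient_field_one: "\<one>\<^bsub>quotient_field R\<^esub> = fraction R \<one> \<one>"
  by (simp_all add: quotient_field_def)

lemma one_nonzero: "\<one> \<in> carrier R - {\<zero>}" by simp

lemma quotient_field_cring: "cring (quotient_field R)" (is "cring ?Q")
proof (rule cringI)
  note mult = fraction_mult and add = fraction_add
  note facts = fraction_in nonzero_mult one_nonzero integral_iff
  show "abelian_group ?Q"
  proof (rule abelian_groupI)
    fix x y assume x: "x \<in> carrier ?Q" and y: "y \<in> carrier ?Q"
    obtain a b where ab: "a \<in> carrier R" "b \<in> carrier R - {\<zero>}" "x = fraction R a b"
      using x by (rule quotient_field_elem)
    obtain c d where cd: "c \<in> carrier R" "d \<in> carrier R - {\<zero>}" "y = fraction R c d"
      using y by (rule quotient_field_elem)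
    show "x \<oplus>\<^bsub>?Q\<^esub> y \<in> carrier ?Q" using ab cd by (simp add: add facts)
    show "x \<oplus>\<^bsub>?Q\<^esub> y = y \<oplus>\<^bsub>?Q\<^esub> x" using ab cd by (simp add: add m_comm a_comm)
    fix z assume z: "z \<in> carrier ?Q"
    obtain e f where ef: "e \<in> carrier R" "f \<in> carrier R - {\<zero>}" "z = fraction R e f"
      using z by (rule quotient_field_elem)
    show "x \<oplus>\<^bsub>?Q\<^esub> y \<oplus>\<^bsub>?Q\<^esub> z = x \<oplus>\<^bsub>?Q\<^esub> (y \<oplus>\<^bsub>?Q\<^esub> z)"
      using ab cd ef by (simp add: add facts l_distr r_distr m_ac a_ac)
  next
    show "\<zero>\<^bsub>?Q\<^esub> \<in> carrier ?Q" by (simp add: quotient_field_zero facts)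
  next
    fix x assume x: "x \<in> carrier ?Q"
    obtain a b where ab: "a \<in> carrier R" "b \<in> carrier R - {\<zero>}" "x = fraction R a b"
      using x by (rule quotient_field_elem)
    show "\<zero>\<^bsub>?Q\<^esub> \<oplus>\<^bsub>?Q\<^esub> x = x" using ab by (simp add: quotient_field_zero add)
    have "fraction R (\<ominus> a) b \<oplus>\<^bsub>?Q\<^esub> x = \<zero>\<^bsub>?Q\<^esub>"
      using ab by (simp add: quotient_field_zero add fraction_eq_iff facts l_minus l_neg)
    then show "\<exists>y\<in>carrier ?Q. y \<oplus>\<^bsub>?Q\<^esub> x = \<zero>\<^bsub>?Q\<^esub>" using ab by (meson a_inv_closed facts(1))
  qed
  show "comm_monoid ?Q"
  proof (rule comm_monoidI)
    fix x y assume x: "x \<in> carrier ?Q" and y: "y \<in> carrier ?Q"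
    obtain a b where ab: "a \<in> carrier R" "b \<in> carrier R - {\<zero>}" "x = fraction R a b"
      using x by (rule quotient_field_elem)
    obtain c d where cd: "c \<in> carrier R" "d \<in> carrier R - {\<zero>}" "y = fraction R c d"
      using y by (rule quotient_field_elem)
    show "x \<otimes>\<^bsub>?Q\<^esub> y \<in> carrier ?Q" using ab cd by (simp add: mult facts)
    show "x \<otimes>\<^bsub>?Q\<^esub> y = y \<otimes>\<^bsub>?Q\<^esub> x" using ab cd by (simp add: mult m_comm)
    fix z assume z: "z \<in> carrier ?Q"
    obtain e f where ef: "e \<in> carrier R" "f \<in> carrier R - {\<zero>}" "z = fraction R e f"
      using z by (rule quotient_field_elem)
    show "x \<otimes>\<^bsub>?Q\<^esub> y \<otimes>\<^bsub>?Q\<^esub> z = x \<otimes>\<^bsub>?Q\<^esub> (y \<otimes>\<^bsub>?Q\<^esub> z)"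
      using ab cd ef by (simp add: mult facts m_ac)
  next
    show "\<one>\<^bsub>?Q\<^esub> \<in> carrier ?Q" by (simp add: quotient_field_one facts)
    fix x assume x: "x \<in> carrier ?Q"
    then show "\<one>\<^bsub>?Q\<^esub> \<otimes>\<^bsub>?Q\<^esub> x = x"
      by (elim quotient_field_elem) (simp add: quotient_field_one mult)
  qed
  fix x y z assume x: "x \<in> carrier ?Q" and y: "y \<in> carrier ?Q" and z: "z \<in> carrier ?Q"
  obtain a b where ab: "a \<in> carrier R" "b \<in> carrier R - {\<zero>}" "x = fraction R a b"
    using x by (rule quotient_field_elem)
  obtain c d where cd: "c \<in> carrier R" "d \<in> carrier R - {\<zero>}" "y = fraction R c d"
    using y by (rule quotient_field_elem)
  obtain e f where ef: "e \<in> carrier R" "f \<in> carrier R - {\<zero>}" "z = fraction R e f"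
    using z by (rule quotient_field_elem)
  show "(x \<oplus>\<^bsub>?Q\<^esub> y) \<otimes>\<^bsub>?Q\<^esub> z = x \<otimes>\<^bsub>?Q\<^esub> z \<oplus>\<^bsub>?Q\<^esub> y \<otimes>\<^bsub>?Q\<^esub> z"
    using ab cd ef by (simp add: mult add facts fraction_eq_iff l_distr r_distr m_ac)
qed

lemma quotient_field_field: "field (quotient_field R)"
proof (rule cring.cring_fieldI2[OF quotient_field_cring])
  show "\<zero>\<^bsub>quotient_field R\<^esub> \<noteq> \<one>\<^bsub>quotient_field R\<^esub>"
    by (simp add: quotient_field_zero quotient_field_one fraction_eq_iff)
next
  fix x assume x: "x \<in> carrier (quotient_field R)" "x \<noteq> \<zero>\<^bsub>quotient_field R\<^esub>"
  obtain a b where ab: "a \<in> carrier R" "b \<in> carrier R - {\<zero>}" "x = fraction R a b"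
    using x(1) by (rule quotient_field_elem)
  have a: "a \<noteq> \<zero>" using x(2) ab by (auto simp: quotient_field_zero fraction_eq_iff)
  have "x \<otimes>\<^bsub>quotient_field R\<^esub> fraction R b a = \<one>\<^bsub>quotient_field R\<^esub>"
    using ab a by (simp add: fraction_mult quotient_field_one fraction_eq_iff integral_iff m_comm)
  then show "\<exists>y\<in>carrier (quotient_field R). x \<otimes>\<^bsub>quotient_field R\<^esub> y = \<one>\<^bsub>quotient_field R\<^esub>"
    using ab a by (meson DiffD1 DiffI fraction_in singletonD)
qed

lemma quotient_embed_hom: "quotient_embed R \<in> ring_hom R (quotient_field R)"
  by (rule ring_hom_memI)
    (simp_all add: quotient_embed_def fraction_in fraction_mult fraction_add quotient_field_one)

lemma quotient_embed_inj: "inj_on (quotient_embed R) (carrier R)"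
  by (rule inj_onI) (simp add: quotient_embed_def fraction_eq_iff)

end

text \<open>The monoid ring of \<open>G\<close> with integer coefficients: the free abelian group on \<open>carrier G\<close>,
  whose basis element belonging to \<open>x\<close> is \<open>frag_of x\<close>, with the biadditive extension of the
  product of \<open>G\<close>.\<close>

definition int_monoid_ring :: "('a, 'm) monoid_scheme \<Rightarrow> ('a \<Rightarrow>\<^sub>0 int) ring" where
  "int_monoid_ring G =
     \<lparr> carrier = {f. Poly_Mapping.keys f \<subseteq> carrier G},
       monoid.mult = (\<lambda>f g. frag_extend (\<lambda>x. frag_extend (\<lambda>y. frag_of (x \<otimes>\<^bsub>G\<^esub> y)) g) f),
       one = frag_of \<one>\<^bsub>G\<^esub>,
       ring.zero = 0,
       add = (+) \<rparr>"

definition tensor_relations ::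
    "('k, 'm) ring_scheme \<Rightarrow> ('k, 'a, 'n) module_scheme \<Rightarrow> ('k, 'b, 'o) module_scheme \<Rightarrow>
     (('a \<times> 'b) \<Rightarrow>\<^sub>0 int) set" where
  "tensor_relations K A B =
     {frag_of (a \<oplus>\<^bsub>A\<^esub> a', b) - frag_of (a, b) - frag_of (a', b) | a a' b.
        a \<in> carrier A \<and> a' \<in> carrier A \<and> b \<in> carrier B} \<union>
     {frag_of (a, b \<oplus>\<^bsub>B\<^esub> b') - frag_of (a, b) - frag_of (a, b') | a b b'.
        a \<in> carrier A \<and> b \<in> carrier B \<and> b' \<in> carrier B} \<union>
     {frag_of (c \<odot>\<^bsub>A\<^esub> a, b) - frag_of (a, c \<odot>\<^bsub>B\<^esub> b) | c a b.
        c \<in> carrier K \<and> a \<in> carrier A \<and> b \<in> carrier B}"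

text \<open>The ring \<open>A \<otimes>\<^sub>K B\<close>; the class of \<open>frag_of (a, b)\<close> is the elementary tensor of \<open>a\<close> and
  \<open>b\<close>, and elementary tensors multiply componentwise. The ideal generated by the relations is
  just the subgroup they generate (\<open>tensor_ideal_eq_subgroup\<close>), so the underlying additive
  group is the usual tensor product of \<open>K\<close>-modules.\<close>

definition tensor_product ::
    "('k, 'm) ring_scheme \<Rightarrow> ('k, 'a, 'n) module_scheme \<Rightarrow> ('k, 'b, 'o) module_scheme \<Rightarrow>
     (('a \<times> 'b) \<Rightarrow>\<^sub>0 int) set ring" where
  "tensor_product K A B =
     int_monoid_ring (A \<times>\<times> B) Quot
       genideal (int_monoid_ring (A \<times>\<times> B)) (tensor_relations K A B)"

lemma int_monoid_ring_simps [simp]: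
  "carrier (int_monoid_ring G) = {f. Poly_Mapping.keys f \<subseteq> carrier G}"
  "f \<otimes>\<^bsub>int_monoid_ring G\<^esub> g = frag_extend (\<lambda>x. frag_extend (\<lambda>y. frag_of (x \<otimes>\<^bsub>G\<^esub> y)) g) f"
  "\<one>\<^bsub>int_monoid_ring G\<^esub> = frag_of \<one>\<^bsub>G\<^esub>"
  "\<zero>\<^bsub>int_monoid_ring G\<^esub> = 0"
  "f \<oplus>\<^bsub>int_monoid_ring G\<^esub> g = f + g"
  by (simp_all add: int_monoid_ring_def)

lemma frag_extend_diff_fun: "frag_extend (\<lambda>x. f x - g x) c = frag_extend f c - frag_extend g c"
  by (rule frag_induction[where S = UNIV]) (auto simp: frag_extend_diff)

lemma int_monoid_ring_cring:
  assumes "comm_monoid G"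
  shows "cring (int_monoid_ring G)"
proof -
  interpret comm_monoid G by fact
  have cl: "Poly_Mapping.keys (f \<otimes>\<^bsub>int_monoid_ring G\<^esub> g) \<subseteq> carrier G"
    if f: "Poly_Mapping.keys f \<subseteq> carrier G" and g: "Poly_Mapping.keys g \<subseteq> carrier G" for f g
  proof -
    have inner: "Poly_Mapping.keys (frag_extend (\<lambda>y. frag_of (x \<otimes>\<^bsub>G\<^esub> y)) g) \<subseteq> carrier G"
      if x: "x \<in> carrier G" for x
    proof (rule order_trans[OF keys_frag_extend], rule UN_least)
      fix y assume "y \<in> Poly_Mapping.keys g"
      then have "x \<otimes>\<^bsub>G\<^esub> y \<in> carrier G" using x g by blast
      then show "Poly_Mapping.keys (frag_of (x \<otimes>\<^bsub>G\<^esub> y)) \<subseteq> carrier G" by simp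
    qed
    show ?thesis
      unfolding int_monoid_ring_simps
    proof (rule order_trans[OF keys_frag_extend], rule UN_least)
      fix x assume "x \<in> Poly_Mapping.keys f"
      then have "x \<in> carrier G" using f by blast
      then show "Poly_Mapping.keys (frag_extend (\<lambda>y. frag_of (x \<otimes>\<^bsub>G\<^esub> y)) g) \<subseteq> carrier G"
        by (rule inner)
    qed
  qed
  show ?thesis
  proof (rule cringI)
    show "abelian_group (int_monoid_ring G)"
    proof (rule abelian_groupI)
      fix x assume "x \<in> carrier (int_monoid_ring G)"
      then show "\<exists>y\<in>carrier (int_monoid_ring G). y \<oplus>\<^bsub>int_monoid_ring G\<^esub> x = \<zero>\<^bsub>int_monoid_ring G\<^esub>"
        by (intro bexI[of _ "- x"]) (auto simp: keys_minus)
    next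
      fix x y assume "x \<in> carrier (int_monoid_ring G)" "y \<in> carrier (int_monoid_ring G)"
      then show "x \<oplus>\<^bsub>int_monoid_ring G\<^esub> y \<in> carrier (int_monoid_ring G)"
        using keys_add[of x y] by (simp add: order_trans[OF keys_add])
    qed (simp_all add: add_ac)
    show "comm_monoid (int_monoid_ring G)"
    proof (rule comm_monoidI)
      fix f g assume f: "f \<in> carrier (int_monoid_ring G)" and g: "g \<in> carrier (int_monoid_ring G)"
      show "f \<otimes>\<^bsub>int_monoid_ring G\<^esub> g \<in> carrier (int_monoid_ring G)" using cl f g by simp
      have f': "Poly_Mapping.keys f \<subseteq> carrier G" and g': "Poly_Mapping.keys g \<subseteq> carrier G"
        using f g by auto
      show "f \<otimes>\<^bsub>int_monoid_ring G\<^esub> g = g \<otimes>\<^bsub>int_monoid_ring G\<^esub> f"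
        using f'
      proof (induction f rule: frag_induction)
        case zero
        then show ?case by (simp add: frag_extend_eq_0)
      next
        case (one x)
        have "frag_extend (\<lambda>y. frag_of (x \<otimes>\<^bsub>G\<^esub> y)) g = frag_extend (\<lambda>y. frag_of (y \<otimes>\<^bsub>G\<^esub> x)) g"
          using g' one by (intro frag_extend_eq) (auto simp: m_comm subset_iff)
        then show ?case by simp
      next
        case (diff a b)
        then show ?case by (simp add: frag_extend_diff frag_extend_diff_fun)
      qed
      fix h assume h: "h \<in> carrier (int_monoid_ring G)"
      then have h': "Poly_Mapping.keys h \<subseteq> carrier G" by auto
      show "f \<otimes>\<^bsub>int_monoid_ring G\<^esub> g \<otimes>\<^bsub>int_monoid_ring G\<^esub> h
          = f \<otimes>\<^bsub>int_monoid_ring G\<^esub> (g \<otimes>\<^bsub>int_monoid_ring G\<^esub> h)"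
        using f'
      proof (induction f rule: frag_induction)
        case (one x)
        show ?case using g'
        proof (induction g rule: frag_induction)
          case (one y)
          show ?case using h'
          proof (induction h rule: frag_induction)
            case (one z)
            then show ?case using \<open>x \<in> carrier G\<close> \<open>y \<in> carrier G\<close> by (simp add: m_assoc)
          qed (simp_all add: frag_extend_diff)
        qed (simp_all add: frag_extend_diff)
      qed (simp_all add: frag_extend_diff)
    next
      show "\<one>\<^bsub>int_monoid_ring G\<^esub> \<in> carrier (int_monoid_ring G)" by simp
      fix f assume "f \<in> carrier (int_monoid_ring G)"
      then have "Poly_Mapping.keys f \<subseteq> carrier G" by simp
      then show "\<one>\<^bsub>int_monoid_ring G\<^esub> \<otimes>\<^bsub>int_monoid_ring G\<^esub> f = f"
        by (induction f rule: frag_induction) (simp_all add: frag_extend_diff)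
    qed
  qed (simp add: frag_extend_add)
qed

lemma tensor_monoid:
  assumes "algebra K A" "algebra K B"
  shows "comm_monoid (A \<times>\<times> B)"
proof -
  interpret A: cring A by (rule algebra.M_cring[OF assms(1)])
  interpret B: cring B by (rule algebra.M_cring[OF assms(2)])
  interpret KA: algebra K A by fact
  interpret KB: algebra K B by fact
  show ?thesis
    by (rule comm_monoidI) (auto simp: DirProd_def A.m_ac B.m_ac)
qed

lemma tensor_relations_subset:
  assumes "algebra K A" "algebra K B"
  shows "tensor_relations K A B \<subseteq> carrier (int_monoid_ring (A \<times>\<times> B))"
proof -
  interpret A: cring A by (rule algebra.M_cring[OF assms(1)])
  interpret B: cring B by (rule algebra.M_cring[OF assms(2)])
  interpret KA: algebra K A by fact
  interpret KB: algebra K B by fact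
  show ?thesis
    unfolding tensor_relations_def int_monoid_ring_simps DirProd_def partial_object.simps
    by (auto dest!: keys_diff[THEN subsetD] split: if_splits)
qed

lemma tensor_relationsI:
  "a \<in> carrier A \<Longrightarrow> a' \<in> carrier A \<Longrightarrow> b \<in> carrier B \<Longrightarrow>
     frag_of (a \<oplus>\<^bsub>A\<^esub> a', b) - frag_of (a, b) - frag_of (a', b) \<in> tensor_relations K A B"
  "a \<in> carrier A \<Longrightarrow> b \<in> carrier B \<Longrightarrow> b' \<in> carrier B \<Longrightarrow>
     frag_of (a, b \<oplus>\<^bsub>B\<^esub> b') - frag_of (a, b) - frag_of (a, b') \<in> tensor_relations K A B"
  "c \<in> carrier K \<Longrightarrow> a \<in> carrier A \<Longrightarrow> b \<in> carrier B \<Longrightarrow>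
     frag_of (c \<odot>\<^bsub>A\<^esub> a, b) - frag_of (a, c \<odot>\<^bsub>B\<^esub> b) \<in> tensor_relations K A B"
  unfolding tensor_relations_def by blast+

lemma tensor_ideal_eq_subgroup:
  assumes "algebra K A" "algebra K B"
  shows "genideal (int_monoid_ring (A \<times>\<times> B)) (tensor_relations K A B)
       = generate (add_monoid (int_monoid_ring (A \<times>\<times> B))) (tensor_relations K A B)"
    (is "genideal ?Z ?T = ?H")
proof
  interpret A: cring A by (rule algebra.M_cring[OF assms(1)])
  interpret B: cring B by (rule algebra.M_cring[OF assms(2)])
  interpret KA: algebra K A by fact
  interpret KB: algebra K B by fact
  interpret Z: cring ?Z by (rule int_monoid_ring_cring[OF tensor_monoid[OF assms]])
  note T = tensor_relations_subset[OF assms]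
  have H: "subgroup ?H (add_monoid ?Z)" using Z.add.generate_is_subgroup T by simp
  have HZ: "?H \<subseteq> carrier ?Z" using Z.add.generate_incl T by simp
  have rel: "frag_of x \<otimes>\<^bsub>?Z\<^esub> t \<in> ?T" if x: "x \<in> carrier (A \<times>\<times> B)" and t: "t \<in> ?T" for x t
  proof -
    obtain u v where x': "x = (u, v)" and uv: "u \<in> carrier A" "v \<in> carrier B"
      using x by (auto simp: DirProd_def)
    show ?thesis
      using t unfolding tensor_relations_def[of K A B]
    proof (elim UnE CollectE exE conjE; fold tensor_relations_def[of K A B])
      fix a a' b
      assume l: "a \<in> carrier A" "a' \<in> carrier A" "b \<in> carrier B"
        "t = frag_of (a \<oplus>\<^bsub>A\<^esub> a', b) - frag_of (a, b) - frag_of (a', b)"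
      have "frag_of x \<otimes>\<^bsub>?Z\<^esub> t = frag_of (u \<otimes>\<^bsub>A\<^esub> a \<oplus>\<^bsub>A\<^esub> u \<otimes>\<^bsub>A\<^esub> a', v \<otimes>\<^bsub>B\<^esub> b)
          - frag_of (u \<otimes>\<^bsub>A\<^esub> a, v \<otimes>\<^bsub>B\<^esub> b) - frag_of (u \<otimes>\<^bsub>A\<^esub> a', v \<otimes>\<^bsub>B\<^esub> b)"
        using l uv by (simp add: x' DirProd_def frag_extend_diff A.r_distr)
      then show "frag_of x \<otimes>\<^bsub>?Z\<^esub> t \<in> ?T" using l uv by (simp only: tensor_relationsI A.m_closed B.m_closed)
    next
      fix a b b'
      assume r: "a \<in> carrier A" "b \<in> carrier B" "b' \<in> carrier B"
        "t = frag_of (a, b \<oplus>\<^bsub>B\<^esub> b') - frag_of (a, b) - frag_of (a, b')"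
      have "frag_of x \<otimes>\<^bsub>?Z\<^esub> t = frag_of (u \<otimes>\<^bsub>A\<^esub> a, v \<otimes>\<^bsub>B\<^esub> b \<oplus>\<^bsub>B\<^esub> v \<otimes>\<^bsub>B\<^esub> b')
          - frag_of (u \<otimes>\<^bsub>A\<^esub> a, v \<otimes>\<^bsub>B\<^esub> b) - frag_of (u \<otimes>\<^bsub>A\<^esub> a, v \<otimes>\<^bsub>B\<^esub> b')"
        using r uv by (simp add: x' DirProd_def frag_extend_diff B.r_distr)
      then show "frag_of x \<otimes>\<^bsub>?Z\<^esub> t \<in> ?T" using r uv by (simp only: tensor_relationsI A.m_closed B.m_closed)
    next
      fix c a b
      assume s: "c \<in> carrier K" "a \<in> carrier A" "b \<in> carrier B"
        "t = frag_of (c \<odot>\<^bsub>A\<^esub> a, b) - frag_of (a, c \<odot>\<^bsub>B\<^esub> b)"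
      have "u \<otimes>\<^bsub>A\<^esub> (c \<odot>\<^bsub>A\<^esub> a) = c \<odot>\<^bsub>A\<^esub> (u \<otimes>\<^bsub>A\<^esub> a)" "v \<otimes>\<^bsub>B\<^esub> (c \<odot>\<^bsub>B\<^esub> b) = c \<odot>\<^bsub>B\<^esub> (v \<otimes>\<^bsub>B\<^esub> b)"
        using s uv KA.smult_assoc2[of c a u] KB.smult_assoc2[of c b v]
        by (simp_all add: A.m_comm B.m_comm)
      then have "frag_of x \<otimes>\<^bsub>?Z\<^esub> t = frag_of (c \<odot>\<^bsub>A\<^esub> (u \<otimes>\<^bsub>A\<^esub> a), v \<otimes>\<^bsub>B\<^esub> b)
          - frag_of (u \<otimes>\<^bsub>A\<^esub> a, c \<odot>\<^bsub>B\<^esub> (v \<otimes>\<^bsub>B\<^esub> b))"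
        using s by (simp add: x' DirProd_def frag_extend_diff)
      then show "frag_of x \<otimes>\<^bsub>?Z\<^esub> t \<in> ?T" using s uv by (simp only: tensor_relationsI A.m_closed B.m_closed)
    qed
  qed
  have basis: "frag_of x \<otimes>\<^bsub>?Z\<^esub> f \<in> ?H" if x: "x \<in> carrier (A \<times>\<times> B)" and f: "f \<in> ?H" for x f
    using f
  proof (induction rule: generate.induct)
    have fx: "frag_of x \<in> carrier ?Z" using x by simp
    {
      case one
      have "frag_of x \<otimes>\<^bsub>?Z\<^esub> \<one>\<^bsub>add_monoid ?Z\<^esub> = \<one>\<^bsub>add_monoid ?Z\<^esub>" by simp
      then show ?case using generate.one[of "add_monoid ?Z" ?T] by (simp only:)
    next
      case (incl h)
      then show ?case using rel[OF x] by (blast intro: generate.incl)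
    next
      case (inv h)
      have "frag_of x \<otimes>\<^bsub>?Z\<^esub> (\<ominus>\<^bsub>?Z\<^esub> h) = \<ominus>\<^bsub>?Z\<^esub> (frag_of x \<otimes>\<^bsub>?Z\<^esub> h)"
        using Z.r_minus fx T inv by blast
      then show ?case using generate.inv[OF rel[OF x inv]] by (simp only: a_inv_def)
    next
      case (eng g h)
      then have "g \<in> carrier ?Z" "h \<in> carrier ?Z" using HZ by blast+
      then have "frag_of x \<otimes>\<^bsub>?Z\<^esub> (g \<oplus>\<^bsub>?Z\<^esub> h) = frag_of x \<otimes>\<^bsub>?Z\<^esub> g \<oplus>\<^bsub>?Z\<^esub> frag_of x \<otimes>\<^bsub>?Z\<^esub> h"
        using Z.r_distr fx by blast
      then show ?case using generate.eng[OF eng.IH] by (simp only: monoid_record_simps)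
    }
  qed
  have mult: "g \<otimes>\<^bsub>?Z\<^esub> f \<in> ?H" if g: "g \<in> carrier ?Z" and f: "f \<in> ?H" for g f
  proof -
    have "Poly_Mapping.keys g \<subseteq> carrier (A \<times>\<times> B)" using g by simp
    then show ?thesis
    proof (induction g rule: frag_induction)
      case zero
      have "0 \<otimes>\<^bsub>?Z\<^esub> f = \<one>\<^bsub>add_monoid ?Z\<^esub>" by simp
      then show ?case using generate.one[of "add_monoid ?Z" ?T] by (simp only:)
    next
      case (one x)
      then show ?case using basis f by blast
    next
      case (diff a b)
      let ?p = "a \<otimes>\<^bsub>?Z\<^esub> f" and ?q = "b \<otimes>\<^bsub>?Z\<^esub> f"
      have pq: "?p \<in> carrier ?Z" "?q \<in> carrier ?Z" using HZ diff by blast+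
      have q: "inv\<^bsub>add_monoid ?Z\<^esub> ?q \<in> ?H" using subgroup.m_inv_closed[OF H diff(2)] .
      have "(a - b) \<otimes>\<^bsub>?Z\<^esub> f \<oplus>\<^bsub>?Z\<^esub> ?q = ?p" by (simp add: frag_extend_diff)
      moreover have "?p \<oplus>\<^bsub>?Z\<^esub> (\<ominus>\<^bsub>?Z\<^esub> ?q) \<oplus>\<^bsub>?Z\<^esub> ?q = ?p"
        using pq by (simp only: Z.a_assoc Z.a_inv_closed Z.l_neg Z.r_zero)
      ultimately have "(a - b) \<otimes>\<^bsub>?Z\<^esub> f = ?p \<oplus>\<^bsub>?Z\<^esub> (\<ominus>\<^bsub>?Z\<^esub> ?q)"
        unfolding int_monoid_ring_simps by (metis add_right_cancel)
      then show ?case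
        using subgroup.m_closed[OF H diff(1) q] by (simp only: a_inv_def monoid_record_simps)
    qed
  qed
  have "ideal ?H ?Z"
  proof (rule idealI[OF Z.ring_axioms H])
    fix f g assume f: "f \<in> ?H" and g: "g \<in> carrier ?Z"
    show "g \<otimes>\<^bsub>?Z\<^esub> f \<in> ?H" by (rule mult[OF g f])
    then show "f \<otimes>\<^bsub>?Z\<^esub> g \<in> ?H" using Z.m_comm[of f g] f g HZ by auto
  qed
  then show "genideal ?Z ?T \<subseteq> ?H"
    by (rule Z.genideal_minimal) (blast intro: generate.incl)
  have "subgroup (genideal ?Z ?T) (add_monoid ?Z)"
    using Z.genideal_ideal[OF T] ideal.axioms(1) additive_subgroup.a_subgroup by blast
  then show "?H \<subseteq> genideal ?Z ?T"
    using Z.add.generate_subgroup_incl Z.genideal_self[OF T] by blast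
qed

lemma tensor_product_cring:
  assumes "algebra K A" "algebra K B"
  shows "cring (tensor_product K A B)"
proof -
  interpret Z: cring "int_monoid_ring (A \<times>\<times> B)"
    by (rule int_monoid_ring_cring[OF tensor_monoid[OF assms]])
  show ?thesis unfolding tensor_product_def
    by (rule ideal.quotient_is_cring[OF Z.genideal_ideal[OF tensor_relations_subset[OF assms]]])
      (rule Z.is_cring)
qed

end

theory Submission
  imports Defs
begin

text \<open>
  Let \<open>R = A \<otimes> B\<close>, let \<open>k'\<close> and \<open>l'\<close> be the algebraic closures of \<open>k\<close> in \<open>A\<close> and \<open>B\<close>, and let
  \<open>P \<noteq> Q\<close> be minimal primes of \<open>R\<close>. Choose a subring \<open>U\<close> of \<open>A\<close> maximal such that \<open>D = U \<otimes> B\<close> has no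
  zero divisors. The nonzero elements of \<open>D\<close> are regular in \<open>R\<close>, so they lie in no minimal prime,
  and \<open>R\<close> is algebraic over \<open>D\<close>. For \<open>x \<in> P - Q\<close> an equation of \<open>x\<close> over \<open>D\<close> has the form
  \<open>x\<^sup>e (g + x h) = 0\<close> with \<open>0 \<noteq> g \<in> D\<close>; replacing \<open>g\<close> by \<open>g\<^sup>e\<close> and putting \<open>y = (- x h)\<^sup>e\<close> gives
  \<open>y\<^sup>2 = g y\<close> with \<open>y \<in> P - Q\<close>, that is, an idempotent \<open>y / g\<close>.

  This idempotent is defined over \<open>l'\<close>. In \<open>R \<otimes>\<^bsub>A\<^esub> R = R \<otimes> B\<close> the difference
  \<open>w = y\<^sub>1 g\<^sub>2 - y\<^sub>2 g\<^sub>1\<close> of the two images satisfies \<open>w\<^sup>3 = (g\<^sub>1 g\<^sub>2)\<^sup>2 w\<close>, so it is killed by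
  \<open>(g\<^sub>1 g\<^sub>2)\<^sup>2 - w\<^sup>2\<close>, which becomes regular on the diagonal; elimination turns this into a nonzero
  \<open>u \<in> B \<otimes> B\<close> with \<open>u w = 0\<close>. Take \<open>p / q = y / g\<close> with \<open>q \<in> U \<otimes> B\<close> of minimal length and let
  \<open>b\<^sub>1\<close> be a coefficient of \<open>q\<close>. Minimality gives \<open>u (c \<otimes> b\<^sub>1 - b\<^sub>1 \<otimes> c) = 0\<close> for all other
  coefficients \<open>c\<close> of \<open>p\<close> and \<open>q\<close>. Hence \<open>c / b\<^sub>1\<close> is algebraic over \<open>k\<close>, and it lies in \<open>l'\<close>
  because \<open>B\<close> is integrally closed. After division by \<open>b\<^sub>1\<close> we have \<open>p \<in> A \<otimes> l'\<close>, \<open>q \<in> U \<otimes> l'\<close>,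
  and \<open>p g = q y\<close> shows \<open>p \<in> P - Q\<close>.

  The same argument for \<open>l' \<otimes> A\<close> yields an element \<open>w \<in> P - Q\<close> of \<open>k' \<otimes> l'\<close>. It is algebraic over
  \<open>k\<close>, so \<open>w\<^sup>e (c + w h) = 0\<close> with a unit \<open>c\<close> of \<open>k\<close>. Then \<open>c + w h \<in> Q\<close>, and \<open>P + Q = R\<close>.
\<close>

subsection \<open>Tensor products of algebras\<close>

text \<open>No total quotient ring of R is formed: an idempotent y / g is carried by the equation
  y^2 = g y with g regular, and all statements about fractions are cleared of denominators. The
  descent to l' rests on idempotents being locally constant: for the two images e_1, e_2 of an
  idempotent in the tensor square, 1 - (e_1 - e_2)^2 is an idempotent equal to 1 on the diagonal.
  Away from the diagonal the two images may differ, so u w = 0 with some nonzero u is all that can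
  be expected. It suffices because u has finitely many terms: if u does not distinguish b \<otimes>
  c from c \<otimes> b, then the powers of b / c, up to a common nonzero factor, stay in a
  finite-dimensional space over k. The first pass ends with an element p that satisfies no useful
  equation of its own; only its membership in P - Q survives. Hence the second pass has to find a
  new idempotent fraction, and it works with preimages of P and Q that are not known to be minimal.
  This is why the lemmas about primes ask for the avoidance of certain regular elements.\<close>

locale tensor_pair = K: field K + A: cring A + B: cring B + KA: algebra K A + KB: algebra K B
  for K :: "('k, 'm) ring_scheme" and A :: "('k, 'a, 'n) module_scheme"
    and B :: "('k, 'b, 'o) module_scheme"

lemma tensor_pairI: "field K \<Longrightarrow> algebra K A \<Longrightarrow> algebra K B \<Longrightarrow> tensor_pair K A B"
  by (simp add: tensor_pair_def algebra.M_cring)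

definition tens where
  "tens K A B a b =
     genideal (int_monoid_ring (A \<times>\<times> B)) (tensor_relations K A B)
       +>\<^bsub>int_monoid_ring (A \<times>\<times> B)\<^esub> frag_of (a, b)"

text \<open>\<open>tensor_product\<close> is a bare ring. The scalar multiplication is added so that
  the construction can be iterated, with A \<otimes> B as left factor of a further tensor product; a
  scalar acts through its multiple of 1 in \<open>A\<close>.\<close>

definition tensor_algebra ::
    "('k, 'm) ring_scheme \<Rightarrow> ('k, 'a, 'n) module_scheme \<Rightarrow> ('k, 'b, 'o) module_scheme \<Rightarrow>
     ('k, (('a \<times> 'b) \<Rightarrow>\<^sub>0 int) set) module" where
  "tensor_algebra K A B =
     \<lparr> carrier = carrier (tensor_product K A B), monoid.mult = monoid.mult (tensor_product K A B),
       one = one (tensor_product K A B), ring.zero = ring.zero (tensor_product K A B),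
       add = add (tensor_product K A B),
       smult = (\<lambda>c x. tens K A B (c \<odot>\<^bsub>A\<^esub> \<one>\<^bsub>A\<^esub>) \<one>\<^bsub>B\<^esub> \<otimes>\<^bsub>tensor_product K A B\<^esub> x) \<rparr>"

text \<open>A ring and a module record with the same operations have different types, so ring
  properties are transported field by field.\<close>

lemma cring_cong:
  assumes "cring R" "carrier S = carrier R" "monoid.mult S = monoid.mult R" "one S = one R"
    "ring.zero S = ring.zero R" "add S = add R"
  shows "cring S"
proof -
  interpret R: cring R by fact
  show ?thesis
  proof (rule cringI)
    show "abelian_group S"
      using R.a_assoc R.a_comm R.l_neg by (intro abelian_groupI) (auto simp: assms)
    show "comm_monoid S"
      using R.m_assoc R.m_comm by (intro comm_monoidI) (auto simp: assms)
  qed (simp add: assms R.l_distr)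
qed

context tensor_pair
begin

abbreviation Z where "Z \<equiv> int_monoid_ring (A \<times>\<times> B)"
abbreviation Rel where "Rel \<equiv> genideal Z (tensor_relations K A B)"
abbreviation R where "R \<equiv> tensor_algebra K A B"

lemma carrier_Z: "carrier Z = {f. Poly_Mapping.keys f \<subseteq> carrier A \<times> carrier B}"
  by (simp add: DirProd_def)

lemma Z_cring: "cring Z"
  by (rule int_monoid_ring_cring[OF tensor_monoid]) (rule KA.algebra_axioms KB.algebra_axioms)+

lemma Rel_ideal: "ideal Rel Z"
  using Z_cring cring.axioms(1) ring.genideal_ideal
    tensor_relations_subset[OF KA.algebra_axioms KB.algebra_axioms] by blast

sublocale R: cring "tensor_algebra K A B"
  by (rule cring_cong[OF tensor_product_cring[OF KA.algebra_axioms KB.algebra_axioms]])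
    (simp_all add: tensor_algebra_def)

lemma quot_hom: "(+>\<^bsub>Z\<^esub>) Rel \<in> ring_hom Z R"
  using ideal.rcos_ring_hom[OF Rel_ideal]
  by (simp add: ring_hom_def tensor_algebra_def tensor_product_def)

lemma carrier_R: "carrier R = (+>\<^bsub>Z\<^esub>) Rel ` carrier Z"
  by (auto simp: tensor_algebra_def tensor_product_def FactRing_def A_RCOSETS_defs a_r_coset_def)

lemma tens_alt: "tens K A B a b = Rel +>\<^bsub>Z\<^esub> frag_of (a, b)"
  by (simp add: tens_def)

lemma frag_of_closed: "a \<in> carrier A \<Longrightarrow> b \<in> carrier B \<Longrightarrow> frag_of (a, b) \<in> carrier Z"
  by (simp add: carrier_Z)

lemma tens_closed [simp, intro]:
  "a \<in> carrier A \<Longrightarrow> b \<in> carrier B \<Longrightarrow> tens K A B a b \<in> carrier R"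
  unfolding tens_alt using ring_hom_closed[OF quot_hom frag_of_closed] .

lemma quot_eq:
  assumes "f \<in> carrier Z" "g \<in> carrier Z" "f - g \<in> Rel"
  shows "Rel +>\<^bsub>Z\<^esub> f = Rel +>\<^bsub>Z\<^esub> g"
proof -
  interpret I: ideal Rel Z by (rule Rel_ideal)
  have "(f - g) \<oplus>\<^bsub>Z\<^esub> g \<in> Rel +>\<^bsub>Z\<^esub> g" unfolding a_r_coset_def' using assms(3) by blast
  then have "f \<in> Rel +>\<^bsub>Z\<^esub> g" by simp
  then show ?thesis using I.a_repr_independence' assms by metis
qed

lemma Rel_incl: "tensor_relations K A B \<subseteq> Rel"
  using Z_cring cring.axioms(1) ring.genideal_self
    tensor_relations_subset[OF KA.algebra_axioms KB.algebra_axioms] by blast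

lemma quot_add: "f \<in> carrier Z \<Longrightarrow> g \<in> carrier Z \<Longrightarrow>
    Rel +>\<^bsub>Z\<^esub> (f + g) = (Rel +>\<^bsub>Z\<^esub> f) \<oplus>\<^bsub>R\<^esub> (Rel +>\<^bsub>Z\<^esub> g)"
  using ring_hom_add[OF quot_hom, of f g] by simp

lemma tens_add_left:
  assumes "a \<in> carrier A" "a' \<in> carrier A" "b \<in> carrier B"
  shows "tens K A B (a \<oplus>\<^bsub>A\<^esub> a') b = tens K A B a b \<oplus>\<^bsub>R\<^esub> tens K A B a' b"
proof -
  have "frag_of (a \<oplus>\<^bsub>A\<^esub> a', b) - (frag_of (a, b) + frag_of (a', b)) \<in> Rel"
    using tensor_relationsI(1)[of a A a' b B K] assms Rel_incl by (auto simp: diff_diff_eq)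
  then have "Rel +>\<^bsub>Z\<^esub> frag_of (a \<oplus>\<^bsub>A\<^esub> a', b) = Rel +>\<^bsub>Z\<^esub> (frag_of (a, b) + frag_of (a', b))"
    using assms by (intro quot_eq) (auto simp: carrier_Z intro!: order_trans[OF keys_add])
  then show ?thesis using assms by (simp add: tens_alt quot_add frag_of_closed)
qed

lemma tens_add_right:
  assumes "a \<in> carrier A" "b \<in> carrier B" "b' \<in> carrier B"
  shows "tens K A B a (b \<oplus>\<^bsub>B\<^esub> b') = tens K A B a b \<oplus>\<^bsub>R\<^esub> tens K A B a b'"
proof -
  have "frag_of (a, b \<oplus>\<^bsub>B\<^esub> b') - (frag_of (a, b) + frag_of (a, b')) \<in> Rel"
    using tensor_relationsI(2)[of a A b B b' K] assms Rel_incl by (auto simp: diff_diff_eq)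
  then have "Rel +>\<^bsub>Z\<^esub> frag_of (a, b \<oplus>\<^bsub>B\<^esub> b') = Rel +>\<^bsub>Z\<^esub> (frag_of (a, b) + frag_of (a, b'))"
    using assms by (intro quot_eq) (auto simp: carrier_Z intro!: order_trans[OF keys_add])
  then show ?thesis using assms by (simp add: tens_alt quot_add frag_of_closed)
qed

lemma tens_smult:
  assumes "c \<in> carrier K" "a \<in> carrier A" "b \<in> carrier B"
  shows "tens K A B (c \<odot>\<^bsub>A\<^esub> a) b = tens K A B a (c \<odot>\<^bsub>B\<^esub> b)"
proof -
  have "frag_of (c \<odot>\<^bsub>A\<^esub> a, b) - frag_of (a, c \<odot>\<^bsub>B\<^esub> b) \<in> Rel"
    using tensor_relationsI(3)[of c K a A b B] assms Rel_incl by auto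
  then show ?thesis unfolding tens_alt using assms by (intro quot_eq) (auto simp: carrier_Z)
qed

lemma tens_mult:
  assumes "a \<in> carrier A" "a' \<in> carrier A" "b \<in> carrier B" "b' \<in> carrier B"
  shows "tens K A B a b \<otimes>\<^bsub>R\<^esub> tens K A B a' b' = tens K A B (a \<otimes>\<^bsub>A\<^esub> a') (b \<otimes>\<^bsub>B\<^esub> b')"
  unfolding tens_alt using assms
  by (subst ring_hom_mult[OF quot_hom, symmetric]) (auto simp: carrier_Z DirProd_def)

lemma tens_one: "\<one>\<^bsub>R\<^esub> = tens K A B \<one>\<^bsub>A\<^esub> \<one>\<^bsub>B\<^esub>"
  unfolding tens_alt using ring_hom_one[OF quot_hom] by (simp add: DirProd_def)

lemma tens_zero_left: "b \<in> carrier B \<Longrightarrow> tens K A B \<zero>\<^bsub>A\<^esub> b = \<zero>\<^bsub>R\<^esub>"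
  using tens_add_left[of "\<zero>\<^bsub>A\<^esub>" "\<zero>\<^bsub>A\<^esub>" b] by (metis A.r_zero A.zero_closed R.add.l_cancel_one tens_closed)

lemma tens_zero_right: "a \<in> carrier A \<Longrightarrow> tens K A B a \<zero>\<^bsub>B\<^esub> = \<zero>\<^bsub>R\<^esub>"
  using tens_add_right[of a "\<zero>\<^bsub>B\<^esub>" "\<zero>\<^bsub>B\<^esub>"] by (metis B.r_zero B.zero_closed R.add.l_cancel_one tens_closed)

lemma tens_minus_left:
  assumes "a \<in> carrier A" "b \<in> carrier B"
  shows "tens K A B (\<ominus>\<^bsub>A\<^esub> a) b = \<ominus>\<^bsub>R\<^esub> tens K A B a b"
proof -
  have "tens K A B (\<ominus>\<^bsub>A\<^esub> a) b \<oplus>\<^bsub>R\<^esub> tens K A B a b = \<zero>\<^bsub>R\<^esub>"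
    using tens_add_left[of "\<ominus>\<^bsub>A\<^esub> a" a b] assms by (simp add: A.l_neg tens_zero_left)
  then show ?thesis using assms R.minus_equality by simp
qed

text \<open>Integer combinations of basis elements have signs; these are absorbed by - (a \<otimes>
  b) = (- a) \<otimes> b, so sums of elementary tensors suffice. The induction over differences
  therefore carries \<open>P\<close> for a class together with its negative.\<close>

lemma tens_induct [consumes 1, case_names tens add]:
  assumes z: "z \<in> carrier R"
    and t: "\<And>a b. a \<in> carrier A \<Longrightarrow> b \<in> carrier B \<Longrightarrow> P (tens K A B a b)"
    and add: "\<And>x y. x \<in> carrier R \<Longrightarrow> y \<in> carrier R \<Longrightarrow> P x \<Longrightarrow> P y \<Longrightarrow> P (x \<oplus>\<^bsub>R\<^esub> y)"
  shows "P z"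
proof -
  obtain f where f: "f \<in> carrier Z" "z = Rel +>\<^bsub>Z\<^esub> f" using z carrier_R by auto
  interpret q: ring_hom_ring Z R "(+>\<^bsub>Z\<^esub>) Rel"
    using quot_hom Z_cring R.ring_axioms by (intro ring_hom_ringI2) (auto dest: cring.axioms(1))
  have keys: "Poly_Mapping.keys f \<subseteq> carrier A \<times> carrier B" using f carrier_Z by auto
  have "Poly_Mapping.keys f \<subseteq> carrier A \<times> carrier B \<and> P (Rel +>\<^bsub>Z\<^esub> f) \<and> P (\<ominus>\<^bsub>R\<^esub> (Rel +>\<^bsub>Z\<^esub> f))"
    using keys
  proof (induction f rule: frag_induction)
    case zero
    have "tens K A B \<zero>\<^bsub>A\<^esub> \<zero>\<^bsub>B\<^esub> = \<zero>\<^bsub>R\<^esub>" by (rule tens_zero_left) simp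
    moreover have "Rel +>\<^bsub>Z\<^esub> 0 = \<zero>\<^bsub>R\<^esub>" using q.hom_zero by simp
    ultimately show ?case using t[of "\<zero>\<^bsub>A\<^esub>" "\<zero>\<^bsub>B\<^esub>"] by simp
  next
    case (one x)
    then obtain a b where x: "x = (a, b)" "a \<in> carrier A" "b \<in> carrier B" by auto
    then show ?case using t[of a b] t[of "\<ominus>\<^bsub>A\<^esub> a" b] tens_minus_left[of a b] by (simp add: tens_alt)
  next
    case (diff a b)
    have keys: "Poly_Mapping.keys (a - b) \<subseteq> carrier A \<times> carrier B"
      using diff keys_diff[of a b] by blast
    have a: "a \<in> carrier Z" and b: "b \<in> carrier Z" and ab: "a - b \<in> carrier Z"
      using diff keys by (auto simp: carrier_Z)
    have "(Rel +>\<^bsub>Z\<^esub> (a - b)) \<oplus>\<^bsub>R\<^esub> (Rel +>\<^bsub>Z\<^esub> b) = Rel +>\<^bsub>Z\<^esub> a"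
      using quot_add[OF ab b] by simp
    then have e: "Rel +>\<^bsub>Z\<^esub> (a - b) = (Rel +>\<^bsub>Z\<^esub> a) \<oplus>\<^bsub>R\<^esub> \<ominus>\<^bsub>R\<^esub> (Rel +>\<^bsub>Z\<^esub> b)"
      using a b ab by (metis R.minus_eq R.add.inv_solve_right q.hom_closed a_minus_def)
    have e': "\<ominus>\<^bsub>R\<^esub> (Rel +>\<^bsub>Z\<^esub> (a - b)) = \<ominus>\<^bsub>R\<^esub> (Rel +>\<^bsub>Z\<^esub> a) \<oplus>\<^bsub>R\<^esub> (Rel +>\<^bsub>Z\<^esub> b)"
      unfolding e using a b by (simp add: R.minus_add q.hom_closed)
    show ?case unfolding e' unfolding e using diff keys a b add[OF q.hom_closed R.a_inv_closed] add[OF R.a_inv_closed q.hom_closed]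
      by (simp add: q.hom_closed)
  qed
  then show ?thesis using f by simp
qed

text \<open>The universal property for balanced biadditive maps into an abelian group. The kernel of
  the extension \<open>h0\<close> to the free abelian group is only a subgroup; it contains
  \<open>Rel\<close> because that ideal is already generated by the relations as a group.\<close>

lemma tens_lift:
  fixes M :: "('c, 'p) ring_scheme"
  assumes "abelian_group M"
    and cl: "\<And>a b. a \<in> carrier A \<Longrightarrow> b \<in> carrier B \<Longrightarrow> \<beta> a b \<in> carrier M"
    and add1: "\<And>a a' b. a \<in> carrier A \<Longrightarrow> a' \<in> carrier A \<Longrightarrow> b \<in> carrier B \<Longrightarrow>
       \<beta> (a \<oplus>\<^bsub>A\<^esub> a') b = \<beta> a b \<oplus>\<^bsub>M\<^esub> \<beta> a' b"
    and add2: "\<And>a b b'. a \<in> carrier A \<Longrightarrow> b \<in> carrier B \<Longrightarrow> b' \<in> carrier B \<Longrightarrow>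
       \<beta> a (b \<oplus>\<^bsub>B\<^esub> b') = \<beta> a b \<oplus>\<^bsub>M\<^esub> \<beta> a b'"
    and bal: "\<And>c a b. c \<in> carrier K \<Longrightarrow> a \<in> carrier A \<Longrightarrow> b \<in> carrier B \<Longrightarrow>
       \<beta> (c \<odot>\<^bsub>A\<^esub> a) b = \<beta> a (c \<odot>\<^bsub>B\<^esub> b)"
  obtains h where "h \<in> carrier R \<rightarrow> carrier M"
    "\<And>x y. x \<in> carrier R \<Longrightarrow> y \<in> carrier R \<Longrightarrow> h (x \<oplus>\<^bsub>R\<^esub> y) = h x \<oplus>\<^bsub>M\<^esub> h y"
    "\<And>a b. a \<in> carrier A \<Longrightarrow> b \<in> carrier B \<Longrightarrow> h (tens K A B a b) = \<beta> a b"
proof -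
  interpret M: abelian_group M by fact
  interpret Z: cring Z by (rule Z_cring)
  interpret I: ideal Rel Z by (rule Rel_ideal)
  let ?S = "carrier A \<times> carrier B"
  obtain h0 where h0: "h0 \<in> hom (free_Abelian_group ?S) (add_monoid M)"
      "\<And>x. x \<in> ?S \<Longrightarrow> h0 (frag_of x) = (case x of (a, b) \<Rightarrow> \<beta> a b)"
    using comm_group.free_Abelian_group_universal[OF M.a_comm_group, of "\<lambda>(a, b). \<beta> a b" ?S] cl
    by (auto simp: image_subset_iff)
  have h0_add: "h0 (f + g) = h0 f \<oplus>\<^bsub>M\<^esub> h0 g" if "f \<in> carrier Z" "g \<in> carrier Z" for f g
    using h0(1) that unfolding hom_def by (auto simp: free_Abelian_group_def carrier_Z)
  have h0_cl: "h0 f \<in> carrier M" if "f \<in> carrier Z" for f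
    using h0(1) that unfolding hom_def by (auto simp: free_Abelian_group_def carrier_Z)
  have h0_diff: "h0 (f - g) = h0 f \<ominus>\<^bsub>M\<^esub> h0 g" if fg: "f \<in> carrier Z" "g \<in> carrier Z" for f g
  proof -
    have d: "f - g \<in> carrier Z" using fg keys_diff[of f g] by (auto simp: carrier_Z)
    have "h0 (f - g) \<oplus>\<^bsub>M\<^esub> h0 g = h0 f" using h0_add[OF d fg(2)] by simp
    then show ?thesis using h0_cl[OF d] h0_cl[OF fg(1)] h0_cl[OF fg(2)]
      by (metis M.minus_eq M.add.inv_solve_right)
  qed
  define N where "N = {f \<in> carrier Z. h0 f = \<zero>\<^bsub>M\<^esub>}"
  interpret zg: group_hom "add_monoid Z" "add_monoid M" h0
    using h0_cl h0_add Z.a_group M.a_group by (auto simp: group_hom_def group_hom_axioms_def hom_def)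
  have N: "subgroup N (add_monoid Z)"
    using zg.subgroup_kernel by (simp add: N_def kernel_def)
  have "tensor_relations K A B \<subseteq> N"
  proof
    fix t assume t: "t \<in> tensor_relations K A B"
    have tZ: "t \<in> carrier Z"
      using t tensor_relations_subset[OF KA.algebra_axioms KB.algebra_axioms] by blast
    have d: "p - q \<in> carrier Z" if "p \<in> carrier Z" "q \<in> carrier Z" for p q
      using that keys_diff[of p q] unfolding carrier_Z by blast
    note f = frag_of_closed
    have mm: "u \<oplus>\<^bsub>M\<^esub> v \<ominus>\<^bsub>M\<^esub> u \<ominus>\<^bsub>M\<^esub> v = \<zero>\<^bsub>M\<^esub>" if "u \<in> carrier M" "v \<in> carrier M" for u v
    proof -
      have "u \<oplus>\<^bsub>M\<^esub> v \<ominus>\<^bsub>M\<^esub> u = v"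
        using M.a_comm[of u v] that by (simp add: M.minus_eq M.a_assoc M.r_neg)
      then show ?thesis using that by (simp add: M.minus_eq M.r_neg)
    qed
    have "h0 t = \<zero>\<^bsub>M\<^esub>"
      using t unfolding tensor_relations_def
    proof (elim UnE CollectE exE conjE)
      fix a a' b assume l: "a \<in> carrier A" "a' \<in> carrier A" "b \<in> carrier B"
        "t = frag_of (a \<oplus>\<^bsub>A\<^esub> a', b) - frag_of (a, b) - frag_of (a', b)"
      have "h0 t = h0 (frag_of (a \<oplus>\<^bsub>A\<^esub> a', b)) \<ominus>\<^bsub>M\<^esub> h0 (frag_of (a, b)) \<ominus>\<^bsub>M\<^esub> h0 (frag_of (a', b))"
        unfolding l(4) using l(1-3) by (simp add: h0_diff d f del: int_monoid_ring_simps)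
      also have "\<dots> = \<zero>\<^bsub>M\<^esub>" using l(1-3) cl
        by (simp add: h0(2) add1 mm)
      finally show ?thesis .
    next
      fix a b b' assume l: "a \<in> carrier A" "b \<in> carrier B" "b' \<in> carrier B"
        "t = frag_of (a, b \<oplus>\<^bsub>B\<^esub> b') - frag_of (a, b) - frag_of (a, b')"
      have "h0 t = h0 (frag_of (a, b \<oplus>\<^bsub>B\<^esub> b')) \<ominus>\<^bsub>M\<^esub> h0 (frag_of (a, b)) \<ominus>\<^bsub>M\<^esub> h0 (frag_of (a, b'))"
        unfolding l(4) using l(1-3) by (simp add: h0_diff d f del: int_monoid_ring_simps)
      also have "\<dots> = \<zero>\<^bsub>M\<^esub>" using l(1-3) cl
        by (simp add: h0(2) add2 mm)
      finally show ?thesis .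
    next
      fix c a b assume l: "c \<in> carrier K" "a \<in> carrier A" "b \<in> carrier B"
        "t = frag_of (c \<odot>\<^bsub>A\<^esub> a, b) - frag_of (a, c \<odot>\<^bsub>B\<^esub> b)"
      have "h0 t = h0 (frag_of (c \<odot>\<^bsub>A\<^esub> a, b)) \<ominus>\<^bsub>M\<^esub> h0 (frag_of (a, c \<odot>\<^bsub>B\<^esub> b))"
        unfolding l(4) using l(1-3) by (simp add: h0_diff d f del: int_monoid_ring_simps)
      also have "\<dots> = \<zero>\<^bsub>M\<^esub>" using l(1-3) cl by (simp add: h0(2) bal M.minus_eq M.r_neg)
      finally show ?thesis .
    qed
    then show "t \<in> N" using tZ by (simp add: N_def)
  qed
  then have "generate (add_monoid Z) (tensor_relations K A B) \<subseteq> N"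
    using Z.add.generate_subgroup_incl N by blast
  then have RN: "Rel \<subseteq> N"
    using tensor_ideal_eq_subgroup[OF KA.algebra_axioms KB.algebra_axioms] by simp
  have img: "h0 ` (Rel +>\<^bsub>Z\<^esub> f) = {h0 f}" if f: "f \<in> carrier Z" for f
  proof -
    have "h0 y = h0 f" if y: "y \<in> Rel +>\<^bsub>Z\<^esub> f" for y
    proof -
      obtain r where r: "r \<in> Rel" "y = r \<oplus>\<^bsub>Z\<^esub> f" using y by (auto simp: a_r_coset_def')
      then have "h0 r = \<zero>\<^bsub>M\<^esub>" "r \<in> carrier Z" using RN N_def by auto
      then show ?thesis using r h0_add[of r f] f h0_cl[OF f] by simp
    qed
    moreover have "f \<in> Rel +>\<^bsub>Z\<^esub> f" using I.a_rcos_self[OF f] .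
    ultimately show ?thesis by blast
  qed
  define h where "h c = the_elem (h0 ` c)" for c
  have h: "h (Rel +>\<^bsub>Z\<^esub> f) = h0 f" if "f \<in> carrier Z" for f using img[OF that] by (simp add: h_def)
  show ?thesis
  proof
    show "h \<in> carrier R \<rightarrow> carrier M" unfolding carrier_R using h h0_cl by auto
    show "h (x \<oplus>\<^bsub>R\<^esub> y) = h x \<oplus>\<^bsub>M\<^esub> h y" if x: "x \<in> carrier R" and y: "y \<in> carrier R" for x y
    proof -
      obtain f g where "f \<in> carrier Z" "g \<in> carrier Z" "x = Rel +>\<^bsub>Z\<^esub> f" "y = Rel +>\<^bsub>Z\<^esub> g"
        using x y carrier_R by auto
      moreover then have "f + g \<in> carrier Z" using Z.a_closed[of f g] by simp
      ultimately show ?thesis by (simp add: quot_add[symmetric] h h0_add del: int_monoid_ring_simps)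
    qed
    show "h (tens K A B a b) = \<beta> a b" if "a \<in> carrier A" "b \<in> carrier B" for a b
      using that by (simp add: tens_alt h[OF frag_of_closed] h0(2))
  qed
qed

end

subsection \<open>Linear functionals\<close>

text \<open>A list of pairs serves as a formal tensor. The biadditive map is a parameter because one
  and the same list is evaluated in several ways: as an element of a tensor product, or through a
  slice of it.\<close>

primrec bsum :: "('c, 'm) ring_scheme \<Rightarrow> ('x \<Rightarrow> 'y \<Rightarrow> 'c) \<Rightarrow> ('x \<times> 'y) list \<Rightarrow> 'c" where
  "bsum M \<beta> [] = \<zero>\<^bsub>M\<^esub>"
| "bsum M \<beta> (p # ps) = \<beta> (fst p) (snd p) \<oplus>\<^bsub>M\<^esub> bsum M \<beta> ps"

lemma (in abelian_group) bsum_closed: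
  "(\<And>x y. (x, y) \<in> set ps \<Longrightarrow> \<beta> x y \<in> carrier G) \<Longrightarrow> bsum G \<beta> ps \<in> carrier G"
  by (induction ps) auto

lemma (in abelian_group) bsum_append:
  "(\<And>x y. (x, y) \<in> set (ps @ qs) \<Longrightarrow> \<beta> x y \<in> carrier G) \<Longrightarrow>
    bsum G \<beta> (ps @ qs) = bsum G \<beta> ps \<oplus> bsum G \<beta> qs"
proof (induction ps)
  case Nil
  then show ?case by (simp add: bsum_closed)
next
  case (Cons p ps)
  have 1: "\<beta> (fst p) (snd p) \<in> carrier G" using Cons.prems[of "fst p" "snd p"] by simp
  have 2: "bsum G \<beta> ps \<in> carrier G" "bsum G \<beta> qs \<in> carrier G"
    using Cons.prems by (auto intro: bsum_closed)
  show ?case using Cons 1 2 by (simp add: a_assoc)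
qed

lemma bsum_hom:
  assumes "abelian_group M" "abelian_group N" "h \<zero>\<^bsub>M\<^esub> = \<zero>\<^bsub>N\<^esub>"
    and "\<And>x y. x \<in> carrier M \<Longrightarrow> y \<in> carrier M \<Longrightarrow> h (x \<oplus>\<^bsub>M\<^esub> y) = h x \<oplus>\<^bsub>N\<^esub> h y"
    and "\<And>x y. (x, y) \<in> set ps \<Longrightarrow> \<beta> x y \<in> carrier M"
  shows "h (bsum M \<beta> ps) = bsum N (\<lambda>x y. h (\<beta> x y)) ps"
  using assms(5)
proof (induction ps)
  case Nil
  then show ?case using assms(3) by simp
next
  case (Cons p ps)
  have "\<beta> (fst p) (snd p) \<in> carrier M" using Cons.prems[of "fst p" "snd p"] by simp
  moreover have "bsum M \<beta> ps \<in> carrier M"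
    using Cons.prems by (auto intro: abelian_group.bsum_closed[OF assms(1)])
  ultimately show ?case using Cons assms(4) by simp
qed

lemma bsum_cong:
  "(\<And>x y. (x, y) \<in> set ps \<Longrightarrow> \<beta> x y = \<gamma> x y) \<Longrightarrow> bsum M \<beta> ps = bsum M \<gamma> ps"
  by (induction ps) auto

definition functional :: "('k, 'm) ring_scheme \<Rightarrow> ('k, 'a, 'n) module_scheme \<Rightarrow> ('a \<Rightarrow> 'k) \<Rightarrow> bool" where
  "functional K M \<phi> \<longleftrightarrow> \<phi> \<in> carrier M \<rightarrow> carrier K \<and>
     (\<forall>x\<in>carrier M. \<forall>y\<in>carrier M. \<phi> (x \<oplus>\<^bsub>M\<^esub> y) = \<phi> x \<oplus>\<^bsub>K\<^esub> \<phi> y) \<and>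
     (\<forall>c\<in>carrier K. \<forall>x\<in>carrier M. \<phi> (c \<odot>\<^bsub>M\<^esub> x) = c \<otimes>\<^bsub>K\<^esub> \<phi> x)"

lemma functionalD:
  assumes "functional K M \<phi>"
  shows "x \<in> carrier M \<Longrightarrow> \<phi> x \<in> carrier K"
    "x \<in> carrier M \<Longrightarrow> y \<in> carrier M \<Longrightarrow> \<phi> (x \<oplus>\<^bsub>M\<^esub> y) = \<phi> x \<oplus>\<^bsub>K\<^esub> \<phi> y"
    "c \<in> carrier K \<Longrightarrow> x \<in> carrier M \<Longrightarrow> \<phi> (c \<odot>\<^bsub>M\<^esub> x) = c \<otimes>\<^bsub>K\<^esub> \<phi> x"
  using assms by (auto simp: functional_def)

primrec kspan :: "('k, 'm) ring_scheme \<Rightarrow> ('k, 'a, 'n) module_scheme \<Rightarrow> 'a list \<Rightarrow> 'a set" where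
  "kspan K M [] = {\<zero>\<^bsub>M\<^esub>}"
| "kspan K M (v # vs) = {c \<odot>\<^bsub>M\<^esub> v \<oplus>\<^bsub>M\<^esub> m | c m. c \<in> carrier K \<and> m \<in> kspan K M vs}"

text \<open>Linear independence in the form that suits lists: over a field it is enough to keep each
  vector out of the span of its successors.\<close>

primrec indep :: "('k, 'm) ring_scheme \<Rightarrow> ('k, 'a, 'n) module_scheme \<Rightarrow> 'a list \<Rightarrow> bool" where
  "indep K M [] = True"
| "indep K M (v # vs) \<longleftrightarrow> v \<notin> kspan K M vs \<and> indep K M vs"

definition subspace :: "('k, 'm) ring_scheme \<Rightarrow> ('k, 'a, 'n) module_scheme \<Rightarrow> 'a set \<Rightarrow> bool" where
  "subspace K M H \<longleftrightarrow> H \<subseteq> carrier M \<and> \<zero>\<^bsub>M\<^esub> \<in> H \<and>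
     (\<forall>x\<in>H. \<forall>y\<in>H. x \<oplus>\<^bsub>M\<^esub> y \<in> H) \<and> (\<forall>c\<in>carrier K. \<forall>x\<in>H. c \<odot>\<^bsub>M\<^esub> x \<in> H)"

lemma subspaceD:
  assumes "subspace K M H"
  shows "x \<in> H \<Longrightarrow> x \<in> carrier M" "\<zero>\<^bsub>M\<^esub> \<in> H" "x \<in> H \<Longrightarrow> y \<in> H \<Longrightarrow> x \<oplus>\<^bsub>M\<^esub> y \<in> H"
    "c \<in> carrier K \<Longrightarrow> x \<in> H \<Longrightarrow> c \<odot>\<^bsub>M\<^esub> x \<in> H"
  using assms by (auto simp: subspace_def)

lemma kspan_Cons_intro:
  "x = c \<odot>\<^bsub>M\<^esub> v \<oplus>\<^bsub>M\<^esub> m \<Longrightarrow> c \<in> carrier K \<Longrightarrow> m \<in> kspan K M vs \<Longrightarrow> x \<in> kspan K M (v # vs)"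
  by auto

context module
begin

lemma smult_minus_one: "x \<in> carrier M \<Longrightarrow> (\<ominus> \<one>) \<odot>\<^bsub>M\<^esub> x = \<ominus>\<^bsub>M\<^esub> x"
  by (simp add: smult_l_minus)

lemma subspace_carrier: "subspace R M (carrier M)"
  by (simp add: subspace_def)

lemma subspace_minus: "subspace R M H \<Longrightarrow> x \<in> H \<Longrightarrow> \<ominus>\<^bsub>M\<^esub> x \<in> H"
  using subspaceD[of R M H] smult_minus_one by (metis R.a_inv_closed R.one_closed)

lemma kspan_subspace: "set vs \<subseteq> carrier M \<Longrightarrow> subspace R M (kspan R M vs)"
proof (induction vs)
  case Nil
  then show ?case by (simp add: subspace_def)
next
  case (Cons v vs)
  let ?H = "kspan R M vs"
  have v: "v \<in> carrier M" and H: "subspace R M ?H" using Cons by auto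
  note HD = subspaceD[OF H]
  show ?case
    unfolding subspace_def
  proof (intro conjI ballI subsetI)
    fix x assume "x \<in> kspan R M (v # vs)"
    then show "x \<in> carrier M" using v HD(1) by auto
  next
    have "\<zero> \<odot>\<^bsub>M\<^esub> v \<oplus>\<^bsub>M\<^esub> \<zero>\<^bsub>M\<^esub> = \<zero>\<^bsub>M\<^esub>" using v by simp
    then show "\<zero>\<^bsub>M\<^esub> \<in> kspan R M (v # vs)" 
      by (intro kspan_Cons_intro[OF sym]) (use HD(2) in auto)
  next
    fix x y assume "x \<in> kspan R M (v # vs)" "y \<in> kspan R M (v # vs)"
    then obtain c m c' m' where c: "c \<in> carrier R" "m \<in> ?H" "c' \<in> carrier R" "m' \<in> ?H"
      and x: "x = c \<odot>\<^bsub>M\<^esub> v \<oplus>\<^bsub>M\<^esub> m" and y: "y = c' \<odot>\<^bsub>M\<^esub> v \<oplus>\<^bsub>M\<^esub> m'" by auto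
    have "x \<oplus>\<^bsub>M\<^esub> y = (c \<oplus> c') \<odot>\<^bsub>M\<^esub> v \<oplus>\<^bsub>M\<^esub> (m \<oplus>\<^bsub>M\<^esub> m')"
      using c v HD(1) by (simp add: x y smult_l_distr M.a_ac)
    then show "x \<oplus>\<^bsub>M\<^esub> y \<in> kspan R M (v # vs)"
      by (rule kspan_Cons_intro) (use c HD(3) in auto)
  next
    fix d x assume d: "d \<in> carrier R" and "x \<in> kspan R M (v # vs)"
    then obtain c m where c: "c \<in> carrier R" "m \<in> ?H"
      and x: "x = c \<odot>\<^bsub>M\<^esub> v \<oplus>\<^bsub>M\<^esub> m" by auto
    have "d \<odot>\<^bsub>M\<^esub> x = (d \<otimes> c) \<odot>\<^bsub>M\<^esub> v \<oplus>\<^bsub>M\<^esub> (d \<odot>\<^bsub>M\<^esub> m)"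
      using c v d HD(1) by (simp add: x smult_r_distr smult_assoc1)
    then show "d \<odot>\<^bsub>M\<^esub> x \<in> kspan R M (v # vs)"
      by (rule kspan_Cons_intro) (use c d HD(4) in auto)
  qed
qed

lemma kspan_ConsI: "v \<in> carrier M \<Longrightarrow> set vs \<subseteq> carrier M \<Longrightarrow> m \<in> kspan R M vs \<Longrightarrow> m \<in> kspan R M (v # vs)"
proof -
  assume v: "v \<in> carrier M" and vs: "set vs \<subseteq> carrier M" and m: "m \<in> kspan R M vs"
  then have "\<zero> \<odot>\<^bsub>M\<^esub> v \<oplus>\<^bsub>M\<^esub> m = m" using subspaceD(1)[OF kspan_subspace] by simp
  then show ?thesis 
    by (intro kspan_Cons_intro[OF sym]) (use m in auto)
qed

lemma kspan_mem: "set vs \<subseteq> carrier M \<Longrightarrow> v \<in> set vs \<Longrightarrow> v \<in> kspan R M vs"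
proof (induction vs)
  case Nil
  then show ?case by simp
next
  case (Cons w vs)
  show ?case
  proof (cases "v = w")
    case True
    have "\<one> \<odot>\<^bsub>M\<^esub> w \<oplus>\<^bsub>M\<^esub> \<zero>\<^bsub>M\<^esub> = w" using Cons by simp
    moreover have "\<zero>\<^bsub>M\<^esub> \<in> kspan R M vs" using Cons kspan_subspace subspaceD(2) by fastforce
    ultimately show ?thesis unfolding True by (intro kspan_Cons_intro[OF sym]) auto
  next
    case False
    then show ?thesis using Cons kspan_ConsI[of w vs v] by auto
  qed
qed

text \<open>Enough functionals without bases: a subspace \<open>H\<close> maximal among those that
  contain \<open>H0\<close> and omit \<open>v\<close> is a complement of the line through
  \<open>v\<close>, and \<phi> is the coordinate along \<open>v\<close>.\<close>

lemma functional_exists: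
  assumes "field R" and H0: "subspace R M H0" and v: "v \<in> carrier M" "v \<notin> H0"
  obtains \<phi> where "functional R M \<phi>" "\<phi> v = \<one>" "\<And>x. x \<in> H0 \<Longrightarrow> \<phi> x = \<zero>"
proof -
  interpret K: field R by fact
  let ?S = "{H. subspace R M H \<and> H0 \<subseteq> H \<and> v \<notin> H}"
  have "\<exists>H\<in>?S. \<forall>Y\<in>?S. H \<subseteq> Y \<longrightarrow> Y = H"
  proof (rule subset_Zorn_nonempty)
    show "?S \<noteq> {}" using H0 v by blast
    fix C assume C: "C \<noteq> {}" "subset.chain ?S C"
    have sub: "H \<in> ?S" if "H \<in> C" for H using C(2) that by (auto simp: subset.chain_def)
    have "subspace R M (\<Union>C)"
      unfolding subspace_def
    proof (intro conjI ballI)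
      have "H \<subseteq> carrier M" if "H \<in> C" for H using sub[OF that] unfolding subspace_def by simp
      then show "\<Union>C \<subseteq> carrier M" by blast
      obtain H1 where "H1 \<in> C" using C(1) by blast
      then show "\<zero>\<^bsub>M\<^esub> \<in> \<Union>C" using sub[of H1] unfolding subspace_def by blast
      fix x assume "x \<in> \<Union>C"
      then obtain H where H: "H \<in> C" "x \<in> H" by blast
      { fix c assume "c \<in> carrier R" then show "c \<odot>\<^bsub>M\<^esub> x \<in> \<Union>C"
          using H sub[OF H(1)] subspaceD(4)[of R M H c x] by simp (metis UnionI) }
      fix y assume "y \<in> \<Union>C"
      then obtain H' where H': "H' \<in> C" "y \<in> H'" by blast
      then have "H \<subseteq> H' \<or> H' \<subseteq> H" using C(2) H(1) by (auto simp: subset.chain_def)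
      then obtain H2 where "H2 \<in> C" "x \<in> H2" "y \<in> H2" using H H' by blast
      then show "x \<oplus>\<^bsub>M\<^esub> y \<in> \<Union>C" using sub[of H2] subspaceD(3)[of R M H2 x y] by simp (metis UnionI)
    qed
    moreover obtain H1 where "H1 \<in> C" using C(1) by blast
    then have "H0 \<subseteq> \<Union>C" using sub[of H1] by auto
    moreover have "v \<notin> \<Union>C" using sub by auto
    ultimately show "\<Union>C \<in> ?S" by simp
  qed
  then obtain H where HS: "H \<in> ?S" and HM: "\<forall>Y\<in>?S. H \<subseteq> Y \<longrightarrow> Y = H" by (rule bexE)
  from HS have H: "subspace R M H" "H0 \<subseteq> H" "v \<notin> H" by simp_all
  have max: "Y = H" if "subspace R M Y" "H0 \<subseteq> Y" "v \<notin> Y" "H \<subseteq> Y" for Y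
    using HM that by simp
  note HD = subspaceD[OF H(1)]
  have mz: "\<ominus>\<^bsub>M\<^esub> \<zero>\<^bsub>M\<^esub> = \<zero>\<^bsub>M\<^esub>" by (simp add: M.minus_equality)
  \<comment> \<open>For \<open>a\<close> outside \<open>H\<close>, maximality puts \<open>v\<close>
    into H + K a. As \<open>v\<close> is not in \<open>H\<close>, the coefficient of
    \<open>a\<close> is nonzero, and the equation can be solved for \<open>a\<close> modulo
    \<open>H\<close>.\<close>
  have ex: "\<exists>c\<in>carrier R. a \<ominus>\<^bsub>M\<^esub> c \<odot>\<^bsub>M\<^esub> v \<in> H" if a: "a \<in> carrier M" for a
  proof (cases "a \<in> H")
    case True
    then show ?thesis using a v by (intro bexI[of _ \<zero>]) (auto simp: M.minus_eq mz)
  next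
    case False
    let ?X = "{h \<oplus>\<^bsub>M\<^esub> c \<odot>\<^bsub>M\<^esub> a | h c. h \<in> H \<and> c \<in> carrier R}"
    have XI: "x \<in> ?X" if "x = h \<oplus>\<^bsub>M\<^esub> c \<odot>\<^bsub>M\<^esub> a" "h \<in> H" "c \<in> carrier R" for x h c
      using that by blast
    have "subspace R M ?X"
      unfolding subspace_def
    proof (intro conjI ballI)
      show "?X \<subseteq> carrier M" using HD(1) a by auto
      have "\<zero>\<^bsub>M\<^esub> \<oplus>\<^bsub>M\<^esub> \<zero> \<odot>\<^bsub>M\<^esub> a = \<zero>\<^bsub>M\<^esub>" using a by simp
      then show "\<zero>\<^bsub>M\<^esub> \<in> ?X" by (intro XI[OF sym]) (use HD(2) in auto)
      fix x assume "x \<in> ?X"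
      then obtain h c where h: "h \<in> H" "c \<in> carrier R" and x: "x = h \<oplus>\<^bsub>M\<^esub> c \<odot>\<^bsub>M\<^esub> a" by auto
      { fix d assume d: "d \<in> carrier R"
        have "d \<odot>\<^bsub>M\<^esub> x = d \<odot>\<^bsub>M\<^esub> h \<oplus>\<^bsub>M\<^esub> (d \<otimes> c) \<odot>\<^bsub>M\<^esub> a"
          using d h a HD(1) by (simp add: x smult_r_distr smult_assoc1)
        then show "d \<odot>\<^bsub>M\<^esub> x \<in> ?X" by (rule XI) (use d h HD(4) in auto) }
      fix y assume "y \<in> ?X"
      then obtain h' c' where h': "h' \<in> H" "c' \<in> carrier R" and y: "y = h' \<oplus>\<^bsub>M\<^esub> c' \<odot>\<^bsub>M\<^esub> a" by auto
      have "x \<oplus>\<^bsub>M\<^esub> y = (h \<oplus>\<^bsub>M\<^esub> h') \<oplus>\<^bsub>M\<^esub> (c \<oplus> c') \<odot>\<^bsub>M\<^esub> a"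
        using h h' a HD(1) by (simp add: x y smult_l_distr M.a_ac)
      then show "x \<oplus>\<^bsub>M\<^esub> y \<in> ?X" by (rule XI) (use h h' HD(3) in auto)
    qed
    moreover have HX: "H \<subseteq> ?X"
    proof
      fix h assume h: "h \<in> H"
      then have "h = h \<oplus>\<^bsub>M\<^esub> \<zero> \<odot>\<^bsub>M\<^esub> a" using a HD(1) by simp
      then show "h \<in> ?X" by (rule XI) (use h in auto)
    qed
    moreover have "a \<in> ?X"
    proof -
      have "a = \<zero>\<^bsub>M\<^esub> \<oplus>\<^bsub>M\<^esub> \<one> \<odot>\<^bsub>M\<^esub> a" using a by simp
      then show ?thesis by (rule XI) (use HD(2) in auto)
    qed
    ultimately have "v \<in> ?X" using max[of ?X] False H(2) by blast
    then obtain h c where h: "h \<in> H" "c \<in> carrier R" and ve: "v = h \<oplus>\<^bsub>M\<^esub> c \<odot>\<^bsub>M\<^esub> a" by auto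
    have c0: "c \<noteq> \<zero>" using ve h H(3) HD(1) a by auto
    define d where "d = inv c"
    have d: "d \<in> carrier R" "d \<otimes> c = \<one>" using c0 h(2) K.field_Units by (auto simp: d_def)
    have "d \<odot>\<^bsub>M\<^esub> v = d \<odot>\<^bsub>M\<^esub> h \<oplus>\<^bsub>M\<^esub> a"
      using d h a HD(1) by (simp add: ve smult_r_distr smult_assoc1[symmetric])
    then have "a \<ominus>\<^bsub>M\<^esub> d \<odot>\<^bsub>M\<^esub> v = \<ominus>\<^bsub>M\<^esub> (d \<odot>\<^bsub>M\<^esub> h)"
      using d h a HD(1) M.a_lcomm[of a "\<ominus>\<^bsub>M\<^esub> (d \<odot>\<^bsub>M\<^esub> h)" "\<ominus>\<^bsub>M\<^esub> a"]
      by (simp add: M.minus_eq M.minus_add M.r_neg)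
    moreover have "\<ominus>\<^bsub>M\<^esub> (d \<odot>\<^bsub>M\<^esub> h) \<in> H" using d h HD(4) subspace_minus[OF H(1)] by simp
    ultimately have "a \<ominus>\<^bsub>M\<^esub> d \<odot>\<^bsub>M\<^esub> v \<in> H" by simp
    then show ?thesis using d(1) by (rule bexI)
  qed
  have uniq: "c = c'" if c: "c \<in> carrier R" "c' \<in> carrier R" and a: "a \<in> carrier M"
    and m: "a \<ominus>\<^bsub>M\<^esub> c \<odot>\<^bsub>M\<^esub> v \<in> H" "a \<ominus>\<^bsub>M\<^esub> c' \<odot>\<^bsub>M\<^esub> v \<in> H" for a c c'
  proof (rule ccontr)
    assume ne: "c \<noteq> c'"
    let ?e = "c' \<ominus> c"
    have e: "?e \<in> carrier R" "?e \<noteq> \<zero>" using c ne by auto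
    have *: "(a \<ominus>\<^bsub>M\<^esub> p) \<oplus>\<^bsub>M\<^esub> \<ominus>\<^bsub>M\<^esub> (a \<ominus>\<^bsub>M\<^esub> q) = q \<ominus>\<^bsub>M\<^esub> p" if "p \<in> carrier M" "q \<in> carrier M" for p q
    proof -
      have "(a \<ominus>\<^bsub>M\<^esub> p) = \<ominus>\<^bsub>M\<^esub> p \<oplus>\<^bsub>M\<^esub> a" using that a by (simp add: M.minus_eq M.a_comm)
      moreover have "\<ominus>\<^bsub>M\<^esub> (a \<ominus>\<^bsub>M\<^esub> q) = \<ominus>\<^bsub>M\<^esub> a \<oplus>\<^bsub>M\<^esub> q" using that a by (simp add: M.minus_eq M.minus_add)
      moreover have "q \<ominus>\<^bsub>M\<^esub> p = \<ominus>\<^bsub>M\<^esub> p \<oplus>\<^bsub>M\<^esub> q" using that by (simp add: M.minus_eq M.a_comm)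
      ultimately show ?thesis using that a by (simp add: M.a_assoc M.r_neg2)
    qed
    have "(a \<ominus>\<^bsub>M\<^esub> c \<odot>\<^bsub>M\<^esub> v) \<oplus>\<^bsub>M\<^esub> \<ominus>\<^bsub>M\<^esub> (a \<ominus>\<^bsub>M\<^esub> c' \<odot>\<^bsub>M\<^esub> v) = ?e \<odot>\<^bsub>M\<^esub> v"
      using c a v *[of "c \<odot>\<^bsub>M\<^esub> v" "c' \<odot>\<^bsub>M\<^esub> v"]
      by (simp add: M.minus_eq R.minus_eq smult_l_distr smult_l_minus)
    then have "?e \<odot>\<^bsub>M\<^esub> v \<in> H" using HD(3)[OF m(1) subspace_minus[OF H(1) m(2)]] by simp
    moreover have "inv ?e \<in> carrier R" "inv ?e \<otimes> ?e = \<one>" using e K.field_Units by auto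
    ultimately have "v \<in> H" using HD(4)[of "inv ?e" "?e \<odot>\<^bsub>M\<^esub> v"] e v
      by (simp add: smult_assoc1[symmetric])
    then show False using H(3) by simp
  qed
  define \<phi> where "\<phi> a = (THE c. c \<in> carrier R \<and> a \<ominus>\<^bsub>M\<^esub> c \<odot>\<^bsub>M\<^esub> v \<in> H)" for a
  have \<phi>I: "\<phi> a = c" if "a \<in> carrier M" "c \<in> carrier R" "a \<ominus>\<^bsub>M\<^esub> c \<odot>\<^bsub>M\<^esub> v \<in> H" for a c
    unfolding \<phi>_def using that uniq by (intro the_equality) auto
  have \<phi>: "\<phi> a \<in> carrier R" "a \<ominus>\<^bsub>M\<^esub> \<phi> a \<odot>\<^bsub>M\<^esub> v \<in> H" if a: "a \<in> carrier M" for a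
  proof -
    obtain c where "c \<in> carrier R" "a \<ominus>\<^bsub>M\<^esub> c \<odot>\<^bsub>M\<^esub> v \<in> H" using ex[OF a] by (rule bexE)
    then show "\<phi> a \<in> carrier R" "a \<ominus>\<^bsub>M\<^esub> \<phi> a \<odot>\<^bsub>M\<^esub> v \<in> H" using \<phi>I[OF a] by simp_all
  qed
  have "functional R M \<phi>"
    unfolding functional_def
  proof (intro conjI ballI)
    show "\<phi> \<in> carrier M \<rightarrow> carrier R" using \<phi> by auto
    fix x assume x: "x \<in> carrier M"
    { fix y assume y: "y \<in> carrier M"
      have "(x \<oplus>\<^bsub>M\<^esub> y) \<ominus>\<^bsub>M\<^esub> (\<phi> x \<oplus> \<phi> y) \<odot>\<^bsub>M\<^esub> v = (x \<ominus>\<^bsub>M\<^esub> \<phi> x \<odot>\<^bsub>M\<^esub> v) \<oplus>\<^bsub>M\<^esub> (y \<ominus>\<^bsub>M\<^esub> \<phi> y \<odot>\<^bsub>M\<^esub> v)"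
        using \<phi> x y v by (simp add: M.minus_eq M.minus_add smult_l_distr M.a_ac)
      then show "\<phi> (x \<oplus>\<^bsub>M\<^esub> y) = \<phi> x \<oplus> \<phi> y" using HD(3) \<phi> x y by (intro \<phi>I) auto }
    fix c assume c: "c \<in> carrier R"
    have "c \<odot>\<^bsub>M\<^esub> x \<ominus>\<^bsub>M\<^esub> (c \<otimes> \<phi> x) \<odot>\<^bsub>M\<^esub> v = c \<odot>\<^bsub>M\<^esub> (x \<ominus>\<^bsub>M\<^esub> \<phi> x \<odot>\<^bsub>M\<^esub> v)"
      using \<phi> x c v by (simp add: M.minus_eq smult_r_distr smult_assoc1 smult_r_minus)
    then show "\<phi> (c \<odot>\<^bsub>M\<^esub> x) = c \<otimes> \<phi> x" using HD(4) \<phi> x c by (intro \<phi>I) auto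
  qed
  moreover have "\<phi> v = \<one>" using v HD(2) by (intro \<phi>I) (auto simp: M.minus_eq M.r_neg)
  moreover have "\<phi> x = \<zero>" if "x \<in> H0" for x
    using that H(2) HD(1) v by (intro \<phi>I) (auto simp: M.minus_eq mz)
  ultimately show ?thesis using that by blast
qed

end

subsection \<open>Slices of tensors\<close>

text \<open>Isolated because formal tensors are rewritten in three settings: for elementary tensors,
  for these with the factors exchanged, and for the action of \<open>A\<close> on the ring
  \<open>S\<close> below.\<close>

locale balanced = KA: module K A + KB: module K B + N: abelian_group N
  for K :: "('k, 'm) ring_scheme" and A :: "('k, 'a, 'n) module_scheme"
    and B :: "('k, 'b, 'o) module_scheme" and N :: "('c, 'p) ring_scheme" +
  fixes \<beta> :: "'a \<Rightarrow> 'b \<Rightarrow> 'c"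
  assumes closed: "a \<in> carrier A \<Longrightarrow> b \<in> carrier B \<Longrightarrow> \<beta> a b \<in> carrier N"
    and add_left: "a \<in> carrier A \<Longrightarrow> a' \<in> carrier A \<Longrightarrow> b \<in> carrier B \<Longrightarrow>
       \<beta> (a \<oplus>\<^bsub>A\<^esub> a') b = \<beta> a b \<oplus>\<^bsub>N\<^esub> \<beta> a' b"
    and add_right: "a \<in> carrier A \<Longrightarrow> b \<in> carrier B \<Longrightarrow> b' \<in> carrier B \<Longrightarrow>
       \<beta> a (b \<oplus>\<^bsub>B\<^esub> b') = \<beta> a b \<oplus>\<^bsub>N\<^esub> \<beta> a b'"
    and balance: "c \<in> carrier K \<Longrightarrow> a \<in> carrier A \<Longrightarrow> b \<in> carrier B \<Longrightarrow>
       \<beta> (c \<odot>\<^bsub>A\<^esub> a) b = \<beta> a (c \<odot>\<^bsub>B\<^esub> b)"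
begin

lemma zero_left: "b \<in> carrier B \<Longrightarrow> \<beta> \<zero>\<^bsub>A\<^esub> b = \<zero>\<^bsub>N\<^esub>"
  using add_left[of "\<zero>\<^bsub>A\<^esub>" "\<zero>\<^bsub>A\<^esub>" b] closed[of "\<zero>\<^bsub>A\<^esub>" b]
  by (simp add: N.add.l_cancel_one)

lemma swap: "balanced K B A N (\<lambda>b a. \<beta> a b)"
  by unfold_locales (auto simp: closed add_left add_right balance)

text \<open>If v is the combination of the a_i with coefficients c_i, then \<beta> v w is the sum of
  the \<beta> a_i (c_i w). Only second components change, so these range over a subspace while the
  first components are kept literally.\<close>

lemma bsum_absorb:
  assumes "set qs \<subseteq> U \<times> W" "U \<subseteq> carrier A" "subspace K B W" "w \<in> W"
    "v \<in> kspan K A (map fst qs)"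
  shows "\<exists>qs'. map fst qs' = map fst qs \<and> set qs' \<subseteq> U \<times> W
    \<and> bsum N \<beta> qs' = \<beta> v w \<oplus>\<^bsub>N\<^esub> bsum N \<beta> qs"
  using assms(1,5)
proof (induction qs arbitrary: v)
  case Nil
  have "w \<in> carrier B" using subspaceD(1)[OF assms(3,4)] .
  then show ?case using Nil zero_left by (intro exI[of _ "[]"]) auto
next
  case (Cons q qs)
  obtain a x where q: "q = (a, x)" by (cases q)
  have a: "a \<in> U" "a \<in> carrier A" and x: "x \<in> W" "x \<in> carrier B" and w: "w \<in> carrier B"
    and qs: "set qs \<subseteq> U \<times> W"
    using Cons.prems assms(2,4) subspaceD(1)[OF assms(3)] by (auto simp: q)
  have qs': "set (map fst qs) \<subseteq> carrier A" using qs assms(2) by auto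
  obtain c m where c: "c \<in> carrier K" and m: "m \<in> kspan K A (map fst qs)"
    and v: "v = c \<odot>\<^bsub>A\<^esub> a \<oplus>\<^bsub>A\<^esub> m" using Cons.prems(2) by (auto simp: q)
  have mA: "m \<in> carrier A" using subspaceD(1)[OF KA.kspan_subspace[OF qs'] m] .
  obtain rs where rs: "map fst rs = map fst qs" "set rs \<subseteq> U \<times> W"
      "bsum N \<beta> rs = \<beta> m w \<oplus>\<^bsub>N\<^esub> bsum N \<beta> qs"
    using Cons.IH[OF qs m] by blast
  have cw: "c \<odot>\<^bsub>B\<^esub> w \<in> W" "c \<odot>\<^bsub>B\<^esub> w \<in> carrier B" using c w subspaceD(4)[OF assms(3) c assms(4)] by auto
  have Q: "bsum N \<beta> qs \<in> carrier N"
    using qs assms(2) subspaceD(1)[OF assms(3)] by (intro N.bsum_closed closed) auto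
  have "\<beta> v w = \<beta> a (c \<odot>\<^bsub>B\<^esub> w) \<oplus>\<^bsub>N\<^esub> \<beta> m w"
    using c a mA w by (simp add: v add_left balance)
  then have "bsum N \<beta> ((a, x \<oplus>\<^bsub>B\<^esub> c \<odot>\<^bsub>B\<^esub> w) # rs) = \<beta> v w \<oplus>\<^bsub>N\<^esub> bsum N \<beta> (q # qs)"
    using a x cw Q mA w rs(3) by (simp add: q add_right closed N.a_ac)
  moreover have "x \<oplus>\<^bsub>B\<^esub> c \<odot>\<^bsub>B\<^esub> w \<in> W" using subspaceD(3)[OF assms(3) x(1) cw(1)] .
  ultimately show ?case using rs a by (intro exI[of _ "(a, x \<oplus>\<^bsub>B\<^esub> c \<odot>\<^bsub>B\<^esub> w) # rs"]) (auto simp: q)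
qed

text \<open>A first component that depends on the later ones is absorbed by them. The surviving ones
  come from the original list and stay inside \<open>U\<close>, which later keeps denominators
  inside U \<otimes> B.\<close>

lemma bsum_indep:
  assumes "set ps \<subseteq> U \<times> W" "U \<subseteq> carrier A" "subspace K B W"
  shows "\<exists>qs. set qs \<subseteq> U \<times> W \<and> indep K A (map fst qs) \<and> bsum N \<beta> qs = bsum N \<beta> ps"
  using assms(1)
proof (induction ps)
  case Nil
  show ?case by (intro exI[of _ "[]"]) auto
next
  case (Cons p ps)
  obtain v w where p: "p = (v, w)" by (cases p)
  obtain qs where qs: "set qs \<subseteq> U \<times> W" "indep K A (map fst qs)" "bsum N \<beta> qs = bsum N \<beta> ps"
    using Cons by auto
  have vw: "v \<in> U" "w \<in> W" using Cons.prems by (auto simp: p)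
  show ?case
  proof (cases "v \<in> kspan K A (map fst qs)")
    case True
    obtain rs where "map fst rs = map fst qs" "set rs \<subseteq> U \<times> W"
      "bsum N \<beta> rs = \<beta> v w \<oplus>\<^bsub>N\<^esub> bsum N \<beta> qs"
      using bsum_absorb[OF qs(1) assms(2,3) vw(2) True] by blast
    then show ?thesis using qs by (intro exI[of _ rs]) (simp add: p)
  next
    case False
    then show ?thesis using qs vw by (intro exI[of _ "(v, w) # qs"]) (simp add: p)
  qed
qed

text \<open>A functional that is 1 on the head and 0 on the span of the other first components
  slices the sum down to the second component of the head.\<close>

lemma indep_slices_zero:
  assumes "field K" "set qs \<subseteq> carrier A \<times> carrier B" "indep K A (map fst qs)"
    and "\<And>\<phi>. functional K A \<phi> \<Longrightarrow> bsum B (\<lambda>a b. \<phi> a \<odot>\<^bsub>B\<^esub> b) qs = \<zero>\<^bsub>B\<^esub>"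
  shows "snd ` set qs \<subseteq> {\<zero>\<^bsub>B\<^esub>}"
  using assms(2-4)
proof (induction qs)
  case Nil
  then show ?case by simp
next
  case (Cons q qs)
  obtain a b where q: "q = (a, b)" by (cases q)
  have ab: "a \<in> carrier A" "b \<in> carrier B" and qs: "set qs \<subseteq> carrier A \<times> carrier B"
    using Cons.prems by (auto simp: q)
  have qs': "set (map fst qs) \<subseteq> carrier A" using qs by auto
  have "a \<notin> kspan K A (map fst qs)" using Cons.prems(2) by (simp add: q)
  then obtain \<phi> where \<phi>: "functional K A \<phi>" "\<phi> a = \<one>\<^bsub>K\<^esub>"
      "\<And>x. x \<in> kspan K A (map fst qs) \<Longrightarrow> \<phi> x = \<zero>\<^bsub>K\<^esub>"
    using KA.functional_exists[OF assms(1) KA.kspan_subspace[OF qs'] ab(1)] by metis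
  have "bsum B (\<lambda>a b. \<phi> a \<odot>\<^bsub>B\<^esub> b) qs = bsum B (\<lambda>a b. \<zero>\<^bsub>B\<^esub>) qs"
  proof (rule bsum_cong)
    fix x y assume xy: "(x, y) \<in> set qs"
    then have "x \<in> set (map fst qs)" by force
    then have "\<phi> x = \<zero>\<^bsub>K\<^esub>" using \<phi>(3) KA.kspan_mem[OF qs'] by blast
    then show "\<phi> x \<odot>\<^bsub>B\<^esub> y = \<zero>\<^bsub>B\<^esub>" using xy qs by auto
  qed
  also have "\<dots> = \<zero>\<^bsub>B\<^esub>" by (induction qs) auto
  finally have "b = \<zero>\<^bsub>B\<^esub>" using Cons.prems(3)[OF \<phi>(1)] \<phi>(2) ab by (simp add: q)
  moreover have "bsum B (\<lambda>a b. \<phi> a \<odot>\<^bsub>B\<^esub> b) qs = \<zero>\<^bsub>B\<^esub>" if \<phi>: "functional K A \<phi>" for \<phi>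
  proof -
    have "bsum B (\<lambda>a b. \<phi> a \<odot>\<^bsub>B\<^esub> b) qs \<in> carrier B"
      using qs functionalD(1)[OF \<phi>] by (intro KB.M.bsum_closed) auto
    then show ?thesis using Cons.prems(3)[OF \<phi>] \<open>b = \<zero>\<^bsub>B\<^esub>\<close> functionalD(1)[OF \<phi> ab(1)]
      by (simp add: q)
  qed
  ultimately show ?case using Cons.IH[OF qs] Cons.prems(2) by (simp add: q)
qed

end

definition nonzerodiv :: "('c, 'p) ring_scheme \<Rightarrow> 'c \<Rightarrow> bool" where
  "nonzerodiv R x \<longleftrightarrow> x \<in> carrier R \<and> (\<forall>y\<in>carrier R. x \<otimes>\<^bsub>R\<^esub> y = \<zero>\<^bsub>R\<^esub> \<longrightarrow> y = \<zero>\<^bsub>R\<^esub>)"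

lemma nonzerodivD:
  assumes "nonzerodiv R x"
  shows "x \<in> carrier R" "y \<in> carrier R \<Longrightarrow> x \<otimes>\<^bsub>R\<^esub> y = \<zero>\<^bsub>R\<^esub> \<Longrightarrow> y = \<zero>\<^bsub>R\<^esub>"
  using assms by (auto simp: nonzerodiv_def)

context tensor_pair
begin

definition emb1 where "emb1 a = tens K A B a \<one>\<^bsub>B\<^esub>"
definition emb2 where "emb2 b = tens K A B \<one>\<^bsub>A\<^esub> b"

lemma emb1_closed [simp, intro]: "a \<in> carrier A \<Longrightarrow> emb1 a \<in> carrier R"
  and emb2_closed [simp, intro]: "b \<in> carrier B \<Longrightarrow> emb2 b \<in> carrier R"
  by (simp_all add: emb1_def emb2_def)

lemma emb1_hom: "emb1 \<in> ring_hom A R"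
  by (rule ring_hom_memI) (simp_all add: emb1_def tens_mult tens_add_left tens_one)

lemma emb2_hom: "emb2 \<in> ring_hom B R"
  by (rule ring_hom_memI) (simp_all add: emb2_def tens_mult tens_add_right tens_one)

lemma tens_eq: "a \<in> carrier A \<Longrightarrow> b \<in> carrier B \<Longrightarrow> tens K A B a b = emb1 a \<otimes>\<^bsub>R\<^esub> emb2 b"
  by (simp add: emb1_def emb2_def tens_mult)

lemma smult_def': "c \<odot>\<^bsub>R\<^esub> x = emb1 (c \<odot>\<^bsub>A\<^esub> \<one>\<^bsub>A\<^esub>) \<otimes>\<^bsub>R\<^esub> x"
  by (simp add: tensor_algebra_def emb1_def)

lemma smult_one_mult: "c \<in> carrier K \<Longrightarrow> a \<in> carrier A \<Longrightarrow> (c \<odot>\<^bsub>A\<^esub> \<one>\<^bsub>A\<^esub>) \<otimes>\<^bsub>A\<^esub> a = c \<odot>\<^bsub>A\<^esub> a"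
  "c \<in> carrier K \<Longrightarrow> b \<in> carrier B \<Longrightarrow> (c \<odot>\<^bsub>B\<^esub> \<one>\<^bsub>B\<^esub>) \<otimes>\<^bsub>B\<^esub> b = c \<odot>\<^bsub>B\<^esub> b"
  using KA.smult_assoc2[of c "\<one>\<^bsub>A\<^esub>" a] KB.smult_assoc2[of c "\<one>\<^bsub>B\<^esub>" b] by simp_all

lemma smult_tens: "c \<in> carrier K \<Longrightarrow> a \<in> carrier A \<Longrightarrow> b \<in> carrier B \<Longrightarrow>
    c \<odot>\<^bsub>R\<^esub> tens K A B a b = tens K A B (c \<odot>\<^bsub>A\<^esub> a) b"
  by (simp add: smult_def' emb1_def tens_mult smult_one_mult)

text \<open>This makes R eligible as the left factor of the tensor product with a second copy of
  \<open>B\<close>.\<close>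

sublocale KR: algebra K "tensor_algebra K A B"
proof (rule algebraI)
  fix c d x y assume c: "c \<in> carrier K" and d: "d \<in> carrier K"
    and x: "x \<in> carrier R" and y: "y \<in> carrier R"
  note h = ring_hom_add[OF emb1_hom] ring_hom_mult[OF emb1_hom] ring_hom_one[OF emb1_hom]
  show "(c \<oplus>\<^bsub>K\<^esub> d) \<odot>\<^bsub>R\<^esub> x = c \<odot>\<^bsub>R\<^esub> x \<oplus>\<^bsub>R\<^esub> d \<odot>\<^bsub>R\<^esub> x"
    using c d x by (simp add: smult_def' KA.smult_l_distr h R.l_distr)
  have "emb1 ((c \<otimes>\<^bsub>K\<^esub> d) \<odot>\<^bsub>A\<^esub> \<one>\<^bsub>A\<^esub>) = emb1 (c \<odot>\<^bsub>A\<^esub> \<one>\<^bsub>A\<^esub>) \<otimes>\<^bsub>R\<^esub> emb1 (d \<odot>\<^bsub>A\<^esub> \<one>\<^bsub>A\<^esub>)"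
    using c d by (simp add: h(2)[symmetric] smult_one_mult KA.smult_assoc1)
  then show "(c \<otimes>\<^bsub>K\<^esub> d) \<odot>\<^bsub>R\<^esub> x = c \<odot>\<^bsub>R\<^esub> (d \<odot>\<^bsub>R\<^esub> x)"
    using c d x by (simp add: smult_def' R.m_assoc)
qed (simp_all add: smult_def' K.is_cring R.is_cring R.r_distr R.m_assoc
    ring_hom_one[OF emb1_hom])

lemma emb1_smult: "c \<in> carrier K \<Longrightarrow> a \<in> carrier A \<Longrightarrow> emb1 (c \<odot>\<^bsub>A\<^esub> a) = c \<odot>\<^bsub>R\<^esub> emb1 a"
  by (simp add: emb1_def smult_tens)

lemma emb2_smult: "c \<in> carrier K \<Longrightarrow> b \<in> carrier B \<Longrightarrow> emb2 (c \<odot>\<^bsub>B\<^esub> b) = c \<odot>\<^bsub>R\<^esub> emb2 b"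
  by (simp add: emb2_def smult_tens tens_smult)

sublocale tens: balanced K A B "tensor_algebra K A B" "tens K A B"
  by unfold_locales (auto simp: tens_add_left tens_add_right tens_smult)

lemma tens_rep: "z \<in> carrier R \<Longrightarrow>
    \<exists>ps. set ps \<subseteq> carrier A \<times> carrier B \<and> z = bsum R (tens K A B) ps"
proof (induction rule: tens_induct)
  case (tens a b)
  then show ?case by (intro exI[of _ "[(a, b)]"]) auto
next
  case (add x y)
  then obtain ps qs where "set ps \<subseteq> carrier A \<times> carrier B" "x = bsum R (tens K A B) ps"
      "set qs \<subseteq> carrier A \<times> carrier B" "y = bsum R (tens K A B) qs" by blast
  then show ?case by (intro exI[of _ "ps @ qs"]) (subst R.bsum_append, auto)
qed

text \<open>The universal property of the coproduct of commutative algebras. As \<open>C\<close>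
  carries no module structure, linearity over \<open>K\<close> is expressed by agreement of
  \<open>f\<close> and \<open>g\<close> on scalars.\<close>

lemma tens_ring_lift:
  fixes C :: "('c, 'p) ring_scheme"
  assumes C: "cring C" and f: "f \<in> ring_hom A C" and g: "g \<in> ring_hom B C"
    and fg: "\<And>c. c \<in> carrier K \<Longrightarrow> f (c \<odot>\<^bsub>A\<^esub> \<one>\<^bsub>A\<^esub>) = g (c \<odot>\<^bsub>B\<^esub> \<one>\<^bsub>B\<^esub>)"
  obtains h where "h \<in> ring_hom R C"
    "\<And>a b. a \<in> carrier A \<Longrightarrow> b \<in> carrier B \<Longrightarrow> h (tens K A B a b) = f a \<otimes>\<^bsub>C\<^esub> g b"
proof -
  interpret C: cring C by fact
  note cl = ring_hom_closed[OF f] ring_hom_closed[OF g]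
  have fc: "f (c \<odot>\<^bsub>A\<^esub> a) \<otimes>\<^bsub>C\<^esub> g b = f a \<otimes>\<^bsub>C\<^esub> g (c \<odot>\<^bsub>B\<^esub> b)"
    if "c \<in> carrier K" "a \<in> carrier A" "b \<in> carrier B" for a b c
  proof -
    have "f (c \<odot>\<^bsub>A\<^esub> a) = f (c \<odot>\<^bsub>A\<^esub> \<one>\<^bsub>A\<^esub>) \<otimes>\<^bsub>C\<^esub> f a"
      using that by (simp add: ring_hom_mult[OF f, symmetric] smult_one_mult)
    moreover have "g (c \<odot>\<^bsub>B\<^esub> b) = g (c \<odot>\<^bsub>B\<^esub> \<one>\<^bsub>B\<^esub>) \<otimes>\<^bsub>C\<^esub> g b"
      using that by (simp add: ring_hom_mult[OF g, symmetric] smult_one_mult)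
    ultimately show ?thesis using that fg[of c] cl by (simp add: C.m_ac)
  qed
  obtain h where h: "h \<in> carrier R \<rightarrow> carrier C"
    "\<And>x y. x \<in> carrier R \<Longrightarrow> y \<in> carrier R \<Longrightarrow> h (x \<oplus>\<^bsub>R\<^esub> y) = h x \<oplus>\<^bsub>C\<^esub> h y"
    "\<And>a b. a \<in> carrier A \<Longrightarrow> b \<in> carrier B \<Longrightarrow> h (tens K A B a b) = f a \<otimes>\<^bsub>C\<^esub> g b"
    by (rule tens_lift[OF C.is_abelian_group, of "\<lambda>a b. f a \<otimes>\<^bsub>C\<^esub> g b"])
      (auto simp: cl ring_hom_add[OF f] ring_hom_add[OF g] C.l_distr C.r_distr fc)
  have hc: "x \<in> carrier R \<Longrightarrow> h x \<in> carrier C" for x using h(1) by auto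
  have m1: "h (tens K A B a b \<otimes>\<^bsub>R\<^esub> y) = h (tens K A B a b) \<otimes>\<^bsub>C\<^esub> h y"
    if a: "a \<in> carrier A" and b: "b \<in> carrier B" and y: "y \<in> carrier R" for a b y
    using y
  proof (induction rule: tens_induct)
    case (tens a' b')
    then show ?case using a b cl
      by (simp add: tens_mult h ring_hom_mult[OF f] ring_hom_mult[OF g] C.m_ac)
  next
    case (add x y)
    then show ?case using a b hc by (simp add: R.r_distr C.r_distr h(2))
  qed
  have m: "h (x \<otimes>\<^bsub>R\<^esub> y) = h x \<otimes>\<^bsub>C\<^esub> h y" if x: "x \<in> carrier R" and y: "y \<in> carrier R" for x y
    using x
  proof (induction rule: tens_induct)
    case (tens a b)
    then show ?case using m1 y by blast
  next
    case (add x x')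
    then show ?case using y hc by (simp add: R.l_distr C.l_distr h(2))
  qed
  have "h \<in> ring_hom R C"
  proof (rule ring_hom_memI)
    show "h \<one>\<^bsub>R\<^esub> = \<one>\<^bsub>C\<^esub>"
      using h(3)[of "\<one>\<^bsub>A\<^esub>" "\<one>\<^bsub>B\<^esub>"] by (simp add: tens_one ring_hom_one[OF f] ring_hom_one[OF g])
  qed (use hc m h(2) in auto)
  then show ?thesis using h(3) that by blast
qed

lemma slice1_ex:
  assumes \<phi>: "functional K A \<phi>"
  shows "\<exists>h. h \<in> carrier R \<rightarrow> carrier B \<and>
    (\<forall>x\<in>carrier R. \<forall>y\<in>carrier R. h (x \<oplus>\<^bsub>R\<^esub> y) = h x \<oplus>\<^bsub>B\<^esub> h y) \<and>
    (\<forall>a\<in>carrier A. \<forall>b\<in>carrier B. h (tens K A B a b) = \<phi> a \<odot>\<^bsub>B\<^esub> b)"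
proof -
  note f = functionalD[OF \<phi>]
  obtain h where "h \<in> carrier R \<rightarrow> carrier B"
    "\<And>x y. x \<in> carrier R \<Longrightarrow> y \<in> carrier R \<Longrightarrow> h (x \<oplus>\<^bsub>R\<^esub> y) = h x \<oplus>\<^bsub>B\<^esub> h y"
    "\<And>a b. a \<in> carrier A \<Longrightarrow> b \<in> carrier B \<Longrightarrow> h (tens K A B a b) = \<phi> a \<odot>\<^bsub>B\<^esub> b"
    by (rule tens_lift[OF B.is_abelian_group, of "\<lambda>a b. \<phi> a \<odot>\<^bsub>B\<^esub> b"])
      (auto simp: f KB.smult_l_distr KB.smult_r_distr KB.smult_assoc1[symmetric] K.m_comm)
  then show ?thesis by blast
qed

lemma slice2_ex:
  assumes \<psi>: "functional K B \<psi>"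
  shows "\<exists>h. h \<in> carrier R \<rightarrow> carrier A \<and>
    (\<forall>x\<in>carrier R. \<forall>y\<in>carrier R. h (x \<oplus>\<^bsub>R\<^esub> y) = h x \<oplus>\<^bsub>A\<^esub> h y) \<and>
    (\<forall>a\<in>carrier A. \<forall>b\<in>carrier B. h (tens K A B a b) = \<psi> b \<odot>\<^bsub>A\<^esub> a)"
proof -
  note f = functionalD[OF \<psi>]
  obtain h where "h \<in> carrier R \<rightarrow> carrier A"
    "\<And>x y. x \<in> carrier R \<Longrightarrow> y \<in> carrier R \<Longrightarrow> h (x \<oplus>\<^bsub>R\<^esub> y) = h x \<oplus>\<^bsub>A\<^esub> h y"
    "\<And>a b. a \<in> carrier A \<Longrightarrow> b \<in> carrier B \<Longrightarrow> h (tens K A B a b) = \<psi> b \<odot>\<^bsub>A\<^esub> a"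
    by (rule tens_lift[OF A.is_abelian_group, of "\<lambda>a b. \<psi> b \<odot>\<^bsub>A\<^esub> a"])
      (auto simp: f KA.smult_l_distr KA.smult_r_distr KA.smult_assoc1[symmetric] K.m_comm)
  then show ?thesis by blast
qed

text \<open>\<open>slice1\<close> is \<phi> \<otimes> id and \<open>slice2\<close> is id \<otimes>
  \<psi>, after the identification of K \<otimes> B with \<open>B\<close> and of A \<otimes> K with
  \<open>A\<close>.\<close>

definition slice1 where "slice1 \<phi> = (SOME h. h \<in> carrier R \<rightarrow> carrier B \<and>
    (\<forall>x\<in>carrier R. \<forall>y\<in>carrier R. h (x \<oplus>\<^bsub>R\<^esub> y) = h x \<oplus>\<^bsub>B\<^esub> h y) \<and>
    (\<forall>a\<in>carrier A. \<forall>b\<in>carrier B. h (tens K A B a b) = \<phi> a \<odot>\<^bsub>B\<^esub> b))"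

definition slice2 where "slice2 \<psi> = (SOME h. h \<in> carrier R \<rightarrow> carrier A \<and>
    (\<forall>x\<in>carrier R. \<forall>y\<in>carrier R. h (x \<oplus>\<^bsub>R\<^esub> y) = h x \<oplus>\<^bsub>A\<^esub> h y) \<and>
    (\<forall>a\<in>carrier A. \<forall>b\<in>carrier B. h (tens K A B a b) = \<psi> b \<odot>\<^bsub>A\<^esub> a))"

lemma slice1:
  assumes "functional K A \<phi>"
  shows "x \<in> carrier R \<Longrightarrow> slice1 \<phi> x \<in> carrier B"
    "x \<in> carrier R \<Longrightarrow> y \<in> carrier R \<Longrightarrow> slice1 \<phi> (x \<oplus>\<^bsub>R\<^esub> y) = slice1 \<phi> x \<oplus>\<^bsub>B\<^esub> slice1 \<phi> y"
    "a \<in> carrier A \<Longrightarrow> b \<in> carrier B \<Longrightarrow> slice1 \<phi> (tens K A B a b) = \<phi> a \<odot>\<^bsub>B\<^esub> b"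
  using someI_ex[OF slice1_ex[OF assms]] unfolding slice1_def[symmetric] by auto

lemma slice2:
  assumes "functional K B \<psi>"
  shows "x \<in> carrier R \<Longrightarrow> slice2 \<psi> x \<in> carrier A"
    "x \<in> carrier R \<Longrightarrow> y \<in> carrier R \<Longrightarrow> slice2 \<psi> (x \<oplus>\<^bsub>R\<^esub> y) = slice2 \<psi> x \<oplus>\<^bsub>A\<^esub> slice2 \<psi> y"
    "a \<in> carrier A \<Longrightarrow> b \<in> carrier B \<Longrightarrow> slice2 \<psi> (tens K A B a b) = \<psi> b \<odot>\<^bsub>A\<^esub> a"
  using someI_ex[OF slice2_ex[OF assms]] unfolding slice2_def[symmetric] by auto

lemma slice1_zero: "functional K A \<phi> \<Longrightarrow> slice1 \<phi> \<zero>\<^bsub>R\<^esub> = \<zero>\<^bsub>B\<^esub>"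
  using slice1(2)[of \<phi> "\<zero>\<^bsub>R\<^esub>" "\<zero>\<^bsub>R\<^esub>"] slice1(1)[of \<phi> "\<zero>\<^bsub>R\<^esub>"] by (simp add: B.add.l_cancel_one)

lemma slice2_zero: "functional K B \<psi> \<Longrightarrow> slice2 \<psi> \<zero>\<^bsub>R\<^esub> = \<zero>\<^bsub>A\<^esub>"
  using slice2(2)[of \<psi> "\<zero>\<^bsub>R\<^esub>" "\<zero>\<^bsub>R\<^esub>"] slice2(1)[of \<psi> "\<zero>\<^bsub>R\<^esub>"] by (simp add: A.add.l_cancel_one)

lemma slice1_emb2:
  assumes \<phi>: "functional K A \<phi>" and x: "x \<in> carrier R" and b: "b \<in> carrier B"
  shows "slice1 \<phi> (emb2 b \<otimes>\<^bsub>R\<^esub> x) = b \<otimes>\<^bsub>B\<^esub> slice1 \<phi> x"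
  using x
proof (induction rule: tens_induct)
  case (tens a b')
  have "b \<otimes>\<^bsub>B\<^esub> (\<phi> a \<odot>\<^bsub>B\<^esub> b') = \<phi> a \<odot>\<^bsub>B\<^esub> (b \<otimes>\<^bsub>B\<^esub> b')"
    using tens b functionalD(1)[OF \<phi>, of a] KB.smult_assoc2[of "\<phi> a" b' b] by (simp add: B.m_comm)
  then show ?case using tens b by (simp add: emb2_def tens_mult slice1[OF \<phi>])
next
  case (add x y)
  then show ?case using b by (simp add: R.r_distr slice1[OF \<phi>] B.r_distr)
qed

lemma slice2_emb1:
  assumes \<psi>: "functional K B \<psi>" and x: "x \<in> carrier R" and a: "a \<in> carrier A"
  shows "slice2 \<psi> (emb1 a \<otimes>\<^bsub>R\<^esub> x) = a \<otimes>\<^bsub>A\<^esub> slice2 \<psi> x"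
  using x
proof (induction rule: tens_induct)
  case (tens a' b)
  have "a \<otimes>\<^bsub>A\<^esub> (\<psi> b \<odot>\<^bsub>A\<^esub> a') = \<psi> b \<odot>\<^bsub>A\<^esub> (a \<otimes>\<^bsub>A\<^esub> a')"
    using tens a functionalD(1)[OF \<psi>, of b] KA.smult_assoc2[of "\<psi> b" a' a] by (simp add: A.m_comm)
  then show ?case using tens a by (simp add: emb1_def tens_mult slice2[OF \<psi>])
next
  case (add x y)
  then show ?case using a by (simp add: R.r_distr slice2[OF \<psi>] A.r_distr)
qed

lemma slice1_bsum:
  assumes \<phi>: "functional K A \<phi>" and ps: "set ps \<subseteq> carrier A \<times> carrier B"
  shows "slice1 \<phi> (bsum R (tens K A B) ps) = bsum B (\<lambda>a b. \<phi> a \<odot>\<^bsub>B\<^esub> b) ps"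
proof -
  have "slice1 \<phi> (bsum R (tens K A B) ps) = bsum B (\<lambda>a b. slice1 \<phi> (tens K A B a b)) ps"
    using ps by (intro bsum_hom R.is_abelian_group B.is_abelian_group slice1 slice1_zero \<phi>) auto
  also have "\<dots> = bsum B (\<lambda>a b. \<phi> a \<odot>\<^bsub>B\<^esub> b) ps"
    using ps by (intro bsum_cong) (auto simp: slice1[OF \<phi>])
  finally show ?thesis .
qed

lemma slice2_bsum:
  assumes \<psi>: "functional K B \<psi>" and ps: "set ps \<subseteq> carrier B \<times> carrier A"
  shows "slice2 \<psi> (bsum R (\<lambda>b a. tens K A B a b) ps) = bsum A (\<lambda>b a. \<psi> b \<odot>\<^bsub>A\<^esub> a) ps"
proof -
  have "slice2 \<psi> (bsum R (\<lambda>b a. tens K A B a b) ps) = bsum A (\<lambda>b a. slice2 \<psi> (tens K A B a b)) ps"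
    using ps by (intro bsum_hom R.is_abelian_group A.is_abelian_group slice2 slice2_zero \<psi>) auto
  also have "\<dots> = bsum A (\<lambda>b a. \<psi> b \<odot>\<^bsub>A\<^esub> a) ps"
    using ps by (intro bsum_cong) (auto simp: slice2[OF \<psi>])
  finally show ?thesis .
qed

lemma bsum_zero: "\<lbrakk>snd ` set ps \<subseteq> {\<zero>\<^bsub>B\<^esub>}; set ps \<subseteq> carrier A \<times> carrier B\<rbrakk> \<Longrightarrow>
    bsum R (tens K A B) ps = \<zero>\<^bsub>R\<^esub>"
  by (induction ps) (auto simp: tens_zero_right)

text \<open>Stands in for a basis of \<open>A\<close>: after rewriting with independent first
  components, the vanishing of all slices forces every second component to vanish.\<close>

lemma slice1_separates:
  assumes z: "z \<in> carrier R" and 0: "\<And>\<phi>. functional K A \<phi> \<Longrightarrow> slice1 \<phi> z = \<zero>\<^bsub>B\<^esub>"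
  shows "z = \<zero>\<^bsub>R\<^esub>"
proof -
  obtain ps where ps: "set ps \<subseteq> carrier A \<times> carrier B" "z = bsum R (tens K A B) ps"
    using tens_rep[OF z] by blast
  obtain qs where qs: "set qs \<subseteq> carrier A \<times> carrier B" "indep K A (map fst qs)"
      "bsum R (tens K A B) qs = bsum R (tens K A B) ps"
    using tens.bsum_indep[OF ps(1) subset_refl KB.subspace_carrier] by blast
  have "snd ` set qs \<subseteq> {\<zero>\<^bsub>B\<^esub>}"
    using tens.indep_slices_zero[OF K.field_axioms qs(1,2)] 0 slice1_bsum[OF _ qs(1)] qs(3) ps(2) by simp
  then show ?thesis using bsum_zero[OF _ qs(1)] qs(3) ps(2) by simp
qed

lemma bsum_swap: "bsum M (\<lambda>y x. \<beta> x y) (map prod.swap ps) = bsum M \<beta> ps"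
  by (induction ps) auto

lemma slice2_separates:
  assumes z: "z \<in> carrier R" and 0: "\<And>\<psi>. functional K B \<psi> \<Longrightarrow> slice2 \<psi> z = \<zero>\<^bsub>A\<^esub>"
  shows "z = \<zero>\<^bsub>R\<^esub>"
proof -
  interpret sw: balanced K B A "tensor_algebra K A B" "\<lambda>b a. tens K A B a b" by (rule tens.swap)
  obtain ps where ps: "set ps \<subseteq> carrier A \<times> carrier B" "z = bsum R (tens K A B) ps"
    using tens_rep[OF z] by blast
  have ps': "set (map prod.swap ps) \<subseteq> carrier B \<times> carrier A" using ps(1) by auto
  obtain qs where qs: "set qs \<subseteq> carrier B \<times> carrier A" "indep K B (map fst qs)"
      "bsum R (\<lambda>b a. tens K A B a b) qs = bsum R (\<lambda>b a. tens K A B a b) (map prod.swap ps)"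
    using sw.bsum_indep[OF ps' subset_refl KA.subspace_carrier] by blast
  have qz: "bsum R (\<lambda>b a. tens K A B a b) qs = z" using qs(3) ps(2) by (simp add: bsum_swap)
  have "snd ` set qs \<subseteq> {\<zero>\<^bsub>A\<^esub>}"
    using sw.indep_slices_zero[OF K.field_axioms qs(1,2)] 0 slice2_bsum[OF _ qs(1)] qz by simp
  then have "bsum R (\<lambda>b a. tens K A B a b) qs = \<zero>\<^bsub>R\<^esub>" using qs(1)
    by (induction qs) (auto simp: tens_zero_left)
  then show ?thesis using qz by simp
qed

lemma slice1_smult:
  assumes \<phi>: "functional K A \<phi>" and c: "c \<in> carrier K" and x: "x \<in> carrier R"
  shows "slice1 \<phi> (c \<odot>\<^bsub>R\<^esub> x) = c \<odot>\<^bsub>B\<^esub> slice1 \<phi> x"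
  using x
proof (induction rule: tens_induct)
  case (tens a b)
  then show ?case using c functionalD(1)[OF \<phi>, of a]
    by (simp add: smult_tens slice1[OF \<phi>] functionalD(3)[OF \<phi>] KB.smult_assoc1)
next
  case (add x y)
  then show ?case using c by (simp add: KR.smult_r_distr KB.smult_r_distr slice1[OF \<phi>])
qed

text \<open>Flatness over a field in disguise: slices are linear over \<open>B\<close>, so the
  question is decided in the domain \<open>B\<close>.\<close>

lemma emb2_nonzerodiv:
  assumes "domain B" "b \<in> carrier B" "b \<noteq> \<zero>\<^bsub>B\<^esub>"
  shows "nonzerodiv R (emb2 b)"
  unfolding nonzerodiv_def
proof (intro conjI ballI impI)
  fix y assume y: "y \<in> carrier R" and 0: "emb2 b \<otimes>\<^bsub>R\<^esub> y = \<zero>\<^bsub>R\<^esub>"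
  show "y = \<zero>\<^bsub>R\<^esub>"
  proof (rule slice1_separates[OF y])
    fix \<phi> assume \<phi>: "functional K A \<phi>"
    have "b \<otimes>\<^bsub>B\<^esub> slice1 \<phi> y = \<zero>\<^bsub>B\<^esub>"
      using slice1_emb2[OF \<phi> y assms(2)] slice1_zero[OF \<phi>] 0 by simp
    then show "slice1 \<phi> y = \<zero>\<^bsub>B\<^esub>"
      using domain.integral[OF assms(1)] assms(2,3) slice1(1)[OF \<phi> y] by blast
  qed
qed (use assms in auto)

lemma emb1_nonzerodiv:
  assumes "domain A" "a \<in> carrier A" "a \<noteq> \<zero>\<^bsub>A\<^esub>"
  shows "nonzerodiv R (emb1 a)"
  unfolding nonzerodiv_def
proof (intro conjI ballI impI)
  fix y assume y: "y \<in> carrier R" and 0: "emb1 a \<otimes>\<^bsub>R\<^esub> y = \<zero>\<^bsub>R\<^esub>"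
  show "y = \<zero>\<^bsub>R\<^esub>"
  proof (rule slice2_separates[OF y])
    fix \<psi> assume \<psi>: "functional K B \<psi>"
    have "a \<otimes>\<^bsub>A\<^esub> slice2 \<psi> y = \<zero>\<^bsub>A\<^esub>"
      using slice2_emb1[OF \<psi> y assms(2)] slice2_zero[OF \<psi>] 0 by simp
    then show "slice2 \<psi> y = \<zero>\<^bsub>A\<^esub>"
      using domain.integral[OF assms(1)] assms(2,3) slice2(1)[OF \<psi> y] by blast
  qed
qed (use assms in auto)

end

subsection \<open>The tensor square over the left factor\<close>

context cring
begin

lemma nonzerodiv_mult:
  assumes "nonzerodiv R x" "nonzerodiv R y"
  shows "nonzerodiv R (x \<otimes> y)"
proof -
  note x = nonzerodivD[OF assms(1)] and y = nonzerodivD[OF assms(2)]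
  have "z = \<zero>" if z: "z \<in> carrier R" "(x \<otimes> y) \<otimes> z = \<zero>" for z
  proof (rule y(2)[OF z(1)], rule x(2))
    show "x \<otimes> (y \<otimes> z) = \<zero>" using z x(1) y(1) by (simp add: m_assoc)
  qed (use z y(1) in simp)
  then show ?thesis using x(1) y(1) by (simp add: nonzerodiv_def)
qed

text \<open>Commuting idempotents e and f satisfy (e - f)^3 = e - f. This is that identity for e = p
  / G and f = q / G with denominators cleared.\<close>

lemma diff_cube:
  assumes cl: "p \<in> carrier R" "q \<in> carrier R" "G \<in> carrier R"
    and p: "p \<otimes> p = G \<otimes> p" and q: "q \<otimes> q = G \<otimes> q"
  shows "(G \<otimes> G \<ominus> (p \<ominus> q) \<otimes> (p \<ominus> q)) \<otimes> (p \<ominus> q) = \<zero>"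
proof -
  define w where "w = p \<ominus> q"
  have w: "w \<in> carrier R" using cl by (simp add: w_def)
  have pw: "p \<otimes> w = G \<otimes> p \<ominus> p \<otimes> q" and qw: "q \<otimes> w = p \<otimes> q \<ominus> G \<otimes> q"
    using cl by (simp_all add: w_def minus_eq r_distr r_minus p q m_comm)
  \<comment> \<open>The counterpart of e f (e - f) = 0, which removes the mixed terms below.\<close>
  have 1: "(p \<otimes> q) \<otimes> w = \<zero>"
  proof -
    have "(p \<otimes> q) \<otimes> w = q \<otimes> (p \<otimes> w)" using cl w by (simp add: m_ac)
    also have "\<dots> = G \<otimes> (p \<otimes> q) \<ominus> p \<otimes> (q \<otimes> q)"
      unfolding pw using cl by (simp add: minus_eq r_distr r_minus m_ac)
    also have "\<dots> = \<zero>" unfolding q using cl by (simp add: m_ac minus_eq r_neg)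
    finally show ?thesis .
  qed
  have pww: "p \<otimes> w \<otimes> w = G \<otimes> (p \<otimes> w)"
  proof -
    have "p \<otimes> w \<otimes> w = G \<otimes> (p \<otimes> w) \<ominus> (p \<otimes> q) \<otimes> w"
      by (subst pw) (use cl w in \<open>simp add: minus_eq l_distr l_minus m_assoc\<close>)
    then show ?thesis using 1 cl w by (simp add: minus_eq)
  qed
  have qww: "q \<otimes> w \<otimes> w = \<ominus> (G \<otimes> (q \<otimes> w))"
  proof -
    have "q \<otimes> w \<otimes> w = (p \<otimes> q) \<otimes> w \<ominus> G \<otimes> (q \<otimes> w)"
      by (subst qw) (use cl w in \<open>simp add: minus_eq l_distr l_minus m_assoc\<close>)
    then show ?thesis using 1 cl w by (simp add: minus_eq)
  qed
  have "w \<otimes> w \<otimes> w = p \<otimes> w \<otimes> w \<ominus> q \<otimes> w \<otimes> w"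
    by (subst (1) w_def) (use cl w in \<open>simp add: minus_eq l_distr l_minus m_assoc\<close>)
  also have "\<dots> = G \<otimes> (p \<otimes> w \<oplus> q \<otimes> w)"
    unfolding pww qww using cl w by (simp add: minus_eq r_distr)
  also have "p \<otimes> w \<oplus> q \<otimes> w = G \<otimes> w"
  proof -
    have "p \<otimes> w \<oplus> q \<otimes> w = G \<otimes> p \<ominus> G \<otimes> q"
      unfolding pw qw using cl by (simp add: minus_eq a_assoc r_neg1)
    then show ?thesis using cl by (simp add: w_def minus_eq r_distr r_minus)
  qed
  finally have "w \<otimes> w \<otimes> w = G \<otimes> G \<otimes> w" using cl w by (simp add: m_assoc)
  then have "(G \<otimes> G \<ominus> w \<otimes> w) \<otimes> w = \<zero>"
    using cl w by (simp add: minus_eq l_distr l_minus r_neg)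
  then show ?thesis unfolding w_def .
qed

end

context tensor_pair
begin

lemma emb1_scalar: "c \<in> carrier K \<Longrightarrow> emb1 (c \<odot>\<^bsub>A\<^esub> \<one>\<^bsub>A\<^esub>) = emb2 (c \<odot>\<^bsub>B\<^esub> \<one>\<^bsub>B\<^esub>)"
  using tens_smult[of c "\<one>\<^bsub>A\<^esub>" "\<one>\<^bsub>B\<^esub>"] by (simp add: emb1_def emb2_def)

lemma emb_scalar: "c \<in> carrier K \<Longrightarrow> emb1 (c \<odot>\<^bsub>A\<^esub> \<one>\<^bsub>A\<^esub>) = c \<odot>\<^bsub>R\<^esub> \<one>\<^bsub>R\<^esub>"
  by (simp add: emb1_smult ring_hom_one[OF emb1_hom])

end

locale tensor_tower = tensor_pair K A B + T: tensor_pair K "tensor_algebra K A B" B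
  for K :: "('k, 'm) ring_scheme" and A :: "('k, 'a, 'n) module_scheme"
    and B :: "('k, 'b, 'o) module_scheme"
begin

abbreviation S where "S \<equiv> tensor_algebra K (tensor_algebra K A B) B"

text \<open>The ring \<open>S = R \<otimes> B\<close> is a model of \<open>R \<otimes>\<^bsub>A\<^esub> R\<close>: the two maps \<open>R \<rightarrow> S\<close> are
  \<open>T.emb1\<close> and \<open>E2\<close>, the latter sending \<open>a \<otimes> b\<close> to \<open>(a \<otimes> 1) \<otimes> b\<close>, and \<open>Mu\<close> is the
  multiplication \<open>S \<rightarrow> R\<close>.\<close>

definition E2 where "E2 = (SOME h. h \<in> ring_hom R S \<and>
   (\<forall>a\<in>carrier A. \<forall>b\<in>carrier B. h (tens K A B a b) = T.emb1 (emb1 a) \<otimes>\<^bsub>S\<^esub> T.emb2 b))"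

definition Mu where "Mu = (SOME h. h \<in> ring_hom S R \<and>
   (\<forall>r\<in>carrier R. \<forall>b\<in>carrier B. h (tens K R B r b) = r \<otimes>\<^bsub>R\<^esub> emb2 b))"

lemma T_emb1_scalar: "c \<in> carrier K \<Longrightarrow> T.emb1 (c \<odot>\<^bsub>R\<^esub> \<one>\<^bsub>R\<^esub>) = T.emb2 (c \<odot>\<^bsub>B\<^esub> \<one>\<^bsub>B\<^esub>)"
  using T.tens_smult[of c "\<one>\<^bsub>R\<^esub>" "\<one>\<^bsub>B\<^esub>"] by (simp add: T.emb1_def T.emb2_def)

lemma E2_ex: "\<exists>h. h \<in> ring_hom R S \<and>
   (\<forall>a\<in>carrier A. \<forall>b\<in>carrier B. h (tens K A B a b) = T.emb1 (emb1 a) \<otimes>\<^bsub>S\<^esub> T.emb2 b)"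
proof -
  have "(\<lambda>a. T.emb1 (emb1 a)) \<in> ring_hom A S"
    using ring_hom_trans[OF emb1_hom T.emb1_hom] by (simp add: o_def)
  from tens_ring_lift[OF T.R.is_cring this T.emb2_hom]
  obtain h where "h \<in> ring_hom R S"
    "\<And>a b. a \<in> carrier A \<Longrightarrow> b \<in> carrier B \<Longrightarrow> h (tens K A B a b) = T.emb1 (emb1 a) \<otimes>\<^bsub>S\<^esub> T.emb2 b"
    by (simp add: T_emb1_scalar emb_scalar) blast
  then show ?thesis by blast
qed

lemma E2_hom: "E2 \<in> ring_hom R S"
  and E2_tens: "a \<in> carrier A \<Longrightarrow> b \<in> carrier B \<Longrightarrow> E2 (tens K A B a b) = T.emb1 (emb1 a) \<otimes>\<^bsub>S\<^esub> T.emb2 b"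
  using someI_ex[OF E2_ex] unfolding E2_def[symmetric] by auto

lemma Mu_ex: "\<exists>h. h \<in> ring_hom S R \<and>
   (\<forall>r\<in>carrier R. \<forall>b\<in>carrier B. h (tens K R B r b) = r \<otimes>\<^bsub>R\<^esub> emb2 b)"
proof -
  have "(\<lambda>x. x) \<in> ring_hom R R" by (rule ring_hom_memI) auto
  moreover have "c \<odot>\<^bsub>R\<^esub> \<one>\<^bsub>R\<^esub> = emb2 (c \<odot>\<^bsub>B\<^esub> \<one>\<^bsub>B\<^esub>)" if "c \<in> carrier K" for c
    using emb_scalar emb1_scalar that by metis
  ultimately obtain h where "h \<in> ring_hom S R"
    "\<And>a b. a \<in> carrier R \<Longrightarrow> b \<in> carrier B \<Longrightarrow> h (tens K R B a b) = a \<otimes>\<^bsub>R\<^esub> emb2 b"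
    using T.tens_ring_lift[OF R.is_cring _ emb2_hom] by metis
  then show ?thesis by blast
qed

lemma Mu_hom: "Mu \<in> ring_hom S R"
  and Mu_tens: "r \<in> carrier R \<Longrightarrow> b \<in> carrier B \<Longrightarrow> Mu (tens K R B r b) = r \<otimes>\<^bsub>R\<^esub> emb2 b"
  using someI_ex[OF Mu_ex] unfolding Mu_def[symmetric] by auto

lemma Mu_closed [simp]: "x \<in> carrier S \<Longrightarrow> Mu x \<in> carrier R"
  and E2_closed [simp]: "y \<in> carrier R \<Longrightarrow> E2 y \<in> carrier S"
  using ring_hom_closed[OF Mu_hom] ring_hom_closed[OF E2_hom] by auto

lemma Mu_emb1: "r \<in> carrier R \<Longrightarrow> Mu (T.emb1 r) = r"
  using Mu_tens[of r "\<one>\<^bsub>B\<^esub>"] by (simp add: T.emb1_def ring_hom_one[OF emb2_hom])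

lemma Mu_emb2: "b \<in> carrier B \<Longrightarrow> Mu (T.emb2 b) = emb2 b"
  using Mu_tens[of "\<one>\<^bsub>R\<^esub>" b] by (simp add: T.emb2_def)

lemma Mu_E2: "r \<in> carrier R \<Longrightarrow> Mu (E2 r) = r"
proof (induction rule: tens_induct)
  case (tens a b)
  then show ?case 

    by (simp add: E2_tens ring_hom_mult[OF Mu_hom] Mu_emb1 Mu_emb2 tens_eq[symmetric])
next
  case (add x y)
  then show ?case by (simp add: ring_hom_add[OF Mu_hom] ring_hom_add[OF E2_hom])
qed

lemma E2_emb1: "a \<in> carrier A \<Longrightarrow> E2 (emb1 a) = T.emb1 (emb1 a)"
  using E2_tens[of a "\<one>\<^bsub>B\<^esub>"] by (simp add: emb1_def[of a] ring_hom_one[OF T.emb2_hom] T.emb1_closed)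

lemma E2_emb2: "b \<in> carrier B \<Longrightarrow> E2 (emb2 b) = T.emb2 b"
  using E2_tens[of "\<one>\<^bsub>A\<^esub>" b] by (simp add: emb2_def[of b] ring_hom_one[OF T.emb1_hom] ring_hom_one[OF emb1_hom])

text \<open>Slices along the last copy of \<open>B\<close> are linear over R, so regularity is
  tested in R.\<close>

lemma T_emb1_nonzerodiv:
  assumes g: "nonzerodiv R g"
  shows "nonzerodiv S (T.emb1 g)"
  unfolding nonzerodiv_def
proof (intro conjI ballI impI)
  note gR = nonzerodivD(1)[OF g]
  show "T.emb1 g \<in> carrier S" using gR by simp
  fix y assume y: "y \<in> carrier S" and 0: "T.emb1 g \<otimes>\<^bsub>S\<^esub> y = \<zero>\<^bsub>S\<^esub>"
  show "y = \<zero>\<^bsub>S\<^esub>"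
  proof (rule T.slice2_separates[OF y])
    fix \<psi> assume \<psi>: "functional K B \<psi>"
    have "g \<otimes>\<^bsub>R\<^esub> T.slice2 \<psi> y = \<zero>\<^bsub>R\<^esub>"
      using T.slice2_emb1[OF \<psi> y gR] T.slice2_zero[OF \<psi>] 0 by simp
    then show "T.slice2 \<psi> y = \<zero>\<^bsub>R\<^esub>" using nonzerodivD(2)[OF g T.slice2(1)[OF \<psi> y]] by simp
  qed
qed

text \<open>The exchange \<open>t\<close> of the two copies of \<open>B\<close> in A \<otimes> B
  \<otimes> B is an involution of \<open>S\<close> that interchanges the two maps from R. This
  reduces the claim to \<open>T.emb1\<close>.\<close>

lemma E2_nonzerodiv:
  assumes g: "nonzerodiv R g"
  shows "nonzerodiv S (E2 g)"
proof -
  note gR = nonzerodivD(1)[OF g]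
  have "(\<lambda>b. T.emb1 (emb2 b)) \<in> ring_hom B S"
    using ring_hom_trans[OF emb2_hom T.emb1_hom] by (simp add: o_def)
  moreover have "E2 (c \<odot>\<^bsub>R\<^esub> \<one>\<^bsub>R\<^esub>) = T.emb1 (emb2 (c \<odot>\<^bsub>B\<^esub> \<one>\<^bsub>B\<^esub>))" if c: "c \<in> carrier K" for c
    using E2_emb1[of "c \<odot>\<^bsub>A\<^esub> \<one>\<^bsub>A\<^esub>"] c emb_scalar[OF c] emb1_scalar[OF c] by simp
  note EB = this
  from T.tens_ring_lift[OF T.R.is_cring E2_hom \<open>(\<lambda>b. T.emb1 (emb2 b)) \<in> ring_hom B S\<close>] EB
  obtain t where t: "t \<in> ring_hom S S"
    and tt: "\<And>r b. r \<in> carrier R \<Longrightarrow> b \<in> carrier B \<Longrightarrow> t (tens K R B r b) = E2 r \<otimes>\<^bsub>S\<^esub> T.emb1 (emb2 b)"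
    by blast
  have t1: "t (T.emb1 r) = E2 r" if "r \<in> carrier R" for r
    using tt[of r "\<one>\<^bsub>B\<^esub>"] that by (simp add: T.emb1_def[of r] ring_hom_one[OF emb2_hom] ring_hom_one[OF T.emb1_hom])
  have t2: "t (T.emb2 b) = T.emb1 (emb2 b)" if "b \<in> carrier B" for b
    using tt[of "\<one>\<^bsub>R\<^esub>" b] that by (simp add: T.emb2_def[of b] ring_hom_one[OF E2_hom])
  have tE: "t (E2 r) = T.emb1 r" if "r \<in> carrier R" for r
    using that
  proof (induction rule: tens_induct)
    case (tens a b)
    then show ?case
      by (simp add: E2_tens ring_hom_mult[OF t] t1 t2 E2_emb1)
        (simp add: tens_eq ring_hom_mult[OF T.emb1_hom])
  next
    case (add x y)
    then show ?case by (simp add: ring_hom_add[OF t] ring_hom_add[OF E2_hom] ring_hom_add[OF T.emb1_hom])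
  qed
  have ttid: "t (t z) = z" if "z \<in> carrier S" for z
    using that
  proof (induction rule: T.tens_induct)
    case (tens r b)
    then show ?case
      by (simp add: tt ring_hom_mult[OF t] tE t1 E2_emb2) (simp add: T.tens_eq)
  next
    case (add x y)
    then show ?case using ring_hom_closed[OF t] by (simp add: ring_hom_add[OF t])
  qed
  show ?thesis
    unfolding nonzerodiv_def
  proof (intro conjI ballI impI)
    show "E2 g \<in> carrier S" using gR by simp
    fix y assume y: "y \<in> carrier S" and 0: "E2 g \<otimes>\<^bsub>S\<^esub> y = \<zero>\<^bsub>S\<^esub>"
    have tz: "t \<zero>\<^bsub>S\<^esub> = \<zero>\<^bsub>S\<^esub>" using ring_hom_zero[OF t T.R.ring_axioms T.R.ring_axioms] .
    have "T.emb1 g \<otimes>\<^bsub>S\<^esub> t y = \<zero>\<^bsub>S\<^esub>"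
      using ring_hom_mult[OF t, of "E2 g" y] 0 y gR tE tz by simp
    then have "t y = \<zero>\<^bsub>S\<^esub>"
      using nonzerodivD(2)[OF T_emb1_nonzerodiv[OF g]] ring_hom_closed[OF t y] by blast
    then show "y = \<zero>\<^bsub>S\<^esub>" using ttid[OF y] tz by simp
  qed
qed

text \<open>Identifying \<open>S\<close> with \<open>A \<otimes> B \<otimes> B\<close>, the map \<open>mid_slice \<phi>\<close> is \<open>\<phi> \<otimes> id \<otimes> id\<close> followed by
  the inclusion of \<open>B \<otimes> B\<close>.\<close>

lemma mid_slice_ex:
  assumes \<phi>: "functional K A \<phi>"
  shows "\<exists>h. h \<in> carrier S \<rightarrow> carrier S \<and>
    (\<forall>x\<in>carrier S. \<forall>y\<in>carrier S. h (x \<oplus>\<^bsub>S\<^esub> y) = h x \<oplus>\<^bsub>S\<^esub> h y) \<and>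
    (\<forall>r\<in>carrier R. \<forall>b\<in>carrier B. h (tens K R B r b) = T.emb1 (emb2 (slice1 \<phi> r)) \<otimes>\<^bsub>S\<^esub> T.emb2 b)"
proof -
  have bal: "T.emb1 (emb2 (slice1 \<phi> (c \<odot>\<^bsub>R\<^esub> r))) \<otimes>\<^bsub>S\<^esub> T.emb2 b
      = T.emb1 (emb2 (slice1 \<phi> r)) \<otimes>\<^bsub>S\<^esub> T.emb2 (c \<odot>\<^bsub>B\<^esub> b)"
    if c: "c \<in> carrier K" and r: "r \<in> carrier R" and b: "b \<in> carrier B" for c r b
  proof -
    have "T.emb1 (emb2 (slice1 \<phi> (c \<odot>\<^bsub>R\<^esub> r))) = T.emb1 (c \<odot>\<^bsub>R\<^esub> emb2 (slice1 \<phi> r))"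
      using c r by (simp add: slice1_smult[OF \<phi>] emb2_smult slice1[OF \<phi>])
    then show ?thesis
      using T.tens_smult[of c "emb2 (slice1 \<phi> r)" b] c r b
      by (simp add: T.tens_eq slice1[OF \<phi>])
  qed
  obtain h where "h \<in> carrier S \<rightarrow> carrier S"
    "\<And>x y. x \<in> carrier S \<Longrightarrow> y \<in> carrier S \<Longrightarrow> h (x \<oplus>\<^bsub>S\<^esub> y) = h x \<oplus>\<^bsub>S\<^esub> h y"
    "\<And>r b. r \<in> carrier R \<Longrightarrow> b \<in> carrier B \<Longrightarrow>
        h (tens K R B r b) = T.emb1 (emb2 (slice1 \<phi> r)) \<otimes>\<^bsub>S\<^esub> T.emb2 b"
    by (rule T.tens_lift[OF T.R.is_abelian_group,
          of "\<lambda>r b. T.emb1 (emb2 (slice1 \<phi> r)) \<otimes>\<^bsub>S\<^esub> T.emb2 b"])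
      (auto simp: slice1[OF \<phi>] ring_hom_add[OF emb2_hom] ring_hom_add[OF T.emb1_hom]
        ring_hom_add[OF T.emb2_hom] T.R.l_distr T.R.r_distr bal)
  then show ?thesis by blast
qed

definition mid_slice where "mid_slice \<phi> = (SOME h. h \<in> carrier S \<rightarrow> carrier S \<and>
    (\<forall>x\<in>carrier S. \<forall>y\<in>carrier S. h (x \<oplus>\<^bsub>S\<^esub> y) = h x \<oplus>\<^bsub>S\<^esub> h y) \<and>
    (\<forall>r\<in>carrier R. \<forall>b\<in>carrier B. h (tens K R B r b) = T.emb1 (emb2 (slice1 \<phi> r)) \<otimes>\<^bsub>S\<^esub> T.emb2 b))"

lemma mid_slice:
  assumes "functional K A \<phi>"
  shows "x \<in> carrier S \<Longrightarrow> mid_slice \<phi> x \<in> carrier S"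
    "x \<in> carrier S \<Longrightarrow> y \<in> carrier S \<Longrightarrow> mid_slice \<phi> (x \<oplus>\<^bsub>S\<^esub> y) = mid_slice \<phi> x \<oplus>\<^bsub>S\<^esub> mid_slice \<phi> y"
    "r \<in> carrier R \<Longrightarrow> b \<in> carrier B \<Longrightarrow>
      mid_slice \<phi> (tens K R B r b) = T.emb1 (emb2 (slice1 \<phi> r)) \<otimes>\<^bsub>S\<^esub> T.emb2 b"
  using someI_ex[OF mid_slice_ex[OF assms]] unfolding mid_slice_def[symmetric] by auto

lemma mid_slice_zero: "functional K A \<phi> \<Longrightarrow> mid_slice \<phi> \<zero>\<^bsub>S\<^esub> = \<zero>\<^bsub>S\<^esub>"
  using mid_slice(2)[of \<phi> "\<zero>\<^bsub>S\<^esub>" "\<zero>\<^bsub>S\<^esub>"] mid_slice(1)[of \<phi> "\<zero>\<^bsub>S\<^esub>"] by (simp add: T.R.add.l_cancel_one)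

text \<open>\<open>Mu\<close> multiplies the two copies of \<open>B\<close> while \<phi> acts on
  \<open>A\<close>, so the two operations commute. This ties slices in \<open>S\<close> to slices on
  the diagonal.\<close>

lemma Mu_mid_slice: "functional K A \<phi> \<Longrightarrow> x \<in> carrier S \<Longrightarrow> Mu (mid_slice \<phi> x) = emb2 (slice1 \<phi> (Mu x))"
proof -
  assume \<phi>: "functional K A \<phi>" and x: "x \<in> carrier S"
  show ?thesis using x
  proof (induction rule: T.tens_induct)
    case (tens r b)
    then have "slice1 \<phi> (r \<otimes>\<^bsub>R\<^esub> emb2 b) = slice1 \<phi> r \<otimes>\<^bsub>B\<^esub> b"
      using slice1_emb2[OF \<phi>, of r b] by (simp add: R.m_comm B.m_comm slice1[OF \<phi>])
    with tens show ?case
      by (simp add: mid_slice[OF \<phi>] Mu_tens ring_hom_mult[OF Mu_hom] Mu_emb1 Mu_emb2 slice1[OF \<phi>]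
          ring_hom_mult[OF emb2_hom])
  next
    case (add x y)
    then show ?case
      by (simp add: mid_slice[OF \<phi>] ring_hom_add[OF Mu_hom] slice1[OF \<phi>] ring_hom_add[OF emb2_hom])
  qed
qed

text \<open>\<open>W\<close> takes the place of the subring \<open>1 \<otimes> B \<otimes> B\<close>; all that matters is that slices are
  linear over it.\<close>

definition W where
  "W = {\<omega> \<in> carrier S. \<forall>\<phi>. functional K A \<phi> \<longrightarrow>
     (\<forall>x\<in>carrier S. mid_slice \<phi> (\<omega> \<otimes>\<^bsub>S\<^esub> x) = \<omega> \<otimes>\<^bsub>S\<^esub> mid_slice \<phi> x)}"

lemma W_closed: "\<omega> \<in> W \<Longrightarrow> \<omega> \<in> carrier S"
  and W_sm: "\<omega> \<in> W \<Longrightarrow> functional K A \<phi> \<Longrightarrow> x \<in> carrier S \<Longrightarrow>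
    mid_slice \<phi> (\<omega> \<otimes>\<^bsub>S\<^esub> x) = \<omega> \<otimes>\<^bsub>S\<^esub> mid_slice \<phi> x"
  by (simp_all add: W_def)

lemma W_emb1: assumes b: "b \<in> carrier B" shows "T.emb1 (emb2 b) \<in> W"
  unfolding W_def
proof (intro CollectI conjI allI impI ballI)
  fix \<phi> x assume \<phi>: "functional K A \<phi>" and x: "x \<in> carrier S"
  show "mid_slice \<phi> (T.emb1 (emb2 b) \<otimes>\<^bsub>S\<^esub> x) = T.emb1 (emb2 b) \<otimes>\<^bsub>S\<^esub> mid_slice \<phi> x"
    using x
  proof (induction rule: T.tens_induct)
    case (tens r b')
    then have "T.emb1 (emb2 b) \<otimes>\<^bsub>S\<^esub> tens K R B r b' = tens K R B (emb2 b \<otimes>\<^bsub>R\<^esub> r) b'"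
      using b by (simp add: T.emb1_def T.tens_mult)
    then show ?case using tens b
      by (simp add: mid_slice[OF \<phi>] slice1_emb2[OF \<phi>] ring_hom_mult[OF emb2_hom] ring_hom_mult[OF T.emb1_hom]
          slice1[OF \<phi>] T.R.m_assoc)
  next
    case (add x y)
    then show ?case using b by (simp add: T.R.r_distr mid_slice[OF \<phi>])
  qed
qed (use b in simp)

lemma W_emb2: assumes b: "b \<in> carrier B" shows "T.emb2 b \<in> W"
  unfolding W_def
proof (intro CollectI conjI allI impI ballI)
  fix \<phi> x assume \<phi>: "functional K A \<phi>" and x: "x \<in> carrier S"
  show "mid_slice \<phi> (T.emb2 b \<otimes>\<^bsub>S\<^esub> x) = T.emb2 b \<otimes>\<^bsub>S\<^esub> mid_slice \<phi> x"
    using x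
  proof (induction rule: T.tens_induct)
    case (tens r b')
    then have "T.emb2 b \<otimes>\<^bsub>S\<^esub> tens K R B r b' = tens K R B r (b \<otimes>\<^bsub>B\<^esub> b')"
      using b by (simp add: T.emb2_def T.tens_mult)
    then show ?case using tens b
      by (simp add: mid_slice[OF \<phi>] ring_hom_mult[OF T.emb2_hom] slice1[OF \<phi>] T.R.m_lcomm)
  next
    case (add x y)
    then show ?case using b by (simp add: T.R.r_distr mid_slice[OF \<phi>])
  qed
qed (use b in simp)

lemma W_mult: "\<omega> \<in> W \<Longrightarrow> \<omega>' \<in> W \<Longrightarrow> \<omega> \<otimes>\<^bsub>S\<^esub> \<omega>' \<in> W"
  by (auto simp: W_def T.R.m_assoc mid_slice)

lemma W_add: "\<omega> \<in> W \<Longrightarrow> \<omega>' \<in> W \<Longrightarrow> \<omega> \<oplus>\<^bsub>S\<^esub> \<omega>' \<in> W"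
  by (auto simp: W_def T.R.l_distr mid_slice)

lemma W_zero: "\<zero>\<^bsub>S\<^esub> \<in> W"
  by (auto simp: W_def mid_slice mid_slice_zero)

lemma W_one: "\<one>\<^bsub>S\<^esub> \<in> W"
  using W_emb2[of "\<one>\<^bsub>B\<^esub>"] by (simp add: ring_hom_one[OF T.emb2_hom])

lemma smult_S: "c \<in> carrier K \<Longrightarrow> x \<in> carrier S \<Longrightarrow> c \<odot>\<^bsub>S\<^esub> x = T.emb2 (c \<odot>\<^bsub>B\<^esub> \<one>\<^bsub>B\<^esub>) \<otimes>\<^bsub>S\<^esub> x"
  by (simp add: T.smult_def' T_emb1_scalar)

lemma W_smult: "c \<in> carrier K \<Longrightarrow> \<omega> \<in> W \<Longrightarrow> c \<odot>\<^bsub>S\<^esub> \<omega> \<in> W"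
  using W_mult W_emb2 by (simp add: smult_S W_closed)

lemma W_subspace: "subspace K S W"
  unfolding subspace_def using W_closed W_zero W_add W_smult by auto

lemma W_minus: "\<omega> \<in> W \<Longrightarrow> \<ominus>\<^bsub>S\<^esub> \<omega> \<in> W"
  using T.KR.subspace_minus[OF W_subspace] .

lemma mid_slice_W: "functional K A \<phi> \<Longrightarrow> x \<in> carrier S \<Longrightarrow> mid_slice \<phi> x \<in> W"
proof -
  assume \<phi>: "functional K A \<phi>" and x: "x \<in> carrier S"
  show ?thesis using x
    by (induction rule: T.tens_induct) (simp_all add: mid_slice[OF \<phi>] W_add W_mult W_emb1 W_emb2 slice1[OF \<phi>])
qed

lemma mid_slice_emb1:
  assumes "functional K A \<phi>" "a \<in> carrier A" "\<omega> \<in> W"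
  shows "mid_slice \<phi> (T.emb1 (emb1 a) \<otimes>\<^bsub>S\<^esub> \<omega>) = \<phi> a \<odot>\<^bsub>S\<^esub> \<omega>"
proof -
  have p: "\<phi> a \<in> carrier K" using functionalD(1)[OF assms(1,2)] .
  have "slice1 \<phi> (emb1 a) = \<phi> a \<odot>\<^bsub>B\<^esub> \<one>\<^bsub>B\<^esub>"
    using assms(1,2) by (simp add: emb1_def slice1)
  then have "mid_slice \<phi> (tens K R B (emb1 a) \<one>\<^bsub>B\<^esub>) = \<phi> a \<odot>\<^bsub>S\<^esub> \<one>\<^bsub>S\<^esub>"
    using assms(1,2) p
    by (simp add: mid_slice emb2_smult T.emb1_smult
        ring_hom_one[OF emb2_hom] ring_hom_one[OF T.emb1_hom] ring_hom_one[OF T.emb2_hom])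
  then have "mid_slice \<phi> (T.emb1 (emb1 a)) = \<phi> a \<odot>\<^bsub>S\<^esub> \<one>\<^bsub>S\<^esub>"
    by (simp only: T.emb1_def)
  then have "mid_slice \<phi> (\<omega> \<otimes>\<^bsub>S\<^esub> T.emb1 (emb1 a)) = \<omega> \<otimes>\<^bsub>S\<^esub> (\<phi> a \<odot>\<^bsub>S\<^esub> \<one>\<^bsub>S\<^esub>)"
    using W_sm[OF assms(3,1), of "T.emb1 (emb1 a)"] assms(2) by simp
  also have "\<dots> = \<phi> a \<odot>\<^bsub>S\<^esub> \<omega>"
    using T.KR.smult_assoc2[of "\<phi> a" "\<one>\<^bsub>S\<^esub>" \<omega>] p W_closed[OF assms(3)] by (simp add: T.R.m_comm)
  finally show ?thesis using assms(2) W_closed[OF assms(3)] by (simp add: T.R.m_comm)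
qed

text \<open>Multiplication of \<open>A\<close> against \<open>S\<close> takes the role of elementary
  tensors for S = A \<otimes> (B \<otimes> B). The right factor is all of \<open>S\<close>;
  restriction to \<open>W\<close> is made through \<open>W_subspace\<close>.\<close>

sublocale AW: balanced K A S S "\<lambda>a \<omega>. T.emb1 (emb1 a) \<otimes>\<^bsub>S\<^esub> \<omega>"
proof unfold_locales
  fix c a \<omega> assume "c \<in> carrier K" "a \<in> carrier A" "\<omega> \<in> carrier S"
  then show "T.emb1 (emb1 (c \<odot>\<^bsub>A\<^esub> a)) \<otimes>\<^bsub>S\<^esub> \<omega> = T.emb1 (emb1 a) \<otimes>\<^bsub>S\<^esub> (c \<odot>\<^bsub>S\<^esub> \<omega>)"
    using T.KR.smult_assoc2[of c "T.emb1 (emb1 a)" \<omega>] T.KR.smult_assoc2[of c \<omega> "T.emb1 (emb1 a)"]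
    by (simp add: emb1_smult T.emb1_smult T.R.m_comm)
qed (auto simp: ring_hom_add[OF emb1_hom] ring_hom_add[OF T.emb1_hom] T.R.l_distr T.R.r_distr)

lemma AW_rep: "x \<in> carrier S \<Longrightarrow>
    \<exists>ps. set ps \<subseteq> carrier A \<times> W \<and> x = bsum S (\<lambda>a \<omega>. T.emb1 (emb1 a) \<otimes>\<^bsub>S\<^esub> \<omega>) ps"
proof (induction rule: T.tens_induct)
  case (tens r b)
  show ?case using tens(1)
  proof (induction rule: tens_induct)
    case (tens a b')
    have "tens K R B (tens K A B a b') b = T.emb1 (emb1 a) \<otimes>\<^bsub>S\<^esub> (T.emb1 (emb2 b') \<otimes>\<^bsub>S\<^esub> T.emb2 b)"
      using tens \<open>b \<in> carrier B\<close> by (simp add: T.tens_eq tens_eq ring_hom_mult[OF T.emb1_hom] T.R.m_assoc)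
    then show ?case using tens \<open>b \<in> carrier B\<close>
      by (intro exI[of _ "[(a, T.emb1 (emb2 b') \<otimes>\<^bsub>S\<^esub> T.emb2 b)]"]) (auto intro!: W_mult W_emb1 W_emb2)
  next
    case (add x y)
    then obtain ps qs where ps: "set ps \<subseteq> carrier A \<times> W" "set qs \<subseteq> carrier A \<times> W"
      "tens K R B x b = bsum S (\<lambda>a \<omega>. T.emb1 (emb1 a) \<otimes>\<^bsub>S\<^esub> \<omega>) ps"
      "tens K R B y b = bsum S (\<lambda>a \<omega>. T.emb1 (emb1 a) \<otimes>\<^bsub>S\<^esub> \<omega>) qs" by blast
    have "tens K R B (x \<oplus>\<^bsub>R\<^esub> y) b = bsum S (\<lambda>a \<omega>. T.emb1 (emb1 a) \<otimes>\<^bsub>S\<^esub> \<omega>) (ps @ qs)"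
      using add(1,2) ps \<open>b \<in> carrier B\<close> W_closed
      by (subst T.R.bsum_append) (auto simp: T.tens_add_left)
    then show ?case using ps by (intro exI[of _ "ps @ qs"]) auto
  qed
next
  case (add x y)
  then obtain ps qs where ps: "set ps \<subseteq> carrier A \<times> W" "set qs \<subseteq> carrier A \<times> W"
    "x = bsum S (\<lambda>a \<omega>. T.emb1 (emb1 a) \<otimes>\<^bsub>S\<^esub> \<omega>) ps"
    "y = bsum S (\<lambda>a \<omega>. T.emb1 (emb1 a) \<otimes>\<^bsub>S\<^esub> \<omega>) qs" by blast
  have "x \<oplus>\<^bsub>S\<^esub> y = bsum S (\<lambda>a \<omega>. T.emb1 (emb1 a) \<otimes>\<^bsub>S\<^esub> \<omega>) (ps @ qs)"
    using ps W_closed by (subst T.R.bsum_append) auto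
  then show ?case using ps by (intro exI[of _ "ps @ qs"]) auto
qed

end

subsection \<open>Elimination\<close>

context tensor_tower
begin

lemma bsum_eliminate:
  assumes \<phi>: "functional K A \<phi>" and rs: "set rs \<subseteq> carrier S \<times> W"
    and h: "h \<in> carrier S" and z0: "z0 \<in> carrier S"
  shows "bsum S (\<otimes>\<^bsub>S\<^esub>) (map (\<lambda>(z, \<iota>). (h \<otimes>\<^bsub>S\<^esub> z \<ominus>\<^bsub>S\<^esub> mid_slice \<phi> z \<otimes>\<^bsub>S\<^esub> z0, \<iota>)) rs)
    = h \<otimes>\<^bsub>S\<^esub> bsum S (\<otimes>\<^bsub>S\<^esub>) rs \<ominus>\<^bsub>S\<^esub> z0 \<otimes>\<^bsub>S\<^esub> bsum S (\<lambda>z \<iota>. mid_slice \<phi> z \<otimes>\<^bsub>S\<^esub> \<iota>) rs"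
  using rs
proof (induction rs)
  case Nil
  then show ?case using h z0 by (simp add: T.R.minus_eq)
next
  case (Cons r rs)
  obtain z \<iota> where r: "r = (z, \<iota>)" by (cases r)
  have z: "z \<in> carrier S" "\<iota> \<in> carrier S" and rs: "set rs \<subseteq> carrier S \<times> W"
    using Cons.prems W_closed by (auto simp: r)
  have "bsum S (\<otimes>\<^bsub>S\<^esub>) rs \<in> carrier S" "bsum S (\<lambda>z \<iota>. mid_slice \<phi> z \<otimes>\<^bsub>S\<^esub> \<iota>) rs \<in> carrier S"
    using rs W_closed mid_slice(1)[OF \<phi>] by (auto intro!: T.R.bsum_closed)
  then show ?case using Cons.IH[OF rs] z h z0 mid_slice(1)[OF \<phi>, of z]
    by (simp add: r T.R.minus_eq T.R.l_distr T.R.r_distr T.R.l_minus T.R.r_minus T.R.minus_add T.R.m_ac T.R.a_ac)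
qed

lemma mid_slice_bsum:
  assumes \<phi>: "functional K A \<phi>" and rs: "set rs \<subseteq> carrier S \<times> W"
  shows "mid_slice \<phi> (bsum S (\<otimes>\<^bsub>S\<^esub>) rs) = bsum S (\<lambda>z \<iota>. mid_slice \<phi> z \<otimes>\<^bsub>S\<^esub> \<iota>) rs"
proof -
  have "mid_slice \<phi> (bsum S (\<otimes>\<^bsub>S\<^esub>) rs) = bsum S (\<lambda>z \<iota>. mid_slice \<phi> (z \<otimes>\<^bsub>S\<^esub> \<iota>)) rs"
    using rs W_closed by (intro bsum_hom T.R.is_abelian_group mid_slice \<phi> mid_slice_zero) auto
  also have "\<dots> = bsum S (\<lambda>z \<iota>. mid_slice \<phi> z \<otimes>\<^bsub>S\<^esub> \<iota>) rs"
  proof (rule bsum_cong)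
    fix z \<iota> assume "(z, \<iota>) \<in> set rs"
    then have z: "z \<in> carrier S" "\<iota> \<in> W" using rs by auto
    then show "mid_slice \<phi> (z \<otimes>\<^bsub>S\<^esub> \<iota>) = mid_slice \<phi> z \<otimes>\<^bsub>S\<^esub> \<iota>"
      using W_sm[OF z(2) \<phi> z(1)] W_closed[OF z(2)] mid_slice(1)[OF \<phi> z(1)] by (simp add: T.R.m_comm)
  qed
  finally show ?thesis .
qed

text \<open>Linear independence over \<open>B\<close>, measured on the diagonal: it concerns the
  images under \<open>Mu\<close> and not the elements of \<open>S\<close> themselves.\<close>

definition Mu_indep where
  "Mu_indep zs \<longleftrightarrow> (\<forall>cs. length cs = length zs \<longrightarrow> set cs \<subseteq> carrier B \<longrightarrow>
     bsum R (\<lambda>c z. emb2 c \<otimes>\<^bsub>R\<^esub> Mu z) (zip cs zs) = \<zero>\<^bsub>R\<^esub> \<longrightarrow> set cs \<subseteq> {\<zero>\<^bsub>B\<^esub>})"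

text \<open>A relation with coefficients c_i among the transformed elements is a relation with
  coefficients c_i e among the old ones, up to a multiple of \<open>Mu z0\<close>. This is why
  independence survives an elimination step.\<close>

lemma bsum_Mu_eliminate:
  assumes \<phi>: "functional K A \<phi>" and zs: "set zs \<subseteq> carrier S" and cs: "set cs \<subseteq> carrier B"
    and len: "length cs = length zs"
    and h: "h \<in> carrier S" "Mu h = emb2 e" "e \<in> carrier B" and z0: "z0 \<in> carrier S"
  shows "bsum R (\<lambda>c z. emb2 c \<otimes>\<^bsub>R\<^esub> Mu z) (zip cs (map (\<lambda>z. h \<otimes>\<^bsub>S\<^esub> z \<ominus>\<^bsub>S\<^esub> mid_slice \<phi> z \<otimes>\<^bsub>S\<^esub> z0) zs))
    = bsum R (\<lambda>c z. emb2 c \<otimes>\<^bsub>R\<^esub> Mu z) (zip (map (\<lambda>c. c \<otimes>\<^bsub>B\<^esub> e) cs) zs)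
      \<ominus>\<^bsub>R\<^esub> emb2 (bsum B (\<lambda>c z. c \<otimes>\<^bsub>B\<^esub> slice1 \<phi> (Mu z)) (zip cs zs)) \<otimes>\<^bsub>R\<^esub> Mu z0
    \<and> bsum B (\<lambda>c z. c \<otimes>\<^bsub>B\<^esub> slice1 \<phi> (Mu z)) (zip cs zs) \<in> carrier B
    \<and> bsum R (\<lambda>c z. emb2 c \<otimes>\<^bsub>R\<^esub> Mu z) (zip (map (\<lambda>c. c \<otimes>\<^bsub>B\<^esub> e) cs) zs) \<in> carrier R"
  using len cs zs
proof (induction cs zs rule: list_induct2)
  case Nil
  have "emb2 \<zero>\<^bsub>B\<^esub> = \<zero>\<^bsub>R\<^esub>" by (rule ring_hom_zero[OF emb2_hom B.ring_axioms R.ring_axioms])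
  then show ?case using z0 by (simp add: R.minus_eq)
next
  case (Cons c cs z zs)
  have c: "c \<in> carrier B" and z: "z \<in> carrier S" using Cons.prems by auto
  have s: "slice1 \<phi> (Mu z) \<in> carrier B" using slice1(1)[OF \<phi>] z by simp
  have M: "Mu (h \<otimes>\<^bsub>S\<^esub> z \<ominus>\<^bsub>S\<^esub> mid_slice \<phi> z \<otimes>\<^bsub>S\<^esub> z0)
      = emb2 e \<otimes>\<^bsub>R\<^esub> Mu z \<ominus>\<^bsub>R\<^esub> emb2 (slice1 \<phi> (Mu z)) \<otimes>\<^bsub>R\<^esub> Mu z0"
  proof -
    interpret m: ring_hom_ring S R Mu
      using Mu_hom T.R.ring_axioms R.ring_axioms by (intro ring_hom_ringI2)
    show ?thesis using h z z0 mid_slice(1)[OF \<phi> z] Mu_mid_slice[OF \<phi> z]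
      by (simp add: T.R.minus_eq R.minus_eq)
  qed
  note IH = Cons.IH
  show ?case using IH Cons.prems c z s z0 h(3)
    by (simp add: M ring_hom_add[OF emb2_hom] ring_hom_mult[OF emb2_hom] R.minus_eq R.l_distr R.r_distr
        R.l_minus R.r_minus R.minus_add R.m_ac R.a_ac)
qed

text \<open>If \<open>\<Sum> z\<^sub>i \<iota>\<^sub>i = 0\<close> and \<open>h = mid_slice \<phi> z\<^sub>0\<close>, then the elements
  \<open>h z\<^sub>i - mid_slice \<phi> z\<^sub>i z\<^sub>0\<close> satisfy the same relation with one term less. Independence of the
  \<open>Mu z\<^sub>i\<close> over \<open>B\<close> provides a \<open>\<phi>\<close> with \<open>Mu h \<noteq> 0\<close> in every step.\<close>

lemma eliminate:
  assumes dom: "domain B" and nontriv: "\<one>\<^bsub>R\<^esub> \<noteq> \<zero>\<^bsub>R\<^esub>"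
    and "set qs \<subseteq> carrier S \<times> W" "bsum S (\<otimes>\<^bsub>S\<^esub>) qs = \<zero>\<^bsub>S\<^esub>"
    and "Mu_indep (map fst qs)"
  shows "\<exists>u\<in>W. Mu u \<noteq> \<zero>\<^bsub>R\<^esub> \<and> (\<forall>p\<in>set qs. u \<otimes>\<^bsub>S\<^esub> snd p = \<zero>\<^bsub>S\<^esub>)"
  using assms(3-5)
proof (induction "length qs" arbitrary: qs)
  case 0
  have "Mu \<one>\<^bsub>S\<^esub> = \<one>\<^bsub>R\<^esub>" by (rule ring_hom_one[OF Mu_hom])
  then show ?case using 0 W_one nontriv by (intro bexI[of _ "\<one>\<^bsub>S\<^esub>"]) auto
next
  case (Suc n)
  interpret B': domain B by fact
  obtain q0 rs where qs: "qs = q0 # rs" using Suc.hyps(2) by (cases qs) auto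
  obtain z0 \<iota>0 where q0: "q0 = (z0, \<iota>0)" by (cases q0)
  have z0: "z0 \<in> carrier S" and \<iota>0: "\<iota>0 \<in> W" "\<iota>0 \<in> carrier S" and rs: "set rs \<subseteq> carrier S \<times> W"
    using Suc.prems(1) W_closed by (auto simp: qs q0)
  have n: "n = length rs" using Suc.hyps(2) by (simp add: qs)
  have zs: "set (map fst rs) \<subseteq> carrier S" using rs by auto
  have Z: "Mu_indep (z0 # map fst rs)" using Suc.prems(3) by (simp add: qs q0)
  have zerosum: "bsum R (\<lambda>c z. emb2 c \<otimes>\<^bsub>R\<^esub> Mu z) (zip (replicate (length ws) \<zero>\<^bsub>B\<^esub>) ws) = \<zero>\<^bsub>R\<^esub>"
    if "set ws \<subseteq> carrier S" for ws
    using that ring_hom_zero[OF emb2_hom B.ring_axioms R.ring_axioms] by (induction ws) auto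
  \<comment> \<open>Otherwise the coefficients 1, 0, ..., 0 would violate independence.\<close>
  have "Mu z0 \<noteq> \<zero>\<^bsub>R\<^esub>"
  proof
    assume m: "Mu z0 = \<zero>\<^bsub>R\<^esub>"
    let ?cs = "\<one>\<^bsub>B\<^esub> # replicate (length (map fst rs)) \<zero>\<^bsub>B\<^esub>"
    have "bsum R (\<lambda>c z. emb2 c \<otimes>\<^bsub>R\<^esub> Mu z) (zip ?cs (z0 # map fst rs)) = \<zero>\<^bsub>R\<^esub>"
      using zerosum[OF zs] m by simp
    moreover have "set ?cs \<subseteq> carrier B" by auto
    moreover have "length ?cs = length (z0 # map fst rs)" by simp
    ultimately have "set ?cs \<subseteq> {\<zero>\<^bsub>B\<^esub>}" using Z unfolding Mu_indep_def by blast
    then show False by simp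
  qed
  then obtain \<phi> where \<phi>: "functional K A \<phi>" "slice1 \<phi> (Mu z0) \<noteq> \<zero>\<^bsub>B\<^esub>"
    using slice1_separates[of "Mu z0"] z0 by auto
  define e where "e = slice1 \<phi> (Mu z0)"
  define h where "h = mid_slice \<phi> z0"
  have e: "e \<in> carrier B" "e \<noteq> \<zero>\<^bsub>B\<^esub>" using \<phi> z0 slice1(1) by (simp_all add: e_def)
  have h: "h \<in> W" "h \<in> carrier S" "Mu h = emb2 e"
    using mid_slice_W[OF \<phi>(1) z0] W_closed Mu_mid_slice[OF \<phi>(1) z0] by (simp_all add: h_def e_def)
  let ?f = "\<lambda>z. h \<otimes>\<^bsub>S\<^esub> z \<ominus>\<^bsub>S\<^esub> mid_slice \<phi> z \<otimes>\<^bsub>S\<^esub> z0"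
  let ?rs = "map (\<lambda>(z, \<iota>). (?f z, \<iota>)) rs"
  let ?\<Sigma> = "bsum S (\<otimes>\<^bsub>S\<^esub>) rs" and ?\<Sigma>' = "bsum S (\<lambda>z \<iota>. mid_slice \<phi> z \<otimes>\<^bsub>S\<^esub> \<iota>) rs"
  have cl: "?\<Sigma> \<in> carrier S" "?\<Sigma>' \<in> carrier S"
    using rs W_closed mid_slice(1)[OF \<phi>(1)] by (auto intro!: T.R.bsum_closed)
  have s1: "z0 \<otimes>\<^bsub>S\<^esub> \<iota>0 \<oplus>\<^bsub>S\<^esub> ?\<Sigma> = \<zero>\<^bsub>S\<^esub>" using Suc.prems(2) by (simp add: qs q0)
  have s2: "h \<otimes>\<^bsub>S\<^esub> \<iota>0 \<oplus>\<^bsub>S\<^esub> ?\<Sigma>' = \<zero>\<^bsub>S\<^esub>"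
    using mid_slice_bsum[OF \<phi>(1) Suc.prems(1)] Suc.prems(2) mid_slice_zero[OF \<phi>(1)] by (simp add: qs q0 h_def)
  have e1: "?\<Sigma> = \<ominus>\<^bsub>S\<^esub> (z0 \<otimes>\<^bsub>S\<^esub> \<iota>0)"
    using s1 cl z0 \<iota>0 T.R.minus_equality[of ?\<Sigma> "z0 \<otimes>\<^bsub>S\<^esub> \<iota>0"] by (simp add: T.R.a_comm)
  have e2: "?\<Sigma>' = \<ominus>\<^bsub>S\<^esub> (h \<otimes>\<^bsub>S\<^esub> \<iota>0)"
    using s2 cl h \<iota>0 T.R.minus_equality[of ?\<Sigma>' "h \<otimes>\<^bsub>S\<^esub> \<iota>0"] by (simp add: T.R.a_comm)
  have "bsum S (\<otimes>\<^bsub>S\<^esub>) ?rs = \<zero>\<^bsub>S\<^esub>"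
    unfolding bsum_eliminate[OF \<phi>(1) rs h(2) z0] e1 e2 using h z0 \<iota>0
    by (simp add: T.R.r_minus T.R.m_ac T.R.minus_eq T.R.l_neg)
  moreover have "set ?rs \<subseteq> carrier S \<times> W" using rs h z0 mid_slice(1)[OF \<phi>(1)] by auto
  moreover have "Mu_indep (map fst ?rs)"
    unfolding Mu_indep_def
  proof (intro allI impI)
    fix cs assume len: "length cs = length (map fst ?rs)" and cs: "set cs \<subseteq> carrier B"
      and 0: "bsum R (\<lambda>c z. emb2 c \<otimes>\<^bsub>R\<^esub> Mu z) (zip cs (map fst ?rs)) = \<zero>\<^bsub>R\<^esub>"
    have mf: "map fst ?rs = map ?f (map fst rs)" by (induction rs) auto
    have len': "length cs = length (map fst rs)" using len by simp
    let ?F = "bsum B (\<lambda>c z. c \<otimes>\<^bsub>B\<^esub> slice1 \<phi> (Mu z)) (zip cs (map fst rs))"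
    let ?G = "bsum R (\<lambda>c z. emb2 c \<otimes>\<^bsub>R\<^esub> Mu z) (zip (map (\<lambda>c. c \<otimes>\<^bsub>B\<^esub> e) cs) (map fst rs))"
    have F: "?F \<in> carrier B" and G: "?G \<in> carrier R" and FG: "?G \<ominus>\<^bsub>R\<^esub> emb2 ?F \<otimes>\<^bsub>R\<^esub> Mu z0 = \<zero>\<^bsub>R\<^esub>"
      using bsum_Mu_eliminate[OF \<phi>(1) zs cs len' h(2,3) e(1) z0] 0 unfolding mf by auto
    let ?cs = "(\<ominus>\<^bsub>B\<^esub> ?F) # map (\<lambda>c. c \<otimes>\<^bsub>B\<^esub> e) cs"
    have "emb2 (\<ominus>\<^bsub>B\<^esub> ?F) = \<ominus>\<^bsub>R\<^esub> emb2 ?F"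
    proof -
      interpret m: ring_hom_ring B R emb2
        using emb2_hom B.ring_axioms R.ring_axioms by (intro ring_hom_ringI2)
      show ?thesis using F by simp
    qed
    then have "bsum R (\<lambda>c z. emb2 c \<otimes>\<^bsub>R\<^esub> Mu z) (zip ?cs (z0 # map fst rs)) = \<zero>\<^bsub>R\<^esub>"
      using FG F G z0 by (simp add: R.minus_eq R.l_minus R.a_comm)
    moreover have "set ?cs \<subseteq> carrier B" using F cs e by auto
    moreover have "length ?cs = length (z0 # map fst rs)" using len' by simp
    ultimately have "set ?cs \<subseteq> {\<zero>\<^bsub>B\<^esub>}" using Z unfolding Mu_indep_def by blast
    then have ce: "c \<otimes>\<^bsub>B\<^esub> e = \<zero>\<^bsub>B\<^esub>" if "c \<in> set cs" for c using that by auto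
    show "set cs \<subseteq> {\<zero>\<^bsub>B\<^esub>}"
    proof
      fix c assume c: "c \<in> set cs"
      then show "c \<in> {\<zero>\<^bsub>B\<^esub>}" using B'.integral[OF ce[OF c]] e cs by auto
    qed
  qed
  ultimately have "\<exists>u\<in>W. Mu u \<noteq> \<zero>\<^bsub>R\<^esub> \<and> (\<forall>p\<in>set ?rs. u \<otimes>\<^bsub>S\<^esub> snd p = \<zero>\<^bsub>S\<^esub>)"
    using n by (intro Suc.hyps(1)) simp_all
  then obtain u where uW: "u \<in> W"
    and uu: "Mu u \<noteq> \<zero>\<^bsub>R\<^esub> \<and> (\<forall>p\<in>set ?rs. u \<otimes>\<^bsub>S\<^esub> snd p = \<zero>\<^bsub>S\<^esub>)" by (rule bexE)
  note u = uW conjunct1[OF uu] bspec[OF conjunct2[OF uu]]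
  note uS = W_closed[OF u(1)]
  have kill: "u \<otimes>\<^bsub>S\<^esub> \<iota> = \<zero>\<^bsub>S\<^esub>" if "(z, \<iota>) \<in> set rs" for z \<iota>
    using u(3)[of "(?f z, \<iota>)"] that by force
  \<comment> \<open>The common annihilator is u h: \<open>u\<close> already kills the second
    components of \<open>rs\<close>, and h \<iota>0 is minus a combination of these.\<close>
  have "u \<otimes>\<^bsub>S\<^esub> h \<otimes>\<^bsub>S\<^esub> \<iota> = \<zero>\<^bsub>S\<^esub>" if p: "(z, \<iota>) \<in> set qs" for z \<iota>
  proof (cases "(z, \<iota>) \<in> set rs")
    case True
    have "u \<otimes>\<^bsub>S\<^esub> h \<otimes>\<^bsub>S\<^esub> \<iota> = h \<otimes>\<^bsub>S\<^esub> (u \<otimes>\<^bsub>S\<^esub> \<iota>)"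
      using uS h rs True W_closed by (auto simp: T.R.m_ac)
    then show ?thesis using kill[OF True] h by simp
  next
    case False
    then have \<iota>: "\<iota> = \<iota>0" using p by (auto simp: qs q0)
    have "u \<otimes>\<^bsub>S\<^esub> ?\<Sigma>' = bsum S (\<lambda>z \<iota>. u \<otimes>\<^bsub>S\<^esub> (mid_slice \<phi> z \<otimes>\<^bsub>S\<^esub> \<iota>)) rs"
      using uS rs W_closed mid_slice(1)[OF \<phi>(1)]
      by (intro bsum_hom T.R.is_abelian_group) (auto simp: T.R.r_distr)
    also have "\<dots> = bsum S (\<lambda>z \<iota>. \<zero>\<^bsub>S\<^esub>) rs"
    proof (rule bsum_cong)
      fix z \<iota> assume z: "(z, \<iota>) \<in> set rs"
      then have "z \<in> carrier S" "\<iota> \<in> carrier S" using rs W_closed by auto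
      then show "u \<otimes>\<^bsub>S\<^esub> (mid_slice \<phi> z \<otimes>\<^bsub>S\<^esub> \<iota>) = \<zero>\<^bsub>S\<^esub>"
        using kill[OF z] uS mid_slice(1)[OF \<phi>(1), of z] T.R.m_lcomm[of u "mid_slice \<phi> z" \<iota>] by simp
    qed
    also have "\<dots> = \<zero>\<^bsub>S\<^esub>" by (induction rs) auto
    finally show ?thesis using e2 uS h \<iota>0 by (simp add: \<iota> T.R.r_minus T.R.m_assoc)
  qed
  moreover have "u \<otimes>\<^bsub>S\<^esub> h \<in> W" using W_mult u h by blast
  \<comment> \<open>\<open>Mu h\<close> is the image of the nonzero element \<open>e\<close> of the
    domain \<open>B\<close>, hence regular in R.\<close>
  moreover have "Mu (u \<otimes>\<^bsub>S\<^esub> h) \<noteq> \<zero>\<^bsub>R\<^esub>"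
  proof
    assume "Mu (u \<otimes>\<^bsub>S\<^esub> h) = \<zero>\<^bsub>R\<^esub>"
    then have "emb2 e \<otimes>\<^bsub>R\<^esub> Mu u = \<zero>\<^bsub>R\<^esub>"
      using ring_hom_mult[OF Mu_hom uS h(2)] h uS e by (simp add: R.m_comm)
    then show False using nonzerodivD(2)[OF emb2_nonzerodiv[OF dom e]] uS u(2) by simp
  qed
  ultimately show ?case by (intro bexI[of _ "u \<otimes>\<^bsub>S\<^esub> h"]) auto
qed

text \<open>Write w as a sum of a_i \<omega>_i with independent a_i in \<open>A\<close> and with
  \<omega>_i in \<open>W\<close>. Then H w = 0 is a relation between the H a_i with coefficients
  \<omega>_i. Since \<open>Mu\<close> maps H a_i to g^4 a_i and g^4 is regular, these images are
  independent over \<open>B\<close>, and \<open>eliminate\<close> yields a common annihilator of all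
  \<omega>_i.\<close>

lemma annihilator_exists:
  assumes dom: "domain B" and y: "y \<in> carrier R" and g: "nonzerodiv R g"
    and nontriv: "\<one>\<^bsub>R\<^esub> \<noteq> \<zero>\<^bsub>R\<^esub>" and yy: "y \<otimes>\<^bsub>R\<^esub> y = g \<otimes>\<^bsub>R\<^esub> y"
  shows "\<exists>u\<in>W. u \<noteq> \<zero>\<^bsub>S\<^esub> \<and>
    u \<otimes>\<^bsub>S\<^esub> (T.emb1 y \<otimes>\<^bsub>S\<^esub> E2 g \<ominus>\<^bsub>S\<^esub> E2 y \<otimes>\<^bsub>S\<^esub> T.emb1 g) = \<zero>\<^bsub>S\<^esub>"
proof -
  note gR = nonzerodivD(1)[OF g]
  interpret m: ring_hom_ring S R Mu
    using Mu_hom T.R.ring_axioms R.ring_axioms by (intro ring_hom_ringI2)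
  define p where "p = T.emb1 y \<otimes>\<^bsub>S\<^esub> E2 g"
  define q where "q = E2 y \<otimes>\<^bsub>S\<^esub> T.emb1 g"
  define G where "G = T.emb1 g \<otimes>\<^bsub>S\<^esub> E2 g"
  define w where "w = p \<ominus>\<^bsub>S\<^esub> q"
  define H where "H = G \<otimes>\<^bsub>S\<^esub> G \<ominus>\<^bsub>S\<^esub> w \<otimes>\<^bsub>S\<^esub> w"
  have cl: "p \<in> carrier S" "q \<in> carrier S" "G \<in> carrier S" using y gR by (simp_all add: p_def q_def G_def)
  then have w: "w \<in> carrier S" by (simp add: w_def)
  then have H: "H \<in> carrier S" using cl by (simp add: H_def)
  have y1: "T.emb1 y \<otimes>\<^bsub>S\<^esub> T.emb1 y = T.emb1 g \<otimes>\<^bsub>S\<^esub> T.emb1 y"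
    using y gR yy by (simp add: ring_hom_mult[OF T.emb1_hom, symmetric])
  have y2: "E2 y \<otimes>\<^bsub>S\<^esub> E2 y = E2 g \<otimes>\<^bsub>S\<^esub> E2 y"
    using y gR yy by (simp add: ring_hom_mult[OF E2_hom, symmetric])
  have "p \<otimes>\<^bsub>S\<^esub> p = (T.emb1 y \<otimes>\<^bsub>S\<^esub> T.emb1 y) \<otimes>\<^bsub>S\<^esub> (E2 g \<otimes>\<^bsub>S\<^esub> E2 g)"
    using y gR by (simp add: p_def T.R.m_ac)
  also have "\<dots> = G \<otimes>\<^bsub>S\<^esub> p" unfolding y1 using y gR by (simp add: p_def G_def T.R.m_ac)
  finally have pp: "p \<otimes>\<^bsub>S\<^esub> p = G \<otimes>\<^bsub>S\<^esub> p" .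
  have "q \<otimes>\<^bsub>S\<^esub> q = (E2 y \<otimes>\<^bsub>S\<^esub> E2 y) \<otimes>\<^bsub>S\<^esub> (T.emb1 g \<otimes>\<^bsub>S\<^esub> T.emb1 g)"
    using y gR by (simp add: q_def T.R.m_ac)
  also have "\<dots> = G \<otimes>\<^bsub>S\<^esub> q" unfolding y2 using y gR by (simp add: q_def G_def T.R.m_ac)
  finally have qq: "q \<otimes>\<^bsub>S\<^esub> q = G \<otimes>\<^bsub>S\<^esub> q" .
  have Hw: "H \<otimes>\<^bsub>S\<^esub> w = \<zero>\<^bsub>S\<^esub>"
    unfolding H_def w_def by (rule T.R.diff_cube[OF cl pp qq])
  \<comment> \<open>\<open>Mu\<close> is a left inverse of both maps from R to \<open>S\<close>, so
    both terms of w become y g.\<close>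
  have "Mu w = \<zero>\<^bsub>R\<^esub>"
    unfolding w_def p_def q_def using y gR
    by (simp add: T.R.minus_eq Mu_emb1 Mu_E2 R.r_neg)
  then have MH: "Mu H = (g \<otimes>\<^bsub>R\<^esub> g) \<otimes>\<^bsub>R\<^esub> (g \<otimes>\<^bsub>R\<^esub> g)"
    unfolding H_def using w cl gR by (simp add: T.R.minus_eq G_def Mu_emb1 Mu_E2)
  then have MHn: "nonzerodiv R (Mu H)" using g R.nonzerodiv_mult by simp
  obtain ps where ps: "set ps \<subseteq> carrier A \<times> W" "w = bsum S (\<lambda>a \<omega>. T.emb1 (emb1 a) \<otimes>\<^bsub>S\<^esub> \<omega>) ps"
    using AW_rep[OF w] by blast
  obtain qs where qs: "set qs \<subseteq> carrier A \<times> W" "indep K A (map fst qs)"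
      "bsum S (\<lambda>a \<omega>. T.emb1 (emb1 a) \<otimes>\<^bsub>S\<^esub> \<omega>) qs = bsum S (\<lambda>a \<omega>. T.emb1 (emb1 a) \<otimes>\<^bsub>S\<^esub> \<omega>) ps"
    using AW.bsum_indep[OF ps(1) subset_refl W_subspace] by blast
  let ?rs = "map (\<lambda>(a, \<omega>). (H \<otimes>\<^bsub>S\<^esub> T.emb1 (emb1 a), \<omega>)) qs"
  have rs: "set ?rs \<subseteq> carrier S \<times> W" using qs(1) H by auto
  have cl_sum: "bsum S (\<lambda>a \<omega>. T.emb1 (emb1 a) \<otimes>\<^bsub>S\<^esub> \<omega>) xs \<in> carrier S"
    if "set xs \<subseteq> carrier A \<times> W" for xs
    using that W_closed by (auto intro!: T.R.bsum_closed)
  have "bsum S (\<otimes>\<^bsub>S\<^esub>) (map (\<lambda>(a, \<omega>). (H \<otimes>\<^bsub>S\<^esub> T.emb1 (emb1 a), \<omega>)) xs)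
      = H \<otimes>\<^bsub>S\<^esub> bsum S (\<lambda>a \<omega>. T.emb1 (emb1 a) \<otimes>\<^bsub>S\<^esub> \<omega>) xs" if "set xs \<subseteq> carrier A \<times> W" for xs
    using that
  proof (induction xs)
    case Nil
    then show ?case using H by simp
  next
    case (Cons x xs)
    then show ?case using H W_closed cl_sum[of xs] by (cases x) (simp add: T.R.r_distr T.R.m_assoc)
  qed
  then have sum0: "bsum S (\<otimes>\<^bsub>S\<^esub>) ?rs = \<zero>\<^bsub>S\<^esub>" using qs(1,3) ps(2) Hw by simp
  have "Mu_indep (map fst ?rs)"
    unfolding Mu_indep_def
  proof (intro allI impI)
    fix cs assume len: "length cs = length (map fst ?rs)" and cs: "set cs \<subseteq> carrier B"
      and 0: "bsum R (\<lambda>c z. emb2 c \<otimes>\<^bsub>R\<^esub> Mu z) (zip cs (map fst ?rs)) = \<zero>\<^bsub>R\<^esub>"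
    let ?as = "map fst qs"
    have as: "set ?as \<subseteq> carrier A" using qs(1) by auto
    have len': "length cs = length ?as" using len by simp
    have mf: "map fst ?rs = map (\<lambda>a. H \<otimes>\<^bsub>S\<^esub> T.emb1 (emb1 a)) ?as" by (induction qs) auto
    have "bsum R (\<lambda>c z. emb2 c \<otimes>\<^bsub>R\<^esub> Mu z) (zip cs (map (\<lambda>a. H \<otimes>\<^bsub>S\<^esub> T.emb1 (emb1 a)) as))
        = Mu H \<otimes>\<^bsub>R\<^esub> bsum R (tens K A B) (zip as cs) \<and> bsum R (tens K A B) (zip as cs) \<in> carrier R"
      if "length cs = length as" "set cs \<subseteq> carrier B" "set as \<subseteq> carrier A" for cs as
      using that
    proof (induction cs as rule: list_induct2)
      case Nil
      then show ?case using H by simp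
    next
      case (Cons c cs a as)
      then have "c \<in> carrier B" "a \<in> carrier A" by auto
      then show ?case using Cons H
        by (simp add: Mu_emb1 tens_eq R.r_distr R.m_ac)
    qed
    from this[OF len' cs as] have "Mu H \<otimes>\<^bsub>R\<^esub> bsum R (tens K A B) (zip ?as cs) = \<zero>\<^bsub>R\<^esub>"
      and z: "bsum R (tens K A B) (zip ?as cs) \<in> carrier R" using 0 unfolding mf by simp_all
    then have t0: "bsum R (tens K A B) (zip ?as cs) = \<zero>\<^bsub>R\<^esub>" using nonzerodivD(2)[OF MHn] by blast
    have zc: "set (zip ?as cs) \<subseteq> carrier A \<times> carrier B"
      using as cs by (meson mem_Sigma_iff set_zip_leftD set_zip_rightD subrelI subset_iff)
    have "map fst (zip ?as cs) = ?as" using len' by simp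
    then have "snd ` set (zip ?as cs) \<subseteq> {\<zero>\<^bsub>B\<^esub>}"
      using tens.indep_slices_zero[OF K.field_axioms zc] qs(2) slice1_bsum[OF _ zc] t0 slice1_zero by simp
    moreover have "snd ` set (zip ?as cs) = set cs" using len' by (metis map_snd_zip set_map)
    ultimately show "set cs \<subseteq> {\<zero>\<^bsub>B\<^esub>}" by simp
  qed
  then have "\<exists>u\<in>W. Mu u \<noteq> \<zero>\<^bsub>R\<^esub> \<and> (\<forall>p\<in>set ?rs. u \<otimes>\<^bsub>S\<^esub> snd p = \<zero>\<^bsub>S\<^esub>)"
    by (rule eliminate[OF dom nontriv rs sum0])
  then obtain u where uW: "u \<in> W"
    and uu: "Mu u \<noteq> \<zero>\<^bsub>R\<^esub> \<and> (\<forall>p\<in>set ?rs. u \<otimes>\<^bsub>S\<^esub> snd p = \<zero>\<^bsub>S\<^esub>)" by (rule bexE)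
  note u = uW conjunct1[OF uu] bspec[OF conjunct2[OF uu]]
  have uS: "u \<in> carrier S" using W_closed u(1) .
  have "u \<otimes>\<^bsub>S\<^esub> w = bsum S (\<lambda>a \<omega>. u \<otimes>\<^bsub>S\<^esub> (T.emb1 (emb1 a) \<otimes>\<^bsub>S\<^esub> \<omega>)) qs"
    unfolding ps(2) qs(3)[symmetric] using uS qs(1) W_closed
    by (intro bsum_hom T.R.is_abelian_group) (auto simp: T.R.r_distr)
  also have "\<dots> = bsum S (\<lambda>a \<omega>. \<zero>\<^bsub>S\<^esub>) qs"
  proof (rule bsum_cong)
    fix a \<omega> assume p: "(a, \<omega>) \<in> set qs"
    then have cl: "a \<in> carrier A" "\<omega> \<in> carrier S" using qs(1) W_closed by auto
    have "u \<otimes>\<^bsub>S\<^esub> \<omega> = \<zero>\<^bsub>S\<^esub>" using u(3)[of "(H \<otimes>\<^bsub>S\<^esub> T.emb1 (emb1 a), \<omega>)"] p by force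
    then show "u \<otimes>\<^bsub>S\<^esub> (T.emb1 (emb1 a) \<otimes>\<^bsub>S\<^esub> \<omega>) = \<zero>\<^bsub>S\<^esub>"
      using cl uS T.R.m_lcomm[of u "T.emb1 (emb1 a)" \<omega>] by simp
  qed
  also have "\<dots> = \<zero>\<^bsub>S\<^esub>" by (induction qs) auto
  finally have "u \<otimes>\<^bsub>S\<^esub> (T.emb1 y \<otimes>\<^bsub>S\<^esub> E2 g \<ominus>\<^bsub>S\<^esub> E2 y \<otimes>\<^bsub>S\<^esub> T.emb1 g) = \<zero>\<^bsub>S\<^esub>"
    by (simp only: w_def p_def q_def)
  moreover have "u \<noteq> \<zero>\<^bsub>S\<^esub>" using u(2) by auto
  ultimately show ?thesis using u(1) by blast
qed

text \<open>The element 1 \<otimes> b \<otimes> c - 1 \<otimes> c \<otimes> b. It vanishes when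
  \<open>b\<close> and \<open>c\<close> are proportional over k; being killed by a nonzero
  \<open>u\<close> is the weaker condition that will make b / c algebraic.\<close>

definition swap_diff where
  "swap_diff b c = T.emb1 (emb2 b) \<otimes>\<^bsub>S\<^esub> T.emb2 c \<ominus>\<^bsub>S\<^esub> T.emb1 (emb2 c) \<otimes>\<^bsub>S\<^esub> T.emb2 b"

lemma swap_diff_W: "b \<in> carrier B \<Longrightarrow> c \<in> carrier B \<Longrightarrow> swap_diff b c \<in> W"
  unfolding swap_diff_def T.R.minus_eq
  by (intro W_add W_minus W_mult W_emb1 W_emb2)

lemma swap_diff_bsum:
  assumes ps: "set ps \<subseteq> carrier A \<times> carrier B" and b: "b \<in> carrier B" and u: "u \<in> carrier S"
  shows "u \<otimes>\<^bsub>S\<^esub> (T.emb1 (bsum R (tens K A B) ps) \<otimes>\<^bsub>S\<^esub> T.emb2 b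
      \<ominus>\<^bsub>S\<^esub> E2 (bsum R (tens K A B) ps) \<otimes>\<^bsub>S\<^esub> T.emb1 (emb2 b))
    = bsum S (\<lambda>a c. T.emb1 (emb1 a) \<otimes>\<^bsub>S\<^esub> (u \<otimes>\<^bsub>S\<^esub> swap_diff c b)) ps"
  using ps
proof (induction ps)
  case Nil
  have "T.emb1 \<zero>\<^bsub>R\<^esub> = \<zero>\<^bsub>S\<^esub>" "E2 \<zero>\<^bsub>R\<^esub> = \<zero>\<^bsub>S\<^esub>"
    using ring_hom_zero[OF T.emb1_hom R.ring_axioms T.R.ring_axioms]
      ring_hom_zero[OF E2_hom R.ring_axioms T.R.ring_axioms] by auto
  then show ?case using b u by (simp add: T.R.minus_eq)
next
  case (Cons p ps)
  obtain a c where p: "p = (a, c)" by (cases p)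
  have ac: "a \<in> carrier A" "c \<in> carrier B" and ps: "set ps \<subseteq> carrier A \<times> carrier B"
    using Cons.prems by (auto simp: p)
  let ?r = "bsum R (tens K A B) ps"
  have r: "?r \<in> carrier R" using ps by (auto intro!: R.bsum_closed)
  have t: "T.emb1 (tens K A B a c) = T.emb1 (emb1 a) \<otimes>\<^bsub>S\<^esub> T.emb1 (emb2 c)"
    using ac by (simp add: tens_eq ring_hom_mult[OF T.emb1_hom])
  have "T.emb1 (emb1 a) \<otimes>\<^bsub>S\<^esub> (u \<otimes>\<^bsub>S\<^esub> swap_diff c b)
      = u \<otimes>\<^bsub>S\<^esub> (T.emb1 (tens K A B a c) \<otimes>\<^bsub>S\<^esub> T.emb2 b \<ominus>\<^bsub>S\<^esub> E2 (tens K A B a c) \<otimes>\<^bsub>S\<^esub> T.emb1 (emb2 b))"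
    using ac b u by (simp add: swap_diff_def t E2_tens T.R.minus_eq T.R.r_distr T.R.r_minus T.R.m_ac)
  moreover have "T.emb1 (tens K A B a c \<oplus>\<^bsub>R\<^esub> ?r) = T.emb1 (tens K A B a c) \<oplus>\<^bsub>S\<^esub> T.emb1 ?r"
    "E2 (tens K A B a c \<oplus>\<^bsub>R\<^esub> ?r) = E2 (tens K A B a c) \<oplus>\<^bsub>S\<^esub> E2 ?r"
    using ac r by (simp_all add: ring_hom_add[OF T.emb1_hom] ring_hom_add[OF E2_hom])
  ultimately show ?case using ac b u r Cons.IH[OF ps, symmetric]
    by (simp add: p T.R.minus_eq T.R.l_distr T.R.r_distr T.R.r_minus T.R.minus_add T.R.a_ac)
qed

text \<open>With independent first components the hypothesis separates into one condition u (c
  \<otimes> b0 - b0 \<otimes> c) = 0 for each coefficient c, and \<open>IC\<close> then divides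
  every c by \<open>b0\<close>. \<open>IC\<close> is an assumption here because it rests on the
  theory of algebraic elements developed below.\<close>

lemma bsum_swap_factor:
  assumes IC: "\<And>b u. b \<in> carrier B \<Longrightarrow> u \<in> W \<Longrightarrow> u \<noteq> \<zero>\<^bsub>S\<^esub> \<Longrightarrow>
        u \<otimes>\<^bsub>S\<^esub> swap_diff b b0 = \<zero>\<^bsub>S\<^esub> \<Longrightarrow> \<exists>l\<in>L. b = b0 \<otimes>\<^bsub>B\<^esub> l"
    and L: "L \<subseteq> carrier B" and b0: "b0 \<in> carrier B" and u: "u \<in> W" "u \<noteq> \<zero>\<^bsub>S\<^esub>"
    and U: "U \<subseteq> carrier A" and ps: "set ps \<subseteq> U \<times> carrier B"
    and 0: "u \<otimes>\<^bsub>S\<^esub> (T.emb1 (bsum R (tens K A B) ps) \<otimes>\<^bsub>S\<^esub> T.emb2 b0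
      \<ominus>\<^bsub>S\<^esub> E2 (bsum R (tens K A B) ps) \<otimes>\<^bsub>S\<^esub> T.emb1 (emb2 b0)) = \<zero>\<^bsub>S\<^esub>"
  shows "\<exists>qs. set qs \<subseteq> U \<times> L \<and> bsum R (tens K A B) ps = emb2 b0 \<otimes>\<^bsub>R\<^esub> bsum R (tens K A B) qs"
proof -
  obtain rs where rs: "set rs \<subseteq> U \<times> carrier B" "indep K A (map fst rs)"
      "bsum R (tens K A B) rs = bsum R (tens K A B) ps"
    using tens.bsum_indep[OF ps U KB.subspace_carrier] by blast
  have rsc: "set rs \<subseteq> carrier A \<times> carrier B" using rs(1) U by auto
  have uS: "u \<in> carrier S" using W_closed u(1) .
  define xs where "xs = map (\<lambda>(a, c). (a, u \<otimes>\<^bsub>S\<^esub> swap_diff c b0)) rs"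
  have om: "u \<otimes>\<^bsub>S\<^esub> swap_diff c b0 \<in> W" if "c \<in> carrier B" for c
    using swap_diff_W[OF that b0] u W_mult by blast
  have xs: "set xs \<subseteq> carrier A \<times> carrier S" using rsc om W_closed by (auto simp: xs_def)
  have xsW: "(a, \<omega>) \<in> set xs \<Longrightarrow> a \<in> carrier A \<and> \<omega> \<in> W" for a \<omega> using rsc om by (auto simp: xs_def)
  have fst_xs: "map fst xs = map fst rs" by (auto simp: xs_def)
  have "bsum S (\<lambda>a c. T.emb1 (emb1 a) \<otimes>\<^bsub>S\<^esub> (u \<otimes>\<^bsub>S\<^esub> swap_diff c b0)) rs = \<zero>\<^bsub>S\<^esub>"
    using 0 swap_diff_bsum[OF rsc b0 uS] rs(3) by simp
  moreover have "bsum S (\<lambda>a c. T.emb1 (emb1 a) \<otimes>\<^bsub>S\<^esub> (u \<otimes>\<^bsub>S\<^esub> swap_diff c b0)) rs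
      = bsum S (\<lambda>a \<omega>. T.emb1 (emb1 a) \<otimes>\<^bsub>S\<^esub> \<omega>) xs"
    unfolding xs_def by (induction rs) auto
  ultimately have x0: "bsum S (\<lambda>a \<omega>. T.emb1 (emb1 a) \<otimes>\<^bsub>S\<^esub> \<omega>) xs = \<zero>\<^bsub>S\<^esub>" by simp
  have "snd ` set xs \<subseteq> {\<zero>\<^bsub>S\<^esub>}"
  proof (rule AW.indep_slices_zero[OF K.field_axioms xs])
    show "indep K A (map fst xs)" using rs(2) fst_xs by simp
    fix \<phi> assume \<phi>: "functional K A \<phi>"
    have "mid_slice \<phi> (bsum S (\<lambda>a \<omega>. T.emb1 (emb1 a) \<otimes>\<^bsub>S\<^esub> \<omega>) xs)
        = bsum S (\<lambda>a \<omega>. mid_slice \<phi> (T.emb1 (emb1 a) \<otimes>\<^bsub>S\<^esub> \<omega>)) xs"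
      using xs by (intro bsum_hom T.R.is_abelian_group mid_slice \<phi> mid_slice_zero) auto
    also have "\<dots> = bsum S (\<lambda>a \<omega>. \<phi> a \<odot>\<^bsub>S\<^esub> \<omega>) xs"
    proof (rule bsum_cong)
      fix a \<omega> assume "(a, \<omega>) \<in> set xs"
      then have "a \<in> carrier A" "\<omega> \<in> W" using xsW by auto
      then show "mid_slice \<phi> (T.emb1 (emb1 a) \<otimes>\<^bsub>S\<^esub> \<omega>) = \<phi> a \<odot>\<^bsub>S\<^esub> \<omega>" by (rule mid_slice_emb1[OF \<phi>])
    qed
    finally show "bsum S (\<lambda>a \<omega>. \<phi> a \<odot>\<^bsub>S\<^esub> \<omega>) xs = \<zero>\<^bsub>S\<^esub>" using x0 mid_slice_zero[OF \<phi>] by simp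
  qed
  then have "\<exists>l\<in>L. c = b0 \<otimes>\<^bsub>B\<^esub> l" if "(a, c) \<in> set rs" for a c
  proof -
    assume z: "snd ` set xs \<subseteq> {\<zero>\<^bsub>S\<^esub>}"
    have "(a, u \<otimes>\<^bsub>S\<^esub> swap_diff c b0) \<in> set xs" using that by (force simp: xs_def)
    then have "u \<otimes>\<^bsub>S\<^esub> swap_diff c b0 = \<zero>\<^bsub>S\<^esub>" using z by force
    then show ?thesis using IC[of c u] u rsc that by auto
  qed
  then have "\<forall>c\<in>snd ` set rs. \<exists>l. l \<in> L \<and> c = b0 \<otimes>\<^bsub>B\<^esub> l" by force
  then obtain l where lc: "\<forall>c\<in>snd ` set rs. l c \<in> L \<and> c = b0 \<otimes>\<^bsub>B\<^esub> l c"
    by (rule bchoice[THEN exE])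
  have l: "l c \<in> L" "c = b0 \<otimes>\<^bsub>B\<^esub> l c" if "(a, c) \<in> set rs" for a c
    using bspec[OF lc, of c] that by force+
  let ?qs = "map (\<lambda>(a, c). (a, l c)) rs"
  have "set ?qs \<subseteq> U \<times> L" using rs(1) l(1) by auto
  moreover have "bsum R (tens K A B) ys = emb2 b0 \<otimes>\<^bsub>R\<^esub> bsum R (tens K A B) (map (\<lambda>(a, c). (a, l c)) ys)
     \<and> bsum R (tens K A B) (map (\<lambda>(a, c). (a, l c)) ys) \<in> carrier R"
    if "set ys \<subseteq> set rs" for ys
    using that
  proof (induction ys)
    case Nil
    then show ?case using b0 by simp
  next
    case (Cons y ys)
    obtain a c where y: "y = (a, c)" by (cases y)
    have ac: "(a, c) \<in> set rs" using Cons.prems by (simp add: y)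
    then have a: "a \<in> carrier A" and lc: "l c \<in> carrier B" using rsc l(1) L by auto
    have "tens K A B a c = emb2 b0 \<otimes>\<^bsub>R\<^esub> tens K A B a (l c)"
      by (subst l(2)[OF ac]) (use a lc b0 in \<open>simp add: emb2_def tens_mult\<close>)
    then show ?case using Cons a lc b0 by (simp add: y R.r_distr)
  qed
  from this[OF subset_refl] have "bsum R (tens K A B) ps = emb2 b0 \<otimes>\<^bsub>R\<^esub> bsum R (tens K A B) ?qs"
    using rs(3) by simp
  ultimately show ?thesis by blast
qed

end

subsection \<open>Algebraic elements\<close>

primrec dspan :: "('r, 'm) ring_scheme \<Rightarrow> 'r set \<Rightarrow> 'r list \<Rightarrow> 'r set" where
  "dspan R D [] = {\<zero>\<^bsub>R\<^esub>}"
| "dspan R D (f # fs) = {d \<otimes>\<^bsub>R\<^esub> f \<oplus>\<^bsub>R\<^esub> m | d m. d \<in> D \<and> m \<in> dspan R D fs}"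

text \<open>The coefficient list is not normalized: leading zeros are allowed, and the leading
  coefficient need not be invertible. Thus the notion makes sense over a subring of a ring with zero
  divisors.\<close>

definition alg_over :: "('r, 'm) ring_scheme \<Rightarrow> 'r set \<Rightarrow> 'r \<Rightarrow> bool" where
  "alg_over R D x \<longleftrightarrow> (\<exists>cs. set cs \<subseteq> D \<and> \<not> set cs \<subseteq> {\<zero>\<^bsub>R\<^esub>} \<and> ring.eval R cs x = \<zero>\<^bsub>R\<^esub>)"

definition no_zero_div :: "('r, 'm) ring_scheme \<Rightarrow> 'r set \<Rightarrow> bool" where
  "no_zero_div R D \<longleftrightarrow> (\<forall>x\<in>D. \<forall>y\<in>D. x \<otimes>\<^bsub>R\<^esub> y = \<zero>\<^bsub>R\<^esub> \<longrightarrow> x = \<zero>\<^bsub>R\<^esub> \<or> y = \<zero>\<^bsub>R\<^esub>)"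

lemma no_zero_divD: "no_zero_div R D \<Longrightarrow> x \<in> D \<Longrightarrow> y \<in> D \<Longrightarrow> x \<otimes>\<^bsub>R\<^esub> y = \<zero>\<^bsub>R\<^esub> \<Longrightarrow> x \<noteq> \<zero>\<^bsub>R\<^esub> \<Longrightarrow> y = \<zero>\<^bsub>R\<^esub>"
  by (auto simp: no_zero_div_def)

lemma dspan_Cons_intro:
  "x = d \<otimes>\<^bsub>R\<^esub> f \<oplus>\<^bsub>R\<^esub> m \<Longrightarrow> d \<in> D \<Longrightarrow> m \<in> dspan R D fs \<Longrightarrow> x \<in> dspan R D (f # fs)"
  by auto

context cring
begin

lemma dspan_closed: "D \<subseteq> carrier R \<Longrightarrow> set fs \<subseteq> carrier R \<Longrightarrow> x \<in> dspan R D fs \<Longrightarrow> x \<in> carrier R"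
proof (induction fs arbitrary: x)
  case (Cons f fs)
  then obtain d m where "x = d \<otimes> f \<oplus> m" "d \<in> D" "m \<in> dspan R D fs" by auto
  then show ?case using Cons.IH[of m] Cons.prems by auto
qed simp

lemma dspan_zero: "subring D R \<Longrightarrow> set fs \<subseteq> carrier R \<Longrightarrow> \<zero> \<in> dspan R D fs"
proof (induction fs)
  case (Cons f fs)
  then show ?case using subringE(2)[of D] by (intro dspan_Cons_intro[where d = \<zero> and m = \<zero>]) auto
qed simp

lemma dspan_add:
  assumes "subring D R" "set fs \<subseteq> carrier R" "x \<in> dspan R D fs" "y \<in> dspan R D fs"
  shows "x \<oplus> y \<in> dspan R D fs"
  using assms(2-4)
proof (induction fs arbitrary: x y)
  case (Cons f fs)
  note DC = subringE(1)[OF assms(1)]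
  obtain d m where x: "x = d \<otimes> f \<oplus> m" "d \<in> D" "m \<in> dspan R D fs" using Cons.prems(2) by auto
  obtain d' m' where y: "y = d' \<otimes> f \<oplus> m'" "d' \<in> D" "m' \<in> dspan R D fs" using Cons.prems(3) by auto
  have fs: "set fs \<subseteq> carrier R" "f \<in> carrier R" using Cons.prems by auto
  note cl = dspan_closed[OF DC fs(1)]
  have "x \<oplus> y = (d \<oplus> d') \<otimes> f \<oplus> (m \<oplus> m')"
    using x y fs cl[OF x(3)] cl[OF y(3)] DC by (simp add: l_distr a_ac subset_iff)
  then show ?case
    by (rule dspan_Cons_intro) (use x y subringE(7)[OF assms(1)] Cons.IH[OF fs(1)] in auto)
qed simp

lemma dspan_mult:
  assumes "subring D R" "set fs \<subseteq> carrier R" "c \<in> D" "x \<in> dspan R D fs"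
  shows "c \<otimes> x \<in> dspan R D fs"
  using assms(2,4)
proof (induction fs arbitrary: x)
  case Nil
  then show ?case using subringE(1)[OF assms(1)] assms(3) by auto
next
  case (Cons f fs)
  note DC = subringE(1)[OF assms(1)]
  obtain d m where x: "x = d \<otimes> f \<oplus> m" "d \<in> D" "m \<in> dspan R D fs" using Cons.prems(2) by auto
  have fs: "set fs \<subseteq> carrier R" "f \<in> carrier R" using Cons.prems by auto
  have cl: "c \<in> carrier R" "d \<in> carrier R" "m \<in> carrier R"
    using DC assms(3) x dspan_closed[OF DC fs(1)] by auto
  have "c \<otimes> x = (c \<otimes> d) \<otimes> f \<oplus> c \<otimes> m"
    using x(1) fs cl by (simp add: r_distr m_assoc)
  then show ?case
    by (rule dspan_Cons_intro) (use x assms(3) subringE(6)[OF assms(1)] Cons.IH[OF fs(1)] in auto)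
qed

lemma dspan_minus:
  assumes "subring D R" "set fs \<subseteq> carrier R" "x \<in> dspan R D fs"
  shows "\<ominus> x \<in> dspan R D fs"
proof -
  have "(\<ominus> \<one>) \<otimes> x = \<ominus> x" using dspan_closed[OF subringE(1)[OF assms(1)] assms(2,3)] by (simp add: l_minus)
  then show ?thesis
    using dspan_mult[OF assms(1,2) _ assms(3), of "\<ominus> \<one>"] subringE(3,5)[OF assms(1)] by simp
qed

lemma dspan_mem:
  assumes "subring D R" "set fs \<subseteq> carrier R" "f \<in> set fs"
  shows "f \<in> dspan R D fs"
  using assms(2,3)
proof (induction fs)
  case (Cons g fs)
  show ?case
  proof (cases "f = g")
    case True
    show ?thesis unfolding True
      by (rule dspan_Cons_intro[where d = \<one> and m = \<zero>])
        (use Cons.prems subringE(3)[OF assms(1)] dspan_zero[OF assms(1)] in auto)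
  next
    case False
    show ?thesis
      by (rule dspan_Cons_intro[where d = \<zero> and m = f])
        (use False Cons subringE(2)[OF assms(1)] in auto)
  qed
qed simp

lemma combine_subring:
  assumes "subring D R"
  shows "set cs \<subseteq> D \<Longrightarrow> set ds \<subseteq> D \<Longrightarrow> combine cs ds \<in> D"
  by (induction cs ds rule: combine.induct) (simp_all add: subringE(2,6,7)[OF assms])

lemma combine_eliminate:
  assumes "length cs = length zs" "set cs \<subseteq> carrier R" "set zs \<subseteq> carrier R" "d ` set zs \<subseteq> carrier R"
    "d0 \<in> carrier R" "v0 \<in> carrier R"
  shows "combine cs (map (\<lambda>v. d0 \<otimes> v \<ominus> d v \<otimes> v0) zs)
    = combine (map ((\<otimes>) d0) cs) zs \<ominus> combine cs (map d zs) \<otimes> v0"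
  using assms(1-4)
proof (induction cs zs rule: list_induct2)
  case Nil
  then show ?case using assms(6) by (simp add: minus_eq)
next
  case (Cons c cs z zs)
  have 1: "combine (map ((\<otimes>) d0) cs) zs \<in> carrier R" "combine cs (map d zs) \<in> carrier R"
    using Cons.prems assms(5) by (auto simp: subset_iff intro!: combine_in_carrier)
  have 2: "c \<in> carrier R" "z \<in> carrier R" "d z \<in> carrier R" using Cons.prems by auto
  have IH: "combine cs (map (\<lambda>v. d0 \<otimes> v \<ominus> d v \<otimes> v0) zs)
    = combine (map ((\<otimes>) d0) cs) zs \<ominus> combine cs (map d zs) \<otimes> v0"
    using Cons by auto
  show ?case using 1 2 assms(5,6)
    by (simp add: IH[unfolded minus_eq] minus_eq l_distr r_distr r_minus minus_add m_ac a_ac)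
qed

text \<open>Fraction-free Gaussian elimination. For a pivot \<open>v0\<close> whose coefficient at
  \<open>f\<close> is nonzero, all d(v0) v - d(v) v0 lie in the span of the remaining generators. R
  may have zero divisors, but the pivot is an element of \<open>D\<close> and is cancelled
  there.\<close>

lemma dspan_dependent:
  assumes D: "subring D R" "no_zero_div R D" and nontriv: "\<one> \<noteq> \<zero>"
    and "set fs \<subseteq> carrier R" "set vs \<subseteq> dspan R D fs" "length fs < length vs"
  shows "\<exists>cs. length cs = length vs \<and> set cs \<subseteq> D \<and> \<not> set cs \<subseteq> {\<zero>} \<and> combine cs vs = \<zero>"
  using assms(4-6)
proof (induction fs arbitrary: vs)
  case Nil
  then obtain v ws where vs: "vs = v # ws" by (cases vs) auto
  have z: "set vs \<subseteq> {\<zero>}" using Nil.prems(2) by simp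
  have "combine (replicate (length ws) \<zero>) ws = \<zero>"
    using z by (intro combine_replicate) (auto simp: vs)
  then show ?case using z nontriv subringE(2,3)[OF D(1)]
    by (intro exI[of _ "\<one> # replicate (length ws) \<zero>"]) (auto simp: vs)
next
  case (Cons f fs)
  note DC = subringE(1)[OF D(1)]
  have fs: "set fs \<subseteq> carrier R" "f \<in> carrier R" using Cons.prems by auto
  note cl = dspan_closed[OF DC fs(1)]
  have vsC: "set vs \<subseteq> carrier R" using Cons.prems(2) dspan_closed[OF DC Cons.prems(1)] by blast
  have "\<forall>v\<in>set vs. \<exists>d. d \<in> D \<and> (\<exists>m\<in>dspan R D fs. v = d \<otimes> f \<oplus> m)"
    using Cons.prems(2) by fastforce
  then obtain d where d: "\<forall>v\<in>set vs. d v \<in> D \<and> (\<exists>m\<in>dspan R D fs. v = d v \<otimes> f \<oplus> m)"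
    by (rule bchoice[THEN exE])
  show ?case
  proof (cases "\<forall>v\<in>set vs. d v = \<zero>")
    case True
    have "set vs \<subseteq> dspan R D fs"
    proof
      fix v assume v: "v \<in> set vs"
      then obtain m where "m \<in> dspan R D fs" "v = \<zero> \<otimes> f \<oplus> m" using d True by metis
      then show "v \<in> dspan R D fs" using fs cl by auto
    qed
    then show ?thesis using Cons.IH[OF fs(1)] Cons.prems(3) by simp
  next
    case False
    then obtain v0 where v0: "v0 \<in> set vs" "d v0 \<noteq> \<zero>" by blast
    obtain xs ys where vs: "vs = xs @ v0 # ys" using split_list[OF v0(1)] by blast
    let ?zs = "xs @ ys"
    let ?g = "\<lambda>v. d v0 \<otimes> v \<ominus> d v \<otimes> v0"
    have zsC: "set xs \<subseteq> carrier R" "set ys \<subseteq> carrier R" "v0 \<in> carrier R" using vsC by (auto simp: vs)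
    have dD: "d v \<in> D" if "v \<in> set vs" for v using d that by blast
    have dC: "d v \<in> carrier R" if "v \<in> set vs" for v using dD[OF that] DC by blast
    obtain m0 where m0: "m0 \<in> dspan R D fs" "v0 = d v0 \<otimes> f \<oplus> m0" using d v0(1) by blast
    have "set (map ?g ?zs) \<subseteq> dspan R D fs"
    proof
      fix w assume "w \<in> set (map ?g ?zs)"
      then obtain v where v: "v \<in> set vs" "w = ?g v" by (auto simp: vs)
      obtain m where m: "m \<in> dspan R D fs" "v = d v \<otimes> f \<oplus> m" using d v(1) by blast
      have mc: "m \<in> carrier R" "m0 \<in> carrier R" using cl m(1) m0(1) by auto
      have "w = d v0 \<otimes> (d v \<otimes> f \<oplus> m) \<ominus> d v \<otimes> (d v0 \<otimes> f \<oplus> m0)"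
        unfolding v(2) using m(2) m0(2) by metis
      also have "\<dots> = d v0 \<otimes> m \<oplus> \<ominus> (d v \<otimes> m0)"
      proof -
        have e: "d v0 \<otimes> (d v \<otimes> f) = d v \<otimes> (d v0 \<otimes> f)" using dC v(1) v0(1) fs by (simp add: m_lcomm)
        have *: "(p \<oplus> q) \<ominus> (p \<oplus> r) = q \<oplus> \<ominus> r" if "p \<in> carrier R" "q \<in> carrier R" "r \<in> carrier R" for p q r
        proof -
          have "(p \<oplus> q) = (q \<oplus> p)" using that by (simp add: a_comm)
          then show ?thesis using that by (simp add: minus_eq minus_add a_assoc r_neg2)
        qed
        show ?thesis using dC v(1) v0(1) fs mc by (simp add: r_distr e *)
      qed
      also have "\<dots> \<in> dspan R D fs"
        using dspan_add[OF D(1) fs(1)] dspan_minus[OF D(1) fs(1)] dspan_mult[OF D(1) fs(1)] dD v(1) v0(1) m(1) m0(1)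
        by simp
      finally show "w \<in> dspan R D fs" .
    qed
    moreover have "length fs < length (map ?g ?zs)" using Cons.prems(3) by (simp add: vs)
    ultimately obtain cs where cs: "length cs = length ?zs" "set cs \<subseteq> D" "\<not> set cs \<subseteq> {\<zero>}"
        "combine cs (map ?g ?zs) = \<zero>"
      using Cons.IH[OF fs(1), of "map ?g ?zs"] by auto
    define cx cy where "cx = take (length xs) cs" and "cy = drop (length xs) cs"
    have c: "cs = cx @ cy" "length cx = length xs" "length cy = length ys"
      using cs(1) by (auto simp: cx_def cy_def)
    have cD: "set cx \<subseteq> D" "set cy \<subseteq> D" using cs(2) c(1) by auto
    let ?s = "combine cs (map d ?zs)"
    \<comment> \<open>Undoing the elimination: the coefficients are multiplied by the pivot, and
      \<open>v0\<close> collects the subtracted terms.\<close>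
    let ?cs = "map ((\<otimes>) (d v0)) cx @ (\<ominus> ?s) # map ((\<otimes>) (d v0)) cy"
    have sD: "?s \<in> D" by (rule combine_subring[OF D(1) cs(2)]) (use dD in \<open>auto simp: vs\<close>)
    have d0: "d v0 \<in> carrier R" using dC v0(1) by blast
    have csC: "set cs \<subseteq> carrier R" using cs(2) DC by blast
    have mC: "set (map ((\<otimes>) (d v0)) cx) \<subseteq> carrier R" "set (map ((\<otimes>) (d v0)) cy) \<subseteq> carrier R"
      using csC c(1) d0 by auto
    have e: "combine (map ((\<otimes>) (d v0)) cs) ?zs \<ominus> ?s \<otimes> v0 = \<zero>"

    proof -
      have "d ` set ?zs \<subseteq> carrier R" using dC by (auto simp: vs)
      moreover have "set ?zs \<subseteq> carrier R" using zsC by simp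
      ultimately show ?thesis
        using combine_eliminate[OF cs(1) csC _ _ d0 zsC(3), of d] cs(4) by simp
    qed
    have e': "combine (map ((\<otimes>) (d v0)) cs) ?zs
        = combine (map ((\<otimes>) (d v0)) cx) xs \<oplus> combine (map ((\<otimes>) (d v0)) cy) ys"
      using combine_append[of "map ((\<otimes>) (d v0)) cx" xs "map ((\<otimes>) (d v0)) cy" ys] c mC zsC by simp
    have C: "combine (map ((\<otimes>) (d v0)) cx) xs \<in> carrier R" "combine (map ((\<otimes>) (d v0)) cy) ys \<in> carrier R"
      using mC zsC by (simp_all only: combine_in_carrier)
    have "combine ?cs vs = combine (map ((\<otimes>) (d v0)) cx) xs
        \<oplus> (\<ominus> ?s \<otimes> v0 \<oplus> combine (map ((\<otimes>) (d v0)) cy) ys)"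
      unfolding vs using combine_append[of "map ((\<otimes>) (d v0)) cx" xs "\<ominus> ?s # map ((\<otimes>) (d v0)) cy" "v0 # ys"]
        c mC zsC sD DC by auto
    also have "\<dots> = combine (map ((\<otimes>) (d v0)) cs) ?zs \<ominus> ?s \<otimes> v0"
      unfolding e' using C zsC sD DC by (simp add: minus_eq l_minus a_ac subset_iff)
    finally have "combine ?cs vs = \<zero>" using e by simp
    moreover have "length ?cs = length vs" using c by (simp add: vs)
    moreover have "set ?cs \<subseteq> D"
      using cD sD subringE(5,6)[OF D(1)] dD[OF v0(1)] by auto
    moreover have "\<not> set ?cs \<subseteq> {\<zero>}"
    proof
      assume z: "set ?cs \<subseteq> {\<zero>}"
      have "x = \<zero>" if x: "x \<in> set cs" for x
      proof -
        have "d v0 \<otimes> x = \<zero>" using z x c(1) by auto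
        then show ?thesis using no_zero_divD[OF D(2) dD[OF v0(1)] _ _ v0(2)] x cs(2) by blast
      qed
      then show False using cs(3) by blast
    qed
    ultimately show ?thesis by blast
  qed
qed

text \<open>The powers descend because coefficient lists start with the leading term. The factor
  \<open>y\<close> admits relations that are known only between the multiples x^i y.\<close>

lemma combine_powers:
  assumes "x \<in> carrier R" "y \<in> carrier R" "set cs \<subseteq> carrier R"
  shows "combine cs (map (\<lambda>i. x [^] i \<otimes> y) (rev [0..<length cs])) = eval cs x \<otimes> y"
  using assms(3)
proof (induction cs)
  case Nil
  then show ?case using assms by simp
next
  case (Cons c cs)
  then show ?case using assms eval_in_carrier[of cs x] by (simp add: l_distr m_assoc)
qed

end

section \<open>Elements and fractions algebraic over the ground field\<close>

definition scalars :: "('k, 'm) ring_scheme \<Rightarrow> ('k, 'b, 'o) module_scheme \<Rightarrow> 'b set" where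
  "scalars K B = (\<lambda>c. c \<odot>\<^bsub>B\<^esub> \<one>\<^bsub>B\<^esub>) ` carrier K"

definition alg_closure_in :: "('k, 'm) ring_scheme \<Rightarrow> ('k, 'b, 'o) module_scheme \<Rightarrow> 'b set" where
  "alg_closure_in K B = {b \<in> carrier B. alg_over B (scalars K B) b}"

context tensor_pair
begin

lemma scalar_hom: "(\<lambda>c. c \<odot>\<^bsub>B\<^esub> \<one>\<^bsub>B\<^esub>) \<in> ring_hom K B"
  by (rule ring_hom_memI) (simp_all add: KB.smult_l_distr KB.smult_assoc1 smult_one_mult)

lemma scalars_subring: "subring (scalars K B) B"
proof -
  interpret h: ring_hom_ring K B "\<lambda>c. c \<odot>\<^bsub>B\<^esub> \<one>\<^bsub>B\<^esub>"
    using scalar_hom K.ring_axioms B.ring_axioms by (intro ring_hom_ringI2)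
  show ?thesis unfolding scalars_def using h.img_is_subring[OF K.carrier_is_subring] .
qed

text \<open>The span depends on \<open>ps\<close> and not on \<open>a\<close>: however the left
  factor is multiplied, the slices stay in one finite-dimensional space. This bounds the degree of b
  / c later.\<close>

lemma slice1_dspan:
  assumes \<phi>: "functional K A \<phi>" and a: "a \<in> carrier A" and ps: "set ps \<subseteq> carrier A \<times> carrier B"
  shows "slice1 \<phi> (emb1 a \<otimes>\<^bsub>R\<^esub> bsum R (tens K A B) ps) \<in> dspan B (scalars K B) (map snd ps)"
  using ps
proof (induction ps)
  case Nil
  then show ?case using a slice1_zero[OF \<phi>] by simp
next
  case (Cons p ps)
  obtain x t where p: "p = (x, t)" by (cases p)
  have x: "x \<in> carrier A" "t \<in> carrier B" and ps: "set ps \<subseteq> carrier A \<times> carrier B"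
    using Cons.prems by (auto simp: p)
  have c: "bsum R (tens K A B) ps \<in> carrier R" using ps by (auto intro!: R.bsum_closed)
  have "emb1 a \<otimes>\<^bsub>R\<^esub> tens K A B x t = tens K A B (a \<otimes>\<^bsub>A\<^esub> x) t" using a x by (simp add: emb1_def tens_mult)
  then have e: "slice1 \<phi> (emb1 a \<otimes>\<^bsub>R\<^esub> tens K A B x t) = (\<phi> (a \<otimes>\<^bsub>A\<^esub> x) \<odot>\<^bsub>B\<^esub> \<one>\<^bsub>B\<^esub>) \<otimes>\<^bsub>B\<^esub> t"
    using a x functionalD(1)[OF \<phi>, of "a \<otimes>\<^bsub>A\<^esub> x"] by (simp add: slice1[OF \<phi>] smult_one_mult)
  have "slice1 \<phi> (emb1 a \<otimes>\<^bsub>R\<^esub> bsum R (tens K A B) (p # ps))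
      = (\<phi> (a \<otimes>\<^bsub>A\<^esub> x) \<odot>\<^bsub>B\<^esub> \<one>\<^bsub>B\<^esub>) \<otimes>\<^bsub>B\<^esub> t \<oplus>\<^bsub>B\<^esub> slice1 \<phi> (emb1 a \<otimes>\<^bsub>R\<^esub> bsum R (tens K A B) ps)"
    using a x c by (simp add: p R.r_distr slice1(2)[OF \<phi>] e)
  then have "slice1 \<phi> (emb1 a \<otimes>\<^bsub>R\<^esub> bsum R (tens K A B) (p # ps)) \<in> dspan B (scalars K B) (t # map snd ps)"
    by (rule dspan_Cons_intro)
      (use Cons.IH[OF ps] functionalD(1)[OF \<phi>, of "a \<otimes>\<^bsub>A\<^esub> x"] a x in \<open>auto simp: scalars_def\<close>)
  then show ?case by (simp add: p)
qed

end

text \<open>Once leading zeros are stripped, the leading coefficient has an inverse in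
  \<open>D\<close>, and division by it makes the equation monic. Its coefficients are then read in
  the larger ring \<open>E\<close>.\<close>

lemma alg_over_integral_over:
  assumes "field Q" "x \<in> carrier Q" "subring E Q" "D \<subseteq> E"
    and inv: "\<And>d. d \<in> D \<Longrightarrow> d \<noteq> \<zero>\<^bsub>Q\<^esub> \<Longrightarrow> inv\<^bsub>Q\<^esub> d \<in> D" and alg: "alg_over Q D x"
  shows "integral_over Q E x"
proof -
  interpret Q: field Q by fact
  obtain cs where cs: "set cs \<subseteq> D" "\<not> set cs \<subseteq> {\<zero>\<^bsub>Q\<^esub>}" "Q.eval cs x = \<zero>\<^bsub>Q\<^esub>"
    using alg unfolding alg_over_def by blast
  have EC: "E \<subseteq> carrier Q" using subringE(1)[OF assms(3)] .
  have csC: "set cs \<subseteq> carrier Q" using cs(1) assms(4) EC by blast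
  let ?p = "Q.normalize cs"
  have pD: "set ?p \<subseteq> D" using cs(1) by (induction cs) auto
  have "?p \<noteq> []" using cs(2) by (induction cs) (auto split: if_splits)
  moreover have pol: "polynomial\<^bsub>Q\<^esub> D ?p" using Q.normalize_gives_polynomial[OF cs(1)] .
  ultimately obtain d ds where p: "?p = d # ds" and d0: "d \<noteq> \<zero>\<^bsub>Q\<^esub>"
    by (cases ?p) (auto simp: polynomial_def)
  have d: "d \<in> D" and ds: "set ds \<subseteq> D" using pD p by auto
  have dC: "d \<in> carrier Q" "inv\<^bsub>Q\<^esub> d \<in> carrier Q" "inv\<^bsub>Q\<^esub> d \<otimes>\<^bsub>Q\<^esub> d = \<one>\<^bsub>Q\<^esub>"
    using d0 d assms(4) EC Q.field_Units by auto
  have dsC: "set ds \<subseteq> carrier Q" using ds assms(4) EC by blast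
  have ev0: "Q.eval ?p x = \<zero>\<^bsub>Q\<^esub>" using Q.eval_normalize[OF csC assms(2)] cs(3) by simp
  let ?q = "map ((\<otimes>\<^bsub>Q\<^esub>) (inv\<^bsub>Q\<^esub> d)) ?p"
  have evm: "Q.eval (map ((\<otimes>\<^bsub>Q\<^esub>) (inv\<^bsub>Q\<^esub> d)) r) x = inv\<^bsub>Q\<^esub> d \<otimes>\<^bsub>Q\<^esub> Q.eval r x" if "set r \<subseteq> carrier Q" for r
    using that
  proof (induction r)
    case Nil
    then show ?case using dC by simp
  next
    case (Cons c r)
    then show ?case using dC assms(2) Q.eval_in_carrier[of r x] by (simp add: Q.r_distr Q.m_assoc)
  qed
  have "set ?p \<subseteq> carrier Q" using p dC dsC by simp
  then have "Q.eval ?q x = \<zero>\<^bsub>Q\<^esub>" using evm[of ?p] ev0 dC by simp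
  moreover have "polynomial\<^bsub>Q\<^esub> E ?q" "?q \<noteq> []" "hd ?q = \<one>\<^bsub>Q\<^esub>"
  proof -
    have "inv\<^bsub>Q\<^esub> d \<in> E" using inv[OF d d0] assms(4) by blast
    then have "inv\<^bsub>Q\<^esub> d \<otimes>\<^bsub>Q\<^esub> y \<in> E" if "y \<in> set ?p" for y
      using subringE(6)[OF assms(3)] that pD assms(4) by blast
    then have "set ?q \<subseteq> E" by auto
    then show "polynomial\<^bsub>Q\<^esub> E ?q" "?q \<noteq> []" "hd ?q = \<one>\<^bsub>Q\<^esub>"
      unfolding p polynomial_def using dC by simp_all
  qed
  ultimately show ?thesis unfolding integral_over_def by blast
qed

lemma list_in_image: "set cs \<subseteq> f ` D \<Longrightarrow> \<exists>ds. set ds \<subseteq> D \<and> cs = map f ds"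
proof (induction cs)
  case (Cons c cs)
  then obtain ds d where "set ds \<subseteq> D" "cs = map f ds" "d \<in> D" "c = f d" by auto
  then show ?case by (intro exI[of _ "d # ds"]) simp
qed simp

context domain
begin

lemma quotient_embed_ring_hom: "ring_hom_ring R (quotient_field R) (quotient_embed R)"
  by (rule ring_hom_ringI2[OF ring_axioms cring.axioms(1)[OF quotient_field_cring] quotient_embed_hom])

lemma quotient_embed_eq_zero_iff:
  "x \<in> carrier R \<Longrightarrow> quotient_embed R x = \<zero>\<^bsub>quotient_field R\<^esub> \<longleftrightarrow> x = \<zero>"
proof -
  interpret e: ring_hom_ring R "quotient_field R" "quotient_embed R" by (rule quotient_embed_ring_hom)
  assume x: "x \<in> carrier R"
  show ?thesis
    using inj_onD[OF quotient_embed_inj, of x \<zero>] x e.hom_zero by auto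
qed

text \<open>In the quotient field, Y i = (b / c)^i Y 0. With n the length of \<open>ts\<close>, the
  n + 1 elements Y 0, ..., Y n lie in a module with n generators. A dependence between them is a
  polynomial of degree at most n in b / c times the nonzero Y 0.\<close>

lemma alg_over_fraction:
  assumes D: "subring D R" and b: "b \<in> carrier R" and c: "c \<in> carrier R" "c \<noteq> \<zero>"
    and ts: "set ts \<subseteq> carrier R"
    and Y: "\<And>i. i \<le> length ts \<Longrightarrow> Y i \<in> dspan R D ts"
    and bY: "\<And>i. i \<le> length ts \<Longrightarrow> b [^] i \<otimes> Y 0 = c [^] i \<otimes> Y i" and Y0: "Y (0::nat) \<noteq> \<zero>"
  shows "alg_over (quotient_field R) (quotient_embed R ` D) (fraction R b c)"
proof -
  let ?Q = "quotient_field R" and ?e = "quotient_embed R"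
  interpret Q: field ?Q by (rule quotient_field_field)
  interpret e: ring_hom_ring R ?Q ?e by (rule quotient_embed_ring_hom)
  note DC = subringE(1)[OF D]
  have YC: "Y i \<in> carrier R" if "i \<le> length ts" for i using dspan_closed[OF DC ts Y[OF that]] .
  let ?x = "fraction R b c"
  have xQ: "?x \<in> carrier ?Q" using b c by (intro fraction_in) auto
  have xc: "?x \<otimes>\<^bsub>?Q\<^esub> ?e c = ?e b"
    using b c by (simp add: quotient_embed_def fraction_mult fraction_eq_iff m_comm integral_iff)
  have ec: "?e c \<in> carrier ?Q" "?e c \<noteq> \<zero>\<^bsub>?Q\<^esub>" using c quotient_embed_eq_zero_iff by auto
  have eY: "?e (Y i) = ?x [^]\<^bsub>?Q\<^esub> i \<otimes>\<^bsub>?Q\<^esub> ?e (Y 0)" if i: "i \<le> length ts" for i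
  proof -
    have "?e c [^]\<^bsub>?Q\<^esub> j \<noteq> \<zero>\<^bsub>?Q\<^esub>" for j :: nat
      using ec by (induction j) (simp_all add: Q.integral_iff)
    then have ci: "?e c [^]\<^bsub>?Q\<^esub> i \<in> carrier ?Q" "?e c [^]\<^bsub>?Q\<^esub> i \<noteq> \<zero>\<^bsub>?Q\<^esub>"
      using ec by simp_all
    have "?e c [^]\<^bsub>?Q\<^esub> i \<otimes>\<^bsub>?Q\<^esub> ?e (Y i) = ?e (c [^] i \<otimes> Y i)"
      using c YC[OF i] by (simp add: e.hom_nat_pow)
    also have "\<dots> = ?e b [^]\<^bsub>?Q\<^esub> i \<otimes>\<^bsub>?Q\<^esub> ?e (Y 0)"
      using b YC[of 0] by (simp add: bY[OF i, symmetric] e.hom_nat_pow)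
    also have "\<dots> = ?e c [^]\<^bsub>?Q\<^esub> i \<otimes>\<^bsub>?Q\<^esub> (?x [^]\<^bsub>?Q\<^esub> i \<otimes>\<^bsub>?Q\<^esub> ?e (Y 0))"
      using xQ ec YC[of 0] by (simp add: xc[symmetric] Q.nat_pow_distrib Q.m_ac)
    finally show ?thesis using Q.m_lcancel[OF ci(2,1)] xQ YC[of 0] YC[OF i] by simp
  qed
  let ?vs = "map Y (rev [0..<Suc (length ts)])"
  have "no_zero_div R D" unfolding no_zero_div_def using integral DC by (auto simp: subset_iff)
  moreover have "set ?vs \<subseteq> dspan R D ts" using Y by auto
  ultimately have "\<exists>cs. length cs = length ?vs \<and> set cs \<subseteq> D \<and> \<not> set cs \<subseteq> {\<zero>} \<and> combine cs ?vs = \<zero>"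
    by (intro dspan_dependent[OF D _ one_not_zero ts]) auto
  then obtain cs where cs: "length cs = length ?vs" "set cs \<subseteq> D" "\<not> set cs \<subseteq> {\<zero>}" "combine cs ?vs = \<zero>"
    by blast
  have csC: "set cs \<subseteq> carrier R" using cs(2) DC by blast
  have hc: "?e (combine us ws) = Q.combine (map ?e us) (map ?e ws)"
    if "set us \<subseteq> carrier R" "set ws \<subseteq> carrier R" for us ws
    using that by (induction us ws rule: combine.induct) auto
  have vsC: "set ?vs \<subseteq> carrier R" using YC by auto
  have mv: "map ?e ?vs = map (\<lambda>i. ?x [^]\<^bsub>?Q\<^esub> i \<otimes>\<^bsub>?Q\<^esub> ?e (Y 0)) (rev [0..<Suc (length ts)])"
    unfolding map_map
  proof (rule map_cong[OF refl])
    fix i assume "i \<in> set (rev [0..<Suc (length ts)])"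
    then have "i \<le> length ts" by auto
    then show "(?e \<circ> Y) i = ?x [^]\<^bsub>?Q\<^esub> i \<otimes>\<^bsub>?Q\<^esub> ?e (Y 0)" using eY[of i] unfolding comp_def by blast
  qed
  have len: "length (map ?e cs) = Suc (length ts)" using cs(1) by simp
  have "Q.combine (map ?e cs) (map ?e ?vs) = \<zero>\<^bsub>?Q\<^esub>"
    unfolding hc[OF csC vsC, symmetric] cs(4) by (rule e.hom_zero)
  then have "Q.combine (map ?e cs) (map (\<lambda>i. ?x [^]\<^bsub>?Q\<^esub> i \<otimes>\<^bsub>?Q\<^esub> ?e (Y 0)) (rev [0..<length (map ?e cs)])) = \<zero>\<^bsub>?Q\<^esub>"
    unfolding mv len .
  moreover have "set (map ?e cs) \<subseteq> carrier ?Q" using csC by auto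
  ultimately have "Q.eval (map ?e cs) ?x \<otimes>\<^bsub>?Q\<^esub> ?e (Y 0) = \<zero>\<^bsub>?Q\<^esub>"
    using Q.combine_powers[OF xQ _ \<open>set (map ?e cs) \<subseteq> carrier ?Q\<close>, of "?e (Y 0)"] YC[of 0] by simp
  moreover have "?e (Y 0) \<noteq> \<zero>\<^bsub>?Q\<^esub>" "?e (Y 0) \<in> carrier ?Q"
    using Y0 YC[of 0] quotient_embed_eq_zero_iff by auto
  ultimately have "Q.eval (map ?e cs) ?x = \<zero>\<^bsub>?Q\<^esub>"
    using Q.integral Q.eval_in_carrier[OF \<open>set (map ?e cs) \<subseteq> carrier ?Q\<close> xQ] by blast
  moreover have "set (map ?e cs) \<subseteq> ?e ` D" using cs(2) by auto
  moreover have "\<not> set (map ?e cs) \<subseteq> {\<zero>\<^bsub>?Q\<^esub>}"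
  proof
    assume z: "set (map ?e cs) \<subseteq> {\<zero>\<^bsub>?Q\<^esub>}"
    have "c \<in> {\<zero>}" if "c \<in> set cs" for c
      using z that csC quotient_embed_eq_zero_iff[of c] by auto
    then show False using cs(3) by blast
  qed
  ultimately show ?thesis unfolding alg_over_def by blast
qed

text \<open>The one place where integral closedness is exploited beyond being a domain: inverses in
  \<open>D\<close> turn algebraic into integral, so b / c lies in R, and injectivity of the
  embedding brings its equation over \<open>D\<close> back to R.\<close>

lemma alg_over_integrally_closed:
  assumes ic: "integrally_closed_domain R" and D: "subring D R"
    and inv: "\<And>d. d \<in> D \<Longrightarrow> d \<noteq> \<zero> \<Longrightarrow> \<exists>d'\<in>D. d' \<otimes> d = \<one>"
    and b: "b \<in> carrier R" and c: "c \<in> carrier R" "c \<noteq> \<zero>"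
    and alg: "alg_over (quotient_field R) (quotient_embed R ` D) (fraction R b c)"
  shows "\<exists>l\<in>carrier R. alg_over R D l \<and> b = c \<otimes> l"
proof -
  let ?Q = "quotient_field R" and ?e = "quotient_embed R"
  interpret Q: field ?Q by (rule quotient_field_field)
  interpret e: ring_hom_ring R ?Q ?e by (rule quotient_embed_ring_hom)
  note DC = subringE(1)[OF D]
  let ?x = "fraction R b c"
  have xQ: "?x \<in> carrier ?Q" using b c by (intro fraction_in) auto
  have "integral_over ?Q (?e ` carrier R) ?x"
  proof (rule alg_over_integral_over[OF quotient_field_field xQ _ _ _ alg])
    show "subring (?e ` carrier R) ?Q" by (rule e.img_is_subring[OF carrier_is_subring])
    show "?e ` D \<subseteq> ?e ` carrier R" using DC by blast
    fix d assume d: "d \<in> ?e ` D" "d \<noteq> \<zero>\<^bsub>?Q\<^esub>"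
    obtain a where a: "a \<in> D" "d = ?e a" using d(1) by (rule imageE)
    have a0: "a \<noteq> \<zero>" using d(2) a(2) by fastforce
    obtain a' where a': "a' \<in> D" "a' \<otimes> a = \<one>" using inv[OF a(1) a0] by blast
    have aC: "a \<in> carrier R" "a' \<in> carrier R" using a(1) a'(1) DC by auto
    have "?e a' \<otimes>\<^bsub>?Q\<^esub> d = \<one>\<^bsub>?Q\<^esub>" using a(2) a'(2) aC e.hom_mult[of a' a] by simp
    then have "inv\<^bsub>?Q\<^esub> d = ?e a'" using aC a(2) by (intro Q.comm_inv_char) (auto simp: Q.m_comm)
    then show "inv\<^bsub>?Q\<^esub> d \<in> ?e ` D" using a'(1) by blast
  qed
  then obtain l where l: "l \<in> carrier R" "?x = ?e l"
    using ic xQ unfolding integrally_closed_domain_def by blast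
  have "b = c \<otimes> l" using l b c by (simp add: quotient_embed_def fraction_eq_iff m_comm)
  moreover have "alg_over R D l"
  proof -
    obtain es where es: "set es \<subseteq> ?e ` D" "\<not> set es \<subseteq> {\<zero>\<^bsub>?Q\<^esub>}" "Q.eval es ?x = \<zero>\<^bsub>?Q\<^esub>"
      using alg unfolding alg_over_def by blast
    obtain ds where ds: "set ds \<subseteq> D" "es = map ?e ds" using list_in_image[OF es(1)] by blast
    have dsC: "set ds \<subseteq> carrier R" using ds(1) DC by blast
    have "?e (eval ds l) = \<zero>\<^bsub>?Q\<^esub>" using e.eval_hom'[OF l(1) dsC] es(3) ds(2) l(2) by simp
    then have "eval ds l = \<zero>" using quotient_embed_eq_zero_iff[OF eval_in_carrier[OF dsC l(1)]] by simp
    moreover have "\<not> set ds \<subseteq> {\<zero>}" using es(2) ds(2) e.hom_zero by auto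
    ultimately show ?thesis unfolding alg_over_def using ds(1) by blast
  qed
  ultimately show ?thesis using l(1) by blast
qed

end

context tensor_pair
begin

lemma scalars_inv:
  assumes "d \<in> scalars K B" "d \<noteq> \<zero>\<^bsub>B\<^esub>"
  shows "\<exists>d'\<in>scalars K B. d' \<otimes>\<^bsub>B\<^esub> d = \<one>\<^bsub>B\<^esub>"
proof -
  obtain c where c: "c \<in> carrier K" "d = c \<odot>\<^bsub>B\<^esub> \<one>\<^bsub>B\<^esub>" using assms(1) by (auto simp: scalars_def)
  then have "c \<noteq> \<zero>\<^bsub>K\<^esub>" using assms(2) by auto
  then have i: "inv\<^bsub>K\<^esub> c \<in> carrier K" "inv\<^bsub>K\<^esub> c \<otimes>\<^bsub>K\<^esub> c = \<one>\<^bsub>K\<^esub>" using c K.field_Units by auto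
  have "(inv\<^bsub>K\<^esub> c \<odot>\<^bsub>B\<^esub> \<one>\<^bsub>B\<^esub>) \<otimes>\<^bsub>B\<^esub> d = \<one>\<^bsub>B\<^esub>"
    using i c by (simp add: smult_one_mult KB.smult_assoc1[symmetric])
  then show ?thesis using i by (auto simp: scalars_def)
qed

text \<open>Nonzero scalars are units. The algebra is arbitrary here because the lemma is also
  applied to the scalars of R, which may have zero divisors.\<close>

lemma scalars_no_zero_div: "no_zero_div B (scalars K B)"
  unfolding no_zero_div_def
proof (intro ballI impI)
  fix x y assume x: "x \<in> scalars K B" and y: "y \<in> scalars K B" and 0: "x \<otimes>\<^bsub>B\<^esub> y = \<zero>\<^bsub>B\<^esub>"
  note SC = subringE(1)[OF scalars_subring]
  show "x = \<zero>\<^bsub>B\<^esub> \<or> y = \<zero>\<^bsub>B\<^esub>"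
  proof (rule disjCI)
    assume "y \<noteq> \<zero>\<^bsub>B\<^esub>"
    then obtain y' where y': "y' \<in> scalars K B" "y' \<otimes>\<^bsub>B\<^esub> y = \<one>\<^bsub>B\<^esub>" using scalars_inv[OF y] by blast
    have c: "x \<in> carrier B" "y \<in> carrier B" "y' \<in> carrier B" using x y y' SC by auto
    have "x = x \<otimes>\<^bsub>B\<^esub> (y' \<otimes>\<^bsub>B\<^esub> y)" using c y' by simp
    also have "\<dots> = y' \<otimes>\<^bsub>B\<^esub> (x \<otimes>\<^bsub>B\<^esub> y)" using c by (simp add: B.m_ac)
    finally show "x = \<zero>\<^bsub>B\<^esub>" using 0 c by simp
  qed
qed

end

context tensor_tower
begin

text \<open>Iterating the relation gives (b \<otimes> c)^i u = (c \<otimes> b)^i u. Multiplied by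
  c^(n - i) in the first copy of \<open>B\<close> and sliced into the second, this reads b^i Y 0 =
  c^i Y i, where all Y i lie in the k-span of the second components of \<open>u\<close>.\<close>

lemma swap_diff_algebraic:
  assumes ic: "integrally_closed_domain B" and b: "b \<in> carrier B" and c: "c \<in> carrier B" "c \<noteq> \<zero>\<^bsub>B\<^esub>"
    and u: "u \<in> carrier S" "u \<noteq> \<zero>\<^bsub>S\<^esub>" and 0: "u \<otimes>\<^bsub>S\<^esub> swap_diff b c = \<zero>\<^bsub>S\<^esub>"
  shows "\<exists>l\<in>alg_closure_in K B. b = c \<otimes>\<^bsub>B\<^esub> l"
proof -
  have dom: "domain B" using ic by (simp add: integrally_closed_domain_def)
  interpret B': domain B by fact
  obtain ps where ps: "set ps \<subseteq> carrier R \<times> carrier B" "u = bsum S (tens K R B) ps"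
    using T.tens_rep[OF u(1)] by blast
  define ts where "ts = map snd ps"
  define n where "n = length ts"
  have ts: "set ts \<subseteq> carrier B" using ps(1) by (auto simp: ts_def)
  let ?b1 = "T.emb1 (emb2 b)" and ?c1 = "T.emb1 (emb2 c)" and ?b2 = "T.emb2 b" and ?c2 = "T.emb2 c"
  have cl: "?b1 \<in> carrier S" "?c1 \<in> carrier S" "?b2 \<in> carrier S" "?c2 \<in> carrier S" using b c by auto
  have "u \<otimes>\<^bsub>S\<^esub> (?b1 \<otimes>\<^bsub>S\<^esub> ?c2) \<ominus>\<^bsub>S\<^esub> u \<otimes>\<^bsub>S\<^esub> (?c1 \<otimes>\<^bsub>S\<^esub> ?b2) = \<zero>\<^bsub>S\<^esub>"
    using 0 u(1) cl by (simp add: swap_diff_def T.R.minus_eq T.R.r_distr T.R.r_minus)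
  then have ue: "(?b1 \<otimes>\<^bsub>S\<^esub> ?c2) \<otimes>\<^bsub>S\<^esub> u = (?c1 \<otimes>\<^bsub>S\<^esub> ?b2) \<otimes>\<^bsub>S\<^esub> u"
    using u(1) cl by (simp add: T.R.m_comm)
  have upow: "(?b1 \<otimes>\<^bsub>S\<^esub> ?c2) [^]\<^bsub>S\<^esub> (i::nat) \<otimes>\<^bsub>S\<^esub> u = (?c1 \<otimes>\<^bsub>S\<^esub> ?b2) [^]\<^bsub>S\<^esub> i \<otimes>\<^bsub>S\<^esub> u" for i
  proof (induction i)
    case (Suc i)
    have "(?b1 \<otimes>\<^bsub>S\<^esub> ?c2) [^]\<^bsub>S\<^esub> Suc i \<otimes>\<^bsub>S\<^esub> u = (?b1 \<otimes>\<^bsub>S\<^esub> ?c2) \<otimes>\<^bsub>S\<^esub> ((?b1 \<otimes>\<^bsub>S\<^esub> ?c2) [^]\<^bsub>S\<^esub> i \<otimes>\<^bsub>S\<^esub> u)"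
      using cl u(1) by (simp add: T.R.m_ac)
    also have "\<dots> = (?c1 \<otimes>\<^bsub>S\<^esub> ?b2) [^]\<^bsub>S\<^esub> i \<otimes>\<^bsub>S\<^esub> ((?b1 \<otimes>\<^bsub>S\<^esub> ?c2) \<otimes>\<^bsub>S\<^esub> u)"
      unfolding Suc using cl u(1) by (intro T.R.m_lcomm) auto
    also have "\<dots> = (?c1 \<otimes>\<^bsub>S\<^esub> ?b2) [^]\<^bsub>S\<^esub> Suc i \<otimes>\<^bsub>S\<^esub> u"
      unfolding ue using cl u(1) by (simp add: T.R.m_assoc)
    finally show ?case .
  qed simp
  have E1pow: "T.emb1 (r [^]\<^bsub>R\<^esub> (i::nat)) = T.emb1 r [^]\<^bsub>S\<^esub> i" if "r \<in> carrier R" for r i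
    using that by (induction i) (simp_all add: ring_hom_one[OF T.emb1_hom] ring_hom_mult[OF T.emb1_hom])
  have j2pow: "T.emb2 (x [^]\<^bsub>B\<^esub> (i::nat)) = T.emb2 x [^]\<^bsub>S\<^esub> i" if "x \<in> carrier B" for x i
    using that by (induction i) (simp_all add: ring_hom_one[OF T.emb2_hom] ring_hom_mult[OF T.emb2_hom])
  \<comment> \<open>The complementary power of \<open>c\<close> makes every r i homogeneous of
    degree n, so that the single element r 0 = c^n stands next to b^i for all i up to n.\<close>
  define r where "r i = emb2 b [^]\<^bsub>R\<^esub> i \<otimes>\<^bsub>R\<^esub> emb2 c [^]\<^bsub>R\<^esub> (n - i)" for i :: nat
  have rC: "r i \<in> carrier R" for i using b c by (simp add: r_def)
  have r: "T.emb1 (r i) = ?b1 [^]\<^bsub>S\<^esub> i \<otimes>\<^bsub>S\<^esub> ?c1 [^]\<^bsub>S\<^esub> (n - i)" for i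
    using b c by (simp add: r_def ring_hom_mult[OF T.emb1_hom] E1pow)
  have key: "T.emb2 (b [^]\<^bsub>B\<^esub> i) \<otimes>\<^bsub>S\<^esub> (T.emb1 (r 0) \<otimes>\<^bsub>S\<^esub> u) = T.emb2 (c [^]\<^bsub>B\<^esub> i) \<otimes>\<^bsub>S\<^esub> (T.emb1 (r i) \<otimes>\<^bsub>S\<^esub> u)"
    if i: "i \<le> n" for i
  proof -
    have "?c1 [^]\<^bsub>S\<^esub> i \<otimes>\<^bsub>S\<^esub> ?c1 [^]\<^bsub>S\<^esub> (n - i) = ?c1 [^]\<^bsub>S\<^esub> n"
      using i cl by (simp add: T.R.nat_pow_mult)
    then have "T.emb2 (b [^]\<^bsub>B\<^esub> i) \<otimes>\<^bsub>S\<^esub> (T.emb1 (r 0) \<otimes>\<^bsub>S\<^esub> u)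
        = ?b2 [^]\<^bsub>S\<^esub> i \<otimes>\<^bsub>S\<^esub> ((?c1 [^]\<^bsub>S\<^esub> i \<otimes>\<^bsub>S\<^esub> ?c1 [^]\<^bsub>S\<^esub> (n - i)) \<otimes>\<^bsub>S\<^esub> u)"
      using b cl u(1) by (simp add: r j2pow)
    also have "\<dots> = ?c1 [^]\<^bsub>S\<^esub> (n - i) \<otimes>\<^bsub>S\<^esub> ((?c1 \<otimes>\<^bsub>S\<^esub> ?b2) [^]\<^bsub>S\<^esub> i \<otimes>\<^bsub>S\<^esub> u)"
      using cl u(1) by (simp add: T.R.nat_pow_distrib T.R.m_ac)
    also have "\<dots> = ?c1 [^]\<^bsub>S\<^esub> (n - i) \<otimes>\<^bsub>S\<^esub> ((?b1 \<otimes>\<^bsub>S\<^esub> ?c2) [^]\<^bsub>S\<^esub> i \<otimes>\<^bsub>S\<^esub> u)"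
      by (simp only: upow)
    also have "\<dots> = T.emb2 (c [^]\<^bsub>B\<^esub> i) \<otimes>\<^bsub>S\<^esub> (T.emb1 (r i) \<otimes>\<^bsub>S\<^esub> u)"
      using cl u(1) c by (simp add: r j2pow T.R.nat_pow_distrib T.R.m_ac)
    finally show ?thesis .
  qed
  \<comment> \<open>As a power of the image of a nonzero element of \<open>B\<close>, r 0 is
    regular; so r 0 times \<open>u\<close> is nonzero, and some slice of it is nonzero.\<close>
  have "r 0 = emb2 c [^]\<^bsub>R\<^esub> n" using b c by (simp add: r_def)
  moreover have "nonzerodiv R (emb2 c [^]\<^bsub>R\<^esub> (k::nat))" for k
  proof (induction k)
    case 0
    then show ?case by (simp add: nonzerodiv_def)
  next
    case (Suc k)
    then show ?case using R.nonzerodiv_mult[OF Suc emb2_nonzerodiv[OF dom c]] by simp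
  qed
  ultimately have "nonzerodiv S (T.emb1 (r 0))" using T_emb1_nonzerodiv by simp
  from nonzerodivD(2)[OF this u(1)] have "T.emb1 (r 0) \<otimes>\<^bsub>S\<^esub> u \<noteq> \<zero>\<^bsub>S\<^esub>" using u(2) by argo
  then obtain \<rho> where \<rho>: "functional K R \<rho>" "T.slice1 \<rho> (T.emb1 (r 0) \<otimes>\<^bsub>S\<^esub> u) \<noteq> \<zero>\<^bsub>B\<^esub>"
    using T.slice1_separates[of "T.emb1 (r 0) \<otimes>\<^bsub>S\<^esub> u"] rC u(1) by auto
  define Y where "Y i = T.slice1 \<rho> (T.emb1 (r i) \<otimes>\<^bsub>S\<^esub> u)" for i
  have "Y i \<in> dspan B (scalars K B) ts" for i
    unfolding Y_def ps(2) ts_def by (rule T.slice1_dspan[OF \<rho>(1) rC ps(1)])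
  moreover have "b [^]\<^bsub>B\<^esub> i \<otimes>\<^bsub>B\<^esub> Y 0 = c [^]\<^bsub>B\<^esub> i \<otimes>\<^bsub>B\<^esub> Y i" if "i \<le> length ts" for i
  proof -
    have "T.slice1 \<rho> (T.emb2 (b [^]\<^bsub>B\<^esub> i) \<otimes>\<^bsub>S\<^esub> (T.emb1 (r 0) \<otimes>\<^bsub>S\<^esub> u))
        = T.slice1 \<rho> (T.emb2 (c [^]\<^bsub>B\<^esub> i) \<otimes>\<^bsub>S\<^esub> (T.emb1 (r i) \<otimes>\<^bsub>S\<^esub> u))"
      using key that by (simp add: n_def)
    then show ?thesis using T.slice1_emb2[OF \<rho>(1)] rC u(1) b c by (simp add: Y_def)
  qed
  moreover have "Y 0 \<noteq> \<zero>\<^bsub>B\<^esub>" using \<rho>(2) by (simp add: Y_def)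
  ultimately have "alg_over (quotient_field B) (quotient_embed B ` scalars K B) (fraction B b c)"
    by (intro B'.alg_over_fraction[OF scalars_subring b c ts]) auto
  then show ?thesis
    using B'.alg_over_integrally_closed[OF ic scalars_subring scalars_inv b c]
    unfolding alg_closure_in_def by blast
qed

text \<open>\<open>W\<close> is defined by linearity alone. With \<phi> 1 = 1, an element of
  \<open>W\<close> equals its own \<open>mid_slice\<close>, hence is a sum of elements 1 \<otimes> b
  \<otimes> b', for which the claim is immediate.\<close>

lemma slice2_W:
  assumes \<omega>: "\<omega> \<in> W" and \<psi>: "functional K B \<psi>" and one: "\<one>\<^bsub>A\<^esub> \<noteq> \<zero>\<^bsub>A\<^esub>"
  shows "\<exists>b\<in>carrier B. T.slice2 \<psi> \<omega> = emb2 b"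
proof -
  have "subspace K A {\<zero>\<^bsub>A\<^esub>}" using KA.kspan_subspace[of "[]"] by simp
  then obtain \<phi> where \<phi>: "functional K A \<phi>" "\<phi> \<one>\<^bsub>A\<^esub> = \<one>\<^bsub>K\<^esub>"
    using KA.functional_exists[OF K.field_axioms, of "{\<zero>\<^bsub>A\<^esub>}" "\<one>\<^bsub>A\<^esub>"] one by auto
  have \<omega>S: "\<omega> \<in> carrier S" using W_closed[OF \<omega>] .
  have "mid_slice \<phi> \<omega> = \<omega>"
    using mid_slice_emb1[OF \<phi>(1) A.one_closed \<omega>] \<omega>S \<phi>(2)
    by (simp add: ring_hom_one[OF emb1_hom] ring_hom_one[OF T.emb1_hom])
  moreover have "\<exists>b\<in>carrier B. T.slice2 \<psi> (mid_slice \<phi> x) = emb2 b" if "x \<in> carrier S" for x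
    using that
  proof (induction rule: T.tens_induct)
    case (tens r b)
    let ?\<beta> = "slice1 \<phi> r"
    have \<beta>: "?\<beta> \<in> carrier B" using slice1(1)[OF \<phi>(1)] tens by blast
    have p: "\<psi> b \<in> carrier K" using functionalD(1)[OF \<psi>] tens by blast
    have "T.slice2 \<psi> (mid_slice \<phi> (tens K R B r b)) = T.slice2 \<psi> (tens K R B (emb2 ?\<beta>) b)"
      by (simp only: mid_slice(3)[OF \<phi>(1) tens] T.tens_eq[OF emb2_closed[OF \<beta>] tens(2)])
    also have "\<dots> = emb2 (\<psi> b \<odot>\<^bsub>B\<^esub> ?\<beta>)"
      using tens \<beta> p by (simp add: T.slice2(3)[OF \<psi>] emb2_smult)
    finally show ?case using \<beta> p by (intro bexI[of _ "\<psi> b \<odot>\<^bsub>B\<^esub> ?\<beta>"]) auto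
  next
    case (add x y)
    then obtain a b where ab: "a \<in> carrier B" "b \<in> carrier B"
      "T.slice2 \<psi> (mid_slice \<phi> x) = emb2 a" "T.slice2 \<psi> (mid_slice \<phi> y) = emb2 b" by blast
    have "T.slice2 \<psi> (mid_slice \<phi> (x \<oplus>\<^bsub>S\<^esub> y)) = emb2 (a \<oplus>\<^bsub>B\<^esub> b)"
      using add(1,2) ab by (simp add: mid_slice[OF \<phi>(1)] T.slice2(2)[OF \<psi>] ring_hom_add[OF emb2_hom])
    then show ?case using ab by (intro bexI[of _ "a \<oplus>\<^bsub>B\<^esub> b"]) auto
  qed
  ultimately show ?thesis using \<omega>S by metis
qed

end

text \<open>A form of algebraicity, with a common denominator \<open>d\<close>, that passes to sums and products.\<close>

definition fin_over :: "('r, 'm) ring_scheme \<Rightarrow> 'r set \<Rightarrow> 'r \<Rightarrow> bool" where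
  "fin_over R D x \<longleftrightarrow> (\<exists>fs d. set fs \<subseteq> carrier R \<and> \<one>\<^bsub>R\<^esub> \<in> dspan R D fs \<and> d \<in> D \<and> d \<noteq> \<zero>\<^bsub>R\<^esub> \<and>
     (\<forall>f\<in>set fs. d \<otimes>\<^bsub>R\<^esub> x \<otimes>\<^bsub>R\<^esub> f \<in> dspan R D fs))"

section \<open>Sums and products of algebraic elements\<close>

context cring
begin

text \<open>Serves as an induction principle for spans, with V the set of elements that have the
  desired property.\<close>

lemma dspan_least:
  assumes "\<zero> \<in> V" "\<And>x y. x \<in> V \<Longrightarrow> y \<in> V \<Longrightarrow> x \<oplus> y \<in> V"
    "\<And>d f. d \<in> D \<Longrightarrow> f \<in> set fs \<Longrightarrow> d \<otimes> f \<in> V"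
  shows "dspan R D fs \<subseteq> V"
  using assms(3) by (induction fs) (auto simp: assms(1) intro!: assms(2))

text \<open>g is the last nonzero coefficient and e the number of zeros behind it. The lowest
  coefficient is wanted rather than the leading one because modulo a prime that contains x the
  factor g + x h reduces to g.\<close>

lemma eval_bottom:
  assumes D: "subring D R" and x: "x \<in> carrier R" and "set cs \<subseteq> D" "\<not> set cs \<subseteq> {\<zero>}"
  shows "\<exists>e g h. g \<in> D \<and> g \<noteq> \<zero> \<and> h \<in> carrier R \<and> eval cs x = x [^] (e::nat) \<otimes> (g \<oplus> x \<otimes> h)"
  using assms(3,4)
proof (induction cs rule: rev_induct)
  case (snoc c cs)
  note DC = subringE(1)[OF D]
  have c: "c \<in> D" "c \<in> carrier R" and cs: "set cs \<subseteq> D" "set cs \<subseteq> carrier R" using snoc.prems DC by auto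
  have ev: "eval (cs @ [c]) x = eval cs x \<otimes> x \<oplus> c" using eval_append_aux[OF cs(2) c(2) x] .
  have evC: "eval cs x \<in> carrier R" using eval_in_carrier[OF cs(2) x] .
  show ?case
  proof (cases "c = \<zero>")
    case False
    have "eval (cs @ [c]) x = x [^] (0::nat) \<otimes> (c \<oplus> x \<otimes> eval cs x)"
      using ev evC x c by (simp add: a_comm m_comm)
    then show ?thesis using False c(1) evC by blast
  next
    case True
    then obtain e g h where g: "g \<in> D" "g \<noteq> \<zero>" "h \<in> carrier R" "eval cs x = x [^] (e::nat) \<otimes> (g \<oplus> x \<otimes> h)"
      using snoc.IH[OF cs(1)] snoc.prems by auto
    have "eval (cs @ [c]) x = x [^] (Suc e) \<otimes> (g \<oplus> x \<otimes> h)"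
      using ev True evC x g DC by (simp add: m_ac subset_iff)
    then show ?thesis using g(1-3) by blast
  qed
qed simp

lemma eval_dspan:
  assumes D: "subring D R" and x: "x \<in> carrier R" and "set cs \<subseteq> D" "length cs \<le> n"
  shows "eval cs x \<in> dspan R D (map (\<lambda>i. x [^] i) (rev [0..<n]))"
  using assms(3,4)
proof (induction cs)
  case Nil
  have "set (map (\<lambda>i. x [^] i) (rev [0..<n])) \<subseteq> carrier R" using x by auto
  from dspan_zero[OF D this] show ?case by simp
next
  case (Cons c cs)
  let ?fs = "map (\<lambda>i. x [^] i) (rev [0..<n])"
  have fs: "set ?fs \<subseteq> carrier R" using x by auto
  have "x [^] length cs \<in> set ?fs" using Cons.prems by auto
  then have "c \<otimes> x [^] length cs \<in> dspan R D ?fs"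
    using dspan_mult[OF D fs] dspan_mem[OF D fs] Cons.prems by simp
  then show ?case using dspan_add[OF D fs] Cons by simp
qed

text \<open>The generators are the powers of \<open>x\<close> below the degree of an equation, and
  the denominator is its leading coefficient.\<close>

lemma alg_over_fin_over:
  assumes D: "subring D R" and x: "x \<in> carrier R" and alg: "alg_over R D x"
  shows "fin_over R D x"
proof -
  note DC = subringE(1)[OF D]
  obtain cs where cs: "set cs \<subseteq> D" "\<not> set cs \<subseteq> {\<zero>}" "eval cs x = \<zero>"
    using alg unfolding alg_over_def by blast
  have csC: "set cs \<subseteq> carrier R" using cs(1) DC by blast
  let ?p = "normalize cs"
  have pD: "set ?p \<subseteq> D" using cs(1) by (induction cs) auto
  have "?p \<noteq> []" using cs(2) by (induction cs) (auto split: if_splits)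
  moreover have pol: "polynomial D ?p" using normalize_gives_polynomial[OF cs(1)] .
  ultimately obtain d ds where p: "?p = d # ds" and d0: "d \<noteq> \<zero>" by (cases ?p) (auto simp: polynomial_def)
  have d: "d \<in> D" "d \<in> carrier R" and ds: "set ds \<subseteq> D" "set ds \<subseteq> carrier R" using pD p DC by auto
  have "eval ?p x = \<zero>" using eval_normalize[OF csC x] cs(3) by simp
  then have ev: "d \<otimes> x [^] length ds \<oplus> eval ds x = \<zero>" by (simp add: p)
  let ?n = "length ds"
  let ?fs = "map (\<lambda>i. x [^] i) (rev [0..<?n])"
  have fs: "set ?fs \<subseteq> carrier R" using x by auto
  have evC: "eval ds x \<in> carrier R" using eval_in_carrier[OF ds(2) x] .
  have top: "d \<otimes> x [^] ?n \<in> dspan R D ?fs"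
  proof -
    have "d \<otimes> x [^] ?n = \<ominus> eval ds x" using ev d x evC minus_equality by simp
    then show ?thesis using dspan_minus[OF D fs eval_dspan[OF D x ds(1) order_refl]] by simp
  qed
  have n0: "?n \<noteq> 0"
  proof
    assume n: "?n = 0"
    then have "d = \<zero>" using ev d by simp
    then show False using d0 by simp
  qed
  have "x [^] (0::nat) \<in> set ?fs" using n0 by (auto simp: image_iff intro!: bexI[of _ 0])
  then have "\<one> \<in> dspan R D ?fs" using dspan_mem[OF D fs] by simp
  moreover have "d \<otimes> x \<otimes> f \<in> dspan R D ?fs" if f: "f \<in> set ?fs" for f
  proof -
    obtain i where i: "i < ?n" "f = x [^] i" using f by auto
    have e: "d \<otimes> x \<otimes> f = d \<otimes> x [^] (Suc i)" using i d x by (simp add: m_ac)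
    show ?thesis
    proof (cases "Suc i = ?n")
      case True
      then show ?thesis unfolding e using top by simp
    next
      case False
      then have "Suc i \<in> set (rev [0..<?n])" using i(1) by simp
      then have "x [^] (Suc i) \<in> set ?fs" unfolding set_map by (rule imageI)
      then show ?thesis unfolding e using dspan_mult[OF D fs d(1)] dspan_mem[OF D fs] by blast
    qed
  qed
  ultimately show ?thesis unfolding fin_over_def using fs d(1) d0 by blast
qed

text \<open>The coefficient of x^i is multiplied by d^i, and a nonzero one stays nonzero because
  \<open>D\<close> has no zero divisors.\<close>

lemma eval_scale:
  assumes D: "subring D R" "no_zero_div R D" "\<one> \<noteq> \<zero>" and x: "x \<in> carrier R" and d: "d \<in> D" "d \<noteq> \<zero>"
    and "set cs \<subseteq> D"
  shows "\<exists>ds. length ds = length cs \<and> set ds \<subseteq> D \<and> (set ds \<subseteq> {\<zero>} \<longrightarrow> set cs \<subseteq> {\<zero>}) \<and>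
    eval ds x = eval cs (d \<otimes> x)"
  using assms(7)
proof (induction cs)
  case Nil
  show ?case by simp
next
  case (Cons c cs)
  note DC = subringE(1)[OF D(1)]
  obtain ds where ds: "length ds = length cs" "set ds \<subseteq> D" "set ds \<subseteq> {\<zero>} \<longrightarrow> set cs \<subseteq> {\<zero>}"
    "eval ds x = eval cs (d \<otimes> x)" using Cons by auto
  have dn: "d [^] (n::nat) \<in> D \<and> d [^] n \<noteq> \<zero>" for n
  proof (induction n)
    case (Suc n)
    then show ?case using d subringE(6)[OF D(1)] no_zero_divD[OF D(2), of "d [^] n" d] by auto
  qed (use D(3) subringE(3)[OF D(1)] in simp)
  have dC: "d \<in> carrier R" "c \<in> carrier R" using d Cons.prems DC by auto
  have "eval ((c \<otimes> d [^] length cs) # ds) x = eval (c # cs) (d \<otimes> x)"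
    using ds(1,4) dC x by (simp add: nat_pow_distrib m_assoc)
  moreover have "c = \<zero>" if "c \<otimes> d [^] length cs = \<zero>"
    using no_zero_divD[OF D(2), of "d [^] length cs" c] dn[of "length cs"] that Cons.prems dC
    by (simp add: m_comm)
  moreover have "c \<otimes> d [^] length cs \<in> D" using subringE(6)[OF D(1)] dn Cons.prems by simp
  ultimately show ?case using ds by (intro exI[of _ "(c \<otimes> d [^] length cs) # ds"]) auto
qed

text \<open>All powers of d x stay in the span, since 1 does. One more of them than there are
  generators must be dependent, so counting replaces a determinant; the equation for d x is then
  rewritten for \<open>x\<close>.\<close>

lemma fin_over_alg_over:
  assumes D: "subring D R" "no_zero_div R D" "\<one> \<noteq> \<zero>" and x: "x \<in> carrier R" and fin: "fin_over R D x"
  shows "alg_over R D x"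
proof -
  note DC = subringE(1)[OF D(1)]
  obtain fs d where fs: "set fs \<subseteq> carrier R" and one: "\<one> \<in> dspan R D fs" and d: "d \<in> D" "d \<noteq> \<zero>"
    and st: "\<And>f. f \<in> set fs \<Longrightarrow> d \<otimes> x \<otimes> f \<in> dspan R D fs"
    using fin unfolding fin_over_def by blast
  have dC: "d \<in> carrier R" using d DC by blast
  let ?V = "{m \<in> carrier R. d \<otimes> x \<otimes> m \<in> dspan R D fs}"
  have "dspan R D fs \<subseteq> ?V"
  proof (rule dspan_least)
    show "\<zero> \<in> ?V" using dC x dspan_zero[OF D(1) fs] by simp
    fix y z assume "y \<in> ?V" "z \<in> ?V"
    then show "y \<oplus> z \<in> ?V" using dC x dspan_add[OF D(1) fs] by (simp add: r_distr)
  next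
    fix c f assume c: "c \<in> D" and f: "f \<in> set fs"
    have cf: "c \<in> carrier R" "f \<in> carrier R" using c f DC fs by auto
    have "d \<otimes> x \<otimes> (c \<otimes> f) = c \<otimes> (d \<otimes> x \<otimes> f)" using dC x cf by (simp add: m_lcomm)
    then show "c \<otimes> f \<in> ?V" using dspan_mult[OF D(1) fs c st[OF f]] cf by simp
  qed
  then have st': "d \<otimes> x \<otimes> m \<in> dspan R D fs" if "m \<in> dspan R D fs" for m using that by blast
  have pw: "(d \<otimes> x) [^] (i::nat) \<in> dspan R D fs" for i
  proof (induction i)
    case (Suc i)
    have "(d \<otimes> x) [^] Suc i = d \<otimes> x \<otimes> (d \<otimes> x) [^] i" using dC x by (simp add: m_comm)
    then show ?case using st'[OF Suc] by simp
  qed (use one in simp)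
  let ?vs = "map (\<lambda>i. (d \<otimes> x) [^] i \<otimes> \<one>) (rev [0..<Suc (length fs)])"
  have "set ?vs \<subseteq> dspan R D fs" using pw dC x by auto
  then have "\<exists>cs. length cs = length ?vs \<and> set cs \<subseteq> D \<and> \<not> set cs \<subseteq> {\<zero>} \<and> combine cs ?vs = \<zero>"
    by (intro dspan_dependent[OF D fs]) auto
  then obtain cs where cs: "length cs = length ?vs" "set cs \<subseteq> D" "\<not> set cs \<subseteq> {\<zero>}" "combine cs ?vs = \<zero>"
    by blast
  have len: "Suc (length fs) = length cs" using cs(1) by simp
  have csC: "set cs \<subseteq> carrier R" using cs(2) DC by blast
  have "eval cs (d \<otimes> x) \<otimes> \<one> = \<zero>"
    using combine_powers[OF _ one_closed csC, of "d \<otimes> x"] cs(4) dC x unfolding len by simp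
  then have "eval cs (d \<otimes> x) = \<zero>" using eval_in_carrier[OF csC, of "d \<otimes> x"] dC x by simp
  then show ?thesis using eval_scale[OF D x d cs(2)] cs(3) unfolding alg_over_def by metis
qed

lemma dspan_products:
  assumes D: "subring D R" and fs: "set fs \<subseteq> carrier R" and fs': "set fs' \<subseteq> carrier R"
    and m: "m \<in> dspan R D fs" and m': "m' \<in> dspan R D fs'"
  shows "m \<otimes> m' \<in> dspan R D (concat (map (\<lambda>f. map (\<lambda>f'. f \<otimes> f') fs') fs))" (is "_ \<in> dspan R D ?fs")
proof -
  note DC = subringE(1)[OF D]
  have FS: "set ?fs \<subseteq> carrier R" using fs fs' by auto
  have "dspan R D fs' \<subseteq> {n \<in> carrier R. \<forall>f\<in>set fs. f \<otimes> n \<in> dspan R D ?fs}" (is "_ \<subseteq> ?V")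
  proof (rule dspan_least)
    show "\<zero> \<in> ?V" using dspan_zero[OF D FS] fs by auto
    fix y z assume "y \<in> ?V" "z \<in> ?V"
    then show "y \<oplus> z \<in> ?V" using dspan_add[OF D FS] fs by (auto simp: r_distr subset_iff)
  next
    fix c f' assume c: "c \<in> D" and f': "f' \<in> set fs'"
    have cf: "c \<in> carrier R" "f' \<in> carrier R" using c f' DC fs' by auto
    have "f \<otimes> (c \<otimes> f') \<in> dspan R D ?fs" if f: "f \<in> set fs" for f
    proof -
      have "f \<otimes> (c \<otimes> f') = c \<otimes> (f \<otimes> f')" using cf f fs by (intro m_lcomm) auto
      moreover have "f \<otimes> f' \<in> set ?fs" using f f' by auto
      ultimately show ?thesis using dspan_mult[OF D FS c dspan_mem[OF D FS]] by simp
    qed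
    then show "c \<otimes> f' \<in> ?V" using cf by simp
  qed
  then have m'V: "m' \<in> carrier R" "\<And>f. f \<in> set fs \<Longrightarrow> f \<otimes> m' \<in> dspan R D ?fs" using m' by auto
  have "dspan R D fs \<subseteq> {n \<in> carrier R. n \<otimes> m' \<in> dspan R D ?fs}" (is "_ \<subseteq> ?V")
  proof (rule dspan_least)
    show "\<zero> \<in> ?V" using dspan_zero[OF D FS] m'V by auto
    fix y z assume "y \<in> ?V" "z \<in> ?V"
    then show "y \<oplus> z \<in> ?V" using dspan_add[OF D FS] m'V by (simp add: l_distr)
  next
    fix c f assume c: "c \<in> D" and f: "f \<in> set fs"
    have cf: "c \<in> carrier R" "f \<in> carrier R" using c f DC fs by auto
    have "c \<otimes> f \<otimes> m' = c \<otimes> (f \<otimes> m')" using cf m'V by (simp add: m_assoc)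
    then show "c \<otimes> f \<in> ?V" using dspan_mult[OF D FS c m'V(2)[OF f]] cf by simp
  qed
  then show ?thesis using m by blast
qed

text \<open>The pairwise products of generators serve as generators, and the product of the two
  denominators as denominator.\<close>

lemma fin_over_add_mult:
  assumes D: "subring D R" "no_zero_div R D" and x: "x \<in> carrier R" "fin_over R D x"
    and y: "y \<in> carrier R" "fin_over R D y"
  shows "fin_over R D (x \<oplus> y)" "fin_over R D (x \<otimes> y)"
proof -
  note DC = subringE(1)[OF D(1)]
  obtain fs d where fs: "set fs \<subseteq> carrier R" and one: "\<one> \<in> dspan R D fs" and d: "d \<in> D" "d \<noteq> \<zero>"
    and st: "\<And>f. f \<in> set fs \<Longrightarrow> d \<otimes> x \<otimes> f \<in> dspan R D fs"
    using x(2) unfolding fin_over_def by blast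
  obtain fs' d' where fs': "set fs' \<subseteq> carrier R" and one': "\<one> \<in> dspan R D fs'" and d': "d' \<in> D" "d' \<noteq> \<zero>"
    and st': "\<And>f. f \<in> set fs' \<Longrightarrow> d' \<otimes> y \<otimes> f \<in> dspan R D fs'"
    using y(2) unfolding fin_over_def by blast
  let ?fs = "concat (map (\<lambda>f. map (\<lambda>f'. f \<otimes> f') fs') fs)"
  have FS: "set ?fs \<subseteq> carrier R" using fs fs' by auto
  note pr = dspan_products[OF D(1) fs fs']
  have 1: "\<one> \<in> dspan R D ?fs" using pr[OF one one'] by simp
  have dC: "d \<in> carrier R" "d' \<in> carrier R" using d d' DC by auto
  have dd: "d \<otimes> d' \<in> D" "d \<otimes> d' \<noteq> \<zero>"
    using subringE(6)[OF D(1) d(1) d'(1)] no_zero_divD[OF D(2) d(1) d'(1) _ d(2)] d'(2) by auto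
  have "d \<otimes> d' \<otimes> (x \<oplus> y) \<otimes> g \<in> dspan R D ?fs \<and> d \<otimes> d' \<otimes> (x \<otimes> y) \<otimes> g \<in> dspan R D ?fs"
    if g: "g \<in> set ?fs" for g
  proof -
    obtain f f' where f: "f \<in> set fs" "f' \<in> set fs'" "g = f \<otimes> f'" using g by auto
    have fC: "f \<in> carrier R" "f' \<in> carrier R" using f fs fs' by auto
    have "d \<otimes> d' \<otimes> (x \<oplus> y) \<otimes> g = (d \<otimes> x \<otimes> f) \<otimes> (d' \<otimes> f') \<oplus> (d \<otimes> f) \<otimes> (d' \<otimes> y \<otimes> f')"
      using dC x y fC by (simp add: f(3) l_distr r_distr m_ac)
    moreover have "(d \<otimes> x \<otimes> f) \<otimes> (d' \<otimes> f') \<in> dspan R D ?fs"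
      using pr[OF st[OF f(1)] dspan_mult[OF D(1) fs' d'(1) dspan_mem[OF D(1) fs' f(2)]]] .
    moreover have "(d \<otimes> f) \<otimes> (d' \<otimes> y \<otimes> f') \<in> dspan R D ?fs"
      using pr[OF dspan_mult[OF D(1) fs d(1) dspan_mem[OF D(1) fs f(1)]] st'[OF f(2)]] .
    moreover have "d \<otimes> d' \<otimes> (x \<otimes> y) \<otimes> g = (d \<otimes> x \<otimes> f) \<otimes> (d' \<otimes> y \<otimes> f')"
      using dC x y fC by (simp add: f(3) m_ac)
    moreover have "(d \<otimes> x \<otimes> f) \<otimes> (d' \<otimes> y \<otimes> f') \<in> dspan R D ?fs"
      using pr[OF st[OF f(1)] st'[OF f(2)]] .
    ultimately show ?thesis using dspan_add[OF D(1) FS] by simp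
  qed
  then show "fin_over R D (x \<oplus> y)" "fin_over R D (x \<otimes> y)"
    unfolding fin_over_def using FS 1 dd by blast+
qed

lemma alg_over_self: "subring D R \<Longrightarrow> \<one> \<noteq> \<zero> \<Longrightarrow> x \<in> D \<Longrightarrow> alg_over R D x"
proof -
  assume D: "subring D R" and 1: "\<one> \<noteq> \<zero>" and x: "x \<in> D"
  have xC: "x \<in> carrier R" using x subringE(1)[OF D] by blast
  have "eval [\<one>, \<ominus> x] x = \<zero>" using xC by (simp add: r_neg)
  moreover have "set [\<one>, \<ominus> x] \<subseteq> D" using subringE(3,5)[OF D] x by simp
  moreover have "\<not> set [\<one>, \<ominus> x] \<subseteq> {\<zero>}" using 1 by simp
  ultimately show ?thesis unfolding alg_over_def by blast
qed

lemma alg_over_add_mult: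
  assumes D: "subring D R" "no_zero_div R D" "\<one> \<noteq> \<zero>" and x: "x \<in> carrier R" "alg_over R D x"
    and y: "y \<in> carrier R" "alg_over R D y"
  shows "alg_over R D (x \<oplus> y)" "alg_over R D (x \<otimes> y)"
proof -
  note f = fin_over_add_mult[OF D(1,2) x(1) alg_over_fin_over[OF D(1) x] y(1) alg_over_fin_over[OF D(1) y]]
  show "alg_over R D (x \<oplus> y)" using fin_over_alg_over[OF D _ f(1)] x(1) y(1) by simp
  show "alg_over R D (x \<otimes> y)" using fin_over_alg_over[OF D _ f(2)] x(1) y(1) by simp
qed

end

subsection \<open>Idempotent fractions\<close>

text \<open>For subalgebras this is the image of U \<otimes> V inside A \<otimes> B, so denominators
  need no tensor product of their own.\<close>

definition tens_span where
  "tens_span K A B U V = {bsum (tensor_algebra K A B) (tens K A B) ps | ps. set ps \<subseteq> U \<times> V}"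

context tensor_pair
begin

lemma nontrivial_left: "\<one>\<^bsub>R\<^esub> \<noteq> \<zero>\<^bsub>R\<^esub> \<Longrightarrow> \<one>\<^bsub>A\<^esub> \<noteq> \<zero>\<^bsub>A\<^esub>"
proof
  assume 1: "\<one>\<^bsub>R\<^esub> \<noteq> \<zero>\<^bsub>R\<^esub>" and "\<one>\<^bsub>A\<^esub> = \<zero>\<^bsub>A\<^esub>"
  then have "\<one>\<^bsub>R\<^esub> = \<zero>\<^bsub>R\<^esub>" unfolding tens_one by (simp add: tens_zero_left)
  then show False using 1 by contradiction
qed

lemma tens_spanI: "set ps \<subseteq> U \<times> V \<Longrightarrow> bsum R (tens K A B) ps \<in> tens_span K A B U V"
  unfolding tens_span_def by blast

lemma tens_span_closed: "U \<subseteq> carrier A \<Longrightarrow> V \<subseteq> carrier B \<Longrightarrow> tens_span K A B U V \<subseteq> carrier R"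
proof
  fix x assume UV: "U \<subseteq> carrier A" "V \<subseteq> carrier B" and "x \<in> tens_span K A B U V"
  then obtain ps where ps: "set ps \<subseteq> U \<times> V" "x = bsum R (tens K A B) ps"
    unfolding tens_span_def by blast
  have "set ps \<subseteq> carrier A \<times> carrier B" using ps(1) UV by blast
  then show "x \<in> carrier R" unfolding ps(2) by (intro R.bsum_closed) auto
qed

lemma tens_in_span: "a \<in> U \<Longrightarrow> b \<in> V \<Longrightarrow> U \<subseteq> carrier A \<Longrightarrow> V \<subseteq> carrier B \<Longrightarrow>
    tens K A B a b \<in> tens_span K A B U V"
proof -
  assume "a \<in> U" "b \<in> V" "U \<subseteq> carrier A" "V \<subseteq> carrier B"
  then have "a \<in> carrier A" "b \<in> carrier B" by auto
  then have "bsum R (tens K A B) [(a, b)] = tens K A B a b" by simp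
  moreover have "set [(a, b)] \<subseteq> U \<times> V" using \<open>a \<in> U\<close> \<open>b \<in> V\<close> by simp
  ultimately show ?thesis using tens_spanI by metis
qed

lemma tens_span_mono: "U \<subseteq> U' \<Longrightarrow> V \<subseteq> V' \<Longrightarrow> tens_span K A B U V \<subseteq> tens_span K A B U' V'"
  unfolding tens_span_def by blast

lemma tens_span_add:
  assumes "U \<subseteq> carrier A" "V \<subseteq> carrier B" "x \<in> tens_span K A B U V" "y \<in> tens_span K A B U V"
  shows "x \<oplus>\<^bsub>R\<^esub> y \<in> tens_span K A B U V"
proof -
  obtain ps qs where ps: "set ps \<subseteq> U \<times> V" "x = bsum R (tens K A B) ps"
    "set qs \<subseteq> U \<times> V" "y = bsum R (tens K A B) qs"
    using assms(3,4) unfolding tens_span_def by blast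
  have "set (ps @ qs) \<subseteq> carrier A \<times> carrier B" using ps(1,3) assms(1,2) by auto
  then have "x \<oplus>\<^bsub>R\<^esub> y = bsum R (tens K A B) (ps @ qs)"
    unfolding ps(2,4) by (intro R.bsum_append[symmetric]) auto
  then show ?thesis using ps(1,3) tens_spanI[of "ps @ qs" U V] by simp
qed

lemma tens_span_induct [consumes 3, case_names zero add]:
  assumes UV: "U \<subseteq> carrier A" "V \<subseteq> carrier B" and x: "x \<in> tens_span K A B U V"
    and "P \<zero>\<^bsub>R\<^esub>" "\<And>a b x. a \<in> U \<Longrightarrow> b \<in> V \<Longrightarrow> x \<in> tens_span K A B U V \<Longrightarrow> P x \<Longrightarrow> P (tens K A B a b \<oplus>\<^bsub>R\<^esub> x)"
  shows "P x"
proof -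
  obtain ps where ps: "set ps \<subseteq> U \<times> V" "x = bsum R (tens K A B) ps"
    using x unfolding tens_span_def by blast
  have "P (bsum R (tens K A B) ps)" using ps(1)
  proof (induction ps)
    case (Cons p ps)
    then show ?case using assms(5)[of "fst p" "snd p"] tens_spanI[of ps U V] by auto
  qed (use assms(4) in simp)
  then show ?thesis using ps(2) by simp
qed

lemma tens_span_subring:
  assumes U: "subring U A" and V: "subring V B"
  shows "subring (tens_span K A B U V) R"
proof -
  note UC = subringE(1)[OF U] and VC = subringE(1)[OF V]
  let ?D = "tens_span K A B U V"
  have DC: "?D \<subseteq> carrier R" by (rule tens_span_closed[OF UC VC])
  have z: "\<zero>\<^bsub>R\<^esub> \<in> ?D" using tens_spanI[of "[]"] by simp
  have m1: "tens K A B a b \<otimes>\<^bsub>R\<^esub> y \<in> ?D" if ab: "a \<in> U" "b \<in> V" and y: "y \<in> ?D" for a b y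
    using UC VC y
  proof (induction rule: tens_span_induct)
    case zero
    then show ?case using z ab UC VC by (auto simp: subset_iff)
  next
    case (add a' b' y)
    have c: "a \<in> carrier A" "b \<in> carrier B" "a' \<in> carrier A" "b' \<in> carrier B" "y \<in> carrier R"
      using ab add UC VC DC by auto
    have "tens K A B a b \<otimes>\<^bsub>R\<^esub> (tens K A B a' b' \<oplus>\<^bsub>R\<^esub> y)
        = tens K A B (a \<otimes>\<^bsub>A\<^esub> a') (b \<otimes>\<^bsub>B\<^esub> b') \<oplus>\<^bsub>R\<^esub> tens K A B a b \<otimes>\<^bsub>R\<^esub> y"
      using c by (simp add: R.r_distr tens_mult)
    then show ?case using tens_span_add[OF UC VC] tens_in_span[OF _ _ UC VC] add ab
        subringE(6)[OF U] subringE(6)[OF V] by simp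
  qed
  have m: "x \<otimes>\<^bsub>R\<^esub> y \<in> ?D" if x: "x \<in> ?D" and y: "y \<in> ?D" for x y
    using UC VC x
  proof (induction rule: tens_span_induct)
    case zero
    then show ?case using z y DC by (auto simp: subset_iff)
  next
    case (add a b x)
    have "(tens K A B a b \<oplus>\<^bsub>R\<^esub> x) \<otimes>\<^bsub>R\<^esub> y = tens K A B a b \<otimes>\<^bsub>R\<^esub> y \<oplus>\<^bsub>R\<^esub> x \<otimes>\<^bsub>R\<^esub> y"
      using add y DC UC VC by (intro R.l_distr) auto
    then show ?case using tens_span_add[OF UC VC m1[OF add(1,2) y] add(4)] by simp
  qed
  have one: "\<one>\<^bsub>R\<^esub> \<in> ?D"
    unfolding tens_one using tens_in_span[OF subringE(3)[OF U] subringE(3)[OF V] UC VC] .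
  have neg: "\<ominus>\<^bsub>R\<^esub> x \<in> ?D" if x: "x \<in> ?D" for x
  proof -
    have "\<ominus>\<^bsub>R\<^esub> \<one>\<^bsub>R\<^esub> = tens K A B (\<ominus>\<^bsub>A\<^esub> \<one>\<^bsub>A\<^esub>) \<one>\<^bsub>B\<^esub>" by (simp add: tens_minus_left tens_one)
    then have "\<ominus>\<^bsub>R\<^esub> \<one>\<^bsub>R\<^esub> \<in> ?D"
      using tens_in_span[OF subringE(5)[OF U subringE(3)[OF U]] subringE(3)[OF V] UC VC] by simp
    from m[OF this x] show ?thesis using x DC by (auto simp: R.l_minus subset_iff)
  qed
  show ?thesis
    by (rule R.subringI[OF DC one]) (use neg m tens_span_add[OF UC VC] in auto)
qed

end

context tensor_tower
begin

text \<open>The pattern of a field of definition: a denominator of minimal length, scaled to have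
  one coefficient 1, is unique. Here its two images in \<open>S\<close>, matched at the coefficient
  \<open>b1\<close>, differ by a shorter denominator, which must vanish after multiplication by
  u.\<close>

lemma rational_solution:
  assumes ic: "integrally_closed_domain B" and nontriv: "\<one>\<^bsub>R\<^esub> \<noteq> \<zero>\<^bsub>R\<^esub>" and y: "y \<in> carrier R"
    and g: "nonzerodiv R g" and yy: "y \<otimes>\<^bsub>R\<^esub> y = g \<otimes>\<^bsub>R\<^esub> y"
    and U: "U \<subseteq> carrier A" and gU: "g \<in> tens_span K A B U (carrier B)"
  shows "\<exists>p\<in>tens_span K A B (carrier A) (alg_closure_in K B).
    \<exists>q\<in>tens_span K A B U (alg_closure_in K B). q \<noteq> \<zero>\<^bsub>R\<^esub> \<and> p \<otimes>\<^bsub>R\<^esub> g = q \<otimes>\<^bsub>R\<^esub> y"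
proof -
  have dom: "domain B" using ic by (simp add: integrally_closed_domain_def)
  note gR = nonzerodivD(1)[OF g]
  have L: "alg_closure_in K B \<subseteq> carrier B" by (auto simp: alg_closure_in_def)
  \<comment> \<open>\<open>sol ds\<close> says that \<open>ds\<close> represents a nonzero
    denominator of y / g in U \<otimes> B. The given g is one, with numerator y.\<close>
  define sol where "sol ds \<longleftrightarrow> set ds \<subseteq> U \<times> carrier B \<and> bsum R (tens K A B) ds \<noteq> \<zero>\<^bsub>R\<^esub> \<and>
    (\<exists>p\<in>carrier R. p \<otimes>\<^bsub>R\<^esub> g = bsum R (tens K A B) ds \<otimes>\<^bsub>R\<^esub> y)" for ds
  have "g \<noteq> \<zero>\<^bsub>R\<^esub>" using nonzerodivD(2)[OF g, of "\<one>\<^bsub>R\<^esub>"] nontriv by auto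
  moreover obtain gs where gs: "set gs \<subseteq> U \<times> carrier B" "g = bsum R (tens K A B) gs"
    using gU unfolding tens_span_def by blast
  ultimately have "sol gs" unfolding sol_def using y gR by (auto intro!: bexI[of _ y] simp: R.m_comm)
  then obtain ds where ds: "sol ds" and min: "\<And>es. sol es \<Longrightarrow> length ds \<le> length es"
    using ex_has_least_nat[of sol gs length] by blast
  define q where "q = bsum R (tens K A B) ds"
  have dsU: "set ds \<subseteq> U \<times> carrier B" and q0: "q \<noteq> \<zero>\<^bsub>R\<^esub>" using ds by (auto simp: sol_def q_def)
  obtain p where p: "p \<in> carrier R" "p \<otimes>\<^bsub>R\<^esub> g = q \<otimes>\<^bsub>R\<^esub> y" using ds by (auto simp: sol_def q_def)
  have dsA: "set ds \<subseteq> carrier A \<times> carrier B" using dsU U by auto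
  have qR: "q \<in> carrier R" unfolding q_def using dsA by (auto intro!: R.bsum_closed)
  have "ds \<noteq> []" using q0 by (auto simp: q_def)
  then obtain a1 b1 rest where dse: "ds = (a1, b1) # rest" by (metis neq_Nil_conv surj_pair)
  have a1: "a1 \<in> carrier A" "b1 \<in> carrier B" and restU: "set rest \<subseteq> U \<times> carrier B"
    and restA: "set rest \<subseteq> carrier A \<times> carrier B" using dsU dsA by (auto simp: dse)
  have restR: "bsum R (tens K A B) rest \<in> carrier R" using restA by (auto intro!: R.bsum_closed)
  have b10: "b1 \<noteq> \<zero>\<^bsub>B\<^esub>"
  proof
    assume "b1 = \<zero>\<^bsub>B\<^esub>"
    then have "q = bsum R (tens K A B) rest" using a1 restR by (simp add: q_def dse tens_zero_right)
    then have "sol rest" unfolding sol_def using restU q0 p by auto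
    then show False using min[of rest] by (simp add: dse)
  qed
  obtain u where u: "u \<in> W" "u \<noteq> \<zero>\<^bsub>S\<^esub>"
    and un: "u \<otimes>\<^bsub>S\<^esub> (T.emb1 y \<otimes>\<^bsub>S\<^esub> E2 g \<ominus>\<^bsub>S\<^esub> E2 y \<otimes>\<^bsub>S\<^esub> T.emb1 g) = \<zero>\<^bsub>S\<^esub>"
    using annihilator_exists[OF dom y g nontriv yy] by blast
  have uS: "u \<in> carrier S" using W_closed[OF u(1)] .
  let ?y1 = "T.emb1 y" and ?y2 = "E2 y" and ?g1 = "T.emb1 g" and ?g2 = "E2 g"
  let ?p1 = "T.emb1 p" and ?p2 = "E2 p" and ?q1 = "T.emb1 q" and ?q2 = "E2 q"
  let ?c1 = "T.emb1 (emb2 b1)" and ?c2 = "T.emb2 b1"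
  note cl = y gR p(1) qR a1 uS
  have uyg: "u \<otimes>\<^bsub>S\<^esub> (?y1 \<otimes>\<^bsub>S\<^esub> ?g2) = u \<otimes>\<^bsub>S\<^esub> (?y2 \<otimes>\<^bsub>S\<^esub> ?g1)"
    using un cl by (simp add: T.R.minus_eq T.R.r_distr T.R.r_minus)
      (metis E2_closed T.R.m_closed T.R.minus_eq T.R.r_right_minus_eq T.emb1_closed)
  have pq1: "?p1 \<otimes>\<^bsub>S\<^esub> ?g1 = ?q1 \<otimes>\<^bsub>S\<^esub> ?y1"
    using p(2) cl by (simp add: ring_hom_mult[OF T.emb1_hom, symmetric])
  have pq2: "?p2 \<otimes>\<^bsub>S\<^esub> ?g2 = ?q2 \<otimes>\<^bsub>S\<^esub> ?y2"
    using p(2) cl by (simp add: ring_hom_mult[OF E2_hom, symmetric])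
  \<comment> \<open>The fraction y / g from the first copy is met by the denominator from the
    second. They fit together because u kills the difference of the two images of y / g; the regular
    \<open>?g2\<close> is multiplied in and cancelled.\<close>
  have uq2: "u \<otimes>\<^bsub>S\<^esub> (?q2 \<otimes>\<^bsub>S\<^esub> ?y1) = u \<otimes>\<^bsub>S\<^esub> (?p2 \<otimes>\<^bsub>S\<^esub> ?g1)"
  proof -
    let ?d = "u \<otimes>\<^bsub>S\<^esub> (?q2 \<otimes>\<^bsub>S\<^esub> ?y1) \<ominus>\<^bsub>S\<^esub> u \<otimes>\<^bsub>S\<^esub> (?p2 \<otimes>\<^bsub>S\<^esub> ?g1)"
    have "?g2 \<otimes>\<^bsub>S\<^esub> ?d = ?q2 \<otimes>\<^bsub>S\<^esub> (u \<otimes>\<^bsub>S\<^esub> (?y1 \<otimes>\<^bsub>S\<^esub> ?g2)) \<ominus>\<^bsub>S\<^esub> u \<otimes>\<^bsub>S\<^esub> ((?p2 \<otimes>\<^bsub>S\<^esub> ?g2) \<otimes>\<^bsub>S\<^esub> ?g1)"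
      using cl by (simp add: T.R.minus_eq T.R.r_distr T.R.r_minus T.R.m_ac)
    also have "\<dots> = \<zero>\<^bsub>S\<^esub>"
      unfolding uyg pq2 using cl by (simp add: T.R.minus_eq T.R.m_ac T.R.r_neg)
    finally have "?d = \<zero>\<^bsub>S\<^esub>" using nonzerodivD(2)[OF E2_nonzerodiv[OF g], of ?d] cl by simp
    then show ?thesis using cl by simp
  qed
  \<comment> \<open>\<zeta> and \<pi> compare the two images of q and of p, cross-multiplied by
    \<open>b1\<close>. In \<zeta> the term with coefficient \<open>b1\<close> cancels, so only the
    first components of \<open>rest\<close> remain.\<close>
  define \<zeta> where "\<zeta> = u \<otimes>\<^bsub>S\<^esub> (?q1 \<otimes>\<^bsub>S\<^esub> ?c2 \<ominus>\<^bsub>S\<^esub> ?q2 \<otimes>\<^bsub>S\<^esub> ?c1)"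
  define \<pi> where "\<pi> = u \<otimes>\<^bsub>S\<^esub> (?p1 \<otimes>\<^bsub>S\<^esub> ?c2 \<ominus>\<^bsub>S\<^esub> ?p2 \<otimes>\<^bsub>S\<^esub> ?c1)"
  have \<zeta>S: "\<zeta> \<in> carrier S" and \<pi>S: "\<pi> \<in> carrier S" using cl by (simp_all add: \<zeta>_def \<pi>_def)
  have y\<zeta>: "?y1 \<otimes>\<^bsub>S\<^esub> \<zeta> = ?g1 \<otimes>\<^bsub>S\<^esub> \<pi>"
  proof -
    have "?y1 \<otimes>\<^bsub>S\<^esub> \<zeta> = u \<otimes>\<^bsub>S\<^esub> ((?q1 \<otimes>\<^bsub>S\<^esub> ?y1) \<otimes>\<^bsub>S\<^esub> ?c2) \<ominus>\<^bsub>S\<^esub> (u \<otimes>\<^bsub>S\<^esub> (?q2 \<otimes>\<^bsub>S\<^esub> ?y1)) \<otimes>\<^bsub>S\<^esub> ?c1"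
      using cl by (simp add: \<zeta>_def T.R.minus_eq T.R.r_distr T.R.r_minus T.R.m_ac)
    also have "\<dots> = ?g1 \<otimes>\<^bsub>S\<^esub> \<pi>"
      unfolding pq1[symmetric] uq2 using cl
      by (simp add: \<pi>_def T.R.minus_eq T.R.r_distr T.R.r_minus T.R.m_ac)
    finally show ?thesis .
  qed
  have "swap_diff b1 b1 = \<zero>\<^bsub>S\<^esub>" using a1 by (simp add: swap_diff_def T.R.minus_eq T.R.r_neg)
  moreover have om: "u \<otimes>\<^bsub>S\<^esub> swap_diff c b1 \<in> W" if "c \<in> carrier B" for c
    using W_mult[OF u(1) swap_diff_W[OF that a1(2)]] .
  have sumS: "bsum S (\<lambda>a c. T.emb1 (emb1 a) \<otimes>\<^bsub>S\<^esub> (u \<otimes>\<^bsub>S\<^esub> swap_diff c b1)) rest \<in> carrier S"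
    using restA om W_closed by (intro T.R.bsum_closed) auto
  ultimately have \<zeta>e: "\<zeta> = bsum S (\<lambda>a c. T.emb1 (emb1 a) \<otimes>\<^bsub>S\<^esub> (u \<otimes>\<^bsub>S\<^esub> swap_diff c b1)) rest"
    unfolding \<zeta>_def q_def using swap_diff_bsum[OF dsA a1(2) uS] a1 uS by (simp add: dse)
  \<comment> \<open>A nonzero slice of \<zeta> would again be a denominator of y / g, with the slice
    of \<pi> as numerator, and it would be shorter than \<open>ds\<close>.\<close>
  have "\<zeta> = \<zero>\<^bsub>S\<^esub>"
  proof (rule T.slice2_separates[OF \<zeta>S])
    fix \<psi> assume \<psi>: "functional K B \<psi>"
    have "\<forall>c\<in>carrier B. \<exists>b. b \<in> carrier B \<and> T.slice2 \<psi> (u \<otimes>\<^bsub>S\<^esub> swap_diff c b1) = emb2 b"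
      using slice2_W[OF om \<psi> nontrivial_left[OF nontriv]] by blast
    then obtain \<beta> where \<beta>: "\<forall>c\<in>carrier B. \<beta> c \<in> carrier B \<and> T.slice2 \<psi> (u \<otimes>\<^bsub>S\<^esub> swap_diff c b1) = emb2 (\<beta> c)"
      by (rule bchoice[THEN exE])
    let ?rs = "map (\<lambda>(a, c). (a, \<beta> c)) rest"
    have rs: "set ?rs \<subseteq> U \<times> carrier B" using restU \<beta> by auto
    have "T.slice2 \<psi> \<zeta> = bsum R (\<lambda>a c. T.slice2 \<psi> (T.emb1 (emb1 a) \<otimes>\<^bsub>S\<^esub> (u \<otimes>\<^bsub>S\<^esub> swap_diff c b1))) rest"
      unfolding \<zeta>e using restA om W_closed
      by (intro bsum_hom T.R.is_abelian_group R.is_abelian_group T.slice2(2)[OF \<psi>] T.slice2_zero[OF \<psi>]) auto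
    also have "\<dots> = bsum R (\<lambda>a c. tens K A B a (\<beta> c)) rest"
    proof (rule bsum_cong)
      fix a c assume "(a, c) \<in> set rest"
      then have ac: "a \<in> carrier A" "c \<in> carrier B" using restA by auto
      then show "T.slice2 \<psi> (T.emb1 (emb1 a) \<otimes>\<^bsub>S\<^esub> (u \<otimes>\<^bsub>S\<^esub> swap_diff c b1)) = tens K A B a (\<beta> c)"
        using T.slice2_emb1[OF \<psi> W_closed[OF om[OF ac(2)]], of "emb1 a"] \<beta> by (simp add: tens_eq)
    qed
    also have "\<dots> = bsum R (tens K A B) ?rs" by (induction rest) auto
    finally have s: "T.slice2 \<psi> \<zeta> = bsum R (tens K A B) ?rs" .
    have "y \<otimes>\<^bsub>R\<^esub> T.slice2 \<psi> \<zeta> = g \<otimes>\<^bsub>R\<^esub> T.slice2 \<psi> \<pi>"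
      using T.slice2_emb1[OF \<psi> \<zeta>S y] T.slice2_emb1[OF \<psi> \<pi>S gR] y\<zeta> by simp
    then have "T.slice2 \<psi> \<pi> \<otimes>\<^bsub>R\<^esub> g = bsum R (tens K A B) ?rs \<otimes>\<^bsub>R\<^esub> y"
      using s T.slice2(1)[OF \<psi> \<pi>S] T.slice2(1)[OF \<psi> \<zeta>S] y gR by (simp add: R.m_comm)
    then have "sol ?rs" if "bsum R (tens K A B) ?rs \<noteq> \<zero>\<^bsub>R\<^esub>"
      unfolding sol_def using rs that T.slice2(1)[OF \<psi> \<pi>S] by blast
    then show "T.slice2 \<psi> \<zeta> = \<zero>\<^bsub>R\<^esub>" using min[of ?rs] s by (auto simp: dse)
  qed
  note \<zeta>0 = this
  then have "?g1 \<otimes>\<^bsub>S\<^esub> \<pi> = \<zero>\<^bsub>S\<^esub>" using y\<zeta> cl by simp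
  then have \<pi>0: "\<pi> = \<zero>\<^bsub>S\<^esub>" using nonzerodivD(2)[OF T_emb1_nonzerodiv[OF g] \<pi>S] by simp
  have IC: "\<exists>l\<in>alg_closure_in K B. b = b1 \<otimes>\<^bsub>B\<^esub> l"
    if "b \<in> carrier B" "v \<in> W" "v \<noteq> \<zero>\<^bsub>S\<^esub>" "v \<otimes>\<^bsub>S\<^esub> swap_diff b b1 = \<zero>\<^bsub>S\<^esub>" for b v
    using swap_diff_algebraic[OF ic that(1) a1(2) b10 W_closed[OF that(2)] that(3,4)] .
  obtain qs where qs: "set qs \<subseteq> U \<times> alg_closure_in K B" "q = emb2 b1 \<otimes>\<^bsub>R\<^esub> bsum R (tens K A B) qs"
  proof -
    have "\<exists>qs. set qs \<subseteq> U \<times> alg_closure_in K B \<and> bsum R (tens K A B) ds = emb2 b1 \<otimes>\<^bsub>R\<^esub> bsum R (tens K A B) qs"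
      by (rule bsum_swap_factor[OF _ L a1(2) u U dsU \<zeta>0[unfolded \<zeta>_def q_def]]) (rule IC, assumption+)
    then show thesis using that unfolding q_def by (elim exE conjE)
  qed
  obtain xs where xs: "set xs \<subseteq> carrier A \<times> carrier B" "p = bsum R (tens K A B) xs"
    using tens_rep[OF p(1)] by blast
  obtain ps where ps: "set ps \<subseteq> carrier A \<times> alg_closure_in K B" "p = emb2 b1 \<otimes>\<^bsub>R\<^esub> bsum R (tens K A B) ps"
  proof -
    have "\<exists>ps. set ps \<subseteq> carrier A \<times> alg_closure_in K B \<and> bsum R (tens K A B) xs = emb2 b1 \<otimes>\<^bsub>R\<^esub> bsum R (tens K A B) ps"
      by (rule bsum_swap_factor[OF _ L a1(2) u subset_refl xs(1) \<pi>0[unfolded \<pi>_def xs(2)]]) (rule IC, assumption+)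
    then show thesis using that unfolding xs(2) by (elim exE conjE)
  qed
  let ?p = "bsum R (tens K A B) ps" and ?q = "bsum R (tens K A B) qs"
  have pqR: "?p \<in> carrier R" "?q \<in> carrier R"
    using tens_span_closed[OF subset_refl L] tens_span_closed[OF U L] tens_spanI[OF ps(1)] tens_spanI[OF qs(1)]
    by (auto simp only: subset_iff)
  have "emb2 b1 \<otimes>\<^bsub>R\<^esub> (?p \<otimes>\<^bsub>R\<^esub> g \<ominus>\<^bsub>R\<^esub> ?q \<otimes>\<^bsub>R\<^esub> y) = p \<otimes>\<^bsub>R\<^esub> g \<ominus>\<^bsub>R\<^esub> q \<otimes>\<^bsub>R\<^esub> y"
    unfolding ps(2) qs(2) using pqR a1 y gR by (simp add: R.minus_eq R.r_distr R.r_minus R.m_assoc)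
  also have "\<dots> = \<zero>\<^bsub>R\<^esub>" using p(2) qR y by (simp add: R.minus_eq R.r_neg)
  finally have "?p \<otimes>\<^bsub>R\<^esub> g \<ominus>\<^bsub>R\<^esub> ?q \<otimes>\<^bsub>R\<^esub> y = \<zero>\<^bsub>R\<^esub>"
    using nonzerodivD(2)[OF emb2_nonzerodiv[OF dom a1(2) b10]] pqR y gR by simp
  then have "?p \<otimes>\<^bsub>R\<^esub> g = ?q \<otimes>\<^bsub>R\<^esub> y" using pqR y gR by simp
  moreover have "?q \<noteq> \<zero>\<^bsub>R\<^esub>"
  proof
    assume "?q = \<zero>\<^bsub>R\<^esub>"
    then have "q = \<zero>\<^bsub>R\<^esub>" unfolding qs(2) using a1 by simp
    then show False using q0 by contradiction
  qed
  ultimately show ?thesis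
    by (intro bexI[OF bexI[OF _ tens_spanI[OF qs(1)]] tens_spanI[OF ps(1)]] conjI)
qed

end

subsection \<open>Minimal primes and regular elements\<close>

context cring
begin

text \<open>Krull's argument: an ideal maximal among those disjoint from a multiplicative set is
  prime.\<close>

lemma prime_avoiding:
  assumes M: "M \<subseteq> carrier R" "\<one> \<in> M" "\<zero> \<notin> M" "\<And>x y. x \<in> M \<Longrightarrow> y \<in> M \<Longrightarrow> x \<otimes> y \<in> M"
  shows "\<exists>Q. primeideal Q R \<and> Q \<inter> M = {}"
proof -
  let ?F = "{I. ideal I R \<and> I \<inter> M = {}}"
  have "\<exists>I\<in>?F. \<forall>J\<in>?F. I \<subseteq> J \<longrightarrow> J = I"
  proof (rule subset_Zorn_nonempty)
    show "?F \<noteq> {}" using zeroideal M(3) by auto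
    fix C assume C: "C \<noteq> {}" "subset.chain ?F C"
    have "subset.chain {I. ideal I R} C" using C(2) unfolding subset.chain_def by auto
    then have "ideal (\<Union>C) R" using chain_Union_is_ideal[of C] C(1) by simp
    moreover have "\<Union>C \<inter> M = {}" using C(2) unfolding subset.chain_def by auto
    ultimately show "\<Union>C \<in> ?F" by simp
  qed
  then obtain I where IF: "I \<in> ?F" and mx: "\<forall>J\<in>?F. I \<subseteq> J \<longrightarrow> J = I" by (rule bexE)
  from IF have I: "ideal I R" "I \<inter> M = {}" by simp_all
  interpret I: ideal I R by (rule I(1))
  have meet: "\<exists>i\<in>I. \<exists>r\<in>carrier R. i \<oplus> r \<otimes> a \<in> M" if a: "a \<in> carrier R" "a \<notin> I" for a
  proof (rule ccontr)
    assume no: "\<not> ?thesis"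
    let ?J = "I <+>\<^bsub>R\<^esub> PIdl a"
    have J: "ideal ?J R" by (rule add_ideals[OF I(1) cgenideal_ideal[OF a(1)]])
    have "?J \<inter> M = {}" using no unfolding set_add_def' cgenideal_def by auto
    moreover have IJ: "I \<subseteq> ?J"
    proof
      fix i assume i: "i \<in> I"
      have "i = i \<oplus> \<zero>" using I.Icarr[OF i] by simp
      moreover have "\<zero> \<in> PIdl a" using additive_subgroup.zero_closed ideal.axioms(1) cgenideal_ideal[OF a(1)] by blast
      ultimately show "i \<in> ?J" using i unfolding set_add_def' by blast
    qed
    ultimately have "?J = I" using mx J by simp
    moreover have "a \<in> ?J"
    proof -
      have "a = \<zero> \<oplus> a" using a by simp
      moreover have "a \<in> PIdl a" using cgenideal_self[OF a(1)] .
      ultimately show ?thesis unfolding set_add_def' using I.zero_closed by blast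
    qed
    ultimately show False using a(2) by simp
  qed
  have "primeideal I R"
  proof (rule primeidealI[OF I(1) is_cring])
    show "carrier R \<noteq> I" using I(2) M(1,2) by auto
    fix a b assume a: "a \<in> carrier R" and b: "b \<in> carrier R" and ab: "a \<otimes> b \<in> I"
    show "a \<in> I \<or> b \<in> I"
    proof (rule ccontr)
      assume n: "\<not> (a \<in> I \<or> b \<in> I)"
      obtain i r where i: "i \<in> I" "r \<in> carrier R" "i \<oplus> r \<otimes> a \<in> M" using meet[OF a] n by blast
      obtain j s where j: "j \<in> I" "s \<in> carrier R" "j \<oplus> s \<otimes> b \<in> M" using meet[OF b] n by blast
      have c: "i \<in> carrier R" "j \<in> carrier R" using i j I.Icarr by auto
      have "(i \<oplus> r \<otimes> a) \<otimes> (j \<oplus> s \<otimes> b) = i \<otimes> (j \<oplus> s \<otimes> b) \<oplus> ((r \<otimes> a) \<otimes> j \<oplus> (r \<otimes> s) \<otimes> (a \<otimes> b))"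
        using c i(2) j(2) a b by (simp add: l_distr r_distr m_ac a_ac)
      also have "\<dots> \<in> I"
        using c i(1,2) j(1,2) a b ab by (simp add: I.I_r_closed I.I_l_closed)
      finally show False using M(4)[OF i(3) j(3)] I(2) by blast
    qed
  qed
  then show ?thesis using I(2) by blast
qed

text \<open>The products s z^n with s outside \<open>P\<close> form a multiplicative set, which
  omits 0 because \<open>z\<close> is regular. A prime disjoint from it is contained in
  \<open>P\<close> and omits \<open>z\<close>; by minimality it is \<open>P\<close>.\<close>

lemma minimal_prime_nonzerodiv:
  assumes P: "minimal_prime R P" and z: "nonzerodiv R z"
  shows "z \<notin> P"
proof
  assume zP: "z \<in> P"
  have Pp: "primeideal P R" using P by (simp add: minimal_prime_def)
  interpret P: primeideal P R by (rule Pp)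
  note zC = nonzerodivD(1)[OF z]
  have nz: "nonzerodiv R (z [^] (n::nat))" for n
  proof (induction n)
    case (Suc n)
    then show ?case using nonzerodiv_mult[OF Suc z] by simp
  qed (simp add: nonzerodiv_def)
  let ?M = "{s \<otimes> z [^] (n::nat) | s n. s \<in> carrier R - P}"
  have oneP: "\<one> \<notin> P" using P.I_notcarr P.one_imp_carrier by blast
  have "\<exists>Q. primeideal Q R \<and> Q \<inter> ?M = {}"
  proof (rule prime_avoiding)
    show "?M \<subseteq> carrier R" using zC by auto
    have "\<one> = \<one> \<otimes> z [^] (0::nat)" by simp
    then show "\<one> \<in> ?M" using oneP one_closed by blast
    show "\<zero> \<notin> ?M"
    proof
      assume "\<zero> \<in> ?M"
      then obtain s n where s: "s \<in> carrier R" "s \<notin> P" "s \<otimes> z [^] (n::nat) = \<zero>" by auto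
      then have "s = \<zero>" using nonzerodivD(2)[OF nz[of n] s(1)] nonzerodivD(1)[OF nz[of n]] by (simp add: m_comm)
      then show False using s(2) P.zero_closed by simp
    qed
    fix x y assume "x \<in> ?M" "y \<in> ?M"
    then obtain s n t m where s: "s \<in> carrier R" "s \<notin> P" "x = s \<otimes> z [^] (n::nat)"
      and t: "t \<in> carrier R" "t \<notin> P" "y = t \<otimes> z [^] (m::nat)" by auto
    have "x \<otimes> y = (s \<otimes> t) \<otimes> z [^] (n + m)"
      using s t zC by (simp add: nat_pow_mult[symmetric] m_ac)
    moreover have "s \<otimes> t \<in> carrier R - P" using P.I_prime s t by auto
    ultimately show "x \<otimes> y \<in> ?M" by blast
  qed
  then obtain Q where Q: "primeideal Q R" "Q \<inter> ?M = {}" by blast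
  interpret Q: primeideal Q R by (rule Q(1))
  have "Q \<subseteq> P"
  proof (rule subsetI, rule ccontr)
    fix s assume s: "s \<in> Q" "s \<notin> P"
    have "s \<otimes> z [^] (0::nat) \<in> ?M" using s Q.Icarr[OF s(1)] by blast
    then show False using Q(2) s Q.Icarr[OF s(1)] by auto
  qed
  then have "Q = P" using P Q(1) by (simp add: minimal_prime_def)
  moreover have "z \<notin> Q"
  proof -
    have "\<one> \<otimes> z [^] (1::nat) \<in> ?M" using oneP one_closed by blast
    then show ?thesis using Q(2) zC by auto
  qed
  ultimately show False using zP by simp
qed

section \<open>Adjoining one element to a subring\<close>

definition poly_ext where
  "poly_ext D x = (\<Union>n. dspan R D (map (\<lambda>i. x [^] i) (rev [0..<n])))"

lemma pows_closed: "x \<in> carrier R \<Longrightarrow> set (map (\<lambda>i. x [^] i) (rev [0..<n])) \<subseteq> carrier R"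
  by auto

lemma pows_mem: "i < n \<Longrightarrow> x [^] i \<in> set (map (\<lambda>i. x [^] i) (rev [0..<n]))"
  unfolding set_map by (rule imageI) simp

lemma pows_mono:
  assumes D: "subring D R" and x: "x \<in> carrier R" and "n \<le> m"
  shows "dspan R D (map (\<lambda>i. x [^] i) (rev [0..<n])) \<subseteq> dspan R D (map (\<lambda>i. x [^] i) (rev [0..<m]))"
proof (rule dspan_least)
  note c = pows_closed[OF x, of m]
  show "\<zero> \<in> dspan R D (map (\<lambda>i. x [^] i) (rev [0..<m]))" by (rule dspan_zero[OF D c])
  fix d f assume d: "d \<in> D" and "f \<in> set (map (\<lambda>i. x [^] i) (rev [0..<n]))"
  then obtain i where "i < n" "f = x [^] i" by auto
  then have "f \<in> set (map (\<lambda>i. x [^] i) (rev [0..<m]))" using pows_mem[of i m x] assms(3) by simp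
  then show "d \<otimes> f \<in> dspan R D (map (\<lambda>i. x [^] i) (rev [0..<m]))"
    using dspan_mult[OF D c d dspan_mem[OF D c]] by simp
qed (rule dspan_add[OF D pows_closed[OF x]])

text \<open>Spans for n and m involve exponents up to n - 1 and m - 1, so n + m - 1 generators
  suffice for the product. The sharp bound is what later isolates the leading term of a
  product.\<close>

lemma pows_mult:
  assumes D: "subring D R" and x: "x \<in> carrier R"
    and y: "y \<in> dspan R D (map (\<lambda>i. x [^] i) (rev [0..<n]))"
    and z: "z \<in> dspan R D (map (\<lambda>i. x [^] i) (rev [0..<m]))" and k: "n + m \<le> Suc k"
  shows "y \<otimes> z \<in> dspan R D (map (\<lambda>i. x [^] i) (rev [0..<k]))"
proof -
  let ?p = "\<lambda>n. map (\<lambda>i. x [^] i) (rev [0..<n])"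
  let ?fs = "concat (map (\<lambda>f. map (\<lambda>f'. f \<otimes> f') (?p m)) (?p n))"
  note c = pows_closed[OF x, of k]
  have "dspan R D ?fs \<subseteq> dspan R D (?p k)"
  proof (rule dspan_least)
    fix d f assume d: "d \<in> D" and "f \<in> set ?fs"
    then obtain i j where ij: "i < n" "j < m" "f = x [^] i \<otimes> x [^] j" by auto
    then have "f = x [^] (i + j)" using x by (simp add: nat_pow_mult)
    then have "f \<in> set (?p k)" using pows_mem[of "i + j" k x] ij k by simp
    then show "d \<otimes> f \<in> dspan R D (?p k)" using dspan_mult[OF D c d dspan_mem[OF D c]] by simp
  qed (rule dspan_zero[OF D c], rule dspan_add[OF D c])
  then show ?thesis using dspan_products[OF D pows_closed[OF x] pows_closed[OF x] y z] by blast
qed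

lemma pows_eval:
  "r \<in> dspan R D (map (\<lambda>i. x [^] i) (rev [0..<n])) \<Longrightarrow> \<exists>q. set q \<subseteq> D \<and> length q = n \<and> r = eval q x"
proof (induction n arbitrary: r)
  case 0
  then show ?case by simp
next
  case (Suc n)
  then obtain d m where d: "d \<in> D" "m \<in> dspan R D (map (\<lambda>i. x [^] i) (rev [0..<n]))" "r = d \<otimes> x [^] n \<oplus> m"
    by auto
  obtain q where "set q \<subseteq> D" "length q = n" "m = eval q x" using Suc.IH[OF d(2)] by blast
  then show ?case using d by (intro exI[of _ "d # q"]) simp
qed

lemma poly_ext_closed: "subring D R \<Longrightarrow> x \<in> carrier R \<Longrightarrow> poly_ext D x \<subseteq> carrier R"
  unfolding poly_ext_def using dspan_closed[OF subringE(1) pows_closed] by blast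

lemma poly_ext_add:
  assumes D: "subring D R" and x: "x \<in> carrier R" and y: "y \<in> poly_ext D x" and z: "z \<in> poly_ext D x"
  shows "y \<oplus> z \<in> poly_ext D x"
proof -
  obtain n m where "y \<in> dspan R D (map (\<lambda>i. x [^] i) (rev [0..<n]))"
    "z \<in> dspan R D (map (\<lambda>i. x [^] i) (rev [0..<m]))" using y z unfolding poly_ext_def by blast
  then have "y \<in> dspan R D (map (\<lambda>i. x [^] i) (rev [0..<max n m]))"
    "z \<in> dspan R D (map (\<lambda>i. x [^] i) (rev [0..<max n m]))"
    using pows_mono[OF D x, of n "max n m"] pows_mono[OF D x, of m "max n m"] by auto
  then show ?thesis unfolding poly_ext_def using dspan_add[OF D pows_closed[OF x]] by blast
qed

lemma poly_ext_mult:
  assumes D: "subring D R" and x: "x \<in> carrier R" and y: "y \<in> poly_ext D x" and z: "z \<in> poly_ext D x"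
  shows "y \<otimes> z \<in> poly_ext D x"
proof -
  obtain n m where "y \<in> dspan R D (map (\<lambda>i. x [^] i) (rev [0..<n]))"
    "z \<in> dspan R D (map (\<lambda>i. x [^] i) (rev [0..<m]))" using y z unfolding poly_ext_def by blast
  then have "y \<otimes> z \<in> dspan R D (map (\<lambda>i. x [^] i) (rev [0..<n + m]))" by (intro pows_mult[OF D x]) auto
  then show ?thesis unfolding poly_ext_def by blast
qed

lemma poly_ext_incl: "subring D R \<Longrightarrow> x \<in> carrier R \<Longrightarrow> D \<subseteq> poly_ext D x"
proof
  fix d assume D: "subring D R" and x: "x \<in> carrier R" and d: "d \<in> D"
  have "d \<otimes> x [^] (0::nat) \<in> dspan R D (map (\<lambda>i. x [^] i) (rev [0..<1]))"
    by (rule dspan_mult[OF D pows_closed[OF x] d dspan_mem[OF D pows_closed[OF x]]]) simp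
  moreover have "d \<otimes> x [^] (0::nat) = d" using d subringE(1)[OF D] by auto
  ultimately show "d \<in> poly_ext D x" unfolding poly_ext_def by (metis UN_I UNIV_I)
qed

lemma poly_ext_self: "subring D R \<Longrightarrow> x \<in> carrier R \<Longrightarrow> x \<in> poly_ext D x"
proof -
  assume D: "subring D R" and x: "x \<in> carrier R"
  have "x [^] (1::nat) \<in> dspan R D (map (\<lambda>i. x [^] i) (rev [0..<2]))"
    by (rule dspan_mem[OF D pows_closed[OF x] pows_mem]) simp
  then show ?thesis unfolding poly_ext_def using x by (metis UN_I UNIV_I nat_pow_eone)
qed

lemma poly_ext_subring:
  assumes D: "subring D R" and x: "x \<in> carrier R"
  shows "subring (poly_ext D x) R"
proof (rule subringI)
  show C: "poly_ext D x \<subseteq> carrier R" by (rule poly_ext_closed[OF D x])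
  show "\<one> \<in> poly_ext D x" using poly_ext_incl[OF D x] subringE(3)[OF D] by blast
  show "y \<otimes> z \<in> poly_ext D x" "y \<oplus> z \<in> poly_ext D x" if "y \<in> poly_ext D x" "z \<in> poly_ext D x" for y z
    using poly_ext_add[OF D x that] poly_ext_mult[OF D x that] by auto
  fix y assume y: "y \<in> poly_ext D x"
  have "\<ominus> \<one> \<in> poly_ext D x" using poly_ext_incl[OF D x] subringE(3,5)[OF D] by blast
  then have "(\<ominus> \<one>) \<otimes> y \<in> poly_ext D x" using poly_ext_mult[OF D x _ y] by blast
  then show "\<ominus> y \<in> poly_ext D x" using y C by (auto simp: l_minus)
qed

text \<open>As \<open>x\<close> is transcendental over \<open>D\<close>, an expression with nonzero
  leading coefficient is nonzero, and leading coefficients multiply inside \<open>D\<close>.\<close>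

lemma poly_ext_no_zero_div:
  assumes D: "subring D R" "no_zero_div R D" and x: "x \<in> carrier R" and na: "\<not> alg_over R D x"
  shows "no_zero_div R (poly_ext D x)"
proof -
  note DC = subringE(1)[OF D(1)]
  let ?p = "\<lambda>n. map (\<lambda>i. x [^] i) (rev [0..<n])"
  have lead: "\<exists>n d m. d \<in> D \<and> d \<noteq> \<zero> \<and> m \<in> dspan R D (?p n) \<and> y = d \<otimes> x [^] (n::nat) \<oplus> m"
    if "y \<in> dspan R D (?p k)" "y \<noteq> \<zero>" for y k
    using that
  proof (induction k)
    case 0
    then show ?case by simp
  next
    case (Suc k)
    then obtain d m where d: "d \<in> D" "m \<in> dspan R D (?p k)" "y = d \<otimes> x [^] k \<oplus> m" by auto
    show ?case
    proof (cases "d = \<zero>")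
      case True
      then have "y = m" using d(3) x dspan_closed[OF DC pows_closed[OF x] d(2)] by simp
      then show ?thesis using Suc d(2) by blast
    next
      case False
      then show ?thesis using d by blast
    qed
  qed
  have nz: "d \<otimes> x [^] (n::nat) \<oplus> m \<noteq> \<zero>" if d: "d \<in> D" "d \<noteq> \<zero>" and m: "m \<in> dspan R D (?p n)" for d n m
  proof
    assume 0: "d \<otimes> x [^] n \<oplus> m = \<zero>"
    obtain q where q: "set q \<subseteq> D" "length q = n" "m = eval q x" using pows_eval[OF m] by blast
    have "eval (d # q) x = \<zero>" using 0 q by simp
    moreover have "set (d # q) \<subseteq> D" "\<not> set (d # q) \<subseteq> {\<zero>}" using q d by auto
    ultimately show False using na unfolding alg_over_def by blast
  qed
  have "y \<otimes> z \<noteq> \<zero>" if y: "y \<in> poly_ext D x" "y \<noteq> \<zero>" and z: "z \<in> poly_ext D x" "z \<noteq> \<zero>" for y z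
  proof -
    obtain n d m where d: "d \<in> D" "d \<noteq> \<zero>" "m \<in> dspan R D (?p n)" "y = d \<otimes> x [^] n \<oplus> m"
      using lead y unfolding poly_ext_def by blast
    obtain n' d' m' where d': "d' \<in> D" "d' \<noteq> \<zero>" "m' \<in> dspan R D (?p n')" "z = d' \<otimes> x [^] n' \<oplus> m'"
      using lead z unfolding poly_ext_def by blast
    let ?V = "dspan R D (?p (n + n'))"
    have c: "d \<in> carrier R" "d' \<in> carrier R" "m \<in> carrier R" "m' \<in> carrier R"
      using d d' DC dspan_closed[OF DC pows_closed[OF x]] by auto
    have t: "d \<otimes> x [^] n \<in> dspan R D (?p (Suc n))"
      by (rule dspan_mult[OF D(1) pows_closed[OF x] d(1) dspan_mem[OF D(1) pows_closed[OF x] pows_mem]]) simp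
    have t': "d' \<otimes> x [^] n' \<in> dspan R D (?p (Suc n'))"
      by (rule dspan_mult[OF D(1) pows_closed[OF x] d'(1) dspan_mem[OF D(1) pows_closed[OF x] pows_mem]]) simp
    have "(d \<otimes> x [^] n) \<otimes> m' \<in> ?V" by (rule pows_mult[OF D(1) x t d'(3)]) simp
    moreover have "m \<otimes> (d' \<otimes> x [^] n') \<in> ?V" by (rule pows_mult[OF D(1) x d(3) t']) simp
    moreover have "m \<otimes> m' \<in> ?V" by (rule pows_mult[OF D(1) x d(3) d'(3)]) simp
    ultimately have V: "(d \<otimes> x [^] n) \<otimes> m' \<oplus> (m \<otimes> (d' \<otimes> x [^] n') \<oplus> m \<otimes> m') \<in> ?V"
      by (intro dspan_add[OF D(1) pows_closed[OF x]])
    have "y \<otimes> z = (d \<otimes> d') \<otimes> x [^] (n + n') \<oplus> ((d \<otimes> x [^] n) \<otimes> m' \<oplus> (m \<otimes> (d' \<otimes> x [^] n') \<oplus> m \<otimes> m'))"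
      unfolding d(4) d'(4) using c x by (simp add: l_distr r_distr nat_pow_mult[symmetric] m_ac a_ac)
    moreover have "d \<otimes> d' \<noteq> \<zero>" using no_zero_divD[OF D(2) d(1) d'(1) _ d(2)] d'(2) by blast
    ultimately show ?thesis using nz[OF subringE(6)[OF D(1) d(1) d'(1)] _ V] by simp
  qed
  then show ?thesis unfolding no_zero_div_def by blast
qed

end

section \<open>Regularity of the nonzero elements of U \<otimes> B\<close>

context tensor_pair
begin

lemma slice2_span:
  assumes \<psi>: "functional K B \<psi>" and U: "subspace K A U" and x: "x \<in> tens_span K A B U (carrier B)"
  shows "slice2 \<psi> x \<in> U"
proof -
  have UC: "U \<subseteq> carrier A" using U by (simp add: subspace_def)
  show ?thesis using UC subset_refl x
  proof (induction rule: tens_span_induct)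
    case zero
    then show ?case using slice2_zero[OF \<psi>] subspaceD(2)[OF U] by simp
  next
    case (add a b x)
    have xR: "x \<in> carrier R" "a \<in> carrier A" using tens_span_closed[OF UC subset_refl] add UC by auto
    then have "slice2 \<psi> (tens K A B a b \<oplus>\<^bsub>R\<^esub> x) = \<psi> b \<odot>\<^bsub>A\<^esub> a \<oplus>\<^bsub>A\<^esub> slice2 \<psi> x"
      using add(2) by (simp add: slice2[OF \<psi>])
    then show ?case
      using subspaceD(3)[OF U subspaceD(4)[OF U functionalD(1)[OF \<psi> add(2)] add(1)] add(4)] by simp
  qed
qed

lemma emb1_dspan:
  assumes U: "subring U A" and fs: "set fs \<subseteq> carrier A" and m: "m \<in> dspan A U fs"
  shows "emb1 m \<in> dspan R (tens_span K A B U (carrier B)) (map emb1 fs)"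
proof -
  note UC = subringE(1)[OF U]
  let ?D = "tens_span K A B U (carrier B)"
  have D: "subring ?D R" by (rule tens_span_subring[OF U B.carrier_is_subring])
  have FS: "set (map emb1 fs) \<subseteq> carrier R" using fs by auto
  have "dspan A U fs \<subseteq> {n \<in> carrier A. emb1 n \<in> dspan R ?D (map emb1 fs)}" (is "_ \<subseteq> ?V")
  proof (rule A.dspan_least)
    have "emb1 \<zero>\<^bsub>A\<^esub> = \<zero>\<^bsub>R\<^esub>" by (rule ring_hom_zero[OF emb1_hom A.ring_axioms R.ring_axioms])
    then show "\<zero>\<^bsub>A\<^esub> \<in> ?V" using R.dspan_zero[OF D FS] by simp
    fix x y assume "x \<in> ?V" "y \<in> ?V"
    then show "x \<oplus>\<^bsub>A\<^esub> y \<in> ?V" using R.dspan_add[OF D FS] by (simp add: ring_hom_add[OF emb1_hom])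
  next
    fix d f assume d: "d \<in> U" and f: "f \<in> set fs"
    have c: "d \<in> carrier A" "f \<in> carrier A" using d f UC fs by auto
    have "emb1 d \<in> ?D" unfolding emb1_def using tens_in_span[OF d B.one_closed UC subset_refl] .
    moreover have "emb1 f \<in> dspan R ?D (map emb1 fs)" using f by (intro R.dspan_mem[OF D FS]) auto
    ultimately show "d \<otimes>\<^bsub>A\<^esub> f \<in> ?V"
      using R.dspan_mult[OF D FS] c by (simp add: ring_hom_mult[OF emb1_hom])
  qed
  then show ?thesis using m by blast
qed

text \<open>Slicing into \<open>A\<close> turns coefficients from U \<otimes> B into coefficients
  from \<open>U\<close> and is linear over the generators, which come from \<open>A\<close>.\<close>

lemma slice2_dspan:
  assumes \<psi>: "functional K B \<psi>" and U: "subring U A" "subspace K A U"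
    and fs: "set fs \<subseteq> carrier A" and x: "x \<in> dspan R (tens_span K A B U (carrier B)) (map emb1 fs)"
  shows "slice2 \<psi> x \<in> dspan A U fs"
proof -
  note UC = subringE(1)[OF U(1)]
  let ?D = "tens_span K A B U (carrier B)"
  have DC: "?D \<subseteq> carrier R" by (rule tens_span_closed[OF UC subset_refl])
  have "dspan R ?D (map emb1 fs) \<subseteq> {n \<in> carrier R. slice2 \<psi> n \<in> dspan A U fs}" (is "_ \<subseteq> ?V")
  proof (rule R.dspan_least)
    show "\<zero>\<^bsub>R\<^esub> \<in> ?V" using A.dspan_zero[OF U(1) fs] slice2_zero[OF \<psi>] by simp
    fix x y assume "x \<in> ?V" "y \<in> ?V"
    then show "x \<oplus>\<^bsub>R\<^esub> y \<in> ?V" using A.dspan_add[OF U(1) fs] by (simp add: slice2[OF \<psi>])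
  next
    fix d f assume d: "d \<in> ?D" and "f \<in> set (map emb1 fs)"
    then obtain a where a: "a \<in> set fs" "f = emb1 a" by auto
    have c: "d \<in> carrier R" "a \<in> carrier A" using d a DC fs by auto
    have "slice2 \<psi> (d \<otimes>\<^bsub>R\<^esub> f) = slice2 \<psi> d \<otimes>\<^bsub>A\<^esub> a"
      using slice2_emb1[OF \<psi> c] c slice2(1)[OF \<psi> c(1)] by (simp add: a(2) R.m_comm A.m_comm)
    then show "d \<otimes>\<^bsub>R\<^esub> f \<in> ?V"
      using A.dspan_mult[OF U(1) fs slice2_span[OF \<psi> U(2) d] A.dspan_mem[OF U(1) fs a(1)]] c a(2) by simp
  qed
  then show ?thesis using x by blast
qed

text \<open>After inverting the nonzero elements of \<open>U\<close>, the ring \<open>A\<close> is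
  free over \<open>U\<close>, and R is free over U \<otimes> B. Without localizing, an annihilated
  element is written over finitely many generators. If a nonzero multiple of \<open>a\<close> by
  \<open>U\<close> depends on the other generators, the regular factor d removes \<open>a\<close>;
  otherwise the coefficient of \<open>a\<close> vanishes.\<close>

lemma span_nonzerodiv:
  assumes dom: "domain A" and U: "subring U A" "subspace K A U"
    and nzd: "no_zero_div R (tens_span K A B U (carrier B))"
    and z: "z \<in> tens_span K A B U (carrier B)" "z \<noteq> \<zero>\<^bsub>R\<^esub>"
  shows "nonzerodiv R z"
proof -
  note UC = subringE(1)[OF U(1)]
  let ?D = "tens_span K A B U (carrier B)"
  have D: "subring ?D R" by (rule tens_span_subring[OF U(1) B.carrier_is_subring])
  note DC = subringE(1)[OF D]
  have zR: "z \<in> carrier R" using z(1) DC by blast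
  have main: "x = \<zero>\<^bsub>R\<^esub>" if "set fs \<subseteq> carrier A" "x \<in> dspan R ?D (map emb1 fs)" "z \<otimes>\<^bsub>R\<^esub> x = \<zero>\<^bsub>R\<^esub>" for fs x
    using that
  proof (induction fs arbitrary: x)
    case Nil
    then show ?case by simp
  next
    case (Cons a fs)
    have a: "a \<in> carrier A" and fs: "set fs \<subseteq> carrier A" using Cons.prems(1) by auto
    have FS: "set (map emb1 fs) \<subseteq> carrier R" using fs by auto
    obtain y m where y: "y \<in> ?D" and m: "m \<in> dspan R ?D (map emb1 fs)" and x: "x = y \<otimes>\<^bsub>R\<^esub> emb1 a \<oplus>\<^bsub>R\<^esub> m"
      using Cons.prems(2) by auto
    have c: "y \<in> carrier R" "m \<in> carrier R" using y m DC R.dspan_closed[OF DC FS] by auto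
    then have xR: "x \<in> carrier R" using a by (simp add: x)
    show ?case
    proof (cases "\<exists>d\<in>U. d \<noteq> \<zero>\<^bsub>A\<^esub> \<and> d \<otimes>\<^bsub>A\<^esub> a \<in> dspan A U fs")
      case True
      then obtain d where d: "d \<in> U" "d \<noteq> \<zero>\<^bsub>A\<^esub>" "d \<otimes>\<^bsub>A\<^esub> a \<in> dspan A U fs" by blast
      have dA: "d \<in> carrier A" using d UC by blast
      have dD: "emb1 d \<in> ?D" unfolding emb1_def using tens_in_span[OF d(1) B.one_closed UC subset_refl] .
      have "emb1 d \<otimes>\<^bsub>R\<^esub> x = y \<otimes>\<^bsub>R\<^esub> emb1 (d \<otimes>\<^bsub>A\<^esub> a) \<oplus>\<^bsub>R\<^esub> emb1 d \<otimes>\<^bsub>R\<^esub> m"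
        using dA a c by (simp add: x ring_hom_mult[OF emb1_hom] R.r_distr R.m_lcomm)
      also have "\<dots> \<in> dspan R ?D (map emb1 fs)"
        by (intro R.dspan_add[OF D FS] R.dspan_mult[OF D FS] y dD m emb1_dspan[OF U(1) fs d(3)])
      finally have "emb1 d \<otimes>\<^bsub>R\<^esub> x \<in> dspan R ?D (map emb1 fs)" .
      moreover have "z \<otimes>\<^bsub>R\<^esub> (emb1 d \<otimes>\<^bsub>R\<^esub> x) = \<zero>\<^bsub>R\<^esub>"
        using Cons.prems(3) zR dA xR R.m_lcomm[of z "emb1 d" x] by simp
      ultimately have "emb1 d \<otimes>\<^bsub>R\<^esub> x = \<zero>\<^bsub>R\<^esub>" by (rule Cons.IH[OF fs])
      then show ?thesis using nonzerodivD(2)[OF emb1_nonzerodiv[OF dom dA d(2)] xR] by simp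
    next
      case False
      have zy: "z \<otimes>\<^bsub>R\<^esub> y \<in> ?D" using subringE(6)[OF D z(1) y] .
      have zm: "z \<otimes>\<^bsub>R\<^esub> m \<in> dspan R ?D (map emb1 fs)" by (rule R.dspan_mult[OF D FS z(1) m])
      have 0: "(z \<otimes>\<^bsub>R\<^esub> y) \<otimes>\<^bsub>R\<^esub> emb1 a \<oplus>\<^bsub>R\<^esub> z \<otimes>\<^bsub>R\<^esub> m = \<zero>\<^bsub>R\<^esub>"
        using Cons.prems(3) zR c a by (simp add: x R.r_distr R.m_assoc)
      \<comment> \<open>A nonzero slice would be a nonzero element of \<open>U\<close> that moves
        \<open>a\<close> into the span of the other generators.\<close>
      have "z \<otimes>\<^bsub>R\<^esub> y = \<zero>\<^bsub>R\<^esub>"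
      proof (rule slice2_separates)
        show "z \<otimes>\<^bsub>R\<^esub> y \<in> carrier R" using zR c by simp
        fix \<psi> assume \<psi>: "functional K B \<psi>"
        let ?s = "slice2 \<psi> (z \<otimes>\<^bsub>R\<^esub> y)" and ?t = "slice2 \<psi> (z \<otimes>\<^bsub>R\<^esub> m)"
        have sU: "?s \<in> U" by (rule slice2_span[OF \<psi> U(2) zy])
        have tU: "?t \<in> dspan A U fs" by (rule slice2_dspan[OF \<psi> U fs zm])
        have sA: "?s \<in> carrier A" "?t \<in> carrier A" using slice2(1)[OF \<psi>] zR c by auto
        have "slice2 \<psi> ((z \<otimes>\<^bsub>R\<^esub> y) \<otimes>\<^bsub>R\<^esub> emb1 a) = ?s \<otimes>\<^bsub>A\<^esub> a"
          using slice2_emb1[OF \<psi> _ a, of "z \<otimes>\<^bsub>R\<^esub> y"] zR c a sA R.m_comm[of "z \<otimes>\<^bsub>R\<^esub> y" "emb1 a"] A.m_comm[of ?s a] by simp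
        moreover have "slice2 \<psi> ((z \<otimes>\<^bsub>R\<^esub> y) \<otimes>\<^bsub>R\<^esub> emb1 a \<oplus>\<^bsub>R\<^esub> z \<otimes>\<^bsub>R\<^esub> m)
            = slice2 \<psi> ((z \<otimes>\<^bsub>R\<^esub> y) \<otimes>\<^bsub>R\<^esub> emb1 a) \<oplus>\<^bsub>A\<^esub> ?t"
          using zR c a by (intro slice2(2)[OF \<psi>]) auto
        ultimately have "?s \<otimes>\<^bsub>A\<^esub> a \<oplus>\<^bsub>A\<^esub> ?t = \<zero>\<^bsub>A\<^esub>" using 0 slice2_zero[OF \<psi>] by simp
        then have "?s \<otimes>\<^bsub>A\<^esub> a = \<ominus>\<^bsub>A\<^esub> ?t" using sA a A.minus_equality by simp
        then have "?s \<otimes>\<^bsub>A\<^esub> a \<in> dspan A U fs" using A.dspan_minus[OF U(1) fs tU] by simp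
        then show "?s = \<zero>\<^bsub>A\<^esub>" using False sU by blast
      qed
      then have "y = \<zero>\<^bsub>R\<^esub>" using no_zero_divD[OF nzd z(1) y _ z(2)] by simp
      then have "x = m" using c a by (simp add: x)
      then show ?thesis using Cons.IH[OF fs m] Cons.prems(3) by simp
    qed
  qed
  show ?thesis
    unfolding nonzerodiv_def
  proof (intro conjI ballI impI)
    show "z \<in> carrier R" by (rule zR)
    fix x assume x: "x \<in> carrier R" and 0: "z \<otimes>\<^bsub>R\<^esub> x = \<zero>\<^bsub>R\<^esub>"
    obtain ps where ps: "set ps \<subseteq> carrier A \<times> carrier B" "x = bsum R (tens K A B) ps"
      using tens_rep[OF x] by blast
    have "bsum R (tens K A B) qs \<in> dspan R ?D (map emb1 (map fst qs))"
      if "set qs \<subseteq> carrier A \<times> carrier B" for qs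
      using that
    proof (induction qs)
      case (Cons q qs)
      obtain a b where q: "q = (a, b)" by (cases q)
      have ab: "a \<in> carrier A" "b \<in> carrier B" using Cons.prems by (auto simp: q)
      have "bsum R (tens K A B) (q # qs) = emb2 b \<otimes>\<^bsub>R\<^esub> emb1 a \<oplus>\<^bsub>R\<^esub> bsum R (tens K A B) qs"
        using ab by (simp add: q tens_eq R.m_comm)
      moreover have "emb2 b \<in> ?D" unfolding emb2_def
        using tens_in_span[OF subringE(3)[OF U(1)] ab(2) UC subset_refl] .
      ultimately have "bsum R (tens K A B) (q # qs) \<in> dspan R ?D (emb1 a # map emb1 (map fst qs))"
        using Cons by (intro dspan_Cons_intro[where d = "emb2 b" and m = "bsum R (tens K A B) qs"]) auto
      then show ?case by (simp add: q)
    qed simp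
    from this[OF ps(1)] have xs: "x \<in> dspan R ?D (map emb1 (map fst ps))" unfolding ps(2) .
    have "set (map fst ps) \<subseteq> carrier A" using ps(1) by auto
    then show "x = \<zero>\<^bsub>R\<^esub>" using xs 0 by (rule main)
  qed
qed

end

subsection \<open>Separating minimal primes\<close>

lemma (in cring) nonzerodiv_pow: "nonzerodiv R z \<Longrightarrow> nonzerodiv R (z [^] (n::nat))"
proof (induction n)
  case (Suc n)
  then show ?case using nonzerodiv_mult[of "z [^] n" z] by simp
qed (simp add: nonzerodiv_def)

lemma (in primeideal) pow_mem: "z \<in> carrier R \<Longrightarrow> z [^] (n::nat) \<in> I \<Longrightarrow> z \<in> I"
proof (induction n)
  case 0
  then show ?case using one_imp_carrier I_notcarr by simp
next
  case (Suc n)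
  then show ?case using I_prime[of "z [^] n" z] by auto
qed

lemma no_zero_div_mono: "no_zero_div R E \<Longrightarrow> D \<subseteq> E \<Longrightarrow> no_zero_div R D"
  unfolding no_zero_div_def by blast

section \<open>A base over which R is algebraic\<close>

context tensor_pair
begin

lemma alg_over_all:
  assumes D: "subring D R" "no_zero_div R D" "\<one>\<^bsub>R\<^esub> \<noteq> \<zero>\<^bsub>R\<^esub>"
    and B: "\<And>b. b \<in> carrier B \<Longrightarrow> alg_over R D (emb2 b)"
    and A: "\<And>a. a \<in> carrier A \<Longrightarrow> alg_over R D (emb1 a)" and x: "x \<in> carrier R"
  shows "alg_over R D x"
  using x
proof (induction rule: tens_induct)
  case (tens a b)
  show ?case unfolding tens_eq[OF tens] using tens
    by (intro R.alg_over_add_mult(2)[OF D] A B emb1_closed emb2_closed)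
next
  case (add x y)
  show ?case by (rule R.alg_over_add_mult(1)[OF D add(1,3,2,4)])
qed

text \<open>A tensor involves finitely many elements of the union, and these lie in a single member
  of the chain.\<close>

lemma tens_span_directed:
  assumes "x \<in> tens_span K A B (\<Union>C) V" and CA: "\<And>U. U \<in> C \<Longrightarrow> U \<subseteq> carrier A" and V: "V \<subseteq> carrier B"
    and C: "C \<noteq> {}" "\<And>U U'. U \<in> C \<Longrightarrow> U' \<in> C \<Longrightarrow> U \<subseteq> U' \<or> U' \<subseteq> U"
  shows "\<exists>U\<in>C. x \<in> tens_span K A B U V"
proof -
  have UC: "\<Union>C \<subseteq> carrier A" using CA by blast
  show ?thesis using UC V assms(1)
  proof (induction rule: tens_span_induct)
    case zero
    obtain U where "U \<in> C" using C(1) by blast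
    then show ?case using tens_spanI[of "[]" U V] by (intro bexI[of _ U]) auto
  next
    case (add a b x)
    then obtain U U' where U: "U \<in> C" "a \<in> U" and U': "U' \<in> C" "x \<in> tens_span K A B U' V" by blast
    obtain Y where Y: "Y \<in> C" "U \<subseteq> Y" "U' \<subseteq> Y" using C(2)[OF U(1) U'(1)] U U' by blast
    have "tens K A B a b \<in> tens_span K A B Y V" using tens_in_span[OF _ add(2) CA[OF Y(1)] V] U Y by blast
    moreover have "x \<in> tens_span K A B Y V" using tens_span_mono[OF Y(3) subset_refl] U'(2) by blast
    ultimately show ?case using tens_span_add[OF CA[OF Y(1)] V] Y(1) by blast
  qed
qed

lemma subring_subspace:
  assumes U: "subring U A" and KU: "scalars K A \<subseteq> U"
  shows "subspace K A U"
  unfolding subspace_def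
proof (intro conjI ballI)
  show "U \<subseteq> carrier A" "\<zero>\<^bsub>A\<^esub> \<in> U" using subringE(1,2)[OF U] by auto
  show "x \<oplus>\<^bsub>A\<^esub> y \<in> U" if "x \<in> U" "y \<in> U" for x y using subringE(7)[OF U that] .
  fix c x assume c: "c \<in> carrier K" and x: "x \<in> U"
  have "(c \<odot>\<^bsub>A\<^esub> \<one>\<^bsub>A\<^esub>) \<otimes>\<^bsub>A\<^esub> x \<in> U" using c KU by (intro subringE(6)[OF U _ x]) (auto simp: scalars_def)
  then show "c \<odot>\<^bsub>A\<^esub> x \<in> U" using c x subringE(1)[OF U] by (simp add: smult_one_mult subset_iff)
qed

lemma scalars_left_subring: "subring (scalars K A) A"
  by (rule tensor_pair.scalars_subring[OF tensor_pairI[OF K.field_axioms KB.algebra_axioms KA.algebra_axioms]])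

lemma scalars_span:
  assumes "x \<in> tens_span K A B (scalars K A) (carrier B)"
  shows "\<exists>b\<in>carrier B. x = emb2 b"
  using subringE(1)[OF scalars_left_subring] subset_refl assms
proof (induction rule: tens_span_induct)
  case zero
  then show ?case using ring_hom_zero[OF emb2_hom B.ring_axioms R.ring_axioms] by (intro bexI[of _ "\<zero>\<^bsub>B\<^esub>"]) auto
next
  case (add a b x)
  obtain b' where b': "b' \<in> carrier B" "x = emb2 b'" using add(4) by blast
  obtain c where c: "c \<in> carrier K" "a = c \<odot>\<^bsub>A\<^esub> \<one>\<^bsub>A\<^esub>" using add(1) by (auto simp: scalars_def)
  have "tens K A B a b \<oplus>\<^bsub>R\<^esub> x = emb2 (c \<odot>\<^bsub>B\<^esub> b \<oplus>\<^bsub>B\<^esub> b')"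
    using b' c add(2) tens_smult[of c "\<one>\<^bsub>A\<^esub>" b] by (simp add: ring_hom_add[OF emb2_hom]) (simp add: emb2_def)
  then show ?case using b' c add(2) by blast
qed

lemma scalars_span_no_zero_div:
  assumes dom: "domain B"
  shows "no_zero_div R (tens_span K A B (scalars K A) (carrier B))"
  unfolding no_zero_div_def
proof (intro ballI impI)
  fix x y assume x: "x \<in> tens_span K A B (scalars K A) (carrier B)"
    and y: "y \<in> tens_span K A B (scalars K A) (carrier B)" and 0: "x \<otimes>\<^bsub>R\<^esub> y = \<zero>\<^bsub>R\<^esub>"
  obtain b b' where b: "b \<in> carrier B" "x = emb2 b" "b' \<in> carrier B" "y = emb2 b'"
    using scalars_span[OF x] scalars_span[OF y] by blast
  show "x = \<zero>\<^bsub>R\<^esub> \<or> y = \<zero>\<^bsub>R\<^esub>"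
  proof (cases "b = \<zero>\<^bsub>B\<^esub>")
    case True
    then show ?thesis using b(2) ring_hom_zero[OF emb2_hom B.ring_axioms R.ring_axioms] by simp
  next
    case False
    then show ?thesis using nonzerodivD(2)[OF emb2_nonzerodiv[OF dom b(1) False], of y] b 0 by simp
  qed
qed

text \<open>Lets U[a] \<otimes> B inherit the absence of zero divisors from a simple extension of U
  \<otimes> B.\<close>

lemma poly_ext_span:
  assumes U: "subring U A" and a: "a \<in> carrier A"
    and x: "x \<in> tens_span K A B (A.poly_ext U a) (carrier B)"
  shows "x \<in> R.poly_ext (tens_span K A B U (carrier B)) (emb1 a)"
proof -
  let ?D = "tens_span K A B U (carrier B)"
  have D: "subring ?D R" by (rule tens_span_subring[OF U B.carrier_is_subring])
  have E: "subring (R.poly_ext ?D (emb1 a)) R" using R.poly_ext_subring[OF D] a by simp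
  interpret e: ring_hom_ring A R emb1
    using emb1_hom A.ring_axioms R.ring_axioms by (intro ring_hom_ringI2)
  have 1: "emb1 d \<in> R.poly_ext ?D (emb1 a)" if d: "d \<in> A.poly_ext U a" for d
  proof -
    obtain n where n: "d \<in> dspan A U (map (\<lambda>i. a [^]\<^bsub>A\<^esub> i) (rev [0..<n]))" using d unfolding A.poly_ext_def by blast
    have "emb1 d \<in> dspan R ?D (map emb1 (map (\<lambda>i. a [^]\<^bsub>A\<^esub> i) (rev [0..<n])))"
      by (rule emb1_dspan[OF U A.pows_closed[OF a] n])
    moreover have "map emb1 (map (\<lambda>i. a [^]\<^bsub>A\<^esub> i) (rev [0..<n])) = map (\<lambda>i. emb1 a [^]\<^bsub>R\<^esub> i) (rev [0..<n])"
      using a by (simp add: e.hom_nat_pow)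
    ultimately have "emb1 d \<in> dspan R ?D (map (\<lambda>i. emb1 a [^]\<^bsub>R\<^esub> i) (rev [0..<n]))" by (simp only:)
    then show ?thesis unfolding R.poly_ext_def by (rule UN_I[OF UNIV_I])
  qed
  have 2: "emb2 b \<in> R.poly_ext ?D (emb1 a)" if "b \<in> carrier B" for b
  proof -
    have "emb2 b \<in> ?D" unfolding emb2_def
      using tens_in_span[OF subringE(3)[OF U] that subringE(1)[OF U] subset_refl] .
    then show ?thesis using R.poly_ext_incl[OF D emb1_closed[OF a]] by blast
  qed
  have UC: "A.poly_ext U a \<subseteq> carrier A" by (rule A.poly_ext_closed[OF U a])
  show ?thesis using UC subset_refl x
  proof (induction rule: tens_span_induct)
    case zero
    show ?case by (rule subringE(2)[OF E])
  next
    case (add d b x)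
    have "d \<in> carrier A" using add(1) UC by blast
    then have "tens K A B d b = emb1 d \<otimes>\<^bsub>R\<^esub> emb2 b" using add(2) by (rule tens_eq)
    then show ?case
      using subringE(7)[OF E subringE(6)[OF E 1[OF add(1)] 2[OF add(2)]] add(4)] by simp
  qed
qed

text \<open>In place of a transcendence basis: a subring \<open>U\<close> of \<open>A\<close> that is maximal for
  \<open>U \<otimes> B\<close> being a domain.\<close>

lemma algebraic_base:
  assumes domB: "domain B" and nontriv: "\<one>\<^bsub>R\<^esub> \<noteq> \<zero>\<^bsub>R\<^esub>"
  shows "\<exists>U. subring U A \<and> subspace K A U \<and> no_zero_div R (tens_span K A B U (carrier B)) \<and>
    (\<forall>a\<in>carrier A. alg_over R (tens_span K A B U (carrier B)) (emb1 a))"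
proof -
  let ?D = "\<lambda>U. tens_span K A B U (carrier B)"
  let ?F = "{U. subring U A \<and> scalars K A \<subseteq> U \<and> no_zero_div R (?D U)}"
  have "\<exists>U\<in>?F. \<forall>Y\<in>?F. U \<subseteq> Y \<longrightarrow> Y = U"
  proof (rule subset_Zorn_nonempty)
    \<comment> \<open>The family starts with the scalars: the image of k \<otimes> B in R consists
      of images of elements of the domain \<open>B\<close>.\<close>
    have "scalars K A \<in> ?F" using scalars_left_subring scalars_span_no_zero_div[OF domB] by simp
    then show "?F \<noteq> {}" by blast
    fix C assume ne: "C \<noteq> {}" and ch: "subset.chain ?F C"
    have CF: "subring U A" "scalars K A \<subseteq> U" "no_zero_div R (?D U)" "U \<subseteq> carrier A" if "U \<in> C" for U
    proof -
      have "U \<in> ?F" using that ch unfolding subset.chain_def by blast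
      then show "subring U A" "scalars K A \<subseteq> U" "no_zero_div R (?D U)" by simp_all
      then show "U \<subseteq> carrier A" by (intro subringE(1))
    qed
    have tot: "U \<subseteq> U' \<or> U' \<subseteq> U" if "U \<in> C" "U' \<in> C" for U U'
      using ch that unfolding subset.chain_def by blast
    have two: "\<exists>Y\<in>C. U \<subseteq> Y \<and> U' \<subseteq> Y" if "U \<in> C" "U' \<in> C" for U U'
      using tot[OF that] that by blast
    obtain U0 where U0: "U0 \<in> C" using ne by blast
    have "subring (\<Union>C) A"
    proof (rule A.subringI)
      show "\<Union>C \<subseteq> carrier A" using CF(4) by blast
      show "\<one>\<^bsub>A\<^esub> \<in> \<Union>C" using subringE(3)[OF CF(1)[OF U0]] U0 by blast
      show "\<ominus>\<^bsub>A\<^esub> x \<in> \<Union>C" if "x \<in> \<Union>C" for x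
      proof -
        obtain U where U: "U \<in> C" "x \<in> U" using \<open>x \<in> \<Union>C\<close> by blast
        show ?thesis using subringE(5)[OF CF(1)[OF U(1)] U(2)] U(1) by blast
      qed
      fix x y assume "x \<in> \<Union>C" "y \<in> \<Union>C"
      then obtain U U' where U: "U \<in> C" "x \<in> U" "U' \<in> C" "y \<in> U'" by blast
      obtain Y where Y: "Y \<in> C" "U \<subseteq> Y" "U' \<subseteq> Y" using two[OF U(1,3)] by blast
      have xy: "x \<in> Y" "y \<in> Y" using U Y by auto
      show "x \<otimes>\<^bsub>A\<^esub> y \<in> \<Union>C" using subringE(6)[OF CF(1)[OF Y(1)] xy] Y(1) by blast
      show "x \<oplus>\<^bsub>A\<^esub> y \<in> \<Union>C" using subringE(7)[OF CF(1)[OF Y(1)] xy] Y(1) by blast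
    qed
    moreover have "scalars K A \<subseteq> \<Union>C" using CF(2)[OF U0] U0 by blast
    moreover have "no_zero_div R (?D (\<Union>C))"
      unfolding no_zero_div_def
    proof (intro ballI impI)
      fix x y assume x: "x \<in> ?D (\<Union>C)" and y: "y \<in> ?D (\<Union>C)" and 0: "x \<otimes>\<^bsub>R\<^esub> y = \<zero>\<^bsub>R\<^esub>"
      obtain U where U: "U \<in> C" "x \<in> ?D U" using tens_span_directed[OF x CF(4) subset_refl ne tot] by blast
      obtain U' where U': "U' \<in> C" "y \<in> ?D U'" using tens_span_directed[OF y CF(4) subset_refl ne tot] by blast
      obtain Y where Y: "Y \<in> C" "U \<subseteq> Y" "U' \<subseteq> Y" using two[OF U(1) U'(1)] by blast
      have "x \<in> ?D Y" "y \<in> ?D Y"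
        using tens_span_mono[OF Y(2) subset_refl] tens_span_mono[OF Y(3) subset_refl] U(2) U'(2) by auto
      then show "x = \<zero>\<^bsub>R\<^esub> \<or> y = \<zero>\<^bsub>R\<^esub>" using CF(3)[OF Y(1)] 0 unfolding no_zero_div_def by blast
    qed
    ultimately show "\<Union>C \<in> ?F" by simp
  qed
  then obtain U where UF: "U \<in> ?F" and mx: "\<forall>Y\<in>?F. U \<subseteq> Y \<longrightarrow> Y = U" by (rule bexE)
  from UF have U: "subring U A" "scalars K A \<subseteq> U" "no_zero_div R (?D U)" by simp_all
  have D: "subring (?D U) R" by (rule tens_span_subring[OF U(1) B.carrier_is_subring])
  have "alg_over R (?D U) (emb1 a)" if a: "a \<in> carrier A" for a
  proof (rule ccontr)
    assume na: "\<not> ?thesis"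
    \<comment> \<open>If a \<otimes> 1 were transcendental over U \<otimes> B, then U[a] would
      belong to the family. Maximality puts \<open>a\<close> into \<open>U\<close>, where it is
      algebraic after all.\<close>
    let ?U = "A.poly_ext U a"
    have inc: "U \<subseteq> ?U" by (rule A.poly_ext_incl[OF U(1) a])
    have "?D ?U \<subseteq> R.poly_ext (?D U) (emb1 a)" by (rule subsetI, rule poly_ext_span[OF U(1) a])
    then have "no_zero_div R (?D ?U)"
      by (rule no_zero_div_mono[OF R.poly_ext_no_zero_div[OF D U(3) emb1_closed[OF a] na]])
    then have "?U \<in> ?F" using A.poly_ext_subring[OF U(1) a] order_trans[OF U(2) inc] by (intro CollectI conjI)
    from bspec[OF mx this] inc have "?U = U" by (rule mp)
    then have "a \<in> U" using A.poly_ext_self[OF U(1) a] by simp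
    then have "emb1 a \<in> ?D U"
      unfolding emb1_def using tens_in_span[OF _ B.one_closed subringE(1)[OF U(1)] subset_refl] by blast
    then show False using na R.alg_over_self[OF D nontriv] by blast
  qed
  then show ?thesis using U subring_subspace[OF U(1,2)] by blast
qed

end

context tensor_tower
begin

text \<open>The assumptions on \<open>P\<close> and \<open>Q\<close> speak of U \<otimes> B instead
  of minimality because the lemma is also applied to the preimages of two primes in l' \<otimes>
  A.\<close>

lemma separating_element:
  assumes ic: "integrally_closed_domain B" and U: "subring U A"
    and reg: "\<And>z. z \<in> tens_span K A B U (carrier B) \<Longrightarrow> z \<noteq> \<zero>\<^bsub>R\<^esub> \<Longrightarrow> nonzerodiv R z"
    and P: "primeideal P R"
      "\<And>z. z \<in> tens_span K A B U (carrier B) \<Longrightarrow> z \<noteq> \<zero>\<^bsub>R\<^esub> \<Longrightarrow> z \<notin> P"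
    and Q: "primeideal Q R"
      "\<And>z. z \<in> tens_span K A B U (carrier B) \<Longrightarrow> z \<noteq> \<zero>\<^bsub>R\<^esub> \<Longrightarrow> z \<notin> Q"
    and x: "x \<in> P" "x \<notin> Q" "alg_over R (tens_span K A B U (carrier B)) x"
  shows "\<exists>p\<in>tens_span K A B (carrier A) (alg_closure_in K B). p \<in> P \<and> p \<notin> Q"
proof -
  let ?D = "tens_span K A B U (carrier B)"
  have D: "subring ?D R" by (rule tens_span_subring[OF U B.carrier_is_subring])
  interpret P: primeideal P R by (rule P(1))
  interpret Q: primeideal Q R by (rule Q(1))
  have xR: "x \<in> carrier R" using P.Icarr x(1) .
  have nontriv: "\<one>\<^bsub>R\<^esub> \<noteq> \<zero>\<^bsub>R\<^esub>" using P.one_imp_carrier P.I_notcarr P.zero_closed by metis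
  obtain cs where cs: "set cs \<subseteq> ?D" "\<not> set cs \<subseteq> {\<zero>\<^bsub>R\<^esub>}" "R.eval cs x = \<zero>\<^bsub>R\<^esub>"
    using x(3) unfolding alg_over_def by blast
  obtain e g0 h where g0: "g0 \<in> ?D" "g0 \<noteq> \<zero>\<^bsub>R\<^esub>" and h: "h \<in> carrier R"
    and ev: "R.eval cs x = x [^]\<^bsub>R\<^esub> (e::nat) \<otimes>\<^bsub>R\<^esub> (g0 \<oplus>\<^bsub>R\<^esub> x \<otimes>\<^bsub>R\<^esub> h)"
    using R.eval_bottom[OF D xR cs(1,2)] by blast
  have g0R: "g0 \<in> carrier R" using g0 subringE(1)[OF D] by blast
  \<comment> \<open>With z = - x h the equation reads x^e (g0 - z) = 0. Multiplication by (- h)^e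
    turns x^e into z^e, so z may be replaced by g0 next to z^e; doing so e times gives y^2 = g
    y.\<close>
  define z where "z = x \<otimes>\<^bsub>R\<^esub> (\<ominus>\<^bsub>R\<^esub> h)"
  have zR: "z \<in> carrier R" using xR h by (simp add: z_def)
  have zP: "z \<in> P" unfolding z_def using P.I_r_closed[OF x(1)] h by simp
  have fac: "g0 \<oplus>\<^bsub>R\<^esub> x \<otimes>\<^bsub>R\<^esub> h = g0 \<ominus>\<^bsub>R\<^esub> z"
    using xR h by (simp add: z_def R.minus_eq R.r_minus)
  have xe: "x [^]\<^bsub>R\<^esub> e \<otimes>\<^bsub>R\<^esub> (g0 \<ominus>\<^bsub>R\<^esub> z) = \<zero>\<^bsub>R\<^esub>" using ev cs(3) fac by simp
  have g0P: "g0 \<notin> P" and g0Q: "g0 \<notin> Q" using P(2)[OF g0] Q(2)[OF g0] by auto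
  have g0z: "g0 = (g0 \<ominus>\<^bsub>R\<^esub> z) \<oplus>\<^bsub>R\<^esub> z" using g0R zR by (simp add: R.minus_eq R.a_assoc R.l_neg)
  have "z \<notin> Q"
  proof
    assume zQ: "z \<in> Q"
    have "x [^]\<^bsub>R\<^esub> e \<notin> Q" using Q.pow_mem[OF xR] x(2) by blast
    then have "g0 \<ominus>\<^bsub>R\<^esub> z \<in> Q"
      using Q.I_prime[of "x [^]\<^bsub>R\<^esub> e" "g0 \<ominus>\<^bsub>R\<^esub> z"] xe Q.zero_closed xR g0R zR by auto
    then have "g0 \<in> Q" using Q.a_closed[OF _ zQ] g0z by metis
    then show False using g0Q by contradiction
  qed
  define y where "y = z [^]\<^bsub>R\<^esub> e"
  define g where "g = g0 [^]\<^bsub>R\<^esub> e"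
  have yR: "y \<in> carrier R" and gR: "g \<in> carrier R" using zR g0R by (auto simp: y_def g_def)
  have yQ: "y \<notin> Q" unfolding y_def using Q.pow_mem[OF zR] \<open>z \<notin> Q\<close> by blast
  have yP: "y \<in> P"
  proof (cases e)
    \<comment> \<open>Here y would be 1, but the case cannot occur: g0 would equal z and lie in
      \<open>P\<close>.\<close>
    case 0
    then have "g0 = z" using xe g0R zR by simp
    then show ?thesis using zP g0P by simp
  next
    case (Suc n)
    then show ?thesis unfolding y_def using P.I_l_closed[OF zP] zR by simp
  qed
  have step: "y \<otimes>\<^bsub>R\<^esub> z = y \<otimes>\<^bsub>R\<^esub> g0"
  proof -
    have "y \<otimes>\<^bsub>R\<^esub> (g0 \<ominus>\<^bsub>R\<^esub> z) = (\<ominus>\<^bsub>R\<^esub> h) [^]\<^bsub>R\<^esub> e \<otimes>\<^bsub>R\<^esub> (x [^]\<^bsub>R\<^esub> e \<otimes>\<^bsub>R\<^esub> (g0 \<ominus>\<^bsub>R\<^esub> z))"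
      unfolding y_def z_def[THEN arg_cong[where f = "\<lambda>u. u [^]\<^bsub>R\<^esub> e"]] using xR h zR g0R
      by (simp add: R.nat_pow_distrib R.m_ac)
    also have "\<dots> = \<zero>\<^bsub>R\<^esub>" unfolding xe using h by simp
    finally have "y \<otimes>\<^bsub>R\<^esub> g0 \<ominus>\<^bsub>R\<^esub> y \<otimes>\<^bsub>R\<^esub> z = \<zero>\<^bsub>R\<^esub>"
      using yR g0R zR by (simp add: R.minus_eq R.r_distr R.r_minus)
    then show ?thesis using yR g0R zR by simp
  qed
  have "y \<otimes>\<^bsub>R\<^esub> z [^]\<^bsub>R\<^esub> n = y \<otimes>\<^bsub>R\<^esub> g0 [^]\<^bsub>R\<^esub> n" for n :: nat
  proof (induction n)
    case (Suc n)
    have "y \<otimes>\<^bsub>R\<^esub> z [^]\<^bsub>R\<^esub> Suc n = (y \<otimes>\<^bsub>R\<^esub> z [^]\<^bsub>R\<^esub> n) \<otimes>\<^bsub>R\<^esub> z" using yR zR by (simp add: R.m_assoc)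
    also have "\<dots> = (y \<otimes>\<^bsub>R\<^esub> z) \<otimes>\<^bsub>R\<^esub> g0 [^]\<^bsub>R\<^esub> n" unfolding Suc using yR zR g0R by (simp add: R.m_ac)
    also have "\<dots> = y \<otimes>\<^bsub>R\<^esub> g0 [^]\<^bsub>R\<^esub> Suc n" unfolding step using yR g0R by (simp add: R.m_ac)
    finally show ?case .
  qed simp
  from this[of e] have yy: "y \<otimes>\<^bsub>R\<^esub> y = g \<otimes>\<^bsub>R\<^esub> y" using yR gR by (simp add: y_def[symmetric] g_def[symmetric] R.m_comm)
  have gD: "g \<in> ?D" unfolding g_def
  proof (induction e)
    case (Suc n)
    then show ?case using subringE(6)[OF D Suc g0(1)] by simp
  qed (simp add: subringE(3)[OF D])
  have gz: "nonzerodiv R g" unfolding g_def by (rule R.nonzerodiv_pow[OF reg[OF g0]])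
  have gn: "g \<noteq> \<zero>\<^bsub>R\<^esub>" using nonzerodivD(2)[OF gz R.one_closed] nontriv by auto
  obtain p q where p: "p \<in> tens_span K A B (carrier A) (alg_closure_in K B)"
    and q: "q \<in> tens_span K A B U (alg_closure_in K B)" "q \<noteq> \<zero>\<^bsub>R\<^esub>" and pq: "p \<otimes>\<^bsub>R\<^esub> g = q \<otimes>\<^bsub>R\<^esub> y"
    using rational_solution[OF ic nontriv yR gz yy subringE(1)[OF U] gD] by blast
  have L: "alg_closure_in K B \<subseteq> carrier B" by (auto simp: alg_closure_in_def)
  have pR: "p \<in> carrier R" using tens_span_closed[OF subset_refl L] p by blast
  have qD: "q \<in> ?D" using tens_span_mono[OF subset_refl L] q(1) by blast
  note qz = reg[OF qD q(2)]
  note qR = nonzerodivD(1)[OF qz]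
  have "q \<otimes>\<^bsub>R\<^esub> y \<in> P" using P.I_l_closed[OF yP qR] .
  then have "p \<in> P" using P.I_prime[OF pR gR] P(2)[OF gD gn] pq by auto
  moreover have "p \<notin> Q"
  proof
    assume "p \<in> Q"
    then have "q \<otimes>\<^bsub>R\<^esub> y \<in> Q" using Q.I_r_closed[OF _ gR] pq by metis
    then show False using Q.I_prime[OF qR yR] Q(2)[OF qD q(2)] yQ by blast
  qed
  ultimately show ?thesis using p by blast
qed

end

section \<open>The second pass, with l' as left factor\<close>

lemma tensor_towerI: "tensor_pair K A B \<Longrightarrow> tensor_tower K A B"
proof -
  assume "tensor_pair K A B"
  then interpret tensor_pair K A B .
  show ?thesis
    by (intro tensor_tower.intro tensor_pairI tensor_pair_axioms K.field_axioms KR.algebra_axioms KB.algebra_axioms)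
qed

text \<open>Injectivity on the coefficients keeps the transported equation nontrivial.\<close>

lemma (in ring_hom_ring) alg_over_hom:
  assumes D: "D \<subseteq> carrier R" "h ` D \<subseteq> E" and x: "x \<in> carrier R" "alg_over R D x"
    and inj: "\<And>d. d \<in> D \<Longrightarrow> h d = \<zero>\<^bsub>S\<^esub> \<Longrightarrow> d = \<zero>\<^bsub>R\<^esub>"
  shows "alg_over S E (h x)"
proof -
  obtain cs where cs: "set cs \<subseteq> D" "\<not> set cs \<subseteq> {\<zero>\<^bsub>R\<^esub>}" "R.eval cs x = \<zero>\<^bsub>R\<^esub>"
    using x(2) unfolding alg_over_def by blast
  have "set cs \<subseteq> carrier R" using cs(1) D(1) by (rule order_trans)
  then have "S.eval (map h cs) (h x) = \<zero>\<^bsub>S\<^esub>" using eval_hom'[OF x(1), of cs] cs(3) by simp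
  moreover have "set (map h cs) \<subseteq> E" unfolding set_map using image_mono[OF cs(1)] D(2) by (rule order_trans)
  moreover obtain d where d: "d \<in> set cs" "d \<noteq> \<zero>\<^bsub>R\<^esub>" using cs(2) by blast
  then have "h d \<noteq> \<zero>\<^bsub>S\<^esub>" using inj cs(1) by (metis subsetD)
  then have "\<not> set (map h cs) \<subseteq> {\<zero>\<^bsub>S\<^esub>}" using d(1) by auto
  ultimately show ?thesis unfolding alg_over_def by blast
qed

context tensor_pair
begin

lemma emb1_ring_hom: "ring_hom_ring A R emb1"
  using emb1_hom A.ring_axioms R.ring_axioms by (intro ring_hom_ringI2)

lemma emb2_ring_hom: "ring_hom_ring B R emb2"
  using emb2_hom B.ring_axioms R.ring_axioms by (intro ring_hom_ringI2)

lemma emb1_eq_zero: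
  assumes "domain A" "\<one>\<^bsub>R\<^esub> \<noteq> \<zero>\<^bsub>R\<^esub>" "a \<in> carrier A" "emb1 a = \<zero>\<^bsub>R\<^esub>"
  shows "a = \<zero>\<^bsub>A\<^esub>"
  using nonzerodivD(2)[OF emb1_nonzerodiv[OF assms(1,3)] R.one_closed] assms(2,4) by auto

lemma emb2_eq_zero:
  assumes "domain B" "\<one>\<^bsub>R\<^esub> \<noteq> \<zero>\<^bsub>R\<^esub>" "b \<in> carrier B" "emb2 b = \<zero>\<^bsub>R\<^esub>"
  shows "b = \<zero>\<^bsub>B\<^esub>"
  using nonzerodivD(2)[OF emb2_nonzerodiv[OF assms(1,3)] R.one_closed] assms(2,4) by auto

lemma alg_closure_subring:
  assumes one: "\<one>\<^bsub>B\<^esub> \<noteq> \<zero>\<^bsub>B\<^esub>"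
  shows "subring (alg_closure_in K B) B" "scalars K B \<subseteq> alg_closure_in K B"
proof -
  note D = scalars_subring
  note SC = subringE(1)[OF D]
  show inc: "scalars K B \<subseteq> alg_closure_in K B"
    using B.alg_over_self[OF D one] SC unfolding alg_closure_in_def by blast
  show "subring (alg_closure_in K B) B"
  proof (rule B.subringI)
    show "alg_closure_in K B \<subseteq> carrier B" unfolding alg_closure_in_def by blast
    show "\<one>\<^bsub>B\<^esub> \<in> alg_closure_in K B" using inc subringE(3)[OF D] by blast
    fix x assume x: "x \<in> alg_closure_in K B"
    then have xB: "x \<in> carrier B" "alg_over B (scalars K B) x" by (auto simp: alg_closure_in_def)
    have m: "\<ominus>\<^bsub>B\<^esub> \<one>\<^bsub>B\<^esub> \<in> scalars K B" using subringE(5)[OF D subringE(3)[OF D]] .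
    have "alg_over B (scalars K B) ((\<ominus>\<^bsub>B\<^esub> \<one>\<^bsub>B\<^esub>) \<otimes>\<^bsub>B\<^esub> x)"
      using B.alg_over_add_mult(2)[OF D scalars_no_zero_div one _ B.alg_over_self[OF D one m] xB] by simp
    then show "\<ominus>\<^bsub>B\<^esub> x \<in> alg_closure_in K B" using xB by (simp add: alg_closure_in_def B.l_minus)
    fix y assume "y \<in> alg_closure_in K B"
    then have yB: "y \<in> carrier B" "alg_over B (scalars K B) y" by (auto simp: alg_closure_in_def)
    show "x \<otimes>\<^bsub>B\<^esub> y \<in> alg_closure_in K B" "x \<oplus>\<^bsub>B\<^esub> y \<in> alg_closure_in K B"
      using B.alg_over_add_mult[OF D scalars_no_zero_div one xB yB] xB yB by (simp_all add: alg_closure_in_def)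
  qed
qed

text \<open>Makes l' usable as a tensor factor: only the carrier shrinks, and the operations are
  those of \<open>B\<close>.\<close>

lemma subring_algebra:
  assumes L: "subring L B" "scalars K B \<subseteq> L"
  shows "algebra K (B\<lparr>carrier := L\<rparr>)"
proof (rule algebraI)
  note LC = subsetD[OF subringE(1)[OF L(1)]]
  show "cring K" by (rule K.is_cring)
  show "cring (B\<lparr>carrier := L\<rparr>)"
    using B.subcring_iff[OF subringE(1)[OF L(1)]] B.subcringI'[OF L(1)] by simp
  fix c x assume c: "c \<in> carrier K" and "x \<in> carrier (B\<lparr>carrier := L\<rparr>)"
  then have x: "x \<in> L" by simp
  have "(c \<odot>\<^bsub>B\<^esub> \<one>\<^bsub>B\<^esub>) \<otimes>\<^bsub>B\<^esub> x \<in> L" using c L(2) by (intro subringE(6)[OF L(1) _ x]) (auto simp: scalars_def)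
  then show "c \<odot>\<^bsub>B\<lparr>carrier := L\<rparr>\<^esub> x \<in> carrier (B\<lparr>carrier := L\<rparr>)"
    using c LC[OF x] by (simp add: smult_one_mult)
qed (use subsetD[OF subringE(1)[OF L(1)]] in
    \<open>simp_all add: KB.smult_l_distr KB.smult_r_distr KB.smult_assoc1 KB.smult_assoc2\<close>)

end

context tensor_tower
begin

text \<open>When the left factor is algebraic over k, the scalars themselves can serve as
  \<open>U\<close>. Then U \<otimes> B is a copy of \<open>B\<close>, and avoiding the nonzero
  elements of \<open>B\<close> is all that is asked of the primes.\<close>

lemma algebraic_separating_left:
  assumes domA: "domain A" and ic: "integrally_closed_domain B"
    and alg: "\<And>a. a \<in> carrier A \<Longrightarrow> alg_over A (scalars K A) a"
    and P: "primeideal P R" "\<And>b. b \<in> carrier B \<Longrightarrow> b \<noteq> \<zero>\<^bsub>B\<^esub> \<Longrightarrow> emb2 b \<notin> P"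
    and Q: "primeideal Q R" "\<And>b. b \<in> carrier B \<Longrightarrow> b \<noteq> \<zero>\<^bsub>B\<^esub> \<Longrightarrow> emb2 b \<notin> Q"
    and x: "x \<in> P" "x \<notin> Q"
  shows "\<exists>p\<in>tens_span K A B (carrier A) (alg_closure_in K B). p \<in> P \<and> p \<notin> Q"
proof -
  have domB: "domain B" using ic by (simp add: integrally_closed_domain_def)
  let ?D = "tens_span K A B (scalars K A) (carrier B)"
  have D: "subring ?D R" by (rule tens_span_subring[OF scalars_left_subring B.carrier_is_subring])
  interpret P: primeideal P R by (rule P(1))
  have nontriv: "\<one>\<^bsub>R\<^esub> \<noteq> \<zero>\<^bsub>R\<^esub>" using P.one_imp_carrier P.I_notcarr P.zero_closed by metis
  have el: "\<exists>b\<in>carrier B. b \<noteq> \<zero>\<^bsub>B\<^esub> \<and> z = emb2 b" if z: "z \<in> ?D" "z \<noteq> \<zero>\<^bsub>R\<^esub>" for z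
  proof -
    obtain b where b: "b \<in> carrier B" "z = emb2 b" using scalars_span[OF z(1)] by blast
    then show ?thesis using z(2) ring_hom_zero[OF emb2_hom B.ring_axioms R.ring_axioms] by metis
  qed
  interpret e1: ring_hom_ring A R emb1 by (rule emb1_ring_hom)
  note SC = subringE(1)[OF scalars_left_subring]
  have "alg_over R ?D (emb1 a)" if a: "a \<in> carrier A" for a
  proof (rule e1.alg_over_hom[OF SC _ a alg[OF a]])
    show "emb1 ` scalars K A \<subseteq> ?D"
      unfolding emb1_def using tens_in_span[OF _ B.one_closed SC subset_refl] by (rule image_subsetI)
    show "d = \<zero>\<^bsub>A\<^esub>" if "d \<in> scalars K A" "emb1 d = \<zero>\<^bsub>R\<^esub>" for d
      using emb1_eq_zero[OF domA nontriv subsetD[OF SC that(1)] that(2)] .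
  qed
  moreover have "alg_over R ?D (emb2 b)" if "b \<in> carrier B" for b
    unfolding emb2_def
    by (rule R.alg_over_self[OF D nontriv tens_in_span[OF subringE(3)[OF scalars_left_subring] that SC subset_refl]])
  ultimately have xalg: "alg_over R ?D x"
    by (rule alg_over_all[OF D scalars_span_no_zero_div[OF domB] nontriv _ _ P.Icarr[OF x(1)], rotated])
  show ?thesis
  proof (rule separating_element[OF ic scalars_left_subring _ P(1) _ Q(1) _ x xalg])
    fix z assume z: "z \<in> ?D" "z \<noteq> \<zero>\<^bsub>R\<^esub>"
    obtain b where b: "b \<in> carrier B" "b \<noteq> \<zero>\<^bsub>B\<^esub>" "z = emb2 b" using el[OF z] by blast
    show "nonzerodiv R z" "z \<notin> P" "z \<notin> Q"
      unfolding b(3) using emb2_nonzerodiv[OF domB b(1,2)] P(2)[OF b(1,2)] Q(2)[OF b(1,2)] by auto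
  qed
qed

end

context tensor_pair
begin

text \<open>The factors are exchanged so that \<open>A\<close> becomes the integrally closed right
  factor, with l' on the left. The map \<sigma> from l' \<otimes> A to R pulls \<open>P\<close> and
  \<open>Q\<close> back to primes about whose minimality nothing is claimed. They avoid the nonzero
  elements of \<open>A\<close>, because these are regular in R.\<close>

lemma algebraic_separating_element:
  assumes icA: "integrally_closed_domain A" and icB: "integrally_closed_domain B"
    and P: "primeideal P R" "\<And>z. nonzerodiv R z \<Longrightarrow> z \<notin> P"
    and Q: "primeideal Q R" "\<And>z. nonzerodiv R z \<Longrightarrow> z \<notin> Q"
    and p: "p \<in> tens_span K A B (carrier A) (alg_closure_in K B)" "p \<in> P" "p \<notin> Q"
  shows "\<exists>w. w \<in> P \<and> w \<notin> Q \<and> alg_over R (scalars K R) w"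
proof -
  define L where "L = alg_closure_in K B"
  let ?B = "B\<lparr>carrier := L\<rparr>"
  have domA: "domain A" and domB: "domain B" using icA icB by (simp_all add: integrally_closed_domain_def)
  interpret dB: domain B by (rule domB)
  interpret P: primeideal P R by (rule P(1))
  have nontriv: "\<one>\<^bsub>R\<^esub> \<noteq> \<zero>\<^bsub>R\<^esub>" using P.one_imp_carrier P.I_notcarr P.zero_closed by metis
  have L: "subring L B" "scalars K B \<subseteq> L"
    using alg_closure_subring[OF dB.one_not_zero] unfolding L_def by simp_all
  note LC = subringE(1)[OF L(1)]
  have domL: "domain ?B" by (rule dB.subring_is_domain[OF L(1)])
  have LA: "alg_closure_in K A \<subseteq> carrier A" by (auto simp: alg_closure_in_def)
  interpret V: tensor_tower K ?B A
    by (rule tensor_towerI[OF tensor_pairI[OF K.field_axioms subring_algebra[OF L] KA.algebra_axioms]])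
  have "emb2 \<in> ring_hom ?B R"
    using LC by (intro ring_hom_memI) (auto simp: subset_iff ring_hom_add[OF emb2_hom] ring_hom_mult[OF emb2_hom] ring_hom_one[OF emb2_hom])
  from V.tens_ring_lift[OF R.is_cring this emb1_hom]
  obtain \<sigma> where \<sigma>: "\<sigma> \<in> ring_hom V.R R"
    and \<sigma>t: "\<And>b a. b \<in> L \<Longrightarrow> a \<in> carrier A \<Longrightarrow> \<sigma> (tens K ?B A b a) = emb2 b \<otimes>\<^bsub>R\<^esub> emb1 a"
    by (simp add: emb1_scalar) blast
  have s: "\<sigma> (tens K ?B A b a) = tens K A B a b" if "b \<in> L" "a \<in> carrier A" for a b
    using \<sigma>t[OF that] that LC by (simp add: tens_eq subset_iff R.m_comm)
  interpret s: ring_hom_ring V.R R \<sigma>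
    using \<sigma> V.R.ring_axioms R.ring_axioms by (intro ring_hom_ringI2)
  let ?v = "\<lambda>I. {r \<in> carrier V.R. \<sigma> r \<in> I}"
  have "\<exists>x\<in>carrier V.R. \<sigma> x = p"
    using subset_refl LC p(1)[folded L_def]
  proof (induction rule: tens_span_induct)
    case zero
    show ?case by (intro bexI[of _ "\<zero>\<^bsub>V.R\<^esub>"]) auto
  next
    case (add a b x)
    then obtain y where y: "y \<in> carrier V.R" "\<sigma> y = x" by blast
    have "tens K ?B A b a \<in> carrier V.R" using add(1,2) by (intro V.tens_closed) auto
    then show ?case using y s[OF add(2,1)] by (intro bexI[of _ "tens K ?B A b a \<oplus>\<^bsub>V.R\<^esub> y"]) auto
  qed
  then obtain x where x: "x \<in> carrier V.R" "\<sigma> x = p" by blast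
  have s2: "\<sigma> (V.emb2 a) = emb1 a" if "a \<in> carrier A" for a
    unfolding V.emb2_def using \<sigma>t[of "\<one>\<^bsub>B\<^esub>" a] subringE(3)[OF L(1)] that by (simp add: ring_hom_one[OF emb2_hom])
  have avoid: "V.emb2 a \<notin> ?v I" if "a \<in> carrier A" "a \<noteq> \<zero>\<^bsub>A\<^esub>" "\<And>z. nonzerodiv R z \<Longrightarrow> z \<notin> I" for a I
    using s2[OF that(1)] that(3)[OF emb1_nonzerodiv[OF domA that(1,2)]] by simp
  have "\<exists>w\<in>tens_span K ?B A (carrier ?B) (alg_closure_in K A). w \<in> ?v P \<and> w \<notin> ?v Q"
  proof (rule V.algebraic_separating_left[OF domL icA])
    show "primeideal (?v P) V.R" "primeideal (?v Q) V.R"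
      by (rule s.primeideal_vimage[OF V.R.is_cring P(1)], rule s.primeideal_vimage[OF V.R.is_cring Q(1)])
    show "V.emb2 a \<notin> ?v P" "V.emb2 a \<notin> ?v Q" if "a \<in> carrier A" "a \<noteq> \<zero>\<^bsub>A\<^esub>" for a
      by (rule avoid[OF that P(2)], assumption, rule avoid[OF that Q(2)])
    show "x \<in> ?v P" "x \<notin> ?v Q" using x p(2,3) by auto
    fix b assume "b \<in> carrier ?B"
    then have "alg_over B (scalars K B) b" by (simp add: L_def alg_closure_in_def)
    then show "alg_over ?B (scalars K ?B) b"
      unfolding alg_over_def scalars_def by (simp add: B.eval_consistent[OF L(1)])
  qed
  then obtain w where w: "w \<in> tens_span K ?B A (carrier ?B) (alg_closure_in K A)" "\<sigma> w \<in> P" "w \<notin> ?v Q" by blast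
  have wR: "w \<in> carrier V.R" using V.tens_span_closed[OF subset_refl LA] w(1) by blast
  have KRp: "tensor_pair K A R" by (rule tensor_pairI[OF K.field_axioms KA.algebra_axioms KR.algebra_axioms])
  note D = tensor_pair.scalars_subring[OF KRp] tensor_pair.scalars_no_zero_div[OF KRp] nontriv
  interpret e1: ring_hom_ring A R emb1 by (rule emb1_ring_hom)
  interpret e2: ring_hom_ring B R emb2 by (rule emb2_ring_hom)
  have a1: "alg_over R (scalars K R) (emb1 a)" if "a \<in> alg_closure_in K A" for a
  proof (rule e1.alg_over_hom[where D = "scalars K A"])
    show "a \<in> carrier A" "alg_over A (scalars K A) a" using that by (auto simp: alg_closure_in_def)
    show "scalars K A \<subseteq> carrier A" by (rule subringE(1)[OF scalars_left_subring])
    then show "d = \<zero>\<^bsub>A\<^esub>" if "d \<in> scalars K A" "emb1 d = \<zero>\<^bsub>R\<^esub>" for d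
      using that by (intro emb1_eq_zero[OF domA nontriv]) auto
    show "emb1 ` scalars K A \<subseteq> scalars K R" by (auto simp: scalars_def emb_scalar)
  qed
  have a2: "alg_over R (scalars K R) (emb2 b)" if "b \<in> L" for b
  proof (rule e2.alg_over_hom[where D = "scalars K B"])
    show "b \<in> carrier B" "alg_over B (scalars K B) b" using that by (auto simp: L_def alg_closure_in_def)
    show "scalars K B \<subseteq> carrier B" by (rule subringE(1)[OF scalars_subring])
    then show "d = \<zero>\<^bsub>B\<^esub>" if "d \<in> scalars K B" "emb2 d = \<zero>\<^bsub>R\<^esub>" for d
      using that by (intro emb2_eq_zero[OF domB nontriv]) auto
    show "emb2 ` scalars K B \<subseteq> scalars K R" by (auto simp: scalars_def emb_scalar emb1_scalar[symmetric])
  qed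
  have "alg_over R (scalars K R) (\<sigma> w)"
    using subset_refl LA w(1)
  proof (induction rule: V.tens_span_induct)
    case zero
    show ?case using R.alg_over_self[OF D(1) nontriv subringE(2)[OF D(1)]] by simp
  next
    case (add b a x)
    have ba: "b \<in> L" "a \<in> carrier A" "b \<in> carrier B" using add(1,2) LA LC by auto
    have xR: "x \<in> carrier V.R" using V.tens_span_closed[OF subset_refl LA] add(3) by blast
    have "alg_over R (scalars K R) (emb2 b \<otimes>\<^bsub>R\<^esub> emb1 a)"
      by (rule R.alg_over_add_mult(2)[OF D emb2_closed[OF ba(3)] a2[OF ba(1)] emb1_closed[OF ba(2)] a1[OF add(2)]])
    then have "alg_over R (scalars K R) ((emb2 b \<otimes>\<^bsub>R\<^esub> emb1 a) \<oplus>\<^bsub>R\<^esub> \<sigma> x)"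
      using ba xR by (intro R.alg_over_add_mult(1)[OF D] add(4)) auto
    moreover have "tens K ?B A b a \<in> carrier V.R" using ba by (intro V.tens_closed) auto
    ultimately show ?case using xR \<sigma>t[OF ba(1,2)] by simp
  qed
  then show ?thesis using w(2,3) wR by blast
qed

lemma comaximal_of_algebraic:
  assumes P: "primeideal P R" and Q: "primeideal Q R" and w: "w \<in> P" "w \<notin> Q" "alg_over R (scalars K R) w"
  shows "comaximal R P Q"
proof -
  interpret P: primeideal P R by (rule P)
  interpret Q: primeideal Q R by (rule Q)
  have KRp: "tensor_pair K A R" by (rule tensor_pairI[OF K.field_axioms KA.algebra_axioms KR.algebra_axioms])
  note D = tensor_pair.scalars_subring[OF KRp]
  have wR: "w \<in> carrier R" using P.Icarr w(1) .
  obtain cs where cs: "set cs \<subseteq> scalars K R" "\<not> set cs \<subseteq> {\<zero>\<^bsub>R\<^esub>}" "R.eval cs w = \<zero>\<^bsub>R\<^esub>"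
    using w(3) unfolding alg_over_def by blast
  obtain e g h where g: "g \<in> scalars K R" "g \<noteq> \<zero>\<^bsub>R\<^esub>" and h: "h \<in> carrier R"
    and ev: "R.eval cs w = w [^]\<^bsub>R\<^esub> (e::nat) \<otimes>\<^bsub>R\<^esub> (g \<oplus>\<^bsub>R\<^esub> w \<otimes>\<^bsub>R\<^esub> h)"
    using R.eval_bottom[OF D wR cs(1,2)] by blast
  obtain g' where g': "g' \<in> scalars K R" "g' \<otimes>\<^bsub>R\<^esub> g = \<one>\<^bsub>R\<^esub>"
    using tensor_pair.scalars_inv[OF KRp g] by blast
  have c: "g \<in> carrier R" "g' \<in> carrier R" using g g' subringE(1)[OF D] by auto
  have "w [^]\<^bsub>R\<^esub> e \<notin> Q" using Q.pow_mem[OF wR] w(2) by blast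
  then have gQ: "g \<oplus>\<^bsub>R\<^esub> w \<otimes>\<^bsub>R\<^esub> h \<in> Q"
    using Q.I_prime[of "w [^]\<^bsub>R\<^esub> e" "g \<oplus>\<^bsub>R\<^esub> w \<otimes>\<^bsub>R\<^esub> h"] ev cs(3) Q.zero_closed wR c h by auto
  \<comment> \<open>Since g' g = 1, every r equals r g' g, and g is the sum of - w h from
    \<open>P\<close> and g + w h from \<open>Q\<close>.\<close>
  have decomp: "r = (r \<otimes>\<^bsub>R\<^esub> g') \<otimes>\<^bsub>R\<^esub> (w \<otimes>\<^bsub>R\<^esub> (\<ominus>\<^bsub>R\<^esub> h)) \<oplus>\<^bsub>R\<^esub> (r \<otimes>\<^bsub>R\<^esub> g') \<otimes>\<^bsub>R\<^esub> (g \<oplus>\<^bsub>R\<^esub> w \<otimes>\<^bsub>R\<^esub> h)"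
    if r: "r \<in> carrier R" for r
  proof -
    have "w \<otimes>\<^bsub>R\<^esub> (\<ominus>\<^bsub>R\<^esub> h) \<oplus>\<^bsub>R\<^esub> (g \<oplus>\<^bsub>R\<^esub> w \<otimes>\<^bsub>R\<^esub> h) = g"
      using wR h c by (simp add: R.r_minus R.a_lcomm R.l_neg)
    then have "(r \<otimes>\<^bsub>R\<^esub> g') \<otimes>\<^bsub>R\<^esub> (w \<otimes>\<^bsub>R\<^esub> (\<ominus>\<^bsub>R\<^esub> h)) \<oplus>\<^bsub>R\<^esub> (r \<otimes>\<^bsub>R\<^esub> g') \<otimes>\<^bsub>R\<^esub> (g \<oplus>\<^bsub>R\<^esub> w \<otimes>\<^bsub>R\<^esub> h)
        = (r \<otimes>\<^bsub>R\<^esub> g') \<otimes>\<^bsub>R\<^esub> g"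
      using r wR h c R.r_distr[of "w \<otimes>\<^bsub>R\<^esub> (\<ominus>\<^bsub>R\<^esub> h)" "g \<oplus>\<^bsub>R\<^esub> w \<otimes>\<^bsub>R\<^esub> h" "r \<otimes>\<^bsub>R\<^esub> g'"] by simp
    then show ?thesis using r c g'(2) by (simp add: R.m_assoc)
  qed
  have "carrier R \<subseteq> P <+>\<^bsub>R\<^esub> Q"
  proof
    fix r assume r: "r \<in> carrier R"
    have "(r \<otimes>\<^bsub>R\<^esub> g') \<otimes>\<^bsub>R\<^esub> (w \<otimes>\<^bsub>R\<^esub> (\<ominus>\<^bsub>R\<^esub> h)) \<in> P"
      using P.I_l_closed[OF P.I_r_closed[OF w(1)]] r c h by simp
    moreover have "(r \<otimes>\<^bsub>R\<^esub> g') \<otimes>\<^bsub>R\<^esub> (g \<oplus>\<^bsub>R\<^esub> w \<otimes>\<^bsub>R\<^esub> h) \<in> Q"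
      using Q.I_l_closed[OF gQ] r c by simp
    ultimately show "r \<in> P <+>\<^bsub>R\<^esub> Q"
      using decomp[OF r] unfolding set_add_def' by blast
  qed
  moreover have "P <+>\<^bsub>R\<^esub> Q \<subseteq> carrier R"
    unfolding set_add_def' using P.Icarr Q.Icarr by blast
  ultimately show ?thesis unfolding comaximal_def by blast
qed

lemma minimal_primes_comaximal:
  assumes icA: "integrally_closed_domain A" and icB: "integrally_closed_domain B"
    and P: "minimal_prime R P" and Q: "minimal_prime R Q" and PQ: "P \<noteq> Q"
  shows "comaximal R P Q"
proof -
  have domA: "domain A" and domB: "domain B" using icA icB by (simp_all add: integrally_closed_domain_def)
  have Pp: "primeideal P R" and Qp: "primeideal Q R" using P Q by (simp_all add: minimal_prime_def)
  interpret P: primeideal P R by (rule Pp)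
  have nontriv: "\<one>\<^bsub>R\<^esub> \<noteq> \<zero>\<^bsub>R\<^esub>" using P.one_imp_carrier P.I_notcarr P.zero_closed by metis
  note nzP = R.minimal_prime_nonzerodiv[OF P] and nzQ = R.minimal_prime_nonzerodiv[OF Q]
  obtain x where x: "x \<in> P" "x \<notin> Q"
  proof -
    have "\<not> P \<subseteq> Q" using Q Pp PQ unfolding minimal_prime_def by blast
    then show thesis using that by blast
  qed
  obtain U where U: "subring U A" "subspace K A U" "no_zero_div R (tens_span K A B U (carrier B))"
    and alg: "\<forall>a\<in>carrier A. alg_over R (tens_span K A B U (carrier B)) (emb1 a)"
    using algebraic_base[OF domB nontriv] by blast
  let ?D = "tens_span K A B U (carrier B)"
  have D: "subring ?D R" by (rule tens_span_subring[OF U(1) B.carrier_is_subring])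
  have reg: "nonzerodiv R z" if "z \<in> ?D" "z \<noteq> \<zero>\<^bsub>R\<^esub>" for z
    by (rule span_nonzerodiv[OF domA U that])
  have "alg_over R ?D (emb2 b)" if "b \<in> carrier B" for b
    unfolding emb2_def
    by (rule R.alg_over_self[OF D nontriv tens_in_span[OF subringE(3)[OF U(1)] that subringE(1)[OF U(1)] subset_refl]])
  then have xalg: "alg_over R ?D x"
    by (rule alg_over_all[OF D U(3) nontriv _ bspec[OF alg] P.Icarr[OF x(1)]])
  interpret V: tensor_tower K A B by (rule tensor_towerI[OF tensor_pair_axioms])
  have "\<exists>p\<in>tens_span K A B (carrier A) (alg_closure_in K B). p \<in> P \<and> p \<notin> Q"
  proof (rule V.separating_element[OF icB U(1) reg Pp _ Qp _ x xalg])
    show "z \<notin> P" "z \<notin> Q" if "z \<in> ?D" "z \<noteq> \<zero>\<^bsub>R\<^esub>" for z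
      using nzP[OF reg[OF that]] nzQ[OF reg[OF that]] by auto
  qed
  then obtain p where p: "p \<in> tens_span K A B (carrier A) (alg_closure_in K B)" "p \<in> P" "p \<notin> Q" by blast
  have "\<exists>w. w \<in> P \<and> w \<notin> Q \<and> alg_over R (scalars K R) w"
    by (rule algebraic_separating_element[OF icA icB Pp nzP Qp nzQ p])
  then show ?thesis using comaximal_of_algebraic[OF Pp Qp] by blast
qed

end

text \<open>Brings prime ideals from \<open>tensor_algebra\<close> back to
  \<open>tensor_product\<close>, whose record type differs. Additive inverses agree because they are
  determined by the carrier, addition and zero.\<close>

lemma primeideal_cong:
  assumes P: "primeideal P R"
    and S: "carrier S = carrier R" "monoid.mult S = monoid.mult R" "one S = one R"
      "ring.zero S = ring.zero R" "add S = add R"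
  shows "primeideal P S"
proof -
  interpret P: primeideal P R by (rule P)
  have c: "cring S" by (rule cring_cong[OF P.is_cring S])
  have "inv\<^bsub>add_monoid S\<^esub> x = inv\<^bsub>add_monoid R\<^esub> x" for x by (simp add: m_inv_def S)
  then have "subgroup P (add_monoid S)" using P.a_subgroup by (simp add: subgroup_def S)
  then have "ideal P S"
    using P.I_l_closed P.I_r_closed by (intro idealI cring.axioms(1)[OF c]) (auto simp: S)
  then show ?thesis
    using c P.I_prime P.I_notcarr by (intro primeidealI) (auto simp: S)
qed

theorem theorem3p4:
  fixes K :: "('k, 'm) ring_scheme"
    and A :: "('k, 'a, 'n) module_scheme"
    and B :: "('k, 'b, 'o) module_scheme"
  assumes "field K"
    and "algebra K A" and "algebra K B"
    and "integrally_closed_domain A" and "integrally_closed_domain B"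
  shows "MPC (tensor_product K A B)"
  unfolding MPC_def
proof (intro allI impI, elim conjE)
  interpret tensor_pair K A B by (rule tensor_pairI[OF assms(1-3)])
  let ?T = "tensor_product K A B"
  have T: "carrier ?T = carrier R" "monoid.mult ?T = monoid.mult R" "one ?T = one R"
    "ring.zero ?T = ring.zero R" "add ?T = add R"
    by (simp_all add: tensor_algebra_def)
  have prime: "primeideal I R \<longleftrightarrow> primeideal I ?T" for I
    using primeideal_cong[OF _ T, of I] primeideal_cong[OF _ T[symmetric], of I] by blast
  have minimal: "minimal_prime R I \<longleftrightarrow> minimal_prime ?T I" for I
    by (simp add: minimal_prime_def prime)
  fix P Q assume "minimal_prime ?T P" "minimal_prime ?T Q" "P \<noteq> Q"
  then have "comaximal R P Q"
    by (intro minimal_primes_comaximal[OF assms(4,5)]) (simp_all add: minimal)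
  then show "comaximal ?T P Q" by (simp add: comaximal_def set_add_def' T)
qed

end
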